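(* Let $C$ be a $d\times d$ positive definite matrix, $a>0$, and $O$ a $d\times d$ orthogonal matrix, and let $X_t$ satisfy $$X_t=H_t^{1/2}Z_t,\qquad H_t=C+AX_{t-1}X_{t-1}^{\intercal}A^{\intercal},\qquad A=aO,$$ with $(Z_t)$ i.i.d. $N(0,I_d)$; equivalently, $X_t=a\,m_tO\,X_{t-1}+Q_t$ with $(m_t)$ i.i.d. $N(0,1)$ and $(Q_t)$ i.i.d. $N(0,C)$ independent of $(m_t)$. If $$a<\exp\left\{\tfrac12\left[-\psi(1)+\log2\right]\right\}=1.88736\ldots,$$ where $\psi$ is the digamma function, then the process has a unique strictly stationary solution $(X_t)$, and $X_t$ is multivariate regularly varying with index $\alpha>0$ satisfying $\mathbb{E}[(|m_t|a)^{\alpha}]=1$.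
   Context: $H_t^{1/2}$ is the symmetric positive definite square root. Let $\bar{\mathbb{R}}=\mathbb{R}\cup\{-\infty,\infty\}$ and $\bar{\mathbb{R}}^d_0=\bar{\mathbb{R}}^d\setminus\{0\}$ with its Borel $\sigma$-field. An $\mathbb{R}^d$-valued random variable $X$ is multivariate regularly varying if there is a non-null Radon measure $\mu$ on $\bar{\mathbb{R}}^d_0$ such that the measures $\mu_x(\cdot)=\mathbb{P}(x^{-1}X\in\cdot)/\mathbb{P}(\Vert X\Vert>x)$ converge vaguely to $\mu$ as $x\to\infty$. Then there is $\alpha$ such that $\mu(tB)=t^{-\alpha}\mu(B)$ for all $t>0$ and all $\mu$-continuity sets $B$; $\alpha$ is called the index of regular variation. *)

theory Defs
  imports "HOL-Probability.Probability"
begin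

section \<open>Positive definite matrices and centered Gaussian laws\<close>

definition positive_definite :: "real ^ 'd ^ 'd \<Rightarrow> bool" where
  "positive_definite S \<longleftrightarrow> transpose S = S \<and> (\<forall>x. x \<noteq> 0 \<longrightarrow> 0 < x \<bullet> (S *v x))"

text \<open>The symmetric positive definite square root; meaningful for positive definite arguments,
  where it exists and is unique.\<close>

definition spd_sqrt :: "real ^ 'd ^ 'd \<Rightarrow> real ^ 'd ^ 'd" where
  "spd_sqrt H = (THE S. positive_definite S \<and> S ** S = H)"

definition outer :: "real ^ 'd \<Rightarrow> real ^ 'd ^ 'd" where
  "outer x = (\<chi> i j. x $ i * x $ j)"

text \<open>The law \<open>N(0, S)\<close> for a positive definite covariance matrix \<open>S\<close>.\<close>

definition centered_normal :: "real ^ 'd ^ 'd \<Rightarrow> (real ^ 'd) measure" where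
  "centered_normal S = density lborel
     (\<lambda>x. ennreal (exp (- (x \<bullet> (matrix_inv S *v x)) / 2) / sqrt ((2 * pi) ^ CARD('d) * det S)))"

section \<open>Processes indexed by the integers\<close>

definition process_law ::
    "'a measure \<Rightarrow> (int \<Rightarrow> 'a \<Rightarrow> 'b::topological_space) \<Rightarrow> (int \<Rightarrow> 'b) measure" where
  "process_law M X = distr M (PiM UNIV (\<lambda>_. borel)) (\<lambda>\<omega> t. X t \<omega>)"

definition strictly_stationary ::
    "'a measure \<Rightarrow> (int \<Rightarrow> 'a \<Rightarrow> 'b::topological_space) \<Rightarrow> bool" where
  "strictly_stationary M X \<longleftrightarrow>
     (\<forall>t. X t \<in> borel_measurable M) \<and>
     (\<forall>h. process_law M (\<lambda>t. X (t + h)) = process_law M X)"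

definition iid ::
    "'a measure \<Rightarrow> 'b::topological_space measure \<Rightarrow> (int \<Rightarrow> 'a \<Rightarrow> 'b) \<Rightarrow> bool" where
  "iid M \<nu> Y \<longleftrightarrow>
     prob_space.indep_vars M (\<lambda>_. borel) Y UNIV \<and> (\<forall>t. distr M borel (Y t) = \<nu>)"

text \<open>Independence of two random elements with possibly different value types (the library's
  \<open>indep_var\<close> needs a common type).\<close>

definition indep_elements ::
    "'a measure \<Rightarrow> 'b measure \<Rightarrow> ('a \<Rightarrow> 'b) \<Rightarrow> 'c measure \<Rightarrow> ('a \<Rightarrow> 'c) \<Rightarrow> bool" where
  "indep_elements M S X T Y \<longleftrightarrow>
     X \<in> measurable M S \<and> Y \<in> measurable M T \<and>
     prob_space.indep_set M {X -` E \<inter> space M |E. E \<in> sets S} {Y -` E \<inter> space M |E. E \<in> sets T}"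

text \<open>Stationary solutions of \<open>X\<^sub>t = H\<^sub>t\<^sup>1\<^sup>/\<^sup>2 Z\<^sub>t\<close>, \<open>H\<^sub>t = C + A X\<^sub>t\<^sub>-\<^sub>1 X\<^sub>t\<^sub>-\<^sub>1\<^sup>T A\<^sup>T\<close>.
  The innovation \<open>Z\<^sub>t\<close> is required to be independent of the past \<open>(X\<^sub>s)\<close>, \<open>s < t\<close>, so that \<open>H\<^sub>t\<close> is
  the conditional covariance matrix of \<open>X\<^sub>t\<close> given the past.\<close>

definition stationary_bekk_solution ::
    "'a measure \<Rightarrow> real ^ 'd ^ 'd \<Rightarrow> real ^ 'd ^ 'd \<Rightarrow>
     (int \<Rightarrow> 'a \<Rightarrow> real ^ 'd) \<Rightarrow> (int \<Rightarrow> 'a \<Rightarrow> real ^ 'd) \<Rightarrow> bool" where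
  "stationary_bekk_solution M C A Z X \<longleftrightarrow>
     iid M (centered_normal (mat 1)) Z \<and>
     strictly_stationary M X \<and>
     (\<forall>t. indep_elements M borel (Z t)
            (PiM {..<t} (\<lambda>_. borel)) (\<lambda>\<omega>. \<lambda>s\<in>{..<t}. X s \<omega>)) \<and>
     (\<forall>t. AE \<omega> in M.
        X t \<omega> = spd_sqrt (C + A ** outer (X (t - 1) \<omega>) ** transpose A) *v Z t \<omega>)"

text \<open>Innovations and stationary solutions of \<open>X\<^sub>t = m\<^sub>t A X\<^sub>t\<^sub>-\<^sub>1 + Q\<^sub>t\<close>; the two whole
  sequences \<open>(m\<^sub>t)\<close> and \<open>(Q\<^sub>t)\<close> are independent.\<close>

definition sre_innovations ::
    "'a measure \<Rightarrow> real ^ 'd ^ 'd \<Rightarrow> (int \<Rightarrow> 'a \<Rightarrow> real) \<Rightarrow> (int \<Rightarrow> 'a \<Rightarrow> real ^ 'd) \<Rightarrow> bool" where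
  "sre_innovations M C m Q \<longleftrightarrow>
     iid M (density lborel std_normal_density) m \<and>
     iid M (centered_normal C) Q \<and>
     indep_elements M (PiM UNIV (\<lambda>_. borel)) (\<lambda>\<omega> t. m t \<omega>)
                            (PiM UNIV (\<lambda>_. borel)) (\<lambda>\<omega> t. Q t \<omega>)"

definition stationary_sre_solution ::
    "'a measure \<Rightarrow> real ^ 'd ^ 'd \<Rightarrow> (int \<Rightarrow> 'a \<Rightarrow> real) \<Rightarrow> (int \<Rightarrow> 'a \<Rightarrow> real ^ 'd) \<Rightarrow>
     (int \<Rightarrow> 'a \<Rightarrow> real ^ 'd) \<Rightarrow> bool" where
  "stationary_sre_solution M A m Q X \<longleftrightarrow>
     strictly_stationary M X \<and>
     (\<forall>t. AE \<omega> in M. X t \<omega> = m t \<omega> *\<^sub>R (A *v X (t - 1) \<omega>) + Q t \<omega>)"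

section \<open>Multivariate regular variation\<close>

text \<open>The punctured extended space is the subspace \<open>- {0}\<close> of the type \<open>ereal ^ 'd\<close>; its compact
  subsets are the compact subsets of \<open>ereal ^ 'd\<close> not containing \<open>0\<close>.\<close>

definition punctured_borel :: "(ereal ^ 'd) measure" where
  "punctured_borel = restrict_space borel (- {0})"

text \<open>Local finiteness suffices in the definition of a Radon measure, since the punctured extended
  space is locally compact with a countable base.\<close>

definition radon_punctured :: "(ereal ^ 'd) measure \<Rightarrow> bool" where
  "radon_punctured \<mu> \<longleftrightarrow>
     sets \<mu> = sets punctured_borel \<and>
     (\<forall>K. compact K \<and> 0 \<notin> K \<longrightarrow> emeasure \<mu> K < \<infinity>)"

definition vague_limit :: "(real \<Rightarrow> (ereal ^ 'd) measure) \<Rightarrow> (ereal ^ 'd) measure \<Rightarrow> bool" where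
  "vague_limit \<nu> \<mu> \<longleftrightarrow>
     (\<forall>f :: ereal ^ 'd \<Rightarrow> real.
        continuous_on (- {0}) f \<and> (\<exists>K. compact K \<and> 0 \<notin> K \<and> (\<forall>y. y \<notin> K \<longrightarrow> f y = 0)) \<longrightarrow>
        ((\<lambda>x. \<integral>y. f y \<partial>\<nu> x) \<longlongrightarrow> (\<integral>y. f y \<partial>\<mu>)) at_top)"

definition embed_ereal :: "real ^ 'd \<Rightarrow> ereal ^ 'd" where
  "embed_ereal v = (\<chi> i. ereal (v $ i))"

definition scale_ereal :: "real \<Rightarrow> ereal ^ 'd \<Rightarrow> ereal ^ 'd" where
  "scale_ereal t y = (\<chi> i. ereal t * y $ i)"

text \<open>The measure \<open>B \<mapsto> P(x\<^sup>-\<^sup>1 X \<in> B) / P(\<parallel>X\<parallel> > x)\<close> on the punctured extended space.\<close>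

definition tail_measure :: "'a measure \<Rightarrow> ('a \<Rightarrow> real ^ 'd) \<Rightarrow> real \<Rightarrow> (ereal ^ 'd) measure" where
  "tail_measure M X x =
     scale_measure (inverse (emeasure M {\<omega> \<in> space M. norm (X \<omega>) > x}))
       (restrict_space (distr M borel (\<lambda>\<omega>. embed_ereal (X \<omega> /\<^sub>R x))) (- {0}))"

definition regularly_varying_limit ::
    "'a measure \<Rightarrow> ('a \<Rightarrow> real ^ 'd) \<Rightarrow> (ereal ^ 'd) measure \<Rightarrow> bool" where
  "regularly_varying_limit M X \<mu> \<longleftrightarrow>
     X \<in> borel_measurable M \<and> radon_punctured \<mu> \<and> emeasure \<mu> (space \<mu>) \<noteq> 0 \<and>
     vague_limit (tail_measure M X) \<mu>"

definition regularly_varying_index :: "'a measure \<Rightarrow> ('a \<Rightarrow> real ^ 'd) \<Rightarrow> real \<Rightarrow> bool" where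
  "regularly_varying_index M X \<alpha> \<longleftrightarrow>
     (\<exists>\<mu>. regularly_varying_limit M X \<mu> \<and>
        (\<forall>t > 0. \<forall>B \<in> sets \<mu>. emeasure \<mu> (frontier B - {0}) = 0 \<longrightarrow>
           emeasure \<mu> (scale_ereal t ` B) = ennreal (t powr - \<alpha>) * emeasure \<mu> B))"

end

theory Submission
  imports Defs "HOL-Real_Asymp.Real_Asymp" "HOL-Complex_Analysis.Great_Picard"
begin

text \<open>
  Let \<open>\<alpha>\<close> solve \<open>E (|m| a) powr \<alpha> = 1\<close>; it exists because the logarithm of this moment is convex in the
  exponent with negative slope at \<open>0\<close>. The recursion is a perpetuity, so its stationary law \<open>piX\<close> is
  unique, and it is a mixture of centred normal laws whose random covariance follows a similar
  recursion. The latter stays in a cone of uniformly elliptic matrices, so the density of \<open>piX\<close> and its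
  Lipschitz constants are controlled by the tail of one scalar, the trace.

  Under the measure tilted by \<open>(|m| a) powr \<alpha>\<close>, \<open>ln (|m| a)\<close> is the step of a random walk with positive
  drift. Integrals of test functions against the rescaled law are almost harmonic for this walk twisted by
  the rotation \<open>Orth\<close>: bounded solutions are asymptotically invariant, orbit averages over \<open>Orth\<close> make
  the twist disappear, and a conserved quantity identifies the limit. Equicontinuity of the rescaled
  densities turns this into pointwise convergence to a homogeneous density, which is not zero since the
  scalar tail is not negligible. This density defines the limit measure.

  A Markov chain indexed by the integers is determined by its kernel and its invariant law; the linear
  recursion and the BEKK recursion have the same kernel, hence the same stationary process law.
\<close>

text \<open>The threshold says that ln (|m| a) has negative mean: this mean is the slope at 0 of the
  logarithm of the moment.

  The obstacle is that each step of the walk also rotates the test function. In place of a renewal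
  theorem there is an energy estimate: the squared one-step increments of a bounded almost harmonic
  family have bounded total expectation along the walk, and they are almost subharmonic, so a single
  one is at most of order 1/n for every n.

  All errors must be of size exp (- eps |t|). This comes from trading moments of the state of order
  \<open>bet\<close> = alpha - eps, which are finite, against Hoelder continuity of order
  \<open>th\<close> = 2 eps in the additive noise.

  Densities are made to converge pointwise because test functions on the extended space need not
  vanish at infinity; the bound |y|^-(alpha + d) then dominates the whole tail.

  The limit is not zero because otherwise the conserved integral, whose integrand is nonnegative,
  would vanish; the additive constant of the scalar recursion would then have no effect at
  arbitrarily high levels.\<close>

section \<open>Numerical bounds for the threshold on \<open>a\<close>\<close>

text \<open>The function 1/x is convex, so its integral over [n + 1/2, n + 3/2] is at least its
  value at the midpoint n + 1. In the proof this is the first term of the series of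
  \<open>ln_approx_bounds\<close>, taken at the ratio of the endpoints.\<close>

lemma one_over_Suc_le_ln_midpoints:
 "1 / (real n + 1) \<le> ln (real n + 3/2) - ln (real n + 1/2)"
proof -
 define x where "x = (real n + 3/2) / (real n + 1/2)"
 have "x > 1" by (simp add: x_def)
 moreover have "(x - 1) / (x + 1) = 1 / (2 * (real n + 1))"
  by (simp add: x_def divide_simps) (simp add: algebra_simps)
 ultimately have "2 * (1 / (2 * (real n + 1))) \<le> ln x"
  using ln_approx_bounds[of x 1] by simp
 moreover have "ln x = ln (real n + 3/2) - ln (real n + 1/2)"
  unfolding x_def by (subst ln_div) auto
 moreover have "2 * (1 / (2 * (real n + 1))) = 1 / (real n + 1)"
  by (simp add: divide_simps)
 ultimately show ?thesis by (simp only:)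
qed

text \<open>The shift by 1/2 makes the sequence decrease to its limit, so each member is an upper
  bound, and it lowers the error from order 1/n to order 1/n^2: a moderate n already gives the
  required digits.\<close>

lemma euler_mascheroni_le_midpoint:
 "euler_mascheroni \<le> harm n - ln (real n + 1/2)"
proof -
 let ?f = "\<lambda>k. harm k - ln (real k + 1/2)"
 have "?f (Suc k) \<le> ?f k" for k
  using one_over_Suc_le_ln_midpoints[of k]
  by (simp add: harm_Suc inverse_eq_divide algebra_simps)
 then have dec: "decseq ?f" by (simp add: decseq_Suc_iff)
 have "(\<lambda>k. (harm k - ln (real k)) - (ln (real k + 1/2) - ln (real k))) \<longlonglongrightarrow> euler_mascheroni - 0"
 proof (intro tendsto_diff euler_mascheroni_LIMSEQ)
  show "(\<lambda>k. ln (real k + 1/2) - ln (real k)) \<longlonglongrightarrow> 0" by real_asymp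
 qed
 then have "?f \<longlonglongrightarrow> euler_mascheroni" by simp
 then show ?thesis using decseq_ge[OF dec] by auto
qed

lemma ln_2_bounds: "ln (2::real) \<in> {0.6931471805..0.6931471807}"
 using ln_approx_bounds[of 2 10] by (simp add: eval_nat_numeral)

lemma ln_3_bounds: "ln (3::real) \<in> {1.09861228..1.0986123}"
 using ln_approx_bounds[of 3 13] by (simp add: eval_nat_numeral)

text \<open>\<open>Digamma 1\<close> is minus the Euler-Mascheroni constant. The two harmonic
  indices are chosen for their logarithms: 143 + 1 = 2^4 3^2 in the lower bound and 121 + 1/2 = 3^5
  / 2 in the upper one, so that only \<open>ln 2\<close> and \<open>ln 3\<close> have to be
  approximated.\<close>

lemma exp_half_euler_bounds:
 "1.88736 \<le> exp (1 / 2 * (- Digamma 1 + ln 2 :: real))"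
 "exp (1 / 2 * (- Digamma 1 + ln 2 :: real)) < 1.88737"
proof -
 have h: "harm 143 \<ge> (5.54355272::real)"
  by (simp add: harm_expand)
 have h': "harm 121 \<le> (5.3771328::real)"
  by (simp add: harm_expand)
 have "ln (2^4 * 3^2 ::real) = ln (2^4) + ln (3^2)" by (rule ln_mult_pos) auto
 also have "... = 4 * ln 2 + 2 * ln 3" by (simp only: ln_realpow zero_less_numeral)
 finally have "ln (144::real) = 4 * ln 2 + 2 * ln 3" by simp
 then have "euler_mascheroni \<ge> (5.54355272::real) - (4 * ln 2 + 2 * ln 3) + 1 / 288"
  using euler_mascheroni_bounds[of 143] h by simp
 then have lo: "euler_mascheroni + ln 2 \<ge> (1.2703584::real)"
  using ln_2_bounds ln_3_bounds by simp
 have "ln (3^5 / 2::real) = ln (3^5) - ln 2" by (rule ln_divide_pos) auto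
 also have "... = 5 * ln 3 - ln 2" by (simp only: ln_realpow zero_less_numeral)
 finally have "ln (243 / 2::real) = 5 * ln 3 - ln 2" by simp
 then have "euler_mascheroni \<le> (5.3771328::real) - (5 * ln 3 - ln 2)"
  using euler_mascheroni_le_midpoint[of 121] h' by simp
 then have hi: "euler_mascheroni + ln 2 \<le> (1.2703662::real)"
  using ln_2_bounds ln_3_bounds by simp
 \<comment> \<open>Since 1.88736 is close to 2, its logarithm is written as \<open>ln 2\<close>
   minus that of a ratio near 1, for which two terms of the series are enough.\<close>
 have "0.0579681 \<le> ln (200000 / 188736::real)"
  using ln_approx_bounds[of "200000 / 188736" 2] by (simp add: eval_nat_numeral)
 moreover have "ln (1.88736::real) = ln 2 - ln (200000 / 188736)"
  by (subst ln_divide_pos[symmetric]) auto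
 ultimately have "ln (1.88736::real) \<le> 1 / 2 * (- Digamma 1 + ln 2)"
  using lo ln_2_bounds by simp
 then have "exp (ln (1.88736::real)) \<le> exp (1 / 2 * (- Digamma 1 + ln 2))"
  by (simp only: exp_le_cancel_iff)
 then show "1.88736 \<le> exp (1 / 2 * (- Digamma 1 + ln 2 :: real))"
  by (subst (asm) exp_ln) auto
 have "ln (200000 / 188737::real) \<le> 0.0579635"
  using ln_approx_bounds[of "200000 / 188737" 2] by (simp add: eval_nat_numeral)
 moreover have "ln (1.88737::real) = ln 2 - ln (200000 / 188737)"
  by (subst ln_divide_pos[symmetric]) auto
 ultimately have "1 / 2 * (- Digamma 1 + ln 2) < ln (1.88737::real)"
  using hi ln_2_bounds by simp
 then have "exp (1 / 2 * (- Digamma 1 + ln 2)) < exp (ln (1.88737::real))"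
  by (simp only: exp_less_cancel_iff)
 then show "exp (1 / 2 * (- Digamma 1 + ln 2 :: real)) < 1.88737"
  by (subst (asm) exp_ln) auto
qed

section \<open>Absolute moments of the normal law and the choice of alpha\<close>

abbreviation stdn :: "real measure" where
 "stdn \<equiv> density lborel (\<lambda>x. ennreal (std_normal_density x))"

lemma prob_space_stdn: "prob_space stdn"
 using prob_space_normal_density[of 1 0] by simp

text \<open>The substitution t = x^2 / 2 turns the moment over the positive half-line into a Gamma
  integral, and evenness doubles it.\<close>

lemma std_normal_abs_powr:
 assumes "s > -1"
 shows "has_bochner_integral stdn (\<lambda>x. \<bar>x\<bar> powr s) (2 powr (s / 2) * Gamma ((s + 1) / 2) / sqrt pi)"
proof -
 define c where "c = (s + 1) / 2"
 have c: "c > 0" using assms by (simp add: c_def)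
 let ?g = "\<lambda>x::real. x\<^sup>2 / 2" and ?f = "\<lambda>t::real. t powr (c - 1) / exp t"
 let ?q = "\<lambda>x. \<bar>x\<bar> powr s * exp (- x\<^sup>2 / 2)"
 have im: "?g ` {0<..} = {0<..}"
 proof (intro equalityI subsetI)
  fix y :: real assume "y \<in> {0<..}"
  then have "y = ?g (sqrt (2 * y))" "sqrt (2 * y) \<in> {0<..}" by auto
  then show "y \<in> ?g ` {0<..}" by blast
 qed auto
 \<comment> \<open>The endpoint 0 is removed so that x^2 / 2 maps the domain bijectively onto
   itself.\<close>
 have "(?f has_integral Gamma c) {0<..}"
  using Gamma_integral_real[OF c]
  by (subst has_integral_spike_set_eq[where T = "{0..}"])
   (auto intro: negligible_subset[of "{0}"])
 then have "?f absolutely_integrable_on {0<..} \<and> integral {0<..} ?f = Gamma c"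
  by (auto intro!: nonnegative_absolutely_integrable_1 simp: has_integral_integrable_integral)
 then have 1: "(\<lambda>x. \<bar>x\<bar> * ?f (?g x)) absolutely_integrable_on {0<..} \<and>
   integral {0<..} (\<lambda>x. \<bar>x\<bar> * ?f (?g x)) = Gamma c"
 proof (subst has_absolute_integral_change_of_variables_1'[where g = ?g])
  show "inj_on ?g {0<..}" by (auto simp: inj_on_def power2_eq_iff)
  show "(?g has_real_derivative x) (at x within {0<..})" for x
   by (auto intro!: derivative_eq_intros)
 qed (simp_all add: im)
 have 2: "\<bar>x\<bar> * ?f (?g x) = 2 powr (1 - c) * ?q x" if "x \<in> {0<..}" for x
 proof -
  have x: "x > 0" using that by simp
  have "?g x powr (c - 1) = x\<^sup>2 powr (c - 1) / 2 powr (c - 1)"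
   by (rule powr_divide)
  also have "x\<^sup>2 powr (c - 1) = (x powr 2) powr (c - 1)"
   using x by simp
  also have "... = x powr (s - 1)"
   unfolding powr_powr by (rule arg_cong[where f = "(powr) x"]) (simp add: c_def field_simps)
  finally have "\<bar>x\<bar> * (?g x powr (c - 1)) = (x * x powr (s - 1)) / 2 powr (c - 1)"
   using x by simp
  also have "x * x powr (s - 1) = x powr s"
   using x powr_mult_base[of x "s - 1"] by simp
  finally have e: "\<bar>x\<bar> * (?g x powr (c - 1)) = x powr s / 2 powr (c - 1)" .
  have e2: "2 powr (1 - c) = 1 / (2::real) powr (c - 1)"
   using powr_minus_divide[of "2::real" "c - 1"] by (simp only: minus_diff_eq)
  have e3: "exp (- x\<^sup>2 / 2) = 1 / exp (x\<^sup>2 / 2)"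
   using exp_minus[of "x\<^sup>2 / 2"] by (simp only: inverse_eq_divide minus_divide_left)
  have "\<bar>x\<bar> * ?f (?g x) = \<bar>x\<bar> * (?g x powr (c - 1)) / exp (x\<^sup>2 / 2)" by (simp only: times_divide_eq_right)
  also have "... = (1 / 2 powr (c - 1)) * (x powr s * (1 / exp (x\<^sup>2 / 2)))"
   unfolding e by (simp only: times_divide_eq_right times_divide_eq_left mult_1_left mult_1_right)
  finally show ?thesis using x unfolding e2 e3 by (simp only: abs_of_pos)
 qed
 have "set_integrable lebesgue {0<..} (\<lambda>x. 2 powr (1 - c) * ?q x)"
  using 1 2 by (subst set_integrable_cong[OF refl refl 2[symmetric]]) auto
 then have i: "set_integrable lebesgue {0<..} ?q" by simp
 have "Gamma c = integral {0<..} (\<lambda>x. 2 powr (1 - c) * ?q x)"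
  using 1 2 by (metis (no_types, lifting) Henstock_Kurzweil_Integration.integral_cong)
 also have "... = 2 powr (1 - c) * integral {0<..} ?q" by simp
 finally have v: "integral {0<..} ?q = 2 powr (c - 1) * Gamma c"
  by (simp add: powr_diff field_simps)
 have "has_bochner_integral lebesgue (\<lambda>x. indicator {0<..} x *\<^sub>R ?q x) (2 powr (c - 1) * Gamma c)"
  using i v set_lebesgue_integral_eq_integral(2)[OF i]
  by (simp add: has_bochner_integral_iff set_integrable_def set_lebesgue_integral_def)
 then have "has_bochner_integral lborel (\<lambda>x. indicator {0<..} x *\<^sub>R ?q x) (2 powr (c - 1) * Gamma c)"
  by (simp add: has_bochner_integral_iff integrable_completion integral_completion)
 moreover have "AE x in lborel. indicator {0<..} x *\<^sub>R ?q x = indicator {0..} x *\<^sub>R ?q x"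
  using AE_lborel_singleton[of "0::real"] by eventually_elim (auto simp: indicator_def)
 ultimately have "has_bochner_integral lborel (\<lambda>x. indicator {0..} x *\<^sub>R ?q x) (2 powr (c - 1) * Gamma c)"
  by (subst has_bochner_integral_cong_AE[symmetric, where f = "\<lambda>x. indicator {0<..} x *\<^sub>R ?q x"]) auto
 then have "has_bochner_integral lborel ?q (2 *\<^sub>R (2 powr (c - 1) * Gamma c))"
  by (rule has_bochner_integral_even_function) simp
 then have "has_bochner_integral lborel (\<lambda>x. (1 / sqrt (2 * pi)) * ?q x)
   ((1 / sqrt (2 * pi)) * (2 *\<^sub>R (2 powr (c - 1) * Gamma c)))"
  by (rule has_bochner_integral_mult_right)
 also have "(1 / sqrt (2 * pi)) * (2 *\<^sub>R (2 powr (c - 1) * Gamma c)) = 2 powr (s / 2) * Gamma c / sqrt pi"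
 proof -
  have "2 * 2 powr (c - 1) = sqrt 2 * 2 powr (s / 2)"
  proof -
   have "2 * 2 powr (c - 1) = (2::real) powr (1 + (c - 1))" by (simp only: powr_add) simp
   also have "1 + (c - 1) = 1/2 + s/2" by (simp add: c_def field_simps)
   also have "(2::real) powr (1/2 + s/2) = sqrt 2 * 2 powr (s/2)" by (simp add: powr_add powr_half_sqrt)
   finally show ?thesis .
  qed
  then show ?thesis by (simp add: real_sqrt_mult field_simps)
 qed
 finally have "has_bochner_integral lborel (\<lambda>x. std_normal_density x *\<^sub>R \<bar>x\<bar> powr s)
   (2 powr (s / 2) * Gamma c / sqrt pi)"
  by (rule has_bochner_integral_cong[THEN iffD1, rotated -1]) (auto simp: std_normal_density_def)
 then show ?thesis
  by (intro has_bochner_integral_density) (auto simp: c_def)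
qed

definition nmom :: "real \<Rightarrow> real \<Rightarrow> real" where
 "nmom a s = (\<integral>x. (\<bar>x\<bar> * a) powr s \<partial>stdn)"

lemma nmom_integrable:
 assumes "s > -1" "a > 0"
 shows "integrable stdn (\<lambda>x. (\<bar>x\<bar> * a) powr s)"
 using std_normal_abs_powr[OF assms(1)] assms
 by (simp add: powr_mult has_bochner_integral_iff)

lemma nmom_eq:
 assumes "s > -1" "a > 0"
 shows "nmom a s = a powr s * (2 powr (s / 2) * Gamma ((s + 1) / 2) / sqrt pi)"
 using std_normal_abs_powr[OF assms(1)] assms
 by (simp add: nmom_def powr_mult has_bochner_integral_iff)

lemma nmom_eq_exp:
 assumes "s > -1" "a > 0"
 shows "nmom a s = exp (s * (ln a + ln 2 / 2) + ln (Gamma ((s + 1) / 2)) - ln (sqrt pi))"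
 using assms Gamma_real_pos[of "(s + 1) / 2"]
 by (simp add: nmom_eq exp_add exp_diff powr_def algebra_simps)

text \<open>\<open>f\<close> is the logarithm of the moment. Its slope at 0 is ln a + ln 2 / 2 +
  psi(1/2) / 2, and psi(1/2) = psi(1) - 2 ln 2 makes the bound on \<open>a\<close> equivalent to a
  negative slope. So \<open>f\<close> first drops below 0 and later becomes positive; convexity,
  which is monotonicity of \<open>Digamma\<close>, keeps it negative up to the zero in
  between.\<close>

lemma exists_moment_index:
 assumes a: "a > 0" "a < exp (1 / 2 * (- Digamma 1 + ln 2))"
 shows "\<exists>\<alpha>>0. nmom a \<alpha> = 1 \<and> (\<forall>s. 0 < s \<and> s < \<alpha> \<longrightarrow> nmom a s < 1)"
proof -
 define f where "f s = s * (ln a + ln 2 / 2) + ln (Gamma ((s + 1) / 2)) - ln (sqrt pi)" for s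
 define G where "G s = ln (Gamma ((s + 1) / 2))" for s :: real
 have f_G: "f = (\<lambda>s. s * (ln a + ln 2 / 2) + G s - ln (sqrt pi))"
  by (simp add: f_def G_def fun_eq_iff)
 have nf: "nmom a s = exp (f s)" if "s > -1" for s
  using nmom_eq_exp[OF that a(1)] by (simp add: f_def)
 have f0: "f 0 = 0" by (simp add: f_def Gamma_one_half_real)
 have "ln a < 1 / 2 * (- Digamma 1 + ln 2)"
  using a by (metis exp_less_cancel_iff exp_ln)
 then have D: "ln a + ln 2 / 2 + Digamma (1/2::real) / 2 < 0"
  by (simp add: Digamma_one_half field_simps)
 have der: "(f has_real_derivative (ln a + ln 2 / 2 + Digamma ((s + 1) / 2) / 2)) (at s)" if "s > -1" for s
 proof -
  have p: "(s + 1) / 2 > 0" using that by simp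
  then have g: "Gamma ((s + 1) / 2) > 0" by (rule Gamma_real_pos)
  have "((\<lambda>s. Gamma ((s + 1) / 2)) has_real_derivative
    Gamma ((s + 1) / 2) * Digamma ((s + 1) / 2) * (1 / 2)) (at s)"
   by (rule DERIV_chain2[OF has_field_derivative_Gamma])
    (use p in \<open>auto intro!: derivative_eq_intros elim!: nonpos_Ints_cases\<close>)
  from DERIV_chain2[OF DERIV_ln_divide[OF g] this] g
  have "((\<lambda>s. ln (Gamma ((s + 1) / 2))) has_real_derivative Digamma ((s + 1) / 2) / 2) (at s)"
   by simp
  then have "(G has_real_derivative Digamma ((s + 1) / 2) / 2) (at s)" unfolding G_def .
  then show ?thesis unfolding f_G by (auto intro!: derivative_eq_intros)
 qed
 have cvx: "convex_on {-1<..} f"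
 proof (rule convex_on_realI[where f' = "\<lambda>s. ln a + ln 2 / 2 + Digamma ((s + 1) / 2) / 2"])
  fix x y :: real assume "x \<in> {-1<..}" "y \<in> {-1<..}" "x \<le> y"
  then have "Digamma ((x + 1) / 2) \<le> Digamma ((y + 1) / 2)"
   by (intro Digamma_real_mono) auto
  then show "ln a + ln 2 / 2 + Digamma ((x + 1) / 2) / 2 \<le> ln a + ln 2 / 2 + Digamma ((y + 1) / 2) / 2"
   by linarith
 next
  fix x :: real assume "x \<in> {-1<..}"
  then show "(f has_real_derivative ln a + ln 2 / 2 + Digamma ((x + 1) / 2) / 2) (at x)"
   by (intro der) simp
 qed simp
 have "\<exists>d>0. \<forall>h>0. h < d \<longrightarrow> f (0 + h) < f 0"
  by (rule DERIV_neg_dec_right[OF der[of 0]]) (use D in simp_all)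
 then obtain d where d: "d > 0" "\<And>h. 0 < h \<Longrightarrow> h < d \<Longrightarrow> f h < 0"
  using f0 by auto
 \<comment> \<open>At the odd exponents 2 n + 1 the Gamma factor is n!, which eventually beats the
   powers of any small \<open>a\<close>; this provides a point with moment larger than 1.\<close>
 have "(\<lambda>n. (1 / (2 * a\<^sup>2)) ^ n / fact n) \<longlonglongrightarrow> 0"
  using summable_LIMSEQ_zero[OF summable_exp_generic[of "1 / (2 * a\<^sup>2)"]]
  by (simp only: real_scaleR_def divide_inverse mult.commute)
 then obtain n where n: "(1 / (2 * a\<^sup>2)) ^ n / fact n < a * sqrt 2 / sqrt pi"
 proof -
  assume l: "(\<lambda>n. (1 / (2 * a\<^sup>2)) ^ n / fact n) \<longlonglongrightarrow> 0"
  have "a * sqrt 2 / sqrt pi > 0" using a by simp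
  from order_tendstoD(2)[OF l this] show ?thesis
   using that by (auto simp: eventually_sequentially)
 qed
 define s1 where "s1 = 2 * real n + 1"
 have "nmom a s1 = a ^ (2 * n + 1) * (sqrt 2 * 2 ^ n * fact n / sqrt pi)"
 proof -
  have "(2::real) powr (s1 / 2) = sqrt 2 * 2 ^ n"
   by (simp add: s1_def add_divide_distrib powr_add powr_half_sqrt powr_realpow)
  moreover have "a powr s1 = a ^ (2 * n + 1)"
  proof -
   have "s1 = real (2 * n + 1)" by (simp add: s1_def)
   then show ?thesis using a by (simp only: powr_realpow)
  qed
  moreover have "Gamma ((s1 + 1) / 2) = fact n"
   using Gamma_fact[of n, where 'a = real] by (simp add: s1_def add_divide_distrib add.commute)
  ultimately show ?thesis using a by (subst nmom_eq) (auto simp: s1_def)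
 qed
 also have "... > 1"
 proof -
  have "(1 / (2 * a\<^sup>2)) ^ n / fact n = 1 / ((2 * a\<^sup>2) ^ n * fact n)"
   by (simp only: power_one_over divide_divide_eq_left)
  moreover have p: "(2 * a\<^sup>2) ^ n * fact n > 0" using a by simp
  ultimately have "1 < a * sqrt 2 / sqrt pi * ((2 * a\<^sup>2) ^ n * fact n)"
   using n by (simp only: pos_divide_less_eq)
  also have "... = a ^ (2 * n + 1) * (sqrt 2 * 2 ^ n * fact n / sqrt pi)"
   by (simp add: power_mult power_mult_distrib power2_eq_square mult_ac)
  finally show ?thesis .
 qed
 finally have "f s1 > 0" by (subst (asm) nf) (auto simp: s1_def)
 \<comment> \<open>Smaller than \<open>d\<close>, hence in the range where \<open>f\<close> is known
   to be negative, and smaller than \<open>s1\<close>, hence a left end for the intermediate value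
   theorem.\<close>
 define s0 where "s0 = min (d / 2) (s1 / 2)"
 have s0: "0 < s0" "s0 < d" "s0 < s1" "f s0 < 0"
  using d by (auto simp: s0_def s1_def min_def)
 have cont: "continuous_on {s0..s1} f"
  by (intro continuous_at_imp_continuous_on ballI DERIV_isCont[OF der]) (use s0 in auto)
 obtain \<alpha> where \<alpha>: "s0 \<le> \<alpha>" "\<alpha> \<le> s1" "f \<alpha> = 0"
  using IVT'[OF _ _ _ cont, of 0] s0 \<open>f s1 > 0\<close> by auto
 have "\<alpha> > s0" using \<alpha> s0 by (cases "\<alpha> = s0") auto
 have neg: "f s < 0" if "0 < s" "s < \<alpha>" for s
 proof (cases "s \<le> s0")
  case True
  then show ?thesis using d(2)[of s] that s0 by auto
 next
  case False
  \<comment> \<open>\<open>s\<close> is a convex combination of \<open>s0\<close>, where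
    \<open>f\<close> is negative, and of its zero \<alpha>, with positive weight on
    \<open>s0\<close>.\<close>
  define u where "u = (s - s0) / (\<alpha> - s0)"
  have u: "0 < u" "u < 1" using False that by (auto simp: u_def)
  have "s = (1 - u) *\<^sub>R s0 + u *\<^sub>R \<alpha>"
  proof -
   have "u * (\<alpha> - s0) = s - s0" using \<open>\<alpha> > s0\<close> by (simp add: u_def)
   then show ?thesis by (simp add: algebra_simps)
  qed
  then have "f s \<le> (1 - u) * f s0 + u * f \<alpha>"
   using convex_onD[OF cvx, of u s0 \<alpha>] u s0 \<alpha> by auto
  also have "... < 0" using u s0 \<alpha> by (simp add: mult_pos_neg)
  finally show ?thesis .
 qed
 show ?thesis
  using \<alpha> neg s0 \<open>\<alpha> > s0\<close> by (intro exI[of _ \<alpha>]) (auto simp: nf)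
qed

lemma integrable_exp_neg_abs:
 assumes "e > (0::real)"
 shows "integrable lborel (\<lambda>t::real. exp (- e * \<bar>t\<bar>))"
proof -
 have "prob_space (density lborel (exponential_density e))"
  by (rule prob_space_exponential_density[OF assms])
 then have "(\<integral>\<^sup>+x. ennreal (exponential_density e x) \<partial>lborel) = 1"
  by (auto dest!: prob_space.emeasure_space_1 simp: emeasure_density)
 then have "integrable lborel (exponential_density e)"
  by (intro integrableI_nonneg) (auto simp: exponential_density_nonneg assms)
 then have "integrable lborel (\<lambda>x. (1 / e) * exponential_density e x)" by simp
 also have "(\<lambda>x. (1 / e) * exponential_density e x) = (\<lambda>x. indicator {0..} x *\<^sub>R exp (- e * \<bar>x\<bar>))"
  using assms by (auto simp: fun_eq_iff exponential_density_def indicator_def)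
 finally have "has_bochner_integral lborel (\<lambda>x. indicator {0..} x *\<^sub>R exp (- e * \<bar>x\<bar>))
   (\<integral>x. indicator {0..} x *\<^sub>R exp (- e * \<bar>x\<bar>) \<partial>lborel)"
  by (simp add: has_bochner_integral_iff)
 from has_bochner_integral_even_function[OF this] show ?thesis
  by (simp add: has_bochner_integral_iff)
qed

section \<open>Almost harmonic functions of a walk with positive drift\<close>

text \<open>The walk goes from t to t - l with l of law \<tau>. That exp (- \<epsilon> l) has mean
  below 1 is a quantitative positive drift: it yields both the bounded potential of
  \<open>ee\<close> and the contraction that removes the boundary term in
  \<open>subharmonic_bounded\<close>.\<close>

locale drift_walk =
 fixes \<tau> :: "real measure" and \<epsilon> :: real
 assumes prob: "prob_space \<tau>" and sets_\<tau>[measurable_cong, simp]: "sets \<tau> = sets borel"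
  and eps: "\<epsilon> > 0"
  and exp_int: "integrable \<tau> (\<lambda>l. exp (- \<epsilon> * l))" "integrable \<tau> (\<lambda>l. exp (\<epsilon> * l))"
  and drift: "(\<integral>l. exp (- \<epsilon> * l) \<partial>\<tau>) < 1"
begin

sublocale prob_space \<tau> by (rule prob)

lemma space_\<tau>[simp]: "space \<tau> = UNIV"
 using sets_eq_imp_space_eq[OF sets_\<tau>] by simp

lemma prob_UNIV[simp]: "prob UNIV = 1"
 using prob_space by simp

lemma integrable_abs: "integrable \<tau> (\<lambda>l. \<bar>l\<bar>)"
proof (rule Bochner_Integration.integrable_bound)
 show "integrable \<tau> (\<lambda>l. (1 / \<epsilon>) * (exp (\<epsilon> * l) + exp (- \<epsilon> * l)))"
  using exp_int by simp
 have "\<bar>l\<bar> \<le> (1 / \<epsilon>) * (exp (\<epsilon> * l) + exp (- \<epsilon> * l))" for l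
 proof -
  have "\<epsilon> * l \<le> exp (\<epsilon> * l)" "- \<epsilon> * l \<le> exp (- \<epsilon> * l)"
   using exp_ge_add_one_self[of "\<epsilon> * l"] exp_ge_add_one_self[of "- \<epsilon> * l"] by linarith+
  then have "\<epsilon> * \<bar>l\<bar> \<le> exp (\<epsilon> * l) + exp (- \<epsilon> * l)"
   using exp_gt_zero[of "\<epsilon> * l"] exp_gt_zero[of "- \<epsilon> * l"] by (cases "l \<ge> 0") (auto simp del: exp_gt_zero)
  then show ?thesis using eps by (simp add: field_simps)
 qed
 then show "AE l in \<tau>. norm \<bar>l\<bar> \<le> norm ((1 / \<epsilon>) * (exp (\<epsilon> * l) + exp (- \<epsilon> * l)))"
  using eps by (auto intro!: AE_I2)
qed simp

lemma integrable_id: "integrable \<tau> (\<lambda>l. l)"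
 by (rule Bochner_Integration.integrable_bound[OF integrable_abs]) auto

text \<open>The mean of the factor (1 - exp (- \<epsilon> l)) / \<epsilon> from
  \<open>ww_step\<close>: one step of the walk lowers the mean of \<open>ww\<close> by at least
  \<open>c0\<close> times \<open>ee\<close>.\<close>

definition c0 :: real where "c0 = (1 - (\<integral>l. exp (- \<epsilon> * l) \<partial>\<tau>)) / \<epsilon>"

lemma c0_pos: "c0 > 0"
 using drift eps by (simp add: c0_def)

lemma mean_pos: "(\<integral>l. l \<partial>\<tau>) > 0"
proof -
 have "1 - \<epsilon> * (\<integral>l. l \<partial>\<tau>) = (\<integral>l. 1 - \<epsilon> * l \<partial>\<tau>)"
  using integrable_id by (simp add: prob_space)
 also have "... \<le> (\<integral>l. exp (- \<epsilon> * l) \<partial>\<tau>)"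
  using exp_int integrable_id
  by (intro integral_mono) (auto intro: order_trans[OF _ exp_ge_add_one_self])
 finally show ?thesis using drift eps
  by (smt (verit, ccfv_SIG) mult_nonneg_nonpos)
qed

text \<open>The scale on which all deviations from harmonicity are measured. It decays in both
  directions, so that the walk collects only a bounded total amount of it.\<close>

definition ee :: "real \<Rightarrow> real" where "ee t = exp (- \<epsilon> * \<bar>t\<bar>)"
definition ww :: "real \<Rightarrow> real" where
 "ww t = (if t \<le> 0 then exp (\<epsilon> * t) / \<epsilon> else (2 - exp (- \<epsilon> * t)) / \<epsilon>)"

lemma ee_measurable[measurable]: "ee \<in> borel_measurable borel" unfolding ee_def by measurable
lemma ww_measurable[measurable]: "ww \<in> borel_measurable borel" unfolding ww_def by measurable
lemma ee_bounds: "0 \<le> ee t" "ee t \<le> 1" using eps by (auto simp: ee_def)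
lemma ww_bounds: "0 \<le> ww t" "ww t \<le> 2 / \<epsilon>"
proof -
 have "0 \<le> ww t \<and> ww t \<le> 2 / \<epsilon>"
 proof (cases "t \<le> 0")
  case True
  then have "exp (\<epsilon> * t) \<le> 1" using eps by (simp add: mult_nonneg_nonpos)
  then have "exp (\<epsilon> * t) \<le> 2" by linarith
  then show ?thesis using True eps by (auto simp: ww_def divide_right_mono)
 next
  case False
  then have "exp (- \<epsilon> * t) \<le> 1" using eps by simp
  then have "0 \<le> 2 - exp (- \<epsilon> * t)" "2 - exp (- \<epsilon> * t) \<le> 2"
   using exp_gt_zero[of "- \<epsilon> * t"] by linarith+
  then show ?thesis using False eps by (auto simp: ww_def divide_right_mono simp del: mult_minus_left)
 qed
 then show "0 \<le> ww t" "ww t \<le> 2 / \<epsilon>" by auto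
qed

text \<open>The function \<open>ww\<close> is the integral of \<open>ee\<close> over \<open>(-\<infinity>, t]\<close>; the inequality is the
 integrated form of \<open>ee s \<ge> ee t * ee (s - t)\<close>.\<close>

lemma ww_step: "ee t * ((1 - exp (- \<epsilon> * l)) / \<epsilon>) \<le> ww t - ww (t - l)"
proof -
 \<comment> \<open>In the variables exp (\<epsilon> t) and exp (\<epsilon> l) the claim becomes a
   rational inequality in each of four regions, given by the signs of t and of t - l.\<close>
 define x where "x = exp (\<epsilon> * t)"
 define y where "y = exp (\<epsilon> * l)"
 have p: "x > 0" "y > 0" by (auto simp: x_def y_def)
 have mono: "x \<le> 1 \<longleftrightarrow> t \<le> 0" "y \<le> x \<longleftrightarrow> l \<le> t" "x \<le> y \<longleftrightarrow> t \<le> l" "y \<le> 1 \<longleftrightarrow> l \<le> 0"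
  using eps by (auto simp: x_def y_def mult_le_0_iff)
 have E: "exp (- \<epsilon> * l) = 1 / y" "exp (\<epsilon> * (t - l)) = x / y" "exp (- \<epsilon> * (t - l)) = y / x" "exp (- \<epsilon> * t) = 1 / x"
  by (auto simp: x_def y_def exp_minus exp_diff right_diff_distrib inverse_eq_divide)
 have sq: "y + 1 / y \<ge> 2" using p sum_squares_ge_zero[of "y - 1" 0]
  by (simp add: field_simps power2_eq_square)
 have et: "ee t = (if t \<le> 0 then x else 1 / x)"
  by (auto simp: ee_def x_def exp_minus inverse_eq_divide)
 have ew: "\<epsilon> * ww u = (if u \<le> 0 then exp (\<epsilon> * u) else 2 - exp (- \<epsilon> * u))" for u
  using eps by (simp add: ww_def)
 have ew1: "\<epsilon> * ww t = (if t \<le> 0 then x else 2 - 1 / x)"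
  unfolding ew E by (simp add: x_def)
 have ew2: "\<epsilon> * ww (t - l) = (if t \<le> l then x / y else 2 - y / x)"
  unfolding ew E by simp
 consider "t \<le> 0" "t \<le> l" | "t \<le> 0" "l < t" | "t > 0" "t \<le> l" | "t > 0" "l < t" by linarith
 then have "ee t * (1 - 1 / y) \<le> \<epsilon> * ww t - \<epsilon> * ww (t - l)"
 proof cases
  case 1
  then show ?thesis unfolding et ew1 ew2 by (simp add: algebra_simps)
 next
  case 2
  have "2 - y / x \<le> x / y" using p sum_squares_ge_zero[of "x - y" 0]
   by (simp add: field_simps power2_eq_square)
  then show ?thesis using 2 unfolding et ew1 ew2 by (simp add: algebra_simps)
 next
  case 3
  then have xy: "x > 1" "y \<ge> x" using mono by force+
  have "2 - 1 / x - x / y - (1 / x - 1 / (x * y)) = (2 * x * y - 2 * y - x * x + 1) / (x * y)"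
   using p by (simp add: field_simps)
  also have "2 * x * y - 2 * y - x * x + 1 = 2 * (x - 1) * (y - x) + (x - 1)\<^sup>2"
   by (simp add: algebra_simps power2_eq_square)
  also have "(...) / (x * y) \<ge> 0" using xy p by simp
  finally show ?thesis using 3 unfolding et ew1 ew2 by (simp add: algebra_simps)
 next
  case 4
  have "1 / x * (2 - 1 / y) \<le> y / x"
  proof -
   have "1 / x * (2 - 1 / y) \<le> 1 / x * y" using sq p by (intro mult_left_mono) auto
   then show ?thesis by simp
  qed
  then show ?thesis using 4 unfolding et ew1 ew2 by (simp add: algebra_simps)
 qed
 then have "ee t * (1 - 1 / y) / \<epsilon> \<le> (\<epsilon> * ww t - \<epsilon> * ww (t - l)) / \<epsilon>"
  using eps by (intro divide_right_mono) auto
 also have "(\<epsilon> * ww t - \<epsilon> * ww (t - l)) / \<epsilon> = ww t - ww (t - l)"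
  using eps by (simp add: diff_divide_distrib)
 finally show ?thesis by (simp only: E times_divide_eq_right)
qed

lemma integrable_shift:
 assumes "f \<in> borel_measurable borel" "\<And>t. \<bar>f t\<bar> \<le> (B::real)"
 shows "integrable \<tau> (\<lambda>l. f (t - l))"
 using assms by (intro integrable_const_bound[where B = B]) (auto simp: AE_I2)

lemma integral_shift_bound:
 assumes "f \<in> borel_measurable borel" "\<And>t. \<bar>f t\<bar> \<le> (B::real)"
 shows "\<bar>\<integral>l. f (t - l) \<partial>\<tau>\<bar> \<le> B"
proof -
 have "\<bar>\<integral>l. f (t - l) \<partial>\<tau>\<bar> \<le> (\<integral>l. \<bar>f (t - l)\<bar> \<partial>\<tau>)" by (rule integral_abs_bound)
 also have "... \<le> (\<integral>l. B \<partial>\<tau>)"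
  using integrable_shift[OF assms] assms by (intro integral_mono) auto
 finally show ?thesis by (simp add: prob_space)
qed

lemma measurable_shift:
 fixes f :: "real \<Rightarrow> real"
 assumes [measurable]: "f \<in> borel_measurable borel"
 shows "(\<lambda>t. \<integral>l. f (t - l) \<partial>\<tau>) \<in> borel_measurable borel"
 by (rule borel_measurable_lebesgue_integral[where f = "\<lambda>t l. f (t - l)"]) measurable

lemma shift_tendsto_0:
 assumes f: "f \<in> borel_measurable borel" "\<And>t. \<bar>f t\<bar> \<le> (B::real)" "(f \<longlongrightarrow> 0) at_top"
 shows "((\<lambda>t. \<integral>l. f (t - l) \<partial>\<tau>) \<longlongrightarrow> 0) at_top"
proof -
 note [measurable] = f(1)
 have lim: "((\<lambda>t. f (t - l)) \<longlongrightarrow> 0) at_top" for l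
 proof -
  have "filterlim (\<lambda>t::real. t - l) at_top at_top" by real_asymp
  from filterlim_compose[OF f(3) this] show ?thesis .
 qed
 have "((\<lambda>t. \<integral>l. f (t - l) \<partial>\<tau>) \<longlongrightarrow> (\<integral>l. 0 \<partial>\<tau>)) at_top"
  by (rule integral_dominated_convergence_at_top[where w = "\<lambda>_. B"]) (use f lim in auto)
 then show ?thesis by simp
qed

text \<open>The truncated potential: the expected sum of f over the first n positions t, t - l1, t -
  l1 - l2, ... of the walk.\<close>

fun pot :: "(real \<Rightarrow> real) \<Rightarrow> nat \<Rightarrow> real \<Rightarrow> real" where
 "pot f 0 t = 0"
| "pot f (Suc n) t = f t + (\<integral>l. pot f n (t - l) \<partial>\<tau>)"

lemma pot_bound:
 assumes f: "f \<in> borel_measurable borel" "\<And>t. \<bar>f t\<bar> \<le> (B::real)"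
 shows "pot f n \<in> borel_measurable borel \<and> (\<forall>t. \<bar>pot f n t\<bar> \<le> real n * B)"
proof (induction n)
 case (Suc n)
 then have m: "pot f n \<in> borel_measurable borel" and b: "\<And>t. \<bar>pot f n t\<bar> \<le> real n * B" by auto
 have "\<bar>pot f (Suc n) t\<bar> \<le> real (Suc n) * B" for t
  using f(2)[of t] integral_shift_bound[OF m b, of t] by (simp add: algebra_simps)
 moreover have "pot f (Suc n) \<in> borel_measurable borel"
 proof -
  have "pot f (Suc n) = (\<lambda>t. f t + (\<integral>l. pot f n (t - l) \<partial>\<tau>))" by (simp add: fun_eq_iff)
  then show ?thesis using measurable_shift[OF m] f(1) by simp
 qed
 ultimately show ?case by blast
qed simp

lemma pot_tendsto_0:
 assumes f: "f \<in> borel_measurable borel" "\<And>t. \<bar>f t\<bar> \<le> (B::real)" "(f \<longlongrightarrow> 0) at_top"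
 shows "(pot f n \<longlongrightarrow> 0) at_top"
proof (induction n)
 case 0
 then show ?case by simp
next
 case (Suc n)
 have "((\<lambda>t. \<integral>l. pot f n (t - l) \<partial>\<tau>) \<longlongrightarrow> 0) at_top"
  using pot_bound[OF f(1,2)] Suc by (intro shift_tendsto_0) auto
 from tendsto_add[OF f(3) this] show ?case by simp
qed

lemma pot_nonneg:
 assumes "\<And>t. 0 \<le> f t" shows "0 \<le> pot f n t"
 by (induction n arbitrary: t) (auto intro!: add_nonneg_nonneg assms integral_nonneg_AE)

text \<open>\<open>ww\<close> is a Lyapunov function: each step lowers its mean by at least
  \<open>c0\<close> times the current \<open>ee\<close>, and it stays nonnegative, so the collected
  amount cannot exceed its initial value.\<close>

lemma pot_ee_le: "c0 * pot ee n t \<le> ww t"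
proof (induction n arbitrary: t)
 case 0
 then show ?case using ww_bounds by simp
next
 case (Suc n)
 have b: "pot ee n \<in> borel_measurable borel" "\<And>t. \<bar>pot ee n t\<bar> \<le> real n * 1"
  using pot_bound[of ee 1 n] ee_bounds by auto
 have i1: "integrable \<tau> (\<lambda>l. pot ee n (t - l))" by (rule integrable_shift[OF b])
 have wb: "\<bar>ww t\<bar> \<le> 2 / \<epsilon>" for t using ww_bounds[of t] by simp
 have i2: "integrable \<tau> (\<lambda>l. ww (t - l))" using wb by (intro integrable_shift[where B = "2 / \<epsilon>"]) auto
 have i3: "integrable \<tau> (\<lambda>l. ee t * ((1 - exp (- \<epsilon> * l)) / \<epsilon>))"
  using exp_int by simp
 have "c0 * ee t = (\<integral>l. ee t * ((1 - exp (- \<epsilon> * l)) / \<epsilon>) \<partial>\<tau>)"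
  using exp_int by (simp add: c0_def prob_space)
 also have "... \<le> (\<integral>l. ww t - ww (t - l) \<partial>\<tau>)"
  using i2 i3 ww_step by (intro integral_mono) auto
 also have "... = ww t - (\<integral>l. ww (t - l) \<partial>\<tau>)" using i2 by (simp add: prob_space)
 finally have "c0 * ee t + (\<integral>l. ww (t - l) \<partial>\<tau>) \<le> ww t" by simp
 moreover have "c0 * (\<integral>l. pot ee n (t - l) \<partial>\<tau>) \<le> (\<integral>l. ww (t - l) \<partial>\<tau>)"
 proof -
  have "c0 * (\<integral>l. pot ee n (t - l) \<partial>\<tau>) = (\<integral>l. c0 * pot ee n (t - l) \<partial>\<tau>)" by simp
  also have "... \<le> (\<integral>l. ww (t - l) \<partial>\<tau>)" using i1 i2 Suc by (intro integral_mono) auto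
  finally show ?thesis .
 qed
 ultimately show ?case by (simp add: algebra_simps)
qed

lemma pot_ee_bound: "pot ee n t \<le> 2 / (\<epsilon> * c0)"
 using order_trans[OF pot_ee_le[of n t] ww_bounds(2)[of t]] c0_pos eps
 by (simp add: field_simps)

text \<open>Iterating the inequality n times leaves a sum of errors, bounded by the potential of
  \<open>ee\<close>, and the mean of \<phi> after n steps. The latter is at most B exp (\<epsilon>
  t) q^n, and q < 1 is the drift condition; thus an exponential growth bound improves to
  boundedness.\<close>

theorem subharmonic_bounded:
 assumes m[measurable]: "\<phi> \<in> borel_measurable borel"
  and B: "\<And>t. 0 \<le> \<phi> t" "\<And>t. \<phi> t \<le> B * exp (\<epsilon> * t)"
  and K: "K \<ge> 0" "\<And>t. \<phi> t \<le> (\<integral>l. \<phi> (t - l) \<partial>\<tau>) + K * ee t"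
 shows "\<phi> t \<le> 2 * K / (\<epsilon> * c0)"
proof -
 define q where "q = (\<integral>l. exp (- \<epsilon> * l) \<partial>\<tau>)"
 have q: "0 \<le> q" "q < 1" using drift by (auto simp: q_def intro!: integral_nonneg_AE)
 have B0: "B \<ge> 0" using order_trans[OF B(1)[of 0] B(2)[of 0]] by simp
 have e_eq: "B * exp (\<epsilon> * (t - l)) = B * exp (\<epsilon> * t) * exp (- \<epsilon> * l)" for t l
  by (simp add: exp_add[symmetric] algebra_simps)
 have ie: "integrable \<tau> (\<lambda>l. B * exp (\<epsilon> * (t - l)))" for t
  unfolding e_eq using exp_int by simp
 have i\<phi>: "integrable \<tau> (\<lambda>l. \<phi> (t - l))" for t
  by (rule Bochner_Integration.integrable_bound[OF ie[of t]])
   (use B B0 in \<open>auto intro!: AE_I2\<close>)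
 have *: "\<phi> t \<le> K * pot ee n t + B * exp (\<epsilon> * t) * q ^ n" for n t
 proof (induction n arbitrary: t)
  case 0
  then show ?case using B by simp
 next
  case (Suc n)
  have b: "pot ee n \<in> borel_measurable borel" "\<And>t. \<bar>pot ee n t\<bar> \<le> real n * 1"
   using pot_bound[of ee 1 n] ee_bounds by auto
  have i1: "integrable \<tau> (\<lambda>l. pot ee n (t - l))" by (rule integrable_shift[OF b])
  have "\<phi> t \<le> (\<integral>l. \<phi> (t - l) \<partial>\<tau>) + K * ee t" by (rule K)
  also have "(\<integral>l. \<phi> (t - l) \<partial>\<tau>) \<le> (\<integral>l. K * pot ee n (t - l) + B * exp (\<epsilon> * (t - l)) * q ^ n \<partial>\<tau>)"
   using i1 ie i\<phi> Suc by (intro integral_mono) auto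
  also have "... = K * (\<integral>l. pot ee n (t - l) \<partial>\<tau>) + (\<integral>l. B * exp (\<epsilon> * (t - l)) * q ^ n \<partial>\<tau>)"
   using i1 ie by simp
  also have "(\<integral>l. B * exp (\<epsilon> * (t - l)) * q ^ n \<partial>\<tau>) = B * exp (\<epsilon> * t) * q ^ Suc n"
   unfolding e_eq using exp_int by (simp add: q_def)
  finally show ?case by (simp add: algebra_simps)
 qed
 have "(\<lambda>n. K * (2 / (\<epsilon> * c0)) + B * exp (\<epsilon> * t) * q ^ n) \<longlonglongrightarrow> K * (2 / (\<epsilon> * c0)) + B * exp (\<epsilon> * t) * 0"
  using q by (intro tendsto_intros LIMSEQ_realpow_zero) auto
 moreover have "\<phi> t \<le> K * (2 / (\<epsilon> * c0)) + B * exp (\<epsilon> * t) * q ^ n" for n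
  using *[of t n] mult_left_mono[OF pot_ee_bound[of n t] K(1)] by linarith
 ultimately have "\<phi> t \<le> K * (2 / (\<epsilon> * c0)) + B * exp (\<epsilon> * t) * 0"
  by (intro LIMSEQ_le_const) auto
 then show ?thesis by (simp add: mult.commute)
qed


lemma integrable_ee: "integrable lborel ee"
 unfolding ee_def by (rule integrable_exp_neg_abs[OF eps])

text \<open>The conserved quantity: integrated over s \<le> T, the defect of \<phi> equals the mean
  over l of the integral of \<phi> from T - l to T. By asymptotic invariance the latter is close to
  the mean of l times \<phi>(T), while the former tends to the total integral of the defect.\<close>

theorem harmonic_limit:
 assumes m[measurable]: "\<phi> \<in> borel_measurable borel"
  and C: "\<And>t. \<bar>\<phi> t\<bar> \<le> C" and B: "\<And>t. \<bar>\<phi> t\<bar> \<le> B * exp (\<epsilon> * t)"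
  and K: "\<And>t. \<bar>\<phi> t - (\<integral>l. \<phi> (t - l) \<partial>\<tau>)\<bar> \<le> K * ee t"
  and inv: "\<And>l. ((\<lambda>t. \<phi> (t - l) - \<phi> t) \<longlongrightarrow> 0) at_top"
 shows "(\<phi> \<longlongrightarrow> (\<integral>t. \<phi> t - (\<integral>l. \<phi> (t - l) \<partial>\<tau>) \<partial>lborel) / (\<integral>l. l \<partial>\<tau>)) at_top"
  and "integrable lborel (\<lambda>t. \<phi> t - (\<integral>l. \<phi> (t - l) \<partial>\<tau>))"
proof -
 let ?d = "\<lambda>T l u. indicator {0..1::real} u * (\<phi> (T - l * u) - \<phi> T)"
 let ?i = "\<lambda>T f s. indicator {..T} s * f s"
 define \<psi> where "\<psi> t = \<phi> t - (\<integral>l. \<phi> (t - l) \<partial>\<tau>)" for t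
 have \<psi>m[measurable]: "\<psi> \<in> borel_measurable borel" unfolding \<psi>_def by measurable
 have B0: "B \<ge> 0" using order_trans[OF abs_ge_zero B[of 0]] by simp
 have C0: "C \<ge> 0" using C[of 0] by linarith
 have \<psi>i: "integrable lborel \<psi>"
  by (rule Bochner_Integration.integrable_bound[where f = "\<lambda>t. K * ee t"])
   (use integrable_ee K in \<open>auto simp: \<psi>_def[symmetric] intro!: AE_I2 order_trans[OF _ abs_ge_self]\<close>)
 then show "integrable lborel (\<lambda>t. \<phi> t - (\<integral>l. \<phi> (t - l) \<partial>\<tau>))" by (simp add: \<psi>_def[abs_def])
 \<comment> \<open>Constant of an integrable majorant of the shifted function on s \<le> T, needed
   for Fubini: the growth bound on \<phi> is decay at minus infinity, and exp (- \<epsilon> l) has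
   finite mean.\<close>
 define E where "E T = B * exp (2 * \<epsilon> * \<bar>T\<bar>)" for T
 have E0: "E T \<ge> 0" for T using B0 by (simp add: E_def)
 have tail: "\<bar>indicator {..T} s * \<phi> (s - l)\<bar> \<le> E T * ee s * exp (- \<epsilon> * l)" for T s l
 proof (cases "s \<le> T")
  case True
  have "\<epsilon> * (s - l) \<le> 2 * \<epsilon> * \<bar>T\<bar> + - \<epsilon> * \<bar>s\<bar> + - \<epsilon> * l"
  proof -
   have "s \<le> 2 * \<bar>T\<bar> - \<bar>s\<bar>" using True by linarith
   from mult_left_mono[OF this, of \<epsilon>] eps show ?thesis by (simp add: algebra_simps)
  qed
  then have "exp (\<epsilon> * (s - l)) \<le> exp (2 * \<epsilon> * \<bar>T\<bar>) * ee s * exp (- \<epsilon> * l)"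
   unfolding ee_def exp_add[symmetric] by (simp only: exp_le_cancel_iff)
  then have "B * exp (\<epsilon> * (s - l)) \<le> B * (exp (2 * \<epsilon> * \<bar>T\<bar>) * ee s * exp (- \<epsilon> * l))"
   using B0 by (rule mult_left_mono)
  then show ?thesis using B[of "s - l"] True by (simp add: E_def mult.assoc)
 next
  case False
  then show ?thesis using E0 ee_bounds by simp
 qed
 have i0: "integrable lborel (\<lambda>s. indicator {..T} s * \<phi> s)" for T
  by (rule Bochner_Integration.integrable_bound[where f = "\<lambda>s. E T * ee s"])
   (use integrable_ee tail[of T _ 0] in \<open>auto intro!: AE_I2 order_trans[OF _ abs_ge_self]\<close>)
 \<comment> \<open>The integral of \<phi> from T - l to T, with its sign when l < 0.\<close>
 define J where "J T l = (\<integral>s. (indicator {..T} s - indicator {..T - l} s) * \<phi> s \<partial>lborel)" for T l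
 have J1: "J T l = (\<integral>s. ?i T \<phi> s \<partial>lborel) - (\<integral>s. indicator {..T - l} s * \<phi> s \<partial>lborel)" for T l
  unfolding J_def left_diff_distrib using i0 by simp
 have shift: "(\<integral>s. indicator {..T} s * \<phi> (s - l) \<partial>lborel) = (\<integral>s. indicator {..T - l} s * \<phi> s \<partial>lborel)" for T l
  by (subst lborel_integral_real_affine[where c = 1 and t = l])
   (auto intro!: Bochner_Integration.integral_cong simp: indicator_def)
 have J2: "J T l = l * (\<integral>u. indicator {0..1::real} u * \<phi> (T - l * u) \<partial>lborel)" for T l
 proof (cases "l = 0")
  case False
  have ne: "AE u in lborel. u \<noteq> (0::real)" "AE u in lborel. u \<noteq> (1::real)"
   by (rule AE_lborel_singleton)+
  have "J T l = \<bar>- l\<bar> *\<^sub>R (\<integral>u. (indicator {..T} (T + - l * u) - indicator {..T - l} (T + - l * u)) * \<phi> (T + - l * u) \<partial>lborel)"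
   unfolding J_def using False by (intro lborel_integral_real_affine) auto
  also have "(\<integral>u. (indicator {..T} (T + - l * u) - indicator {..T - l} (T + - l * u)) * \<phi> (T + - l * u) \<partial>lborel)
    = (\<integral>u. sgn l * (indicator {0..1::real} u * \<phi> (T - l * u)) \<partial>lborel)"
  proof (rule integral_cong_AE)
   show "AE u in lborel. (indicator {..T} (T + - l * u) - indicator {..T - l} (T + - l * u)) * \<phi> (T + - l * u)
     = sgn l * (indicator {0..1::real} u * \<phi> (T - l * u))"
    using ne
   proof eventually_elim
    case (elim u)
    have "l * u \<ge> 0 \<longleftrightarrow> (if l > 0 then u \<ge> 0 else u \<le> 0)" using False by (auto simp: zero_le_mult_iff)
    moreover have "l * u \<ge> l \<longleftrightarrow> (if l > 0 then u \<ge> 1 else u \<le> 1)"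
     using False mult_le_cancel_left[of l 1 u] by auto
    ultimately show ?case using False elim
     by (auto simp: indicator_def sgn_real_def split: if_splits)
   qed
  qed measurable
  finally show ?thesis using False by (simp add: sgn_real_def split: if_splits)
 qed (simp add: J_def)
 have Jm[measurable]: "J T \<in> borel_measurable borel" for T
  unfolding J2[abs_def] by measurable
 \<comment> \<open>Comparison with the constant \<phi>(T) on the same interval. The parametrisation
   by u in [0, 1] gives dominated convergence for each l, and the resulting bound 2 C |l| gives it
   again under the mean over l.\<close>
 have diff: "J T l - l * \<phi> T = l * (\<integral>u. ?d T l u \<partial>lborel)" for T l
 proof -
  have "integrable lborel (\<lambda>u. indicator {0..1::real} u * \<phi> (T - l * u))"
   by (rule Bochner_Integration.integrable_bound[where f = "\<lambda>u::real. C * indicator {0..1::real} u"],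
     simp, simp)
    (use C C0 in \<open>auto intro!: AE_I2 simp: indicator_def split: if_splits\<close>)
  moreover have "integrable lborel (\<lambda>u::real. indicator {0..1::real} u * \<phi> T)" by simp
  ultimately show ?thesis unfolding J2 right_diff_distrib by (simp add: algebra_simps)
 qed
 have dom: "AE u in lborel. norm (?d T l u) \<le> 2 * C * indicator {0..1::real} u" for T l
 proof -
  have "\<bar>\<phi> (T - l * u) - \<phi> T\<bar> \<le> 2 * C" for u using C[of "T - l * u"] C[of T] by linarith
  then show ?thesis by (auto intro!: AE_I2 simp: indicator_def)
 qed
 have idom: "integrable lborel (\<lambda>u::real. 2 * C * indicator {0..1::real} u)" by simp
 have dlim: "((\<lambda>T. J T l - l * \<phi> T) \<longlongrightarrow> 0) at_top" for l
 proof -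
  have "((\<lambda>T. \<integral>u. ?d T l u \<partial>lborel) \<longlongrightarrow> (\<integral>u. 0 \<partial>(lborel :: real measure))) at_top"
   using idom dom
   by (intro integral_dominated_convergence_at_top[where w = "\<lambda>u. 2 * C * indicator {0..1::real} u"])
    (auto intro!: AE_I2 tendsto_mult_right_zero inv)
  from tendsto_mult_right_zero[OF this[simplified], of l] show ?thesis unfolding diff .
 qed
 have dbound: "\<bar>J T l - l * \<phi> T\<bar> \<le> 2 * C * \<bar>l\<bar>" for T l
 proof -
  have "\<bar>\<integral>u. ?d T l u \<partial>lborel\<bar> \<le> (\<integral>u. 2 * C * indicator {0..1::real} u \<partial>lborel)"
  proof -
   have "\<bar>\<integral>u. ?d T l u \<partial>lborel\<bar> \<le> (\<integral>u. \<bar>?d T l u\<bar> \<partial>lborel)"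
    by (rule integral_abs_bound)
   also have "... \<le> (\<integral>u. 2 * C * indicator {0..1::real} u \<partial>lborel)"
    using dom[of T l] by (intro integral_mono_AE' idom) auto
   finally show ?thesis .
  qed
  then show ?thesis unfolding diff abs_mult by (simp add: mult.commute mult_left_mono)
 qed
 have iJ: "integrable \<tau> (\<lambda>l. J T l - l * \<phi> T)" for T
  by (rule Bochner_Integration.integrable_bound[where f = "\<lambda>l. 2 * C * \<bar>l\<bar>"])
   (use integrable_abs dbound C0 in \<open>auto intro!: AE_I2\<close>)
 have lim1: "((\<lambda>T. \<integral>l. J T l - l * \<phi> T \<partial>\<tau>) \<longlongrightarrow> (\<integral>l. 0 \<partial>\<tau>)) at_top"
  by (rule integral_dominated_convergence_at_top[where w = "\<lambda>l. 2 * C * \<bar>l\<bar>"])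
   (use integrable_abs dbound dlim in auto)
 have iJ': "integrable \<tau> (J T)" for T
  using Bochner_Integration.integrable_add[OF iJ[of T] integrable_mult_left[OF integrable_id, of "\<phi> T"]] by simp
 have lim2: "((\<lambda>T. \<integral>s. indicator {..T} s * \<psi> s \<partial>lborel) \<longlongrightarrow> (\<integral>s. \<psi> s \<partial>lborel)) at_top"
 proof (rule integral_dominated_convergence_at_top[where w = "\<lambda>s. \<bar>\<psi> s\<bar>"])
  show "AE s in lborel. ((\<lambda>T. indicator {..T} s * \<psi> s) \<longlongrightarrow> \<psi> s) at_top"
  proof (rule AE_I2)
   fix s
   have "\<forall>\<^sub>F T in at_top. \<psi> s = indicator {..T} s * \<psi> s"
    using eventually_ge_at_top[of s] by eventually_elim simp
   then show "((\<lambda>T. indicator {..T} s * \<psi> s) \<longlongrightarrow> \<psi> s) at_top"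
    by (rule Lim_transform_eventually[OF tendsto_const])
  qed
 qed (use \<psi>i in \<open>auto intro!: AE_I2 simp: indicator_def\<close>)
 have eq: "(\<integral>s. ?i T \<psi> s \<partial>lborel) = (\<integral>l. J T l \<partial>\<tau>)" for T
 proof -
  interpret pair_sigma_finite lborel \<tau> ..
  let ?h = "\<lambda>(s, l). indicator {..T} s * \<phi> (s - l)"
  have hi: "integrable \<tau> (\<lambda>l. indicator {..T} s * \<phi> (s - l))" for s
   using integrable_shift[OF m C] by simp
  have ih: "integrable (lborel \<Otimes>\<^sub>M \<tau>) ?h"
  proof (rule Fubini_integrable)
   have "(\<integral>l. norm (indicator {..T} s * \<phi> (s - l)) \<partial>\<tau>) \<le> (\<integral>l. E T * ee s * exp (- \<epsilon> * l) \<partial>\<tau>)" for s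
    using hi exp_int tail by (intro integral_mono) auto
   then show "integrable lborel (\<lambda>s. \<integral>l. norm (?h (s, l)) \<partial>\<tau>)"
    by (intro Bochner_Integration.integrable_bound[where f = "\<lambda>s. E T * ee s * (\<integral>l. exp (- \<epsilon> * l) \<partial>\<tau>)" and g = "\<lambda>s. \<integral>l. norm (?h (s, l)) \<partial>\<tau>"])
     (use integrable_ee in \<open>auto intro!: AE_I2 order_trans[OF _ abs_ge_self]\<close>)
  qed (use hi in auto)
  have "(\<integral>s. ?i T \<psi> s \<partial>lborel) =
    (\<integral>s. indicator {..T} s * \<phi> s - (\<integral>l. indicator {..T} s * \<phi> (s - l) \<partial>\<tau>) \<partial>lborel)"
   by (simp add: \<psi>_def right_diff_distrib)
  also have "... = (\<integral>s. ?i T \<phi> s \<partial>lborel) - (\<integral>s. \<integral>l. indicator {..T} s * \<phi> (s - l) \<partial>\<tau> \<partial>lborel)"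
   using integrable_fst[OF ih] i0 by simp
  also have "(\<integral>s. \<integral>l. indicator {..T} s * \<phi> (s - l) \<partial>\<tau> \<partial>lborel) = (\<integral>l. \<integral>s. indicator {..T} s * \<phi> (s - l) \<partial>lborel \<partial>\<tau>)"
   using Fubini_integral[OF ih] by simp
  also have "... = (\<integral>l. (\<integral>s. ?i T \<phi> s \<partial>lborel) - J T l \<partial>\<tau>)"
   unfolding shift J1 by simp
  also have "... = (\<integral>s. ?i T \<phi> s \<partial>lborel) - (\<integral>l. J T l \<partial>\<tau>)"
   using iJ' by simp
  finally show ?thesis by simp
 qed
 have "(\<integral>l. J T l - l * \<phi> T \<partial>\<tau>) = (\<integral>s. ?i T \<psi> s \<partial>lborel) - (\<integral>l. l \<partial>\<tau>) * \<phi> T" for T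
  unfolding eq using iJ' integrable_id by simp
 with tendsto_diff[OF lim2 lim1]
 have "((\<lambda>T. (\<integral>l. l \<partial>\<tau>) * \<phi> T) \<longlongrightarrow> (\<integral>s. \<psi> s \<partial>lborel)) at_top" by simp
 from tendsto_divide[OF this tendsto_const[of "\<integral>l. l \<partial>\<tau>"]] mean_pos
 show "(\<phi> \<longlongrightarrow> (\<integral>t. \<phi> t - (\<integral>l. \<phi> (t - l) \<partial>\<tau>) \<partial>lborel) / (\<integral>l. l \<partial>\<tau>)) at_top"
  by (simp add: \<psi>_def)
qed

end

section \<open>Asymptotic invariance of bounded harmonic families\<close>

text \<open>With mass on every interval, a Lipschitz function of the step that is small in mean
  square is small at each single l.\<close>

locale full_drift_walk = drift_walk +
 assumes full: "\<And>a b. a < b \<Longrightarrow> measure \<tau> {a<..<b} > 0"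
begin

text \<open>Level k will be the test function composed with the k-th power of the rotation. One step
  of the walk raises the level by one; this is how the twist enters a statement about a walk on the
  real line.\<close>

context
 fixes \<phi> :: "nat \<Rightarrow> real \<Rightarrow> real" and C K :: real
 assumes \<phi>_m[measurable]: "\<And>k. \<phi> k \<in> borel_measurable borel"
  and C: "\<And>k t. \<bar>\<phi> k t\<bar> \<le> C"
  and K: "\<And>k t. \<bar>\<phi> k t - (\<integral>l. \<phi> (Suc k) (t - l) \<partial>\<tau>)\<bar> \<le> K * ee t"
begin

private lemma C0: "C \<ge> 0" using C[of 0 0] by linarith
private lemma K0: "K \<ge> 0" using K[of 0 0] eps by (auto simp: ee_def)

definition "osc k t = (\<integral>l. (\<phi> (Suc k) (t - l) - \<phi> k t)\<^sup>2 \<partial>\<tau>)"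

text \<open>The expected sum of \<open>osc\<close> along the first n steps of the walk, with the
  level rising by one each time.\<close>

fun opot :: "nat \<Rightarrow> nat \<Rightarrow> real \<Rightarrow> real" where
 "opot 0 k t = 0"
| "opot (Suc n) k t = osc k t + (\<integral>l. opot n (Suc k) (t - l) \<partial>\<tau>)"

private lemma i\<phi>: "integrable \<tau> (\<lambda>l. \<phi> k (t - l))"
 by (rule integrable_shift[where B = C]) (use C in auto)

private lemma sq_bound: "(\<phi> k t)\<^sup>2 \<le> C\<^sup>2"
 using C[of k t] C0 by (metis abs_le_square_iff abs_of_nonneg)

private lemma i\<phi>2: "integrable \<tau> (\<lambda>l. (\<phi> k (t - l))\<^sup>2)"
 by (rule integrable_shift[where B = "C\<^sup>2" and f = "\<lambda>x. (\<phi> k x)\<^sup>2"]) (use sq_bound in auto)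

private lemma diff_bound: "(\<phi> k t - \<phi> j s)\<^sup>2 \<le> 4 * C\<^sup>2"
proof -
 have "\<bar>\<phi> k t - \<phi> j s\<bar> \<le> 2 * C" using C[of k t] C[of j s] by linarith
 then have "(\<phi> k t - \<phi> j s)\<^sup>2 \<le> (2 * C)\<^sup>2" using C0 by (metis abs_le_square_iff abs_of_nonneg mult_nonneg_nonneg zero_le_numeral)
 then show ?thesis by (simp add: power_mult_distrib)
qed

private lemma osc_m[measurable]: "osc k \<in> borel_measurable borel"
 unfolding osc_def by measurable

private lemma i_osc: "integrable \<tau> (\<lambda>l. (\<phi> (Suc k) (t - l) - \<phi> k t)\<^sup>2)"
 by (rule integrable_const_bound[where B = "4 * C\<^sup>2"]) (use diff_bound in auto)

private lemma osc_bound: "0 \<le> osc k t" "osc k t \<le> 4 * C\<^sup>2"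
proof -
 show "0 \<le> osc k t" by (simp add: osc_def)
 have "osc k t \<le> (\<integral>l. 4 * C\<^sup>2 \<partial>\<tau>)" unfolding osc_def
  by (rule integral_mono[OF i_osc]) (use diff_bound in auto)
 then show "osc k t \<le> 4 * C\<^sup>2" by (simp add: prob_space)
qed

private lemma opot_prop: "(\<forall>k. opot n k \<in> borel_measurable borel) \<and> (\<forall>k t. \<bar>opot n k t\<bar> \<le> real n * (4 * C\<^sup>2))"
proof (induction n)
 case (Suc n)
 then have m: "\<And>k. opot n k \<in> borel_measurable borel" and b: "\<And>k t. \<bar>opot n k t\<bar> \<le> real n * (4 * C\<^sup>2)" by auto
 have "\<bar>opot (Suc n) k t\<bar> \<le> real (Suc n) * (4 * C\<^sup>2)" for k t
  using osc_bound[of k t] integral_shift_bound[OF m b, of "Suc k" t] by (simp add: algebra_simps)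
 moreover have "opot (Suc n) k \<in> borel_measurable borel" for k
 proof -
  have "opot (Suc n) k = (\<lambda>t. osc k t + (\<integral>l. opot n (Suc k) (t - l) \<partial>\<tau>))" by (simp add: fun_eq_iff)
  then show ?thesis using measurable_shift[OF m] osc_m by simp
 qed
 ultimately show ?case by blast
qed simp

private lemma i_opot: "integrable \<tau> (\<lambda>l. opot n k (t - l))"
 using opot_prop[of n] by (intro integrable_shift) auto

private lemma i_pot: "integrable \<tau> (\<lambda>l. pot ee n (t - l))"
 using pot_bound[of ee 1 n] ee_bounds by (intro integrable_shift) auto

text \<open>For an exactly harmonic family \<open>osc\<close> is the variance of the next value,
  that is the mean of its square minus the present square. The deviation from harmonicity enters
  through twice \<phi> times the defect.\<close>

private lemma osc_le: "osc k t \<le> (\<integral>l. (\<phi> (Suc k) (t - l))\<^sup>2 \<partial>\<tau>) - (\<phi> k t)\<^sup>2 + 2 * C * K * ee t"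
proof -
 define P where "P = (\<integral>l. \<phi> (Suc k) (t - l) \<partial>\<tau>)"
 have "osc k t = (\<integral>l. (\<phi> (Suc k) (t - l))\<^sup>2 - 2 * \<phi> k t * \<phi> (Suc k) (t - l) + (\<phi> k t)\<^sup>2 \<partial>\<tau>)"
  unfolding osc_def by (simp add: power2_diff algebra_simps)
 also have "... = (\<integral>l. (\<phi> (Suc k) (t - l))\<^sup>2 \<partial>\<tau>) - 2 * \<phi> k t * P + (\<phi> k t)\<^sup>2"
  using i\<phi> i\<phi>2 by (simp add: P_def prob_space)
 also have "... = (\<integral>l. (\<phi> (Suc k) (t - l))\<^sup>2 \<partial>\<tau>) - (\<phi> k t)\<^sup>2 + 2 * (\<phi> k t * (\<phi> k t - P))"
  by (simp add: algebra_simps power2_eq_square)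
 also have "\<phi> k t * (\<phi> k t - P) \<le> \<bar>\<phi> k t\<bar> * \<bar>\<phi> k t - P\<bar>" by (metis abs_ge_self abs_mult)
 also have "... \<le> C * (K * ee t)"
  using C[of k t] K[of k t] C0 by (intro mult_mono) (auto simp: P_def)
 finally show ?thesis by (simp add: mult.assoc)
qed

text \<open>Summing \<open>osc_le\<close> along the walk telescopes the squares. As the potential of
  \<open>ee\<close> is bounded in n, so is the total expected oscillation.\<close>

private lemma opot_le: "opot n k t + (\<phi> k t)\<^sup>2 \<le> C\<^sup>2 + 2 * C * K * pot ee n t"
proof (induction n arbitrary: k t)
 case 0
 then show ?case using sq_bound by simp
next
 case (Suc n)
 have "opot (Suc n) k t + (\<phi> k t)\<^sup>2 \<le> (\<integral>l. opot n (Suc k) (t - l) + (\<phi> (Suc k) (t - l))\<^sup>2 \<partial>\<tau>) + 2 * C * K * ee t"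
  using osc_le[of k t] i_opot i\<phi>2 by simp
 also have "(\<integral>l. opot n (Suc k) (t - l) + (\<phi> (Suc k) (t - l))\<^sup>2 \<partial>\<tau>) \<le> (\<integral>l. C\<^sup>2 + 2 * C * K * pot ee n (t - l) \<partial>\<tau>)"
  using i_opot i\<phi>2 i_pot Suc by (intro integral_mono) auto
 also have "... = C\<^sup>2 + 2 * C * K * (\<integral>l. pot ee n (t - l) \<partial>\<tau>)"
  using i_pot by (simp add: prob_space)
 finally show ?case by (simp add: algebra_simps)
qed

private definition "rho t = 4 * C * K * (ee t + (\<integral>l. ee (t - l) \<partial>\<tau>))"

private lemma rho_m[measurable]: "rho \<in> borel_measurable borel"
 unfolding rho_def using measurable_shift[OF ee_measurable] by measurable

private lemma rho_bound: "0 \<le> rho t" "\<bar>rho t\<bar> \<le> 8 * C * K"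
proof -
 have i: "\<bar>\<integral>l. ee (t - l) \<partial>\<tau>\<bar> \<le> 1"
  using ee_bounds by (intro integral_shift_bound) auto
 have n: "0 \<le> (\<integral>l. ee (t - l) \<partial>\<tau>)" using ee_bounds by simp
 show p: "0 \<le> rho t" unfolding rho_def using C0 K0 n ee_bounds[of t] by simp
 have "4 * C * K * (ee t + (\<integral>l. ee (t - l) \<partial>\<tau>)) \<le> 4 * C * K * 2"
  using C0 K0 i ee_bounds[of t] by (intro mult_left_mono) auto
 then show "\<bar>rho t\<bar> \<le> 8 * C * K" using p by (simp add: rho_def)
qed

lemma ee_tendsto_0: "(ee \<longlongrightarrow> 0) at_top"
proof -
 have "((\<lambda>t. exp (- \<epsilon> * t)) \<longlongrightarrow> 0) at_top"
  using eps by real_asymp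
 moreover have "\<forall>\<^sub>F t in at_top. exp (- \<epsilon> * t) = ee t"
  using eventually_ge_at_top[of 0] by eventually_elim (simp add: ee_def)
 ultimately show ?thesis by (rule Lim_transform_eventually)
qed

private lemma rho_tendsto_0: "(rho \<longlongrightarrow> 0) at_top"
proof -
 have "((\<lambda>t. \<integral>l. ee (t - l) \<partial>\<tau>) \<longlongrightarrow> 0) at_top"
  using ee_bounds ee_tendsto_0 by (intro shift_tendsto_0[where B = 1]) auto
 from tendsto_mult_right_zero[OF tendsto_add_zero[OF ee_tendsto_0 this]] show ?thesis
  by (simp add: rho_def[abs_def])
qed

text \<open>The increments of \<open>\<phi>\<close> along one step of the walk satisfy, up to a small error, the same
 equation as \<open>\<phi>\<close>, because two independent steps commute; hence their second moment is almost
 subharmonic.\<close>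

private lemma osc_subharmonic: "osc k t \<le> (\<integral>l. osc (Suc k) (t - l) \<partial>\<tau>) + rho t"
proof -
 define D where "D l l' = \<phi> (Suc (Suc k)) (t - l - l') - \<phi> (Suc k) (t - l')" for l l'
 have D_m[measurable]: "(\<lambda>(l, l'). D l l') \<in> borel_measurable (\<tau> \<Otimes>\<^sub>M \<tau>)"
  unfolding D_def by measurable
 have Db: "\<bar>D l l'\<bar> \<le> 2 * C" for l l'
  using C[of "Suc (Suc k)" "t - l - l'"] C[of "Suc k" "t - l'"] by (simp add: D_def)
 have Db2: "(D l l')\<^sup>2 \<le> 4 * C\<^sup>2" for l l' unfolding D_def by (rule diff_bound)
 have iD: "integrable \<tau> (D l)" for l
  by (rule integrable_const_bound[where B = "2 * C"]) (use Db in auto)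
 have iD2: "integrable \<tau> (\<lambda>l'. (D l l')\<^sup>2)" for l
  by (rule integrable_const_bound[where B = "4 * C\<^sup>2"]) (use Db2 in auto)
 have sq: "(\<phi> (Suc k) (t - l) - \<phi> k t)\<^sup>2 \<le> (\<integral>l'. (D l l')\<^sup>2 \<partial>\<tau>) + 4 * C * K * (ee (t - l) + ee t)" for l
 proof -
  define A where "A = (\<integral>l'. D l l' \<partial>\<tau>)"
  define x where "x = \<phi> (Suc k) (t - l) - \<phi> k t"
  have A: "A = (\<integral>l'. \<phi> (Suc (Suc k)) (t - l - l') \<partial>\<tau>) - (\<integral>l'. \<phi> (Suc k) (t - l') \<partial>\<tau>)"
   unfolding A_def D_def using i\<phi>[of "Suc (Suc k)" "t - l"] i\<phi>[of "Suc k" t] by simp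
  have "\<bar>x - A\<bar> \<le> K * (ee (t - l) + ee t)"
   using K[of "Suc k" "t - l"] K[of k t] by (simp add: A x_def algebra_simps)
  moreover have "\<bar>A\<bar> \<le> 2 * C"
  proof -
   have "\<bar>A\<bar> \<le> (\<integral>l'. \<bar>D l l'\<bar> \<partial>\<tau>)" unfolding A_def by (rule integral_abs_bound)
   also have "... \<le> (\<integral>l'. 2 * C \<partial>\<tau>)" using iD Db by (intro integral_mono) auto
   finally show ?thesis by (simp add: prob_space)
  qed
  moreover have "\<bar>x\<bar> \<le> 2 * C" using C[of "Suc k" "t - l"] C[of k t] by (simp add: x_def)
  \<comment> \<open>The difference of squares factors, and x and A are both bounded by 2 C; this is
    the origin of the factor 4 C K in \<open>rho\<close>.\<close>
  ultimately have "\<bar>x - A\<bar> * \<bar>x + A\<bar> \<le> K * (ee (t - l) + ee t) * (4 * C)"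
   by (intro mult_mono) auto
  moreover have "x\<^sup>2 - A\<^sup>2 \<le> \<bar>x - A\<bar> * \<bar>x + A\<bar>"
  proof -
   have "x\<^sup>2 - A\<^sup>2 = (x - A) * (x + A)" by (simp add: power2_eq_square algebra_simps)
   then show ?thesis by (metis abs_ge_self abs_mult)
  qed
  moreover have "A\<^sup>2 \<le> (\<integral>l'. (D l l')\<^sup>2 \<partial>\<tau>)"
  proof -
   have "0 \<le> (\<integral>l'. (D l l' - A)\<^sup>2 \<partial>\<tau>)" by simp
   also have "... = (\<integral>l'. (D l l')\<^sup>2 - 2 * A * D l l' + A\<^sup>2 \<partial>\<tau>)"
    by (simp add: power2_diff algebra_simps)
   also have "... = (\<integral>l'. (D l l')\<^sup>2 \<partial>\<tau>) - A\<^sup>2"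
    using iD[of l] iD2[of l] by (simp add: prob_space A_def[symmetric] power2_eq_square)
   finally show ?thesis by simp
  qed
  ultimately show ?thesis unfolding x_def[symmetric] by (simp add: mult_ac)
 qed
 have iDD: "integrable \<tau> (\<lambda>l. \<integral>l'. (D l l')\<^sup>2 \<partial>\<tau>)"
 proof (rule integrable_const_bound[where B = "4 * C\<^sup>2"])
  have "(\<integral>l'. (D l l')\<^sup>2 \<partial>\<tau>) \<le> (\<integral>l'. 4 * C\<^sup>2 \<partial>\<tau>)" for l
   using iD2 Db2 by (intro integral_mono) auto
  then show "AE l in \<tau>. norm (\<integral>l'. (D l l')\<^sup>2 \<partial>\<tau>) \<le> 4 * C\<^sup>2"
   by (simp add: prob_space)
 qed measurable
 have ie: "integrable \<tau> (\<lambda>l. ee (t - l))" using ee_bounds by (intro integrable_shift[where B = 1]) auto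
 have "osc k t \<le> (\<integral>l. (\<integral>l'. (D l l')\<^sup>2 \<partial>\<tau>) + 4 * C * K * (ee (t - l) + ee t) \<partial>\<tau>)"
  unfolding osc_def using iDD ie sq i_osc by (intro integral_mono) auto
 also have "... = (\<integral>l. (\<integral>l'. (D l l')\<^sup>2 \<partial>\<tau>) \<partial>\<tau>) + rho t"
  using iDD ie by (simp add: prob_space rho_def algebra_simps)
 \<comment> \<open>Exchanging the two steps makes l' the first one; the inner integral over l is
   then the oscillation at the next level.\<close>
 also have "(\<integral>l. (\<integral>l'. (D l l')\<^sup>2 \<partial>\<tau>) \<partial>\<tau>) = (\<integral>l'. (\<integral>l. (D l l')\<^sup>2 \<partial>\<tau>) \<partial>\<tau>)"
 proof -
  interpret pair_prob_space \<tau> \<tau> ..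
  have "integrable (\<tau> \<Otimes>\<^sub>M \<tau>) (\<lambda>(l, l'). (D l l')\<^sup>2)"
   by (rule integrable_const_bound[where B = "4 * C\<^sup>2"]) (use Db2 in auto)
  from Fubini_integral[OF this] show ?thesis by simp
 qed
 also have "... = (\<integral>l. osc (Suc k) (t - l) \<partial>\<tau>)"
  unfolding osc_def D_def by (simp add: algebra_simps)
 finally show ?thesis .
qed

text \<open>By almost subharmonicity each of the n summands of \<open>opot\<close> has mean at least
  \<open>osc k t\<close>, up to an error that \<open>pot rho n\<close> dominates.\<close>

private lemma osc_opot: "real n * osc k t \<le> opot n k t + real n * pot rho n t"
proof (induction n arbitrary: k t)
 case (Suc n)
 have i1: "integrable \<tau> (\<lambda>l. osc (Suc k) (t - l))"
  using osc_bound by (intro integrable_shift[where B = "4 * C\<^sup>2"]) auto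
 have i2: "integrable \<tau> (\<lambda>l. pot rho n (t - l))"
  using pot_bound[OF rho_m rho_bound(2)] by (intro integrable_shift) auto
 have "real (Suc n) * osc k t = osc k t + real n * osc k t" by (simp add: algebra_simps)
 also have "real n * osc k t \<le> real n * ((\<integral>l. osc (Suc k) (t - l) \<partial>\<tau>) + rho t)"
  by (intro mult_left_mono osc_subharmonic) simp
 also have "... = (\<integral>l. real n * osc (Suc k) (t - l) \<partial>\<tau>) + real n * rho t"
  by (simp add: algebra_simps)
 also have "(\<integral>l. real n * osc (Suc k) (t - l) \<partial>\<tau>) \<le> (\<integral>l. opot n (Suc k) (t - l) + real n * pot rho n (t - l) \<partial>\<tau>)"
  using i1 i2 i_opot Suc by (intro integral_mono) auto
 also have "... = (\<integral>l. opot n (Suc k) (t - l) \<partial>\<tau>) + real n * (\<integral>l. pot rho n (t - l) \<partial>\<tau>)"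
  using i2 i_opot by simp
 finally have "real (Suc n) * osc k t \<le> opot (Suc n) k t + real n * pot rho (Suc n) t"
  by (simp add: algebra_simps)
 also have "real n * pot rho (Suc n) t \<le> real (Suc n) * pot rho (Suc n) t"
  by (intro mult_right_mono pot_nonneg rho_bound(1)) simp
 finally show ?case by simp
qed simp

text \<open>The bound is L / n + \<open>pot rho n\<close>, with L free of n. First n is chosen to
  make one term small, then t to make the other small.\<close>

private lemma osc_tendsto_0: "(osc k \<longlongrightarrow> 0) at_top"
proof (rule tendstoI)
 fix d :: real assume d: "d > 0"
 define L where "L = C\<^sup>2 + 2 * C * K * (2 / (\<epsilon> * c0))"
 obtain n :: nat where n: "n > 0" "L / real n < d / 2"
 proof -
  obtain n :: nat where "real n > max 1 (2 * L / d)" using reals_Archimedean2 by blast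
  then have "n > 0" "2 * L / d < real n" by auto
  then show ?thesis using d that[of n] by (simp add: field_simps)
 qed
 have "(pot rho n \<longlongrightarrow> 0) at_top"
  by (rule pot_tendsto_0[OF rho_m rho_bound(2) rho_tendsto_0])
 then have "\<forall>\<^sub>F t in at_top. pot rho n t < d / 2"
  using d by (intro order_tendstoD(2)) auto
 then show "\<forall>\<^sub>F t in at_top. dist (osc k t) 0 < d"
 proof eventually_elim
  case (elim t)
  have "opot n k t \<le> C\<^sup>2 + 2 * C * K * pot ee n t"
   using opot_le[of n k t] by (smt (verit) zero_le_power2)
  also have "... \<le> L" unfolding L_def
   using C0 K0 pot_ee_bound by (intro add_left_mono mult_left_mono) auto
  finally have "real n * osc k t \<le> L + real n * pot rho n t" using osc_opot[of n k t] by linarith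
  then have "osc k t \<le> L / real n + pot rho n t" using n by (simp add: field_simps)
  then have "osc k t < d" using n elim by linarith
  then show ?case using osc_bound[of k t] by simp
 qed
qed

text \<open>If the increment at l were large, the Lipschitz bound would keep it at least h/2 on an
  interval around l, which has positive mass; the mean square then could not tend to 0.\<close>

theorem harmonic_asymp_invariant:
 assumes Lip: "\<And>k s t. \<bar>\<phi> k s - \<phi> k t\<bar> \<le> \<Lambda> * \<bar>s - t\<bar>"
 shows "((\<lambda>t. \<phi> (Suc k) (t - l) - \<phi> k t) \<longlongrightarrow> 0) at_top"
proof (rule tendstoI)
 fix h :: real assume h: "h > 0"
 have \<Lambda>: "\<Lambda> \<ge> 0" using Lip[of 0 0 1] by simp
 define r where "r = h / (2 * \<Lambda> + 1)"
 have r: "r > 0" "\<Lambda> * r \<le> h / 2" using h \<Lambda> by (auto simp: r_def field_simps)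
 define p where "p = measure \<tau> {l - r<..<l + r}"
 have p: "p > 0" unfolding p_def using r by (intro full) auto
 have "\<forall>\<^sub>F t in at_top. osc k t < (h / 2)\<^sup>2 * p"
  using osc_tendsto_0 p h by (intro order_tendstoD(2)[where y = 0]) auto
 then show "\<forall>\<^sub>F t in at_top. dist (\<phi> (Suc k) (t - l) - \<phi> k t) 0 < h"
 proof eventually_elim
  case (elim t)
  show ?case
  proof (rule ccontr)
   assume "\<not> ?thesis"
   then have big: "\<bar>\<phi> (Suc k) (t - l) - \<phi> k t\<bar> \<ge> h" by simp
   have "(h / 2)\<^sup>2 * indicator {l - r<..<l + r} x \<le> (\<phi> (Suc k) (t - x) - \<phi> k t)\<^sup>2" for x
   proof (cases "x \<in> {l - r<..<l + r}")
    case True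
    have "\<bar>\<phi> (Suc k) (t - l) - \<phi> (Suc k) (t - x)\<bar> \<le> \<Lambda> * \<bar>x - l\<bar>"
     using Lip[of "Suc k" "t - l" "t - x"] by simp
    also have "... \<le> \<Lambda> * r" using True \<Lambda> by (intro mult_left_mono) auto
    also have "... \<le> h / 2" by (rule r)
    finally have "h / 2 \<le> \<bar>\<phi> (Suc k) (t - x) - \<phi> k t\<bar>" using big by linarith
    then have "(h / 2)\<^sup>2 \<le> (\<phi> (Suc k) (t - x) - \<phi> k t)\<^sup>2"
     using h by (metis abs_le_square_iff abs_of_pos half_gt_zero)
    then show ?thesis using True by simp
   qed simp
   then have "(\<integral>x. (h / 2)\<^sup>2 * indicator {l - r<..<l + r} x \<partial>\<tau>) \<le> osc k t"
    unfolding osc_def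
    by (intro integral_mono i_osc integrable_mult_right integrable_const_bound[where B = 1])
     (auto simp: indicator_def)
   then show False using elim by (simp add: p_def)
  qed
 qed
qed

end

end

section \<open>Linear images of Lebesgue measure\<close>

lemma abs_det_swap:
 assumes "m \<noteq> n"
 shows "\<bar>det (matrix (\<lambda>x::real^'n. \<chi> i. x $ Transposition.transpose m n i))\<bar> = 1"
proof -
 let ?p = "Transposition.transpose m n"
 have "matrix (\<lambda>x::real^'n. \<chi> i. x $ ?p i) = (\<chi> i. (mat 1 :: real^'n^'n) $ ?p i)"
  by (auto simp: matrix_def mat_def axis_def vec_eq_iff)
 moreover have "?p permutes UNIV" by (rule permutes_swap_id) auto
 ultimately show ?thesis using assms
  by (simp add: det_permute_rows sign_swap_id)
qed

lemma det_shear: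
 assumes "m \<noteq> n"
 shows "det (matrix (\<lambda>x::real^'n. \<chi> i. if i = m then x $ m + x $ n else x $ i)) = 1"
proof -
 have "matrix (\<lambda>x::real^'n. \<chi> i. if i = m then x $ m + x $ n else x $ i)
   = (\<chi> k. if k = m then row m (mat 1) + 1 *s row n (mat 1) else row k (mat 1 :: real^'n^'n))"
  by (auto simp: matrix_def mat_def axis_def vec_eq_iff row_def)
 then show ?thesis using det_row_operation[OF assms, of "mat 1 :: real^'n^'n" 1] by (simp only: det_I)
qed

lemma measure_shear_cbox:
 assumes "m \<noteq> n"
 shows "measure lebesgue ((\<lambda>x::real^'n. \<chi> i. if i = m then x $ m + x $ n else x $ i) ` cbox a b)
  = measure lebesgue (cbox a b)"
proof (cases "cbox a b = {}")
 case False
 let ?h = "\<lambda>x::real^'n. \<chi> i. if i = m then x $ m + x $ n else x $ i"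
 \<comment> \<open>\<open>measure_shear_interval\<close> asks for a nonnegative lower end in
   coordinate n. Translating the box by v moves that end to 0, and shearing a translate gives a
   translate of the shear.\<close>
 define v :: "real^'n" where "v = (\<chi> i. if i = n then - a $ n else 0)"
 have c: "cbox (v + a) (v + b) = (+) v ` cbox a b" by (simp only: cbox_translation)
 have im: "?h ` cbox (v + a) (v + b) = (+) (?h v) ` ?h ` cbox a b"
  unfolding c image_image by (intro image_cong refl) (auto simp: vec_eq_iff)
 have "measure lebesgue (?h ` cbox (v + a) (v + b)) = measure lebesgue (cbox (v + a) (v + b))"
  by (rule measure_shear_interval[OF assms]) (use False c in \<open>auto simp: v_def\<close>)
 then show ?thesis unfolding im unfolding c by (simp add: measure_translation)
qed simp

lemma measure_swap_cbox:
 shows "measure lebesgue ((\<lambda>x::real^'n. \<chi> i. x $ Transposition.transpose m n i) ` cbox a b)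
  = measure lebesgue (cbox a b)"
proof -
 let ?p = "Transposition.transpose m n" and ?h = "\<lambda>x::real^'n. \<chi> i. x $ Transposition.transpose m n i"
 have hh: "?h (?h x) = x" for x by (simp add: vec_eq_iff)
 have "?h ` cbox a b = {x. ?h x \<in> cbox a b}"
 proof (intro equalityI subsetI)
  fix x assume "x \<in> {x. ?h x \<in> cbox a b}"
  then show "x \<in> ?h ` cbox a b" using hh[of x] by (intro image_eqI[of _ _ "?h x"]) simp_all
 next
  fix x assume "x \<in> ?h ` cbox a b"
  then obtain y where "y \<in> cbox a b" "x = ?h y" by blast
  then show "x \<in> {x. ?h x \<in> cbox a b}" using hh[of y] by simp
 qed
 also have "... = cbox (?h a) (?h b)"
 proof -
  have "(\<forall>i. a $ i \<le> x $ ?p i \<and> x $ ?p i \<le> b $ i) \<longleftrightarrow> (\<forall>i. a $ ?p i \<le> x $ i \<and> x $ i \<le> b $ ?p i)" for x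
   by (metis transpose_involutory)
  then show ?thesis by (auto simp: mem_box_cart)
 qed
 finally have e: "?h ` cbox a b = cbox (?h a) (?h b)" .
 have p: "?p permutes UNIV" by (rule permutes_swap_id) auto
 have "cbox (?h a) (?h b) = {} \<longleftrightarrow> cbox a b = {}" using e by auto
 moreover have "(\<Prod>i\<in>UNIV. ?h b $ i - ?h a $ i) = (\<Prod>i\<in>UNIV. b $ i - a $ i)"
  using prod.permute[OF p, of "\<lambda>i. b $ i - a $ i"] by (simp add: o_def)
 ultimately show ?thesis unfolding e by (simp add: content_cbox_if_cart)
qed

text \<open>The library proves this for index types of class \<open>wellorder\<close> only.\<close>

lemma measure_linear_image_cart:
 fixes f :: "real^'n \<Rightarrow> real^'n"
 assumes "linear f" "S \<in> lmeasurable"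
 shows "f ` S \<in> lmeasurable \<and> measure lebesgue (f ` S) = \<bar>det (matrix f)\<bar> * measure lebesgue S"
proof -
 let ?Q = "\<lambda>f::real^'n \<Rightarrow> real^'n. \<forall>S \<in> lmeasurable.
  f ` S \<in> lmeasurable \<and> measure lebesgue (f ` S) = \<bar>det (matrix f)\<bar> * measure lebesgue S"
 have "?Q f"
 proof (rule induct_linear_elementary[OF \<open>linear f\<close>])
  fix f g :: "real^'n \<Rightarrow> real^'n"
  assume fg: "linear f" "linear g" and Q: "?Q f" "?Q g"
  show "?Q (f \<circ> g)"
  proof
   fix S :: "(real^'n) set" assume S: "S \<in> lmeasurable"
   then have g: "g ` S \<in> lmeasurable" "measure lebesgue (g ` S) = \<bar>det (matrix g)\<bar> * measure lebesgue S"
    using Q(2) by auto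
   then have f: "f ` g ` S \<in> lmeasurable" "measure lebesgue (f ` g ` S) = \<bar>det (matrix f)\<bar> * measure lebesgue (g ` S)"
    using Q(1) by auto
   have "matrix (f \<circ> g) = matrix f ** matrix g" using fg by (simp add: matrix_compose)
   then show "(f \<circ> g) ` S \<in> lmeasurable \<and> measure lebesgue ((f \<circ> g) ` S) = \<bar>det (matrix (f \<circ> g))\<bar> * measure lebesgue S"
    using f g unfolding image_comp[symmetric] by (simp add: det_mul abs_mult del: image_image image_comp)
  qed
 next
  fix f :: "real^'n \<Rightarrow> real^'n" and i assume f: "linear f" "\<And>x. f x $ i = 0"
  then have ni: "\<not> inj f"
   by (metis linear_injective_imp_surjective one_neq_zero surjE vec_component)
  then have "det (matrix f) = 0" using det_nz_iff_inj[OF f(1)] by blast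
  then show "?Q f"
   using negligible_linear_singular_image[OF f(1) ni] negligible_imp_measurable negligible_imp_measure0 by auto
 next
  fix c :: "'n \<Rightarrow> real"
  show "?Q (\<lambda>x. \<chi> i. c i * x $ i)"
   by (simp add: measurable_stretch measure_stretch matrix_def axis_def det_diagonal)
 next
  fix m n :: 'n assume mn: "m \<noteq> n"
  have lin: "linear (\<lambda>x::real^'n. \<chi> i. x $ Transposition.transpose m n i)"
   by (rule linearI) (simp_all add: vec_eq_iff)
  show "?Q (\<lambda>x. \<chi> i. x $ Transposition.transpose m n i)"
   unfolding abs_det_swap[OF mn]
   using measure_linear_sufficient[OF lin _ , where m = 1] measure_swap_cbox[of m n]
   by (metis (no_types, lifting) mult_1)
  have lin2: "linear (\<lambda>x::real^'n. \<chi> i. if i = m then x $ m + x $ n else x $ i)"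
   by (rule linearI) (auto simp: vec_eq_iff algebra_simps)
  show "?Q (\<lambda>x. \<chi> i. if i = m then x $ m + x $ n else x $ i)"
   unfolding det_shear[OF mn] abs_one
   using measure_linear_sufficient[OF lin2 _ , where m = 1] measure_shear_cbox[OF mn]
   by (metis (no_types, lifting) mult_1)
 qed
 then show ?thesis using assms by blast
qed

lemma matrix_algebra_distribs:
 fixes A B C :: "real^'n^'n"
 shows "(A + B) ** C = A ** C + B ** C" "A ** (B + C) = A ** B + A ** C"
  "(A - B) ** C = A ** C - B ** C" "A ** (B - C) = A ** B - A ** C"
  "(r *\<^sub>R A) ** B = r *\<^sub>R (A ** B)" "A ** (r *\<^sub>R B) = r *\<^sub>R (A ** B)"
  "(- A) ** B = - (A ** B)" "A ** (- B) = - (A ** B)"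
 by (simp_all add: matrix_matrix_mult_def vec_eq_iff sum.distrib sum_subtractf sum_distrib_left sum_negf algebra_simps)

lemma matrix_inv_right_left:
 fixes A :: "real^'n^'n"
 assumes "invertible A"
 shows "A ** matrix_inv A = mat 1" "matrix_inv A ** A = mat 1"
 using someI_ex[OF assms[unfolded invertible_def]] by (auto simp: matrix_inv_def)

lemma matrix_inv_mult:
 fixes A :: "real^'n^'n"
 assumes "invertible A"
 shows "A *v (matrix_inv A *v x) = x" "matrix_inv A *v (A *v x) = x"
 using matrix_inv_right_left[OF assms] by (simp_all add: matrix_vector_mul_assoc)

lemma lborel_linear:
 fixes A :: "real^'n^'n"
 assumes "invertible A"
 shows "lborel = density (distr lborel borel (\<lambda>x. A *v x)) (\<lambda>_. ennreal \<bar>det A\<bar>)"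
proof (rule lborel_eqI)
 fix l u :: "real^'n" assume lu: "\<And>b. b \<in> Basis \<Longrightarrow> l \<bullet> b \<le> u \<bullet> b"
 have m: "(\<lambda>x. A *v x) \<in> borel_measurable borel"
  by (intro borel_measurable_continuous_onI linear_continuous_on matrix_vector_mul_bounded_linear)
 let ?B = "matrix_inv A"
 have "(\<lambda>x. A *v x) -` box l u = (\<lambda>x. ?B *v x) ` box l u"
  using matrix_inv_mult[OF assms] by (auto simp: image_iff) metis+
 moreover have "box l u \<in> lmeasurable" by simp
 moreover have "matrix ((*v) ?B) = ?B" by simp
 ultimately have i: "(\<lambda>x. A *v x) -` box l u \<in> lmeasurable"
  "measure lebesgue ((\<lambda>x. A *v x) -` box l u) = \<bar>det ?B\<bar> * measure lebesgue (box l u)"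
  using measure_linear_image_cart[of "(*v) ?B" "box l u"] by auto
 have b: "(\<lambda>x. A *v x) -` box l u \<in> sets borel"
  using measurable_sets[OF m, of "box l u"] by simp
 have "det A * det ?B = 1" using arg_cong[OF matrix_inv_right_left(1)[OF assms], of det] by (simp only: det_mul det_I)
 then have d: "\<bar>det A\<bar> * \<bar>det ?B\<bar> = 1" by (metis abs_mult abs_one)
 have "emeasure (density (distr lborel borel (\<lambda>x. A *v x)) (\<lambda>_. ennreal \<bar>det A\<bar>)) (box l u)
   = ennreal \<bar>det A\<bar> * emeasure lborel ((\<lambda>x. A *v x) -` box l u)"
  using m by (simp add: emeasure_density nn_integral_cmult_indicator emeasure_distr)
 also have "emeasure lborel ((\<lambda>x. A *v x) -` box l u) = ennreal (measure lebesgue ((\<lambda>x. A *v x) -` box l u))"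
  using emeasure_eq_measure2[OF i(1)] b by (simp add: emeasure_completion)
 also have "ennreal \<bar>det A\<bar> * ... = ennreal (measure lebesgue (box l u))"
  unfolding i(2) using d by (simp add: ennreal_mult'[symmetric] mult.assoc[symmetric])
 also have "measure lebesgue (box l u) = (\<Prod>b\<in>Basis. (u - l) \<bullet> b)"
  using lu by (simp add: measure_lborel_box)
 finally show "emeasure (density (distr lborel borel (\<lambda>x. A *v x)) (\<lambda>_. ennreal \<bar>det A\<bar>)) (box l u) = (\<Prod>b\<in>Basis. (u - l) \<bullet> b)" .
qed simp

lemma measurable_matrix_vector[measurable]: "(\<lambda>x. (A :: real^'n^'m) *v x) \<in> borel_measurable borel"
 by (intro borel_measurable_continuous_onI linear_continuous_on matrix_vector_mul_bounded_linear)

lemma nn_integral_linear: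
 fixes A :: "real^'n^'n"
 assumes "invertible A" and f[measurable]: "f \<in> borel_measurable borel"
 shows "(\<integral>\<^sup>+x. f x \<partial>lborel) = ennreal \<bar>det A\<bar> * (\<integral>\<^sup>+x. f (A *v x) \<partial>lborel)"
 by (subst lborel_linear[OF assms(1)]) (simp add: nn_integral_density nn_integral_distr nn_integral_cmult)

subsection \<open>Positive definite matrices\<close>

lemma norm_matrix_vector_le:
 fixes A :: "real^'n^'m"
 shows "norm (A *v x) \<le> norm A * norm x"
proof -
 have "norm (A *v x) = L2_set (\<lambda>i. norm ((A *v x) $ i)) UNIV" by (simp add: norm_vec_def)
 also have "... \<le> L2_set (\<lambda>i. norm (A $ i) * norm x) UNIV"
  by (rule L2_set_mono) (auto simp: matrix_vector_mul_component intro: Cauchy_Schwarz_ineq2)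
 also have "... = norm A * norm x" by (simp add: norm_vec_def L2_set_left_distrib)
 finally show ?thesis .
qed

lemma inner_transpose: "(x::real^'m) \<bullet> (A *v y) = (transpose A *v x) \<bullet> y"
 by (simp add: dot_lmul_matrix)

lemma positive_definiteD:
 assumes "positive_definite S"
 shows "transpose S = S" "x \<noteq> 0 \<Longrightarrow> 0 < x \<bullet> (S *v x)" "0 \<le> x \<bullet> (S *v x)" "x \<bullet> (S *v y) = (S *v x) \<bullet> y"
proof -
 show t: "transpose S = S" and p: "x \<noteq> 0 \<Longrightarrow> 0 < x \<bullet> (S *v x)" using assms by (auto simp: positive_definite_def)
 show "0 \<le> x \<bullet> (S *v x)" using p by (cases "x = 0") auto
 show "x \<bullet> (S *v y) = (S *v x) \<bullet> y" using inner_transpose[of x S y] t by simp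
qed

lemma positive_definite_invertible:
 assumes "positive_definite S"
 shows "invertible S"
proof -
 have "x = 0" if "S *v x = 0" for x
  using positive_definiteD(2)[OF assms, of x] that by fastforce
 then show ?thesis using matrix_left_invertible_ker[of S] invertible_left_inverse[of S] by auto
qed

lemma symmetric_positiveI:
 assumes "transpose S = S" "\<And>x. x \<noteq> 0 \<Longrightarrow> 0 < x \<bullet> (S *v x)"
 shows "positive_definite S"
 using assms by (simp add: positive_definite_def)

lemma matrix_inv_symmetric:
 fixes S :: "real^'n^'n"
 assumes "positive_definite S"
 shows "positive_definite (matrix_inv S)"
proof (rule symmetric_positiveI)
 note inv = positive_definite_invertible[OF assms]
 have "transpose (matrix_inv S) ** S = mat 1"
  using matrix_inv_right_left(1)[OF inv] positive_definiteD(1)[OF assms]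
  by (metis matrix_transpose_mul transpose_mat)
 then show "transpose (matrix_inv S) = matrix_inv S"
  using matrix_inv_right_left(1)[OF inv]
  by (metis matrix_mul_assoc matrix_mul_lid matrix_mul_rid)
 fix x :: "real^'n" assume "x \<noteq> 0"
 then have "matrix_inv S *v x \<noteq> 0" using matrix_inv_mult(1)[OF inv, of x] by fastforce
 from positive_definiteD(2)[OF assms this] show "0 < x \<bullet> (matrix_inv S *v x)"
  using matrix_inv_mult(1)[OF inv, of x] by (simp add: inner_commute)
qed

lemma positive_definite_lower:
 fixes S :: "real^'n^'n"
 assumes "positive_definite S"
 shows "\<exists>k>0. \<forall>x. k * (norm x)\<^sup>2 \<le> x \<bullet> (S *v x)"
proof -
 have ne: "sphere (0::real^'n) 1 \<noteq> {}"
 proof -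
  have "axis undefined 1 \<in> sphere (0::real^'n) 1" by (simp add: norm_axis_1)
  then show ?thesis by blast
 qed
 have "continuous_on (sphere 0 1) (\<lambda>x. x \<bullet> (S *v x))"
  by (intro continuous_intros linear_continuous_on matrix_vector_mul_bounded_linear)
 from continuous_attains_inf[OF compact_sphere ne this]
 obtain y where y: "norm y = 1" "\<And>x. norm x = 1 \<Longrightarrow> y \<bullet> (S *v y) \<le> x \<bullet> (S *v x)" by auto
 define k where "k = y \<bullet> (S *v y)"
 have k: "k > 0" unfolding k_def by (rule positive_definiteD(2)[OF assms]) (use y in auto)
 moreover have "k * (norm x)\<^sup>2 \<le> x \<bullet> (S *v x)" for x
 proof (cases "x = 0")
  case False
  have "k \<le> (x /\<^sub>R norm x) \<bullet> (S *v (x /\<^sub>R norm x))"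
   unfolding k_def using False by (intro y(2)) simp
  also have "... = x \<bullet> (S *v x) / (norm x)\<^sup>2"
   by (simp add: matrix_vector_mult_scaleR power2_eq_square divide_inverse)
  finally show ?thesis using False by (simp add: field_simps)
 qed simp
 ultimately show ?thesis by blast
qed

text \<open>The form at r x + y is a nonnegative quadratic in r. The usual minimising r works unless
  the form vanishes at x, and in that case the linear term must vanish.\<close>

lemma positive_form_Cauchy_Schwarz:
 fixes S :: "real^'n^'n"
 assumes sym: "transpose S = S" and nn: "\<And>x. 0 \<le> x \<bullet> (S *v x)"
 shows "(x \<bullet> (S *v y))\<^sup>2 \<le> (x \<bullet> (S *v x)) * (y \<bullet> (S *v y))"
proof -
 let ?a = "x \<bullet> (S *v x)" and ?b = "x \<bullet> (S *v y)" and ?c = "y \<bullet> (S *v y)"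
 have yx: "y \<bullet> (S *v x) = ?b"
  using inner_transpose[of y S x] sym by (simp add: inner_commute)
 have q: "0 \<le> ?a * r\<^sup>2 + 2 * ?b * r + ?c" for r
 proof -
  have "0 \<le> (r *\<^sub>R x + y) \<bullet> (S *v (r *\<^sub>R x + y))" by (rule nn)
  also have "... = ?a * r\<^sup>2 + 2 * ?b * r + ?c"
   by (simp add: matrix_vector_right_distrib matrix_vector_mult_scaleR inner_add_left inner_add_right yx
     power2_eq_square algebra_simps)
  finally show ?thesis .
 qed
 show ?thesis
 proof (cases "?a = 0")
  case True
  have "?b = 0"
  proof (rule ccontr)
   assume "?b \<noteq> 0"
   \<comment> \<open>At this r the expression, which is then linear in r, equals -1.\<close>
   with q[of "- (?c + 1) / (2 * ?b)"] True show False by simp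
  qed
  then show ?thesis using True by simp
 next
  case False
  then have a: "?a > 0" using nn[of x] by simp
  have "0 \<le> ?a * (?a * (- ?b / ?a)\<^sup>2 + 2 * ?b * (- ?b / ?a) + ?c)"
   using q[of "- ?b / ?a"] a by simp
  also have "... = ?a * ?c - ?b\<^sup>2" using a by (simp add: power2_eq_square field_simps)
  finally show ?thesis by simp
 qed
qed

text \<open>For a positive semidefinite matrix a bound on the form is already a bound on the
  operator norm, with the same constant: Cauchy-Schwarz for the form is applied to x and B
  x.\<close>

lemma symmetric_norm_le:
 fixes B :: "real^'n^'n"
 assumes sym: "transpose B = B" and nn: "\<And>x. 0 \<le> x \<bullet> (B *v x)"
  and ub: "\<And>x. x \<bullet> (B *v x) \<le> b * (norm x)\<^sup>2"
 shows "norm (B *v x) \<le> b * norm x"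
proof (cases "B *v x = 0")
 case True
 have "0 \<le> b * norm x"
  using order_trans[OF nn[of x] ub[of x]] by (cases "x = 0") (auto simp: zero_le_mult_iff)
 then show ?thesis using True by simp
next
 case False
 define y where "y = B *v x"
 have n: "norm y > 0" using False by (simp add: y_def)
 have b: "b \<ge> 0" using order_trans[OF nn[of y] ub[of y]] n by (simp add: zero_le_mult_iff)
 have "((norm y)\<^sup>2)\<^sup>2 = (y \<bullet> (B *v x))\<^sup>2" by (simp add: y_def dot_square_norm)
 also have "... \<le> (y \<bullet> (B *v y)) * (x \<bullet> (B *v x))" by (rule positive_form_Cauchy_Schwarz[OF sym nn])
 also have "... \<le> (b * (norm y)\<^sup>2) * (b * (norm x)\<^sup>2)" using b by (intro mult_mono ub nn) auto
 also have "... = (norm y)\<^sup>2 * (b * norm x)\<^sup>2" by (simp add: power2_eq_square)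
 finally have "(norm y)\<^sup>2 * (norm y)\<^sup>2 \<le> (norm y)\<^sup>2 * (b * norm x)\<^sup>2" by (simp add: power2_eq_square)
 then have "(norm y)\<^sup>2 \<le> (b * norm x)\<^sup>2"
  by (rule mult_left_le_imp_le) (use n in simp)
 then show ?thesis unfolding y_def[symmetric] using b by (simp add: abs_le_square_iff[symmetric])
qed

subsection \<open>The square root\<close>

text \<open>\<open>1 - Y\<close> is a square root of \<open>1 - B\<close> iff \<open>Y = (B + Y\<^sup>2) / 2\<close>, and this map is a
 contraction on the operator ball of radius \<open>\<parallel>B\<parallel> < 1\<close>.\<close>

primrec sq_iter :: "real^'n^'n \<Rightarrow> nat \<Rightarrow> real^'n^'n" where
 "sq_iter B 0 = 0"
| "sq_iter B (Suc n) = (1/2) *\<^sub>R (B + sq_iter B n ** sq_iter B n)"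

lemma matrix_scaleR_vec: "(r *\<^sub>R A) *v x = r *\<^sub>R (A *v (x::real^'n))"
 by (simp add: scaleR_matrix_vector_assoc)

text \<open>The estimates are made in operator norm, where the ball of radius b is invariant because
  b < 1. Successive differences D obey 2 D' = Y' D + D Y, so they shrink by the factor b. The
  Euclidean norm of matrices, bounded through the columns, enters only for summability.\<close>

lemma sq_iter_converges:
 fixes B :: "real^'n^'n"
 assumes b: "0 \<le> b" "b < 1" and B: "\<And>x. norm (B *v x) \<le> b * norm x" and sym: "transpose B = B"
 obtains Y where "sq_iter B \<longlonglongrightarrow> Y" "Y = (1/2) *\<^sub>R (B + Y ** Y)" "transpose Y = Y"
  "\<And>x. norm (Y *v x) \<le> b * norm x"
proof -
 let ?Y = "sq_iter B"
 have bd: "norm (?Y n *v x) \<le> b * norm x" for n x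
 proof (induction n arbitrary: x)
  case (Suc n)
  have "norm (?Y (Suc n) *v x) \<le> (1/2) * (norm (B *v x) + norm (?Y n *v (?Y n *v x)))"
   by (simp add: matrix_scaleR_vec matrix_vector_mult_add_rdistrib matrix_vector_mul_assoc[symmetric] norm_triangle_ineq)
  also have "norm (?Y n *v (?Y n *v x)) \<le> b * (b * norm x)"
   using Suc[of "?Y n *v x"] mult_left_mono[OF Suc[of x] b(1)] by linarith
  also have "b * (b * norm x) \<le> 1 * (b * norm x)" using b by (intro mult_right_mono) auto
  finally show ?case using B[of x] by simp
 qed (use b in simp)
 have dn: "norm ((?Y (Suc n) - ?Y n) *v x) \<le> b ^ n * norm x" for n x
 proof (induction n arbitrary: x)
  case 0
  then show ?case using bd[of "Suc 0" x] b mult_right_mono[of b 1 "norm x"] by (simp del: sq_iter.simps(2))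
 next
  case (Suc n)
  let ?D = "?Y (Suc n) - ?Y n"
  have "?Y (Suc (Suc n)) - ?Y (Suc n) = (1/2) *\<^sub>R (?Y (Suc n) ** ?Y (Suc n) - ?Y n ** ?Y n)"
   by (simp only: sq_iter.simps) (simp add: algebra_simps)
  also have "?Y (Suc n) ** ?Y (Suc n) - ?Y n ** ?Y n = ?Y (Suc n) ** ?D + ?D ** ?Y n"
   by (simp add: matrix_algebra_distribs del: sq_iter.simps)
  finally have "(?Y (Suc (Suc n)) - ?Y (Suc n)) *v x = (1/2) *\<^sub>R (?Y (Suc n) *v (?D *v x) + ?D *v (?Y n *v x))"
   by (simp only: matrix_scaleR_vec matrix_vector_mult_add_rdistrib matrix_vector_mul_assoc)
  then have "norm ((?Y (Suc (Suc n)) - ?Y (Suc n)) *v x) \<le> (1/2) * (norm (?Y (Suc n) *v (?D *v x)) + norm (?D *v (?Y n *v x)))"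
   by (simp add: norm_triangle_ineq del: sq_iter.simps)
  also have "norm (?Y (Suc n) *v (?D *v x)) \<le> b * (b ^ n * norm x)"
   using bd[of "Suc n" "?D *v x"] mult_left_mono[OF Suc[of x] b(1)] by linarith
  also have "norm (?D *v (?Y n *v x)) \<le> b ^ n * (b * norm x)"
   using Suc[of "?Y n *v x"] mult_left_mono[OF bd[of n x], of "b ^ n"] b by (meson order_trans zero_le_power)
  finally show ?case by (simp add: mult_ac)
 qed
 have nm: "norm A \<le> real CARD('n) * c" if "\<And>x. norm (A *v x) \<le> c * norm x" for A :: "real^'n^'n" and c
 proof -
  have "norm A = norm (transpose A)"
  proof -
   have "norm M = sqrt (\<Sum>i\<in>UNIV. \<Sum>j\<in>UNIV. (M $ i $ j)\<^sup>2)" for M :: "real^'n^'n"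
    unfolding norm_vec_def L2_set_def by (simp add: sum_nonneg)
   then show ?thesis unfolding transpose_def by (simp add: sum.swap[of "\<lambda>i j. (A $ i $ j)\<^sup>2"])
  qed
  also have "norm (transpose A) \<le> (\<Sum>i\<in>UNIV. norm (transpose A $ i))"
   by (simp add: norm_vec_def L2_set_le_sum)
  also have "... \<le> (\<Sum>i\<in>(UNIV::'n set). c)"
  proof (rule sum_mono)
   fix i :: 'n
   have "transpose A $ i = A *v axis i 1"
    by (simp add: matrix_vector_mult_basis column_def transpose_def vec_eq_iff)
   then show "norm (transpose A $ i) \<le> c" using that[of "axis i 1"] by (simp add: norm_axis_1)
  qed
  finally show ?thesis by simp
 qed
 have "summable (\<lambda>n. ?Y (Suc n) - ?Y n)"
 proof (rule summable_comparison_test')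
  show "summable (\<lambda>n. real CARD('n) * b ^ n)" using b by (intro summable_mult summable_geometric) auto
  show "norm (?Y (Suc n) - ?Y n) \<le> real CARD('n) * b ^ n" for n by (rule nm[OF dn])
 qed
 then have "convergent (\<lambda>n. \<Sum>k<n. ?Y (Suc k) - ?Y k)" by (simp add: summable_iff_convergent)
 then have "convergent ?Y" by (simp add: sum_lessThan_telescope del: sq_iter.simps(2))
 then obtain Y where Y: "?Y \<longlonglongrightarrow> Y" by (auto simp: convergent_def)
 have ten_mult: "(\<lambda>n. F n ** G n) \<longlonglongrightarrow> F' ** G'"
  if "F \<longlonglongrightarrow> F'" "G \<longlonglongrightarrow> G'" for F G :: "nat \<Rightarrow> real^'n^'n" and F' G'
  unfolding matrix_matrix_mult_def using that by (intro tendsto_intros)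
 have "(\<lambda>n. ?Y (Suc n)) \<longlonglongrightarrow> (1/2) *\<^sub>R (B + Y ** Y)"
  unfolding sq_iter.simps by (intro tendsto_intros ten_mult Y)
 then have 1: "Y = (1/2) *\<^sub>R (B + Y ** Y)" using LIMSEQ_Suc[OF Y] LIMSEQ_unique by blast
 have "transpose (?Y n) = ?Y n" for n
 proof (induction n)
  case (Suc n)
  have "transpose ((1/2) *\<^sub>R (B + ?Y n ** ?Y n)) = (1/2) *\<^sub>R (transpose B + transpose (?Y n) ** transpose (?Y n))"
   unfolding matrix_transpose_mul[symmetric] by (simp add: transpose_def vec_eq_iff)
  then show ?case using Suc sym by simp
 qed (simp add: transpose_def vec_eq_iff)
 moreover have "(\<lambda>n. transpose (?Y n)) \<longlonglongrightarrow> transpose Y"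
  unfolding transpose_def using Y by (intro tendsto_intros)
 ultimately have 2: "transpose Y = Y" using Y LIMSEQ_unique by fastforce
 have 3: "norm (Y *v x) \<le> b * norm x" for x
 proof -
  have "(\<lambda>n. ?Y n *v x) \<longlonglongrightarrow> Y *v x"
   unfolding matrix_vector_mult_def using Y by (intro tendsto_intros)
  then have "(\<lambda>n. norm (?Y n *v x)) \<longlonglongrightarrow> norm (Y *v x)" by (rule tendsto_norm)
  then show ?thesis by (rule LIMSEQ_le_const2) (use bd in auto)
 qed
 show thesis by (rule that[OF Y 1 2 3])
qed

text \<open>The difference D of two roots satisfies (S + T) D + D (S + T) = 2 (S^2 - T^2) = 0. Hence
  the trace of D (S + T) D equals its own negative; as a sum of nonnegative values of the form of S
  + T it can vanish only if D does.\<close>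

lemma positive_definite_sqrt_unique:
 fixes S T :: "real^'n^'n"
 assumes S: "positive_definite S" and T: "positive_definite T" and eq: "S ** S = T ** T"
 shows "S = T"
proof -
 define D where "D = S - T"
 have Dsym: "x \<bullet> (D *v y) = (D *v x) \<bullet> y" for x y
  unfolding D_def using positive_definiteD(4)[OF S] positive_definiteD(4)[OF T]
  by (simp add: matrix_vector_mult_diff_rdistrib inner_diff_left inner_diff_right)
 have z: "(S + T) ** D + D ** (S + T) = 0"
  using eq by (simp add: D_def matrix_algebra_distribs matrix_algebra_distribs)
 define q where "q x = (D *v x) \<bullet> ((S + T) *v (D *v x))" for x
 have qn: "0 \<le> q x" for x
  unfolding q_def matrix_vector_mult_add_rdistrib inner_add_right
  using positive_definiteD(3)[OF S] positive_definiteD(3)[OF T] by (intro add_nonneg_nonneg)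
 have q2: "q x = - ((S + T) *v x) \<bullet> (D *v (D *v x))" for x
 proof -
  have "(S + T) *v (D *v x) = - (D *v ((S + T) *v x))"
   using arg_cong[OF z, of "\<lambda>A. A *v x"]
   by (simp add: matrix_vector_mult_add_rdistrib matrix_vector_mul_assoc[symmetric] eq_neg_iff_add_eq_0)
  then show ?thesis unfolding q_def using Dsym[of "(S + T) *v x" "D *v x"] Dsym[of "D *v x" "(S + T) *v x"]
   by (simp add: inner_commute)
 qed
 define E where "E = D ** (S + T) ** D"
 have tr: "trace (D ** ((S + T) ** D)) = - trace (D ** ((S + T) ** D))"
 proof -
  have "(S + T) ** D = - (D ** (S + T))" using z by (simp add: eq_neg_iff_add_eq_0)
  then have "trace (D ** ((S + T) ** D)) = - trace (D ** (D ** (S + T)))"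
   by (simp add: trace_def matrix_matrix_mult_def sum_negf)
  also have "trace (D ** (D ** (S + T))) = trace ((D ** (S + T)) ** D)" by (rule trace_mul_sym)
  finally show ?thesis by (simp add: matrix_mul_assoc)
 qed
 have "trace (D ** ((S + T) ** D)) = (\<Sum>i\<in>UNIV. q (axis i 1))"
 proof -
  have "(D ** ((S + T) ** D)) $ i $ i = axis i 1 \<bullet> ((D ** ((S + T) ** D)) *v axis i 1)" for i
   by (simp add: matrix_vector_mult_basis column_def inner_axis')
  moreover have "axis i 1 \<bullet> ((D ** ((S + T) ** D)) *v axis i 1) = q (axis i 1)" for i :: 'n
   unfolding q_def by (simp add: matrix_vector_mul_assoc[symmetric] Dsym)
  ultimately show ?thesis by (simp add: trace_def)
 qed
 then have "(\<Sum>i\<in>UNIV. q (axis i 1)) = 0" using tr by simp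
 then have "q (axis i 1) = 0" for i using qn by (simp add: sum_nonneg_eq_0_iff)
 moreover have "D *v x = 0" if "q x = 0" for x
 proof (rule ccontr)
  assume "D *v x \<noteq> 0"
  then have "q x > 0" unfolding q_def matrix_vector_mult_add_rdistrib inner_add_right
   using positive_definiteD(2)[OF S, of "D *v x"] positive_definiteD(3)[OF T, of "D *v x"] by linarith
  then show False using that by simp
 qed
 ultimately have "D *v axis i 1 = 0" for i by blast
 then have "column i D = 0" for i by (simp add: matrix_vector_mult_basis)
 then have "D = 0" by (simp add: column_def vec_eq_iff)
 then show ?thesis by (simp add: D_def)
qed

text \<open>Division by the norm of H leaves B = 1 - H / |H|, whose form lies between 0 and 1 - k /
  |H| < 1, so the iteration applies. The approximating sequence is part of the conclusion because it
  makes \<open>spd_sqrt\<close> a limit of measurable maps.\<close>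

lemma spd_sqrt_construction:
 fixes H :: "real^'n^'n"
 assumes H: "positive_definite H"
 shows "positive_definite (spd_sqrt H)" "spd_sqrt H ** spd_sqrt H = H"
  "(\<lambda>n. sqrt (norm H) *\<^sub>R (mat 1 - sq_iter (mat 1 - (1 / norm H) *\<^sub>R H) n)) \<longlonglongrightarrow> spd_sqrt H"
proof -
 define rr where "rr = norm H"
 obtain k where k: "k > 0" "\<And>x. k * (norm x)\<^sup>2 \<le> x \<bullet> (H *v x)" using positive_definite_lower[OF H] by blast
 have ub: "x \<bullet> (H *v x) \<le> rr * (norm x)\<^sup>2" for x
 proof -
  have "x \<bullet> (H *v x) \<le> norm x * norm (H *v x)" by (rule norm_cauchy_schwarz)
  also have "... \<le> norm x * (norm H * norm x)" by (intro mult_left_mono norm_matrix_vector_le) simp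
  finally show ?thesis by (simp add: rr_def power2_eq_square mult_ac)
 qed
 have kl: "k \<le> rr" using k(2)[of "axis undefined 1"] ub[of "axis undefined 1"] by (simp add: norm_axis_1)
 then have l: "rr > 0" using k by simp
 define B where "B = mat 1 - (1 / rr) *\<^sub>R H"
 have Bq: "x \<bullet> (B *v x) = (norm x)\<^sup>2 - x \<bullet> (H *v x) / rr" for x
  by (simp add: B_def matrix_vector_mult_diff_rdistrib matrix_scaleR_vec inner_diff_right dot_square_norm)
 have Bs: "transpose B = B"
  using positive_definiteD(1)[OF H] unfolding B_def by (auto simp: transpose_def vec_eq_iff mat_def)
 have Bn: "0 \<le> x \<bullet> (B *v x)" for x using ub[of x] l by (simp add: Bq field_simps)
 have Bu: "x \<bullet> (B *v x) \<le> (1 - k / rr) * (norm x)\<^sup>2" for x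
  using k(2)[of x] l by (simp add: Bq field_simps)
 have b: "0 \<le> 1 - k / rr" "1 - k / rr < 1" using kl l k by auto
 obtain Y where Y: "sq_iter B \<longlonglongrightarrow> Y" "Y = (1/2) *\<^sub>R (B + Y ** Y)" "transpose Y = Y"
  "\<And>x. norm (Y *v x) \<le> (1 - k / rr) * norm x"
  using sq_iter_converges[OF b symmetric_norm_le[OF Bs Bn Bu] Bs] by blast
 define S where "S = sqrt rr *\<^sub>R (mat 1 - Y)"
 have "2 *\<^sub>R Y = 2 *\<^sub>R ((1/2) *\<^sub>R (B + Y ** Y))" using Y(2) by (rule arg_cong)
 then have YY: "Y + Y = B + Y ** Y" by (simp add: scaleR_2)
 have "(mat 1 - Y) ** (mat 1 - Y) = mat 1 - ((Y + Y) - Y ** Y)"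
  unfolding matrix_algebra_distribs matrix_mul_lid matrix_mul_rid 
  by (simp only: diff_conv_add_uminus minus_add_distrib minus_minus add.assoc add.commute add.left_commute)
 also have "... = (1 / rr) *\<^sub>R H" unfolding YY by (simp add: B_def)
 finally have "(mat 1 - Y) ** (mat 1 - Y) = (1 / rr) *\<^sub>R H" .
 then have SS: "S ** S = H"
  unfolding S_def matrix_algebra_distribs(5,6) scaleR_scaleR using l by simp
 have pS: "positive_definite S"
 proof (rule symmetric_positiveI)
  show "transpose S = S" using Y(3) by (auto simp: S_def transpose_def vec_eq_iff mat_def)
  fix x :: "real^'n" assume "x \<noteq> 0"
  have "x \<bullet> (Y *v x) \<le> norm x * ((1 - k / rr) * norm x)"
   using norm_cauchy_schwarz[of x "Y *v x"] mult_left_mono[OF Y(4)[of x] norm_ge_zero[of x]] by linarith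
  also have "... = (1 - k / rr) * (norm x)\<^sup>2" by (simp add: power2_eq_square)
  also have "... < 1 * (norm x)\<^sup>2" using b \<open>x \<noteq> 0\<close> by (intro mult_strict_right_mono) auto
  finally show "0 < x \<bullet> (S *v x)" using l
   by (simp add: S_def matrix_scaleR_vec matrix_vector_mult_diff_rdistrib inner_diff_right dot_square_norm)
 qed
 have sp: "spd_sqrt H = S" unfolding spd_sqrt_def
 proof (rule the_equality)
  show "positive_definite S \<and> S ** S = H" using pS SS by blast
  show "T = S" if "positive_definite T \<and> T ** T = H" for T
   using that positive_definite_sqrt_unique[of T S] pS SS by auto
 qed
 show "positive_definite (spd_sqrt H)" "spd_sqrt H ** spd_sqrt H = H" using sp pS SS by auto
 show "(\<lambda>n. sqrt (norm H) *\<^sub>R (mat 1 - sq_iter (mat 1 - (1 / norm H) *\<^sub>R H) n)) \<longlonglongrightarrow> spd_sqrt H"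
  unfolding sp S_def rr_def[symmetric] B_def[symmetric] by (intro tendsto_intros Y(1))
qed

lemma continuous_matrix_mult:
 "continuous_on UNIV (\<lambda>p. (fst p :: real^'n^'n) ** (snd p :: real^'n^'n))"
 unfolding matrix_matrix_mult_def by (intro continuous_intros)

lemma measurable_matrix_mult[measurable (raw)]:
 assumes [measurable]: "f \<in> borel_measurable M" "g \<in> borel_measurable M"
 shows "(\<lambda>x. (f x :: real^'n^'n) ** (g x :: real^'n^'n)) \<in> borel_measurable M"
 by (rule borel_measurable_continuous_Pair[OF assms continuous_matrix_mult])

lemma continuous_matrix_vector_mult_pair:
 "continuous_on UNIV (\<lambda>p. (fst p :: real^'n^'n) *v (snd p :: real^'n))"
 unfolding matrix_vector_mult_def by (intro continuous_intros)

lemma measurable_matrix_vector_mult[measurable (raw)]: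
 assumes [measurable]: "f \<in> borel_measurable M" "g \<in> borel_measurable M"
 shows "(\<lambda>x. (f x :: real^'n^'n) *v (g x :: real^'n)) \<in> borel_measurable M"
 by (rule borel_measurable_continuous_Pair[OF assms continuous_matrix_vector_mult_pair])

lemma measurable_spd_sqrt:
 fixes f :: "'a \<Rightarrow> real^'n^'n"
 assumes [measurable]: "f \<in> borel_measurable M" and "\<And>x. x \<in> space M \<Longrightarrow> positive_definite (f x)"
 shows "(\<lambda>x. spd_sqrt (f x)) \<in> borel_measurable M"
proof (rule borel_measurable_LIMSEQ_metric)
 have "(\<lambda>x. sq_iter (mat 1 - (1 / norm (f x)) *\<^sub>R f x) n) \<in> borel_measurable M" for n
  by (induction n) (simp_all, measurable)
 then show "(\<lambda>x. sqrt (norm (f x)) *\<^sub>R (mat 1 - sq_iter (mat 1 - (1 / norm (f x)) *\<^sub>R f x) n)) \<in> borel_measurable M" for n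
  by measurable
qed (rule spd_sqrt_construction(3)[OF assms(2)])

subsection \<open>Gaussian laws\<close>

definition gdens :: "real^'d^'d \<Rightarrow> real^'d \<Rightarrow> real" where
 "gdens S x = exp (- (x \<bullet> (matrix_inv S *v x)) / 2) / sqrt ((2 * pi) ^ CARD('d) * det S)"

lemma centered_normal_gdens: "centered_normal S = density lborel (\<lambda>x. ennreal (gdens S x))"
 by (simp add: centered_normal_def gdens_def)

lemma gdens_measurable[measurable]: "gdens S \<in> borel_measurable borel"
 unfolding gdens_def by measurable

lemma sets_centered_normal[simp, measurable_cong]: "sets (centered_normal S) = sets borel"
 by (simp add: centered_normal_def)

lemma space_centered_normal[simp]: "space (centered_normal S) = UNIV"
 by (simp add: centered_normal_def)

text \<open>General in the Euclidean space so that one convolution lemma covers both a scalar factor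
  m and a vector factor z.\<close>

definition stdg :: "'z::euclidean_space measure" where
 "stdg = density lborel (\<lambda>z. ennreal (\<Prod>b\<in>Basis. std_normal_density (z \<bullet> b)))"

lemma prod_std_normal:
 "(\<Prod>b\<in>Basis. std_normal_density (z \<bullet> b)) = exp (- (z \<bullet> z) / 2) / sqrt (2 * pi) ^ DIM('z)"
 for z :: "'z::euclidean_space"
proof -
 have "(\<Prod>b\<in>Basis. std_normal_density (z \<bullet> b)) = (\<Prod>b\<in>(Basis::'z set). (1 / sqrt (2 * pi))) * exp (\<Sum>b\<in>Basis. - (z \<bullet> b)\<^sup>2 / 2)"
  unfolding std_normal_density_def prod.distrib by (simp add: exp_sum)
 also have "(\<Sum>b\<in>Basis. - (z \<bullet> b)\<^sup>2 / 2) = - (z \<bullet> z) / 2"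
  by (simp add: sum_divide_distrib[symmetric] sum_negf power2_eq_square euclidean_inner[of z z])
 finally show ?thesis by (simp add: power_divide)
qed

lemma prob_space_stdg: "prob_space (stdg :: 'z::euclidean_space measure)"
proof
 have "(\<integral>\<^sup>+z. ennreal (\<Prod>b\<in>Basis. std_normal_density (z \<bullet> b)) \<partial>(lborel :: 'z measure))
   = (\<integral>\<^sup>+z. (\<Prod>b\<in>Basis. ennreal (std_normal_density (z \<bullet> b))) \<partial>(lborel :: 'z measure))"
  by (simp add: prod_ennreal)
 also have "... = (\<Prod>b\<in>(Basis::'z set). (\<integral>\<^sup>+x. ennreal (std_normal_density x) \<partial>lborel))"
  by (rule nn_integral_lborel_prod) auto
 also have "(\<integral>\<^sup>+x. ennreal (std_normal_density x) \<partial>lborel) = 1"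
  using prob_space.emeasure_space_1[OF prob_space_stdn] by (simp add: emeasure_density)
 finally show "emeasure (stdg :: 'z measure) (space stdg) = 1"
  by (simp add: stdg_def emeasure_density)
qed

lemma sets_stdg[simp, measurable_cong]: "sets stdg = sets borel"
 by (simp add: stdg_def)

lemma stdg_real: "(stdg :: real measure) = stdn"
 by (simp add: stdg_def)

lemma gdens_mat_1: "gdens (mat 1) (z::real^'d) = (\<Prod>b\<in>Basis. std_normal_density (z \<bullet> b))"
proof -
 have i: "invertible (mat 1 :: real^'d^'d)" by (metis invertible_def matrix_mul_lid)
 have "matrix_inv (mat 1 :: real^'d^'d) *v z = z" using matrix_inv_mult(1)[OF i, of z] by simp
 moreover have "DIM(real^'d) = CARD('d)" by simp
 ultimately show ?thesis
  unfolding gdens_def prod_std_normal by (simp only: det_I mult_1_right real_sqrt_power)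
qed

lemma stdg_cart: "stdg = centered_normal (mat 1 :: real^'d^'d)"
 by (simp add: stdg_def centered_normal_gdens gdens_mat_1)

lemma positive_definite_det: "positive_definite S \<Longrightarrow> det S = (det (spd_sqrt S))\<^sup>2" for S :: "real^'d^'d"
 by (metis det_mul power2_eq_square spd_sqrt_construction(2))

lemma positive_definite_det_pos:
 fixes S :: "real^'d^'d"
 assumes "positive_definite S" shows "det S > 0"
proof -
 have "det S \<noteq> 0" using positive_definite_invertible[OF assms] by (simp add: invertible_det_nz)
 then show ?thesis using positive_definite_det[OF assms] by (simp add: zero_less_power2)
qed

lemma gdens_spd_sqrt:
 fixes S :: "real^'d^'d"
 assumes S: "positive_definite S"
 shows "gdens (mat 1) z = \<bar>det (spd_sqrt S)\<bar> * gdens S (spd_sqrt S *v z)"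
proof -
 let ?T = "spd_sqrt S"
 note T = spd_sqrt_construction(1,2)[OF S]
 note Ti = positive_definite_invertible[OF T(1)] and Si = positive_definite_invertible[OF S]
 have i: "invertible (mat 1 :: real^'d^'d)" by (metis invertible_def matrix_mul_lid)
 have i1: "matrix_inv (mat 1 :: real^'d^'d) *v z = z" using matrix_inv_mult(1)[OF i, of z] by simp
 have "S *v (matrix_inv ?T *v z) = ?T *v z"
  by (metis T(2) Ti matrix_inv_mult(1) matrix_vector_mul_assoc)
 then have "matrix_inv S *v (?T *v z) = matrix_inv ?T *v z"
  by (metis Si matrix_inv_mult(2))
 then have "(?T *v z) \<bullet> (matrix_inv S *v (?T *v z)) = z \<bullet> z"
  using positive_definiteD(4)[OF T(1), of z "matrix_inv ?T *v z"] matrix_inv_mult(1)[OF Ti, of z] by simp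
 moreover have "det ?T \<noteq> 0" using Ti by (simp add: invertible_det_nz)
 moreover have "sqrt ((2 * pi) ^ CARD('d) * det S) = sqrt ((2 * pi) ^ CARD('d)) * \<bar>det ?T\<bar>"
  unfolding positive_definite_det[OF S] by (simp add: real_sqrt_mult)
 ultimately show ?thesis by (simp add: gdens_def i1)
qed

lemma gdens_nonneg: "positive_definite S \<Longrightarrow> 0 < gdens S x"
 using positive_definite_det_pos[of S] by (simp add: gdens_def)

lemma centered_normal_spd_sqrt:
 fixes S :: "real^'d^'d"
 assumes S: "positive_definite S"
 shows "distr (centered_normal (mat 1)) borel (\<lambda>z. spd_sqrt S *v z) = centered_normal S"
proof (rule measure_eqI)
 fix A assume "A \<in> sets (distr (centered_normal (mat 1)) borel (\<lambda>z. spd_sqrt S *v z))"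
 then have A[measurable]: "A \<in> sets borel" by simp
 let ?T = "spd_sqrt S"
 have Ti: "invertible ?T" using spd_sqrt_construction(1)[OF S] by (rule positive_definite_invertible)
 have "emeasure (centered_normal S) A = (\<integral>\<^sup>+x. ennreal (gdens S x) * indicator A x \<partial>lborel)"
  by (simp add: centered_normal_gdens emeasure_density)
 also have "... = ennreal \<bar>det ?T\<bar> * (\<integral>\<^sup>+z. ennreal (gdens S (?T *v z)) * indicator A (?T *v z) \<partial>lborel)"
  by (rule nn_integral_linear[OF Ti]) measurable
 also have "... = (\<integral>\<^sup>+z. ennreal (\<bar>det ?T\<bar> * gdens S (?T *v z)) * indicator A (?T *v z) \<partial>lborel)"
  by (subst nn_integral_cmult[symmetric]) (auto simp: ennreal_mult' mult.assoc)
 also have "... = (\<integral>\<^sup>+z. ennreal (gdens (mat 1) z) * indicator ((\<lambda>z. ?T *v z) -` A) z \<partial>lborel)"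
  unfolding gdens_spd_sqrt[OF S, symmetric] by (simp add: indicator_def vimage_def)
 also have "... = emeasure (centered_normal (mat 1)) ((\<lambda>z. ?T *v z) -` A)"
  using measurable_sets[OF measurable_matrix_vector[of ?T] A]
  by (simp add: centered_normal_gdens emeasure_density)
 finally show "emeasure (distr (centered_normal (mat 1)) borel (\<lambda>z. ?T *v z)) A = emeasure (centered_normal S) A"
  by (simp add: emeasure_distr)
qed simp

lemma prob_space_centered_normal:
 fixes S :: "real^'d^'d"
 assumes "positive_definite S"
 shows "prob_space (centered_normal S)"
 unfolding centered_normal_spd_sqrt[OF assms, symmetric]
 using prob_space_stdg[where 'z = "real^'d"] unfolding stdg_cart by (rule prob_space.prob_space_distr) measurable

text \<open>Completing the square; the normalising constants need not be compared, since both sides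
 have total mass one.\<close>

lemma convolution_gaussian:
 fixes C :: "real^'d^'d" and B :: "'z::euclidean_space \<Rightarrow> real^'d"
 assumes C: "positive_definite C" and B: "linear B"
  and H: "\<And>y. H *v y = C *v y + B (adjoint B y)" and Hpd: "positive_definite H"
 shows "distr (stdg \<Otimes>\<^sub>M centered_normal C) borel (\<lambda>(z, q). B z + q) = centered_normal H"
proof -
 let ?g = "\<lambda>z x. ennreal (\<Prod>b\<in>Basis. std_normal_density (z \<bullet> b)) * ennreal (gdens C (x - B z))"
 let ?law = "distr (stdg \<Otimes>\<^sub>M centered_normal C) borel (\<lambda>(z, q). B z + q)"
 interpret Z: prob_space "stdg :: 'z measure" by (rule prob_space_stdg)
 interpret Q: prob_space "centered_normal C" by (rule prob_space_centered_normal[OF C])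
 interpret HH: prob_space "centered_normal H" by (rule prob_space_centered_normal[OF Hpd])
 interpret P: pair_prob_space "stdg :: 'z measure" "centered_normal C" ..
 note Ci = positive_definite_invertible[OF C] and Hi = positive_definite_invertible[OF Hpd]
 let ?Ci = "matrix_inv C"
 have Cpd: "positive_definite ?Ci" by (rule matrix_inv_symmetric[OF C])
 have adj: "z \<bullet> adjoint B y = B z \<bullet> y" for z y by (rule adjoint_works[OF B])
 have Bm[measurable]: "B \<in> borel_measurable borel"
  by (intro borel_measurable_continuous_onI linear_continuous_on) (use B in \<open>simp add: linear_conv_bounded_linear\<close>)
 have adjl: "linear (adjoint B)" by (rule adjoint_linear[OF B])
 \<comment> \<open>The matrix of the quadratic form of z in the joint exponent. It is positive
   definite, hence onto, and so a centre \<open>z0\<close> exists for each x.\<close>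
 define K where "K z = z + adjoint B (?Ci *v B z)" for z
 have Kl: "linear K" unfolding K_def
  by (rule linearI) (simp_all add: linear_add[OF B] linear_scale[OF B] linear_add[OF adjl] linear_scale[OF adjl]
    matrix_vector_right_distrib matrix_vector_mult_scaleR algebra_simps)
 have Kq: "z \<bullet> K z = z \<bullet> z + B z \<bullet> (?Ci *v B z)" for z
  by (simp add: K_def inner_add_right adj)
 have Ksym: "z \<bullet> K w = K z \<bullet> w" for z w
 proof -
  have "z \<bullet> adjoint B (?Ci *v B w) = B z \<bullet> (?Ci *v B w)" by (rule adj)
  also have "... = (?Ci *v B z) \<bullet> B w" by (rule positive_definiteD(4)[OF Cpd])
  also have "... = adjoint B (?Ci *v B z) \<bullet> w" by (simp add: inner_commute adj[symmetric])
  finally show ?thesis by (simp add: K_def inner_add_left inner_add_right)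
 qed
 have "inj K"
 proof (subst linear_injective_0[OF Kl], intro allI impI)
  fix z assume "K z = 0"
  then have "z \<bullet> z + B z \<bullet> (?Ci *v B z) = 0" using Kq[of z] by simp
  then have "z \<bullet> z \<le> 0" using positive_definiteD(3)[OF Cpd, of "B z"] by linarith
  then show "z = 0" by (metis inner_eq_zero_iff inner_ge_zero antisym)
 qed
 then have "surj K" using linear_injective_imp_surjective Kl by blast
 define I where "I = (\<integral>\<^sup>+z. ennreal (exp (- (z \<bullet> K z) / 2)) \<partial>(lborel :: 'z measure))"
 define cz where "cz = 1 / sqrt (2 * pi) ^ DIM('z)"
 define cC where "cC = 1 / sqrt ((2 * pi) ^ CARD('d) * det C)"
 define h where "h x = exp (- (x \<bullet> (matrix_inv H *v x)) / 2)" for x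
 have cC: "cC > 0" using positive_definite_det_pos[OF C] by (simp add: cC_def)
 have cz: "cz > 0" by (simp add: cz_def)
 have hm[measurable]: "h \<in> borel_measurable borel" unfolding h_def by measurable
 have Km[measurable]: "K \<in> borel_measurable borel"
  by (intro borel_measurable_continuous_onI linear_continuous_on) (use Kl in \<open>simp add: linear_conv_bounded_linear\<close>)
 have inner: "(\<integral>\<^sup>+z. ?g z x \<partial>lborel) = ennreal (cz * cC * h x) * I" for x
 proof -
  obtain z0 where z0: "K z0 = adjoint B (?Ci *v x)" using \<open>surj K\<close> by (metis surjD)
  define c where "c = ?Ci *v x"
  have Cc: "C *v c = x" by (simp add: c_def matrix_inv_mult[OF Ci])
  have z0': "adjoint B (?Ci *v B z0) = adjoint B c - z0" using z0 by (simp add: K_def c_def algebra_simps)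
  \<comment> \<open>With the centre at hand, H maps C^-1 (x - B z0) back to x, so H^-1 x is found
    without inverting K.\<close>
  have "H *v (c - ?Ci *v B z0) = x"
   unfolding H by (simp add: matrix_vector_mult_diff_distrib Cc matrix_inv_mult[OF Ci] linear_diff[OF adjl] z0' linear_diff[OF B])
  then have Hx: "matrix_inv H *v x = c - ?Ci *v B z0" using matrix_inv_mult(2)[OF Hi] by metis
  have cs: "u \<bullet> (?Ci *v x) = u \<bullet> c" "x \<bullet> (?Ci *v u) = u \<bullet> c" for u
   using positive_definiteD(4)[OF Cpd, of x u] by (simp_all add: c_def inner_commute)
  have xH: "x \<bullet> (matrix_inv H *v x) = x \<bullet> c - B z0 \<bullet> c"
   unfolding Hx inner_diff_right cs(2) by simp
  have ex: "z \<bullet> z + (x - B z) \<bullet> (?Ci *v (x - B z)) = (z - z0) \<bullet> K (z - z0) + x \<bullet> (matrix_inv H *v x)" for z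
  proof -
   have "(x - B z) \<bullet> (?Ci *v (x - B z)) = x \<bullet> c - 2 * (B z \<bullet> c) + B z \<bullet> (?Ci *v B z)"
    by (simp add: matrix_vector_mult_diff_distrib inner_diff_left inner_diff_right cs)
   moreover have "(z - z0) \<bullet> K (z - z0) = z \<bullet> K z - 2 * (z \<bullet> K z0) + z0 \<bullet> K z0"
    using Ksym[of z0 z] by (simp add: linear_diff[OF Kl] inner_diff_left inner_diff_right inner_commute)
   moreover have "u \<bullet> K z0 = B u \<bullet> c" for u using adj[of u c] z0 by (simp add: c_def)
   ultimately show ?thesis unfolding xH using Kq[of z] by simp
  qed
  have "?g z x
    = ennreal (cz * cC * h x) * ennreal (exp (- ((z - z0) \<bullet> K (z - z0)) / 2))" for z
  proof -
   have "(\<Prod>b\<in>Basis. std_normal_density (z \<bullet> b)) * gdens C (x - B z)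
     = cz * cC * (exp (- (z \<bullet> z) / 2) * exp (- ((x - B z) \<bullet> (?Ci *v (x - B z))) / 2))"
    by (simp add: prod_std_normal gdens_def cz_def cC_def)
   also have "exp (- (z \<bullet> z) / 2) * exp (- ((x - B z) \<bullet> (?Ci *v (x - B z))) / 2)
     = exp (- (z \<bullet> z + (x - B z) \<bullet> (?Ci *v (x - B z))) / 2)"
    by (simp add: exp_add[symmetric] add_divide_distrib diff_divide_distrib)
   also have "... = h x * exp (- ((z - z0) \<bullet> K (z - z0)) / 2)"
    unfolding ex h_def by (simp add: exp_add[symmetric] add_divide_distrib diff_divide_distrib)
   finally show ?thesis using cz cC
    by (subst ennreal_mult'[symmetric], simp add: prod_std_normal, subst ennreal_mult'[symmetric]) (auto simp: h_def mult_ac)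
  qed
  then have "(\<integral>\<^sup>+z. ?g z x \<partial>lborel)
    = ennreal (cz * cC * h x) * (\<integral>\<^sup>+z. ennreal (exp (- ((z - z0) \<bullet> K (z - z0)) / 2)) \<partial>lborel)"
   by (simp add: nn_integral_cmult)
  also have "(\<integral>\<^sup>+z. ennreal (exp (- ((z - z0) \<bullet> K (z - z0)) / 2)) \<partial>lborel) = I"
  proof -
   have "I = (\<integral>\<^sup>+z. ennreal (exp (- (z \<bullet> K z) / 2)) \<partial>distr lborel borel ((+) (- z0)))"
    unfolding I_def by (simp only: lborel_distr_plus)
   then show ?thesis by (simp add: nn_integral_distr)
  qed
  finally show ?thesis .
 qed
 define k where "k = ennreal (cz * cC) * I"
 have D: "emeasure ?law A
   = (\<integral>\<^sup>+x. k * ennreal (h x) * indicator A x \<partial>lborel)" if A[measurable]: "A \<in> sets borel" for A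
 proof -
  have "emeasure ?law A
    = (\<integral>\<^sup>+p. indicator A (case p of (z, q) \<Rightarrow> B z + q) \<partial>(stdg \<Otimes>\<^sub>M centered_normal C))"
   by (simp add: nn_integral_distr nn_integral_indicator[symmetric] del: nn_integral_indicator)
  also have "... = (\<integral>\<^sup>+z. \<integral>\<^sup>+q. indicator A (B z + q) \<partial>centered_normal C \<partial>stdg)"
   by (subst Q.nn_integral_fst[symmetric]) (auto simp: case_prod_beta)
  also have "... = (\<integral>\<^sup>+z. (\<integral>\<^sup>+q. ennreal (gdens C q) * indicator A (B z + q) \<partial>lborel) \<partial>stdg)"
   by (simp add: centered_normal_gdens nn_integral_density)
  also have "... = (\<integral>\<^sup>+z. (\<integral>\<^sup>+x. ennreal (gdens C (x - B z)) * indicator A x \<partial>lborel) \<partial>stdg)"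
  proof (rule nn_integral_cong)
   fix z :: 'z
   have "(\<integral>\<^sup>+x. ennreal (gdens C (x - B z)) * indicator A x \<partial>lborel)
     = (\<integral>\<^sup>+x. ennreal (gdens C (x - B z)) * indicator A x \<partial>distr lborel borel ((+) (B z)))"
    by (simp only: lborel_distr_plus)
   then show "(\<integral>\<^sup>+q. ennreal (gdens C q) * indicator A (B z + q) \<partial>lborel)
     = (\<integral>\<^sup>+x. ennreal (gdens C (x - B z)) * indicator A x \<partial>lborel)"
    by (simp add: nn_integral_distr)
  qed
  also have "... = (\<integral>\<^sup>+z. (\<integral>\<^sup>+x. ?g z x * indicator A x \<partial>lborel) \<partial>lborel)"
   unfolding stdg_def by (subst nn_integral_density) (auto simp: nn_integral_cmult[symmetric] mult.assoc)
  also have "... = (\<integral>\<^sup>+x. (\<integral>\<^sup>+z. ?g z x * indicator A x \<partial>lborel) \<partial>lborel)"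
   by (rule lborel_pair.Fubini') measurable
  also have "... = (\<integral>\<^sup>+x. k * ennreal (h x) * indicator A x \<partial>lborel)"
  proof (rule nn_integral_cong)
   fix x
   have "(\<integral>\<^sup>+z. ?g z x * indicator A x \<partial>lborel)
     = (\<integral>\<^sup>+z. ?g z x \<partial>lborel) * indicator A x"
    by (rule nn_integral_multc) measurable
   also have "... = k * ennreal (h x) * indicator A x"
    unfolding inner k_def using cz cC by (subst ennreal_mult) (auto simp: h_def mult_ac)
   finally show "(\<integral>\<^sup>+z. ?g z x * indicator A x \<partial>lborel) = k * ennreal (h x) * indicator A x" .
  qed
  finally show ?thesis .
 qed
 define cH where "cH = 1 / sqrt ((2 * pi) ^ CARD('d) * det H)"
 have cH: "cH > 0" using positive_definite_det_pos[OF Hpd] by (simp add: cH_def)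
 define G where "G = (\<integral>\<^sup>+x. ennreal (h x) \<partial>(lborel :: (real^'d) measure))"
 have gH: "ennreal (gdens H x) = ennreal cH * ennreal (h x)" for x
 proof -
  have "gdens H x = cH * h x" by (simp add: gdens_def h_def cH_def)
  then show ?thesis using cH by (simp add: ennreal_mult')
 qed
 have m1: "ennreal cH * G = 1"
  using HH.emeasure_space_1 unfolding centered_normal_gdens gH G_def
  by (simp add: emeasure_density nn_integral_cmult)
 have m2: "k * G = 1"
 proof -
  have "prob_space ?law"
   by (rule P.prob_space_distr) measurable
  from prob_space.emeasure_space_1[OF this] D[of UNIV] show ?thesis
   by (simp add: G_def nn_integral_cmult)
 qed
 have "k = ennreal cH"
 proof -
  have "k * (G * ennreal cH) = ennreal cH" using m2 by (simp add: mult.assoc[symmetric])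
  then show ?thesis using m1 by (simp add: mult.commute)
 qed
 show ?thesis
 proof (rule measure_eqI)
  fix A assume "A \<in> sets ?law"
  then have A[measurable]: "A \<in> sets borel" by simp
  show "emeasure ?law A = emeasure (centered_normal H) A"
   unfolding D[OF A] \<open>k = ennreal cH\<close> gH[symmetric]
   by (simp add: centered_normal_gdens emeasure_density)
 qed simp
qed

lemma positive_definite_add:
 fixes S T :: "real^'d^'d"
 assumes "positive_definite S" "transpose T = T" "\<And>x. 0 \<le> x \<bullet> (T *v x)"
 shows "positive_definite (S + T)"
proof (rule symmetric_positiveI)
 show "transpose (S + T) = S + T"
  using positive_definiteD(1)[OF assms(1)] assms(2) by (simp add: transpose_def vec_eq_iff)
 show "0 < x \<bullet> ((S + T) *v x)" if "x \<noteq> 0" for x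
  using positive_definiteD(2)[OF assms(1) that] assms(3)[of x]
  by (simp add: matrix_vector_mult_add_rdistrib inner_add_right)
qed

lemma outer_apply: "outer v *v y = (v \<bullet> y) *\<^sub>R v"
 by (simp add: outer_def matrix_vector_mult_def vec_eq_iff inner_vec_def sum_distrib_left mult_ac)

lemma outer_matrix: "A ** outer x ** transpose A = outer (A *v x)"
proof -
 have "(A ** outer x ** transpose A) $ i $ j = outer (A *v x) $ i $ j" for i j
  by (simp add: outer_def matrix_matrix_mult_def matrix_vector_mult_def transpose_def sum_distrib_left
    sum_distrib_right sum_product mult_ac)
 then show ?thesis by (simp add: vec_eq_iff)
qed

lemma positive_definite_outer:
 assumes "positive_definite C"
 shows "positive_definite (C + outer v)"
proof (rule positive_definite_add[OF assms])
 show "transpose (outer v) = outer v" by (simp add: outer_def transpose_def vec_eq_iff mult.commute)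
 show "0 \<le> x \<bullet> (outer v *v x)" for x by (simp add: outer_apply inner_commute)
qed

text \<open>The bridge between the two equations: with v the image under A of the previous state,
  this is the one-step law of the linear recursion, and it is the Gaussian law with the BEKK
  conditional covariance.\<close>

lemma law_rank_one:
 assumes C: "positive_definite C"
 shows "distr (stdn \<Otimes>\<^sub>M centered_normal C) borel (\<lambda>(m, q). m *\<^sub>R v + q) = centered_normal (C + outer v)"
 unfolding stdg_real[symmetric]
proof (rule convolution_gaussian[OF C])
 show l: "linear (\<lambda>m. m *\<^sub>R v)" by (rule linearI) (auto simp: algebra_simps)
 have "adjoint (\<lambda>m. m *\<^sub>R v) = (\<lambda>y. v \<bullet> y)" by (rule adjoint_unique) simp
 then show "(C + outer v) *v y = C *v y + adjoint (\<lambda>m. m *\<^sub>R v) y *\<^sub>R v" for y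
  by (simp add: matrix_vector_mult_add_rdistrib outer_apply)
qed (rule positive_definite_outer[OF C])

text \<open>Used with B = m A R, where R is a root of the covariance of a Gaussian state: one step
  from such a state, with m given, is again Gaussian.\<close>

lemma law_matrix_sum:
 fixes C B :: "real^'d^'d"
 assumes C: "positive_definite C"
 shows "distr (centered_normal (mat 1) \<Otimes>\<^sub>M centered_normal C) borel (\<lambda>(z, q). B *v z + q)
  = centered_normal (C + B ** transpose B)" "positive_definite (C + B ** transpose B)"
proof -
 have q: "x \<bullet> ((B ** transpose B) *v x) = (transpose B *v x) \<bullet> (transpose B *v x)" for x
  by (metis inner_transpose matrix_vector_mul_assoc)
 show pd: "positive_definite (C + B ** transpose B)"
  by (rule positive_definite_add[OF C]) (auto simp: q matrix_transpose_mul)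
 have adj: "adjoint (\<lambda>z. B *v z) = (\<lambda>y. transpose B *v y)"
  by (rule adjoint_unique) (metis inner_commute inner_transpose)
 show "distr (centered_normal (mat 1) \<Otimes>\<^sub>M centered_normal C) borel (\<lambda>(z, q). B *v z + q)
  = centered_normal (C + B ** transpose B)"
  unfolding stdg_cart[symmetric]
 proof (rule convolution_gaussian[OF C _ _ pd])
  show "(C + B ** transpose B) *v y = C *v y + B *v adjoint (\<lambda>z. B *v z) y" for y
   unfolding adj by (simp only: matrix_vector_mult_add_rdistrib matrix_vector_mul_assoc)
 qed simp
qed

subsection \<open>Density bounds for uniformly elliptic covariances\<close>

context
 fixes S :: "real^'d^'d" and \<kappa> V :: real
 assumes S: "positive_definite S" and \<kappa>: "\<kappa> > 0" and V: "V > 0"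
  and lo: "\<And>x. \<kappa> * V * (norm x)\<^sup>2 \<le> x \<bullet> (S *v x)"
  and up: "\<And>x. x \<bullet> (S *v x) \<le> V * (norm x)\<^sup>2"
begin

text \<open>Cauchy-Schwarz for the form of S, applied to x and S^-1 x.\<close>

lemma inverse_form_lower: "(norm x)\<^sup>2 / V \<le> x \<bullet> (matrix_inv S *v x)"
proof (cases "x = 0")
 case False
 define y where "y = matrix_inv S *v x"
 have Sy: "S *v y = x" by (simp add: y_def matrix_inv_mult[OF positive_definite_invertible[OF S]])
 have "((norm x)\<^sup>2)\<^sup>2 = (y \<bullet> (S *v x))\<^sup>2"
  using positive_definiteD(4)[OF S, of y x] by (simp add: Sy dot_square_norm)
 also have "... \<le> (y \<bullet> (S *v y)) * (x \<bullet> (S *v x))"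
  by (rule positive_form_Cauchy_Schwarz) (use positive_definiteD[OF S] in auto)
 also have "... \<le> (y \<bullet> (S *v y)) * (V * (norm x)\<^sup>2)"
  using positive_definiteD(3)[OF S] by (intro mult_left_mono up)
 finally have "(norm x)\<^sup>2 * (norm x)\<^sup>2 \<le> (x \<bullet> y * V) * (norm x)\<^sup>2"
  by (simp add: Sy power2_eq_square inner_commute mult_ac)
 then have "(norm x)\<^sup>2 \<le> x \<bullet> y * V" by (rule mult_right_le_imp_le) (use False in simp)
 then show ?thesis using V by (simp add: y_def field_simps)
qed simp

lemma inverse_norm_le: "norm (matrix_inv S *v x) \<le> norm x / (\<kappa> * V)"
proof (cases "matrix_inv S *v x = 0")
 case False
 define y where "y = matrix_inv S *v x"
 have Sy: "S *v y = x" by (simp add: y_def matrix_inv_mult[OF positive_definite_invertible[OF S]])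
 have n: "norm y > 0" using False by (simp add: y_def)
 have "\<kappa> * V * (norm y)\<^sup>2 \<le> y \<bullet> x" using lo[of y] by (simp add: Sy)
 also have "... \<le> norm y * norm x" by (rule norm_cauchy_schwarz)
 finally have "(\<kappa> * V * norm y) * norm y \<le> norm x * norm y" by (simp add: power2_eq_square mult_ac)
 then have "\<kappa> * V * norm y \<le> norm x" using n by simp
 then show ?thesis using \<kappa> V by (simp add: y_def field_simps)
qed (use \<kappa> V in simp)

text \<open>A determinant bound without eigenvalues. Compared with S, the Gaussian of covariance
  \<kappa> V times the identity decays faster, so a multiple of its density lies below that of S;
  both have integral 1, which compares the normalising constants.\<close>

lemma normalizer_lower: "1 / sqrt ((2 * pi) ^ CARD('d) * det S) \<le> 1 / sqrt ((2 * pi * \<kappa> * V) ^ CARD('d))"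
proof -
 define r where "r = \<kappa> * V"
 have r: "r > 0" using \<kappa> V by (simp add: r_def)
 let ?R = "r *\<^sub>R (mat 1 :: real^'d^'d)"
 have Rx: "?R *v x = r *\<^sub>R x" for x by (simp add: matrix_scaleR_vec)
 have pR: "positive_definite ?R"
 proof (rule symmetric_positiveI)
  show "transpose ?R = ?R" by (simp add: transpose_def mat_def vec_eq_iff)
  show "0 < x \<bullet> (?R *v x)" if "x \<noteq> 0" for x using r that by (simp add: Rx)
 qed
 have iR: "matrix_inv ?R *v x = (1 / r) *\<^sub>R x" for x
 proof -
  have "?R *v ((1 / r) *\<^sub>R x) = x" using r unfolding Rx by simp
  then show ?thesis using matrix_inv_mult(2)[OF positive_definite_invertible[OF pR], of "(1 / r) *\<^sub>R x"] by simp
 qed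
 have dR: "det ?R = r ^ CARD('d)"
  by (subst det_diagonal) (auto simp: mat_def)
 have one: "(\<integral>\<^sup>+x. ennreal (gdens T x) \<partial>lborel) = 1" if "positive_definite T" for T :: "real^'d^'d"
  using prob_space.emeasure_space_1[OF prob_space_centered_normal[OF that]]
  by (simp add: centered_normal_gdens emeasure_density)
 define cS where "cS = 1 / sqrt ((2 * pi) ^ CARD('d) * det S)"
 define cR where "cR = 1 / sqrt ((2 * pi) ^ CARD('d) * det ?R)"
 have c: "cS > 0" "cR > 0" using positive_definite_det_pos[OF S] positive_definite_det_pos[OF pR] by (auto simp: cS_def cR_def)
 have le: "cS / cR * gdens ?R x \<le> gdens S x" for x
 proof -
  have "x \<bullet> (matrix_inv S *v x) \<le> norm x * norm (matrix_inv S *v x)" by (rule norm_cauchy_schwarz)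
  also have "... \<le> norm x * (norm x / r)" using inverse_norm_le[of x] by (intro mult_left_mono) (simp_all add: r_def)
  also have "... = x \<bullet> (matrix_inv ?R *v x)" by (simp add: iR dot_square_norm power2_eq_square)
  finally show ?thesis using c by (simp add: gdens_def cS_def[symmetric] cR_def[symmetric] field_simps)
    (simp add: cS_def cR_def field_simps)
 qed
 have "ennreal (cS / cR) * (\<integral>\<^sup>+x. ennreal (gdens ?R x) \<partial>lborel) = (\<integral>\<^sup>+x. ennreal (cS / cR * gdens ?R x) \<partial>lborel)"
 proof -
  have "ennreal (cS / cR * gdens ?R x) = ennreal (cS / cR) * ennreal (gdens ?R x)" for x
   by (rule ennreal_mult') (use c in simp)
  then show ?thesis by (simp add: nn_integral_cmult[symmetric] del: ennreal_mult'')
 qed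
 also have "... \<le> (\<integral>\<^sup>+x. ennreal (gdens S x) \<partial>lborel)" by (intro nn_integral_mono ennreal_leI le)
 finally have "cS / cR \<le> 1" using one[OF pR] one[OF S] by simp
 then have "cS \<le> cR" using c by simp
 also have "cR = 1 / sqrt ((2 * pi * \<kappa> * V) ^ CARD('d))"
  unfolding cR_def dR by (simp add: r_def power_mult_distrib mult_ac)
 finally show ?thesis unfolding cS_def .
qed

lemma gdens_upper: "gdens S x \<le> exp (- (norm x)\<^sup>2 / (2 * V)) / sqrt ((2 * pi * \<kappa> * V) ^ CARD('d))"
proof -
 have "gdens S x = exp (- (x \<bullet> (matrix_inv S *v x)) / 2) * (1 / sqrt ((2 * pi) ^ CARD('d) * det S))"
  by (simp add: gdens_def)
 also have "... \<le> exp (- (norm x)\<^sup>2 / (2 * V)) * (1 / sqrt ((2 * pi * \<kappa> * V) ^ CARD('d)))"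
  using inverse_form_lower[of x] positive_definite_det_pos[OF S]
  by (intro mult_mono normalizer_lower) auto
 finally show ?thesis by simp
qed

text \<open>By symmetry the difference of the two exponents is half the inner product of x - y and
  S^-1 (x + y), and exp (- s) is Lipschitz with constant exp (- u) on s \<ge> u.\<close>

lemma gdens_Lipschitz:
 assumes "r \<le> norm x" "r \<le> norm y" "norm x \<le> R" "norm y \<le> R" "0 \<le> r"
 shows "\<bar>gdens S x - gdens S y\<bar> \<le> norm (x - y) * (R / (\<kappa> * V)) * exp (- r\<^sup>2 / (2 * V)) / sqrt ((2 * pi * \<kappa> * V) ^ CARD('d))"
proof -
 let ?f = "\<lambda>x. x \<bullet> (matrix_inv S *v x) / 2"
 have Sp: "positive_definite (matrix_inv S)" by (rule matrix_inv_symmetric[OF S])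
 have fl: "r\<^sup>2 / (2 * V) \<le> ?f u" if "r \<le> norm u" for u
 proof -
  have "r\<^sup>2 \<le> (norm u)\<^sup>2" using that assms by (intro power_mono)
  then have "r\<^sup>2 / V \<le> (norm u)\<^sup>2 / V" using V by (intro divide_right_mono) auto
  then show ?thesis using inverse_form_lower[of u] by (simp add: field_simps)
 qed
 have fe: "?f x - ?f y = (x - y) \<bullet> (matrix_inv S *v (x + y)) / 2"
  using positive_definiteD(4)[OF Sp, of x y]
  by (simp add: matrix_vector_right_distrib inner_diff_left inner_add_right inner_commute field_simps)
 then have "\<bar>?f x - ?f y\<bar> \<le> norm (x - y) * norm (matrix_inv S *v (x + y)) / 2"
  unfolding fe abs_divide using Cauchy_Schwarz_ineq2[of "x - y" "matrix_inv S *v (x + y)"] by simp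
 also have "... \<le> norm (x - y) * (2 * R / (\<kappa> * V)) / 2"
 proof -
  have "norm (x + y) \<le> 2 * R" using norm_triangle_ineq[of x y] assms by linarith
  then have "norm (x + y) / (\<kappa> * V) \<le> 2 * R / (\<kappa> * V)" using \<kappa> V by (intro divide_right_mono) auto
  then have "norm (matrix_inv S *v (x + y)) \<le> 2 * R / (\<kappa> * V)" using inverse_norm_le[of "x + y"] by linarith
  then show ?thesis by (intro divide_right_mono mult_left_mono) auto
 qed
 finally have fd: "\<bar>?f x - ?f y\<bar> \<le> norm (x - y) * (R / (\<kappa> * V))" by simp
 have exp_diff: "\<bar>exp (- s) - exp (- t)\<bar> \<le> \<bar>s - t\<bar> * exp (- u)" if "u \<le> s" "u \<le> t" for s t u :: real
  using that
 proof (induction s t rule: linorder_wlog)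
  case (le s t)
  have "exp (- s) - exp (- t) = exp (- s) * (1 - exp (- (t - s)))"
   by (simp add: right_diff_distrib exp_add[symmetric])
  also have "... \<le> exp (- s) * (t - s)"
  proof (rule mult_left_mono)
   show "1 - exp (- (t - s)) \<le> t - s" using exp_ge_add_one_self[of "- (t - s)"] by linarith
  qed simp
  also have "... \<le> exp (- u) * (t - s)" using le by (intro mult_right_mono) auto
  finally show ?case using le by (simp add: mult.commute)
 next
  case (sym s t)
  then show ?case by (simp add: abs_minus_commute)
 qed
 have "\<bar>exp (- ?f x) - exp (- ?f y)\<bar> \<le> norm (x - y) * (R / (\<kappa> * V)) * exp (- (r\<^sup>2 / (2 * V)))"
  using exp_diff[OF fl[OF assms(1)] fl[OF assms(2)]] mult_right_mono[OF fd, of "exp (- (r\<^sup>2 / (2 * V)))"] by simp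
 then have "\<bar>exp (- ?f x) - exp (- ?f y)\<bar> * (1 / sqrt ((2 * pi) ^ CARD('d) * det S))
  \<le> norm (x - y) * (R / (\<kappa> * V)) * exp (- (r\<^sup>2 / (2 * V))) * (1 / sqrt ((2 * pi * \<kappa> * V) ^ CARD('d)))"
  using normalizer_lower positive_definite_det_pos[OF S] \<kappa> V assms by (intro mult_mono) auto
 moreover have "\<bar>gdens S x - gdens S y\<bar> = \<bar>exp (- ?f x) - exp (- ?f y)\<bar> * (1 / sqrt ((2 * pi) ^ CARD('d) * det S))"
 proof -
  have p: "0 \<le> 1 / sqrt ((2 * pi) ^ CARD('d) * det S)" using positive_definite_det_pos[OF S] by simp
  have "gdens S x - gdens S y = (exp (- ?f x) - exp (- ?f y)) * (1 / sqrt ((2 * pi) ^ CARD('d) * det S))"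
   by (simp add: gdens_def diff_divide_distrib)
  then show ?thesis using p by (simp only: abs_mult abs_of_nonneg)
 qed
 ultimately have "\<bar>gdens S x - gdens S y\<bar> \<le> norm (x - y) * (R / (\<kappa> * V)) * exp (- (r\<^sup>2 / (2 * V))) * (1 / sqrt ((2 * pi * \<kappa> * V) ^ CARD('d)))"
  by simp
 then show ?thesis by simp
qed

end

section \<open>Random series that solve affine recursions\<close>

text \<open>With x j = (mj, qj), the k-th term of the series q0 + m0 T q1 + m0 m1 T^2 q2 + ...; the
  index will count backwards in time.\<close>

definition pterm :: "('e::euclidean_space \<Rightarrow> 'e) \<Rightarrow> (nat \<Rightarrow> real \<times> 'e) \<Rightarrow> nat \<Rightarrow> 'e" where
 "pterm T x k = (\<Prod>j<k. fst (x j)) *\<^sub>R (T ^^ k) (snd (x k))"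

definition perp :: "('e::euclidean_space \<Rightarrow> 'e) \<Rightarrow> (nat \<Rightarrow> real \<times> 'e) \<Rightarrow> 'e" where
 "perp T x = (\<Sum>k. pterm T x k)"

lemma pterm_0: "pterm T x 0 = snd (x 0)"
 by (simp add: pterm_def)

lemma pterm_Suc:
 assumes "linear T"
 shows "pterm T x (Suc k) = fst (x 0) *\<^sub>R T (pterm T (\<lambda>k. x (Suc k)) k)"
proof -
 have "(\<Prod>j<Suc k. fst (x j)) = fst (x 0) * (\<Prod>j<k. fst (x (Suc j)))"
  by (rule prod.lessThan_Suc_shift)
 then show ?thesis by (simp add: pterm_def linear_scale[OF assms])
qed

lemma perp_rec:
 assumes T: "bounded_linear T" and s: "summable (pterm T (\<lambda>k. x (Suc k)))"
 shows "perp T x = snd (x 0) + fst (x 0) *\<^sub>R T (perp T (\<lambda>k. x (Suc k)))" "summable (pterm T x)"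
proof -
 note lT = bounded_linear.linear[OF T]
 have bl: "bounded_linear (\<lambda>v. fst (x 0) *\<^sub>R T v)"
  by (rule bounded_linear_compose[OF bounded_linear_scaleR_right T])
 have s': "summable (\<lambda>k. pterm T x (Suc k))"
  unfolding pterm_Suc[OF lT] by (rule bounded_linear.summable[OF bl s])
 then show sx: "summable (pterm T x)" by (simp add: summable_Suc_iff)
 have "perp T x = pterm T x 0 + (\<Sum>k. pterm T x (Suc k))"
  unfolding perp_def using suminf_split_head[OF sx] by simp
 also have "(\<Sum>k. pterm T x (Suc k)) = fst (x 0) *\<^sub>R T (perp T (\<lambda>k. x (Suc k)))"
  unfolding pterm_Suc[OF lT] perp_def by (rule bounded_linear.suminf[OF bl s, symmetric])
 finally show "perp T x = snd (x 0) + fst (x 0) *\<^sub>R T (perp T (\<lambda>k. x (Suc k)))" by (simp add: pterm_0)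
qed

locale perpetuity =
 fixes T :: "'e::euclidean_space \<Rightarrow> 'e" and \<nu> :: "(real \<times> 'e) measure" and b :: real
 assumes T: "linear T" and b: "b > 0" and Tb: "\<And>v. norm (T v) \<le> b * norm v"
  and prob: "prob_space \<nu>" and sets_\<nu>[measurable_cong, simp]: "sets \<nu> = sets borel"
begin

lemma bT: "bounded_linear T" using T by (simp add: linear_conv_bounded_linear)

lemma T_m[measurable]: "T \<in> borel_measurable borel"
 by (intro borel_measurable_continuous_onI linear_continuous_on bT)

lemma space_\<nu>[simp]: "space \<nu> = UNIV"
 using sets_eq_imp_space_eq[OF sets_\<nu>] by simp

sublocale nu: prob_space \<nu> by (rule prob)
sublocale seq: sequence_space \<nu> by unfold_locales

abbreviation "S \<equiv> PiM (UNIV :: nat set) (\<lambda>_. \<nu>)"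

lemma Tk_m[measurable]: "(T ^^ k) \<in> borel_measurable borel"
 by (induction k) (auto simp: measurable_compose[OF _ T_m] o_def)

lemma pterm_m[measurable]: "(\<lambda>x. pterm T x k) \<in> borel_measurable S"
proof -
 have xj[measurable]: "(\<lambda>x. x j) \<in> measurable S borel" for j
  using measurable_component_singleton[of j UNIV "\<lambda>_. \<nu>"] by (simp cong: measurable_cong_sets)
 have f: "fst \<in> borel_measurable (borel :: (real \<times> 'e) measure)" "snd \<in> borel_measurable (borel :: (real \<times> 'e) measure)"
  by (auto intro!: borel_measurable_continuous_onI continuous_intros)
 have [measurable]: "(\<lambda>x. fst (x j)) \<in> borel_measurable S" "(\<lambda>x. snd (x j)) \<in> borel_measurable S" for j
  by (rule measurable_compose[OF xj f(1)]) (rule measurable_compose[OF xj f(2)])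
 show ?thesis unfolding pterm_def by measurable
qed

lemma perp_m[measurable]: "perp T \<in> borel_measurable S"
 unfolding perp_def by measurable

lemma nn_S: "f \<in> borel_measurable S \<Longrightarrow> (\<integral>\<^sup>+x. f x \<partial>S) = (\<integral>\<^sup>+y. \<integral>\<^sup>+x. f (case_nat y x) \<partial>S \<partial>\<nu>)"
 for f :: "_ \<Rightarrow> ennreal"
proof -
 assume f[measurable]: "f \<in> borel_measurable S"
 have "(\<integral>\<^sup>+x. f x \<partial>S) = (\<integral>\<^sup>+x. f x \<partial>distr (\<nu> \<Otimes>\<^sub>M S) S (\<lambda>(s, \<omega>). case_nat s \<omega>))"
  by (simp only: seq.PiM_iter)
 also have "... = (\<integral>\<^sup>+p. f (case p of (s, \<omega>) \<Rightarrow> case_nat s \<omega>) \<partial>(\<nu> \<Otimes>\<^sub>M S))"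
  by (subst nn_integral_distr) auto
 also have "... = (\<integral>\<^sup>+y. \<integral>\<^sup>+x. f (case_nat y x) \<partial>S \<partial>\<nu>)"
  by (subst seq.P.nn_integral_fst[symmetric]) (auto simp: case_prod_beta)
 finally show ?thesis .
qed

lemma pterm_case_nat: "pterm T (case_nat y x) (Suc k) = fst y *\<^sub>R T (pterm T x k)"
 by (subst pterm_Suc[OF T]) simp

lemma fst_snd_m[measurable]: "fst \<in> borel_measurable \<nu>" "snd \<in> borel_measurable \<nu>"
 by (auto simp: measurable_cong_sets[OF sets_\<nu> refl] intro!: borel_measurable_continuous_onI continuous_intros)

lemma pterm_moment:
 assumes p: "p > 0"
 shows "(\<integral>\<^sup>+x. ennreal (norm (pterm T x k) powr p) \<partial>S)
  \<le> (\<integral>\<^sup>+y. ennreal ((b * \<bar>fst y\<bar>) powr p) \<partial>\<nu>) ^ k * (\<integral>\<^sup>+y. ennreal (norm (snd y) powr p) \<partial>\<nu>)"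
proof (induction k)
 case 0
 have "(\<integral>\<^sup>+x. ennreal (norm (pterm T x 0) powr p) \<partial>S) = (\<integral>\<^sup>+y. \<integral>\<^sup>+x. ennreal (norm (snd y) powr p) \<partial>S \<partial>\<nu>)"
  by (subst nn_S) (simp_all add: pterm_0)
 then show ?case by (simp add: seq.P.emeasure_space_1)
next
 case (Suc k)
 have "(\<integral>\<^sup>+x. ennreal (norm (pterm T x (Suc k)) powr p) \<partial>S)
   = (\<integral>\<^sup>+y. \<integral>\<^sup>+x. ennreal (norm (fst y *\<^sub>R T (pterm T x k)) powr p) \<partial>S \<partial>\<nu>)"
  by (subst nn_S) (simp_all add: pterm_case_nat)
 also have "... \<le> (\<integral>\<^sup>+y. \<integral>\<^sup>+x. ennreal ((b * \<bar>fst y\<bar>) powr p) * ennreal (norm (pterm T x k) powr p) \<partial>S \<partial>\<nu>)"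
 proof (intro nn_integral_mono)
  fix y x
  have "norm (fst y *\<^sub>R T (pterm T x k)) \<le> (b * \<bar>fst y\<bar>) * norm (pterm T x k)"
   using mult_left_mono[OF Tb[of "pterm T x k"], of "\<bar>fst y\<bar>"] by (simp add: mult_ac)
  then have "norm (fst y *\<^sub>R T (pterm T x k)) powr p \<le> ((b * \<bar>fst y\<bar>) * norm (pterm T x k)) powr p"
   using p by (intro powr_mono2) auto
  also have "... = (b * \<bar>fst y\<bar>) powr p * norm (pterm T x k) powr p"
   by (rule powr_mult)
  finally show "ennreal (norm (fst y *\<^sub>R T (pterm T x k)) powr p) \<le> ennreal ((b * \<bar>fst y\<bar>) powr p) * ennreal (norm (pterm T x k) powr p)"
   by (simp add: ennreal_mult'[symmetric] ennreal_leI)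
 qed
 also have "... = (\<integral>\<^sup>+y. ennreal ((b * \<bar>fst y\<bar>) powr p) \<partial>\<nu>) * (\<integral>\<^sup>+x. ennreal (norm (pterm T x k) powr p) \<partial>S)"
  by (simp add: nn_integral_cmult nn_integral_multc)
 also have "... \<le> (\<integral>\<^sup>+y. ennreal ((b * \<bar>fst y\<bar>) powr p) \<partial>\<nu>) * ((\<integral>\<^sup>+y. ennreal ((b * \<bar>fst y\<bar>) powr p) \<partial>\<nu>) ^ k * (\<integral>\<^sup>+y. ennreal (norm (snd y) powr p) \<partial>\<nu>))"
  by (rule mult_left_mono[OF Suc]) simp
 finally show ?case by (simp add: mult_ac)
qed

text \<open>One argument for all p > 0, below and above 1: the k-th term is divided by \<beta>^k
  with \<beta> < 1. The sum of the p-th powers of the weighted terms has finite mean, so almost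
  surely the terms are bounded by a multiple of \<beta>^k, and the geometric series gives both
  convergence and the moment.\<close>

lemma perp_moment:
 assumes p: "p > 0" and q: "(\<integral>\<^sup>+y. ennreal ((b * \<bar>fst y\<bar>) powr p) \<partial>\<nu>) < 1"
  and f: "(\<integral>\<^sup>+y. ennreal (norm (snd y) powr p) \<partial>\<nu>) < \<infinity>"
 shows "AE x in S. summable (pterm T x)" "(\<integral>\<^sup>+x. ennreal (norm (perp T x) powr p) \<partial>S) < \<infinity>"
proof -
 obtain q' where q': "(\<integral>\<^sup>+y. ennreal ((b * \<bar>fst y\<bar>) powr p) \<partial>\<nu>) = ennreal q'" "0 \<le> q'" "q' < 1"
  using q by (cases "\<integral>\<^sup>+y. ennreal ((b * \<bar>fst y\<bar>) powr p) \<partial>\<nu>") (auto simp: ennreal_less_one_iff)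
 obtain E where E: "(\<integral>\<^sup>+y. ennreal (norm (snd y) powr p) \<partial>\<nu>) = ennreal E" "0 \<le> E"
  using f by (cases "\<integral>\<^sup>+y. ennreal (norm (snd y) powr p) \<partial>\<nu>") auto
 \<comment> \<open>Strictly between q' and 1: above q' the weighted moments stay summable, below 1
   the weights \<beta>^k with \<beta> = c^(1/p) still decay.\<close>
 define c where "c = (1 + q') / 2"
 define \<beta> where "\<beta> = c powr (1 / p)"
 have c: "q' < c" "c < 1" "c > 0" using q' by (auto simp: c_def)
 have \<beta>: "0 < \<beta>" "\<beta> < 1" "\<beta> powr p = c"
 proof -
  have "c powr (1 / p) < 1 powr (1 / p)" using c p by (intro powr_less_mono2) auto
  then show "0 < \<beta>" "\<beta> < 1" "\<beta> powr p = c" using c p by (auto simp: \<beta>_def powr_powr)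
 qed
 define g where "g x k = (norm (pterm T x k) / \<beta> ^ k) powr p" for x k
 have g: "g x k = norm (pterm T x k) powr p * (1 / c) ^ k" for x k
 proof -
  have "(\<beta> ^ k) powr p = c ^ k"
   using \<beta> by (simp add: powr_realpow[symmetric] powr_powr mult.commute) (simp add: powr_powr[symmetric] powr_realpow c)
  then show ?thesis by (simp add: g_def powr_divide power_one_over)
 qed
 have gm[measurable]: "(\<lambda>x. g x k) \<in> borel_measurable S" for k unfolding g_def by measurable
 define G where "G x = (\<Sum>k. ennreal (g x k))" for x
 have Gm[measurable]: "G \<in> borel_measurable S" unfolding G_def by measurable
 have "(\<integral>\<^sup>+x. G x \<partial>S) = (\<Sum>k. \<integral>\<^sup>+x. ennreal (g x k) \<partial>S)"
  unfolding G_def by (rule nn_integral_suminf) measurable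
 also have "... \<le> (\<Sum>k. ennreal (E * (q' / c) ^ k))"
 proof (rule suminf_le)
  fix k
  have "(\<integral>\<^sup>+x. ennreal (g x k) \<partial>S) = (\<integral>\<^sup>+x. ennreal (norm (pterm T x k) powr p) \<partial>S) * ennreal ((1 / c) ^ k)"
   unfolding g using c by (subst nn_integral_multc[symmetric]) (auto simp: ennreal_mult)
  also have "... \<le> (ennreal q' ^ k * ennreal E) * ennreal ((1 / c) ^ k)"
   using pterm_moment[OF p, of k] unfolding q'(1) E(1) by (intro mult_right_mono) auto
  also have "... = ennreal (E * (q' / c) ^ k)"
   using q' E c by (simp add: ennreal_power ennreal_mult[symmetric] power_divide mult_ac)
  finally show "(\<integral>\<^sup>+x. ennreal (g x k) \<partial>S) \<le> ennreal (E * (q' / c) ^ k)" .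
 qed auto
 also have "... < \<infinity>"
 proof -
  have "summable (\<lambda>k. E * (q' / c) ^ k)" using q' c by (intro summable_mult summable_geometric) auto
  then have "(\<Sum>k. ennreal (E * (q' / c) ^ k)) = ennreal (\<Sum>k. E * (q' / c) ^ k)"
   using E q' c by (intro suminf_ennreal2) auto
  then show ?thesis by simp
 qed
 finally have GI: "(\<integral>\<^sup>+x. G x \<partial>S) < \<infinity>" .
 have key: "summable (pterm T x) \<and> ennreal (norm (perp T x) powr p) \<le> ennreal ((1 / (1 - \<beta>)) powr p) * G x" if "G x < \<infinity>" for x
 proof -
  obtain r where r: "G x = ennreal r" "r \<ge> 0" using \<open>G x < \<infinity>\<close> by (cases "G x") auto
  have gk: "g x k \<le> r" for k
  proof -
   have "ennreal (g x k) \<le> G x" unfolding G_def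
    using sum_le_suminf[of "\<lambda>k. ennreal (g x k)" "{k}"] by simp
   then show ?thesis using r by simp
  qed
  have t: "norm (pterm T x k) \<le> r powr (1 / p) * \<beta> ^ k" for k
  proof -
   have "norm (pterm T x k) / \<beta> ^ k = (g x k) powr (1 / p)"
    unfolding g_def using p \<beta> by (simp add: powr_powr)
   also have "... \<le> r powr (1 / p)" using gk[of k] p by (intro powr_mono2) (auto simp: g_def)
   finally show ?thesis using \<beta> by (simp add: field_simps)
  qed
  have sg: "summable (\<lambda>k. r powr (1 / p) * \<beta> ^ k)" using \<beta> by (intro summable_mult summable_geometric) auto
  have sn: "summable (\<lambda>k. norm (pterm T x k))" by (rule summable_comparison_test'[OF sg]) (use t in auto)
  have "norm (perp T x) \<le> (\<Sum>k. norm (pterm T x k))" unfolding perp_def by (rule summable_norm[OF sn])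
  also have "... \<le> (\<Sum>k. r powr (1 / p) * \<beta> ^ k)" by (rule suminf_le[OF t sn sg])
  also have "... = r powr (1 / p) * (1 / (1 - \<beta>))" using \<beta> by (simp add: suminf_mult suminf_geometric)
  finally have "norm (perp T x) powr p \<le> (r powr (1 / p) * (1 / (1 - \<beta>))) powr p" using p by (intro powr_mono2) auto
  also have "... = r * (1 / (1 - \<beta>)) powr p"
   using p r \<beta> by (subst powr_mult) (auto simp: powr_powr)
  finally show ?thesis using r summable_norm_cancel[OF sn]
   by (auto simp: ennreal_mult'[symmetric] mult.commute intro!: ennreal_leI)
 qed
 have AE: "AE x in S. G x < \<infinity>"
  using nn_integral_PInf_AE[OF Gm] GI by (auto simp: less_top)
 then show "AE x in S. summable (pterm T x)" by eventually_elim (use key in blast)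
 have "(\<integral>\<^sup>+x. ennreal (norm (perp T x) powr p) \<partial>S) \<le> (\<integral>\<^sup>+x. ennreal ((1 / (1 - \<beta>)) powr p) * G x \<partial>S)"
  by (rule nn_integral_mono_AE) (use AE key in \<open>auto elim!: eventually_mono\<close>)
 also have "... = ennreal ((1 / (1 - \<beta>)) powr p) * (\<integral>\<^sup>+x. G x \<partial>S)" by (rule nn_integral_cmult) simp
 also have "... < \<infinity>" using GI by (simp add: ennreal_mult_less_top)
 finally show "(\<integral>\<^sup>+x. ennreal (norm (perp T x) powr p) \<partial>S) < \<infinity>" .
qed

lemma perp_invariant:
 fixes f :: "'e \<Rightarrow> ennreal"
 assumes AE: "AE x in S. summable (pterm T x)" and f[measurable]: "f \<in> borel_measurable borel"
 shows "(\<integral>\<^sup>+v. f v \<partial>distr S borel (perp T)) = (\<integral>\<^sup>+v. \<integral>\<^sup>+y. f (snd y + fst y *\<^sub>R T v) \<partial>\<nu> \<partial>distr S borel (perp T))"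
  (is "_ = ?R")
proof -
 have "(\<integral>\<^sup>+v. f v \<partial>distr S borel (perp T)) = (\<integral>\<^sup>+x. f (perp T x) \<partial>S)"
  by (simp add: nn_integral_distr)
 also have "... = (\<integral>\<^sup>+y. \<integral>\<^sup>+x. f (perp T (case_nat y x)) \<partial>S \<partial>\<nu>)"
  by (rule nn_S) measurable
 also have "... = (\<integral>\<^sup>+y. \<integral>\<^sup>+x. f (snd y + fst y *\<^sub>R T (perp T x)) \<partial>S \<partial>\<nu>)"
 proof (rule nn_integral_cong, rule nn_integral_cong_AE)
  fix y :: "real \<times> 'e"
  show "AE x in S. f (perp T (case_nat y x)) = f (snd y + fst y *\<^sub>R T (perp T x))"
   using AE by eventually_elim (simp add: perp_rec(1)[OF bT, of "case_nat y _"])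
 qed
 also have "... = (\<integral>\<^sup>+x. \<integral>\<^sup>+y. f (snd y + fst y *\<^sub>R T (perp T x)) \<partial>\<nu> \<partial>S)"
 proof -
  interpret pair_sigma_finite \<nu> S ..
  show ?thesis by (rule Fubini'[symmetric]) measurable
 qed
 also have "... = ?R" by (subst nn_integral_distr) auto
 finally show ?thesis .
qed

end

subsection \<open>Independence and joint laws\<close>

lemma indep_elements_joint:
 assumes "prob_space M" and ind: "indep_elements M S X T Y"
 shows "distr M (S \<Otimes>\<^sub>M T) (\<lambda>w. (X w, Y w)) = distr M S X \<Otimes>\<^sub>M distr M T Y"
proof -
 interpret prob_space M by fact
 have [measurable]: "X \<in> measurable M S" "Y \<in> measurable M T" using ind by (auto simp: indep_elements_def)
 interpret X: prob_space "distr M S X" by (rule prob_space_distr) measurable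
 interpret Y: prob_space "distr M T Y" by (rule prob_space_distr) measurable
 have "distr M S X \<Otimes>\<^sub>M distr M T Y = distr M (S \<Otimes>\<^sub>M T) (\<lambda>w. (X w, Y w))"
 proof (rule pair_measure_eqI)
  fix A B assume "A \<in> sets (distr M S X)" "B \<in> sets (distr M T Y)"
  then have A[measurable]: "A \<in> sets S" and B[measurable]: "B \<in> sets T" by auto
  have "prob ((X -` A \<inter> space M) \<inter> (Y -` B \<inter> space M)) = prob (X -` A \<inter> space M) * prob (Y -` B \<inter> space M)"
   using ind A B by (intro indep_setD[of "{X -` E \<inter> space M |E. E \<in> sets S}" "{Y -` E \<inter> space M |E. E \<in> sets T}"])
    (auto simp: indep_elements_def)
  moreover have "(\<lambda>w. (X w, Y w)) -` (A \<times> B) \<inter> space M = (X -` A \<inter> space M) \<inter> (Y -` B \<inter> space M)" by auto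
  ultimately show "emeasure (distr M S X) A * emeasure (distr M T Y) B
    = emeasure (distr M (S \<Otimes>\<^sub>M T) (\<lambda>w. (X w, Y w))) (A \<times> B)"
   by (simp add: emeasure_distr emeasure_eq_measure ennreal_mult)
 qed (simp_all add: X.sigma_finite_measure_axioms Y.sigma_finite_measure_axioms)
 then show ?thesis by simp
qed

lemma indep_elementsI:
 assumes "prob_space M" and [measurable]: "X \<in> measurable M S" "Y \<in> measurable M T"
  and eq: "\<And>A B. A \<in> sets S \<Longrightarrow> B \<in> sets T \<Longrightarrow>
   measure M ((X -` A \<inter> space M) \<inter> (Y -` B \<inter> space M)) = measure M (X -` A \<inter> space M) * measure M (Y -` B \<inter> space M)"
 shows "indep_elements M S X T Y"
proof -
 interpret prob_space M by fact
 show ?thesis unfolding indep_elements_def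
  by (intro conjI indep_setI) (auto simp: eq)
qed

text \<open>Independence of the two sequences, evaluated on cylinder sets, separates m from Q;
  independence inside each sequence separates the times. Rectangles form an intersection-stable
  generator for each pair, which extends the product formula to all events.\<close>

lemma sre_pair_iid:
 assumes "prob_space M" and inn: "sre_innovations M C m Q" and C: "positive_definite C"
 shows "prob_space.indep_vars M (\<lambda>_. borel) (\<lambda>t w. (m t w, Q t w)) (UNIV :: int set)"
  "distr M borel (\<lambda>w. (m t w, Q t w)) = stdn \<Otimes>\<^sub>M centered_normal C"
  "(\<lambda>w. (m t w, Q t w)) \<in> borel_measurable M"
proof -
 let ?R = "\<lambda>t A B. (m t -` A \<inter> space M) \<inter> (Q t -` B \<inter> space M)"
 interpret prob_space M by fact
 have im: "indep_vars (\<lambda>_. borel) m UNIV" and iQ: "indep_vars (\<lambda>_. borel) Q UNIV"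
  and dm: "\<And>t. distr M borel (m t) = stdn" and dQ: "\<And>t. distr M borel (Q t) = centered_normal C"
  and ie: "indep_elements M (PiM UNIV (\<lambda>_. borel)) (\<lambda>w t. m t w) (PiM UNIV (\<lambda>_. borel)) (\<lambda>w t. Q t w)"
  using inn by (auto simp: sre_innovations_def iid_def)
 have [measurable]: "m t \<in> borel_measurable M" "Q t \<in> borel_measurable M" for t
  using im iQ by (auto simp: indep_vars_def)
 show wm: "(\<lambda>w. (m t w, Q t w)) \<in> borel_measurable M" for t by measurable
 let ?w = "\<lambda>t w. (m t w, Q t w)"
 let ?E = "\<lambda>t. {?R t A B | A B. A \<in> sets borel \<and> B \<in> sets borel}"
 have fac: "prob ((\<Inter>j\<in>J. m j -` A j \<inter> space M) \<inter> (\<Inter>j\<in>J. Q j -` B j \<inter> space M))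
   = (\<Prod>j\<in>J. prob (m j -` A j \<inter> space M)) * (\<Prod>j\<in>J. prob (Q j -` B j \<inter> space M))"
  if J: "J \<noteq> {}" "finite J" and AB: "\<And>j. j \<in> J \<Longrightarrow> A j \<in> sets borel" "\<And>j. j \<in> J \<Longrightarrow> B j \<in> sets borel" for J A B
 proof -
  let ?SA = "{f. \<forall>j\<in>J. f j \<in> A j}" and ?SB = "{f. \<forall>j\<in>J. f j \<in> B j}"
  have S: "?SA \<in> sets (PiM UNIV (\<lambda>_. borel))" "?SB \<in> sets (PiM UNIV (\<lambda>_. borel))"
  proof -
   have "?SA = (\<Inter>j\<in>J. (\<lambda>f. f j) -` A j \<inter> space (PiM UNIV (\<lambda>_. borel)))"
    and "?SB = (\<Inter>j\<in>J. (\<lambda>f. f j) -` B j \<inter> space (PiM UNIV (\<lambda>_. borel)))" using J by (auto simp: space_PiM)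
   then show "?SA \<in> sets (PiM UNIV (\<lambda>_. borel))" "?SB \<in> sets (PiM UNIV (\<lambda>_. borel))"
    using J AB by (auto intro!: sets.finite_INT measurable_sets[OF measurable_component_singleton])
  qed
  have "prob (((\<lambda>w t. m t w) -` ?SA \<inter> space M) \<inter> ((\<lambda>w t. Q t w) -` ?SB \<inter> space M))
   = prob ((\<lambda>w t. m t w) -` ?SA \<inter> space M) * prob ((\<lambda>w t. Q t w) -` ?SB \<inter> space M)"
  proof (rule indep_setD)
   show "indep_set {(\<lambda>w t. m t w) -` E \<inter> space M |E. E \<in> sets (PiM UNIV (\<lambda>_. borel))}
    {(\<lambda>w t. Q t w) -` E \<inter> space M |E. E \<in> sets (PiM UNIV (\<lambda>_. borel))}"
    using ie by (simp add: indep_elements_def)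
  qed (rule CollectI, rule exI, rule conjI[OF refl], rule S)+
  moreover have "(\<lambda>w t. m t w) -` ?SA \<inter> space M = (\<Inter>j\<in>J. m j -` A j \<inter> space M)"
   "(\<lambda>w t. Q t w) -` ?SB \<inter> space M = (\<Inter>j\<in>J. Q j -` B j \<inter> space M)" using J by auto
  moreover have "prob (\<Inter>j\<in>J. m j -` A j \<inter> space M) = (\<Prod>j\<in>J. prob (m j -` A j \<inter> space M))"
   using J AB by (intro indep_varsD[OF im]) auto
  moreover have "prob (\<Inter>j\<in>J. Q j -` B j \<inter> space M) = (\<Prod>j\<in>J. prob (Q j -` B j \<inter> space M))"
   using J AB by (intro indep_varsD[OF iQ]) auto
  ultimately show ?thesis by simp
 qed
 have one: "prob (?R t A B) = prob (m t -` A \<inter> space M) * prob (Q t -` B \<inter> space M)"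
  if "A \<in> sets borel" "B \<in> sets borel" for t A B
  using fac[of "{t}" "\<lambda>_. A" "\<lambda>_. B"] that by simp
 have "indep_sets ?E UNIV"
 proof (rule indep_setsI)
  show "?E t \<subseteq> events" for t by auto
  fix F J assume J: "J \<noteq> {}" "J \<subseteq> (UNIV :: int set)" "finite J" and F: "\<forall>j\<in>J. F j \<in> ?E j"
  then have "\<forall>j\<in>J. \<exists>A B. F j = (m j -` A \<inter> space M) \<inter> (Q j -` B \<inter> space M) \<and> A \<in> sets borel \<and> B \<in> sets borel" by blast
  then obtain A B where AB: "\<And>j. j \<in> J \<Longrightarrow> F j = (m j -` A j \<inter> space M) \<inter> (Q j -` B j \<inter> space M)"
   "\<And>j. j \<in> J \<Longrightarrow> A j \<in> sets borel" "\<And>j. j \<in> J \<Longrightarrow> B j \<in> sets borel" by metis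
  have "(\<Inter>j\<in>J. F j) = (\<Inter>j\<in>J. m j -` A j \<inter> space M) \<inter> (\<Inter>j\<in>J. Q j -` B j \<inter> space M)"
   using AB(1) by auto
  then show "prob (\<Inter>j\<in>J. F j) = (\<Prod>j\<in>J. prob (F j))"
   using fac[OF J(1,3), of A B] AB by (simp add: prod.distrib[symmetric] one)
 qed
 moreover have "Int_stable (?E t)" for t
 proof (rule Int_stableI)
  fix F G assume "F \<in> ?E t" "G \<in> ?E t"
  then obtain A B A' B' where "F = ?R t A B" "G = (m t -` A' \<inter> space M) \<inter> (Q t -` B' \<inter> space M)"
   "A \<in> sets borel" "B \<in> sets borel" "A' \<in> sets borel" "B' \<in> sets borel" by auto
  moreover have "F \<inter> G = (m t -` (A \<inter> A') \<inter> space M) \<inter> (Q t -` (B \<inter> B') \<inter> space M)" using calculation by auto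
  ultimately show "F \<inter> G \<in> ?E t" by blast
 qed
 ultimately have I: "indep_sets (\<lambda>t. sigma_sets (space M) (?E t)) UNIV"
  by (intro indep_sets_sigma) auto
 have sub: "{?w t -` D \<inter> space M | D. D \<in> sets borel} \<subseteq> sigma_sets (space M) (?E t)" for t
 proof -
  let ?N = "sigma (space M) (?E t)"
  have sN: "sets ?N = sigma_sets (space M) (?E t)" "space ?N = space M" by (auto intro!: sets_measure_of space_measure_of)
  have "m t \<in> measurable ?N borel"
  proof (rule measurableI)
   fix A :: "real set" assume "A \<in> sets borel"
   then have "m t -` A \<inter> space M = ?R t A UNIV" by auto
   moreover have "?R t A UNIV \<in> ?E t"
    using \<open>A \<in> sets borel\<close> by (intro CollectI exI[of _ A] exI[of _ UNIV]) auto
   ultimately have "m t -` A \<inter> space M \<in> ?E t" by simp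
   then show "m t -` A \<inter> space ?N \<in> sets ?N" unfolding sN by (rule sigma_sets.Basic)
  qed simp
  moreover have "Q t \<in> measurable ?N borel"
  proof (rule measurableI)
   fix B :: "(real^'b) set" assume "B \<in> sets borel"
   then have "Q t -` B \<inter> space M = ?R t UNIV B" by auto
   moreover have "?R t UNIV B \<in> ?E t"
    using \<open>B \<in> sets borel\<close> by (intro CollectI exI[of _ UNIV] exI[of _ B]) auto
   ultimately have "Q t -` B \<inter> space M \<in> ?E t" by simp
   then show "Q t -` B \<inter> space ?N \<in> sets ?N" unfolding sN by (rule sigma_sets.Basic)
  qed simp
  ultimately have "?w t \<in> measurable ?N borel" by measurable
  then have "?w t -` D \<inter> space ?N \<in> sets ?N" if "D \<in> sets borel" for D using that by (rule measurable_sets)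
  then show ?thesis unfolding sN by auto
 qed
 show "indep_vars (\<lambda>_. borel) ?w UNIV"
  unfolding indep_vars_def2
 proof (intro conjI ballI)
  show "indep_sets (\<lambda>i. {?w i -` A \<inter> space M |A. A \<in> sets borel}) UNIV"
   by (rule indep_sets_mono_sets[OF I]) (rule sub)
 qed (rule wm)
 have "indep_elements M borel (m t) borel (Q t)"
  by (rule indep_elementsI[OF \<open>prob_space M\<close>]) (auto simp: one)
 from indep_elements_joint[OF \<open>prob_space M\<close> this]
 show "distr M borel (\<lambda>w. (m t w, Q t w)) = stdn \<Otimes>\<^sub>M centered_normal C"
  by (simp add: dm dQ borel_prod)
qed

subsection \<open>Markov processes indexed by the integers\<close>

abbreviation "pastB t \<equiv> PiM {..<t :: int} (\<lambda>_. borel)"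

abbreviation past :: "(int \<Rightarrow> 'a \<Rightarrow> 'v) \<Rightarrow> int \<Rightarrow> 'a \<Rightarrow> int \<Rightarrow> 'v" where
 "past X t w \<equiv> \<lambda>s\<in>{..<t}. X s w"

text \<open>An identity for functions of the complete past and the present: given all of the past,
  \<open>X t\<close> has law \<open>K (X (t - 1))\<close>. Keeping the complete past is what later
  yields innovations independent of it.\<close>

definition markov :: "'a measure \<Rightarrow> (int \<Rightarrow> 'a \<Rightarrow> 'v::{second_countable_topology,t2_space}) \<Rightarrow> ('v \<Rightarrow> 'v measure) \<Rightarrow> bool" where
 "markov M X K \<longleftrightarrow> (\<forall>t. X t \<in> borel_measurable M) \<and>
  (\<forall>t. \<forall>H \<in> borel_measurable (pastB t \<Otimes>\<^sub>M borel).
   (\<integral>\<^sup>+w. H (past X t w, X t w) \<partial>M) = (\<integral>\<^sup>+w. \<integral>\<^sup>+x. H (past X t w, x) \<partial>K (X (t - 1) w) \<partial>M))"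

lemma past_measurable:
 assumes "\<And>t. X t \<in> borel_measurable M"
 shows "past X t \<in> measurable M (pastB t)"
 using assms by (intro measurable_restrict) auto

lemma markov_from_innovations:
 fixes g :: "'v::{second_countable_topology,t2_space} \<Rightarrow> 'y \<Rightarrow> 'v"
 assumes "prob_space M" and Xm[measurable]: "\<And>t. X t \<in> borel_measurable M"
  and ind: "\<And>t. indep_elements M N (\<xi> t) (pastB t) (past X t)"
  and law: "\<And>t. distr M N (\<xi> t) = \<nu>" and K: "\<And>v. K v = distr \<nu> borel (g v)"
  and gm[measurable]: "(\<lambda>(v, y). g v y) \<in> borel_measurable (borel \<Otimes>\<^sub>M N)"
  and eq: "\<And>t. AE w in M. X t w = g (X (t - 1) w) (\<xi> t w)"
 shows "markov M X K"
 unfolding markov_def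
proof (intro conjI allI ballI)
 fix t and H :: "(int \<Rightarrow> 'v) \<times> 'v \<Rightarrow> ennreal"
 assume H[measurable]: "H \<in> borel_measurable (pastB t \<Otimes>\<^sub>M borel)"
 interpret prob_space M by fact
 let ?P = "PiM {..<t} (\<lambda>_. borel :: 'v measure)"
 have pm[measurable]: "past X t \<in> measurable M ?P" by (rule past_measurable) measurable
 have xm[measurable]: "\<xi> t \<in> measurable M N" using ind by (simp add: indep_elements_def)
 interpret nu: prob_space \<nu> unfolding law[of t, symmetric] by (rule prob_space_distr) measurable
 have sn[measurable_cong]: "sets \<nu> = sets N" unfolding law[of t, symmetric] by simp
 interpret PM: prob_space "distr M ?P (past X t)" by (rule prob_space_distr) measurable
 have [measurable]: "(\<lambda>p. p (t - 1)) \<in> borel_measurable ?P"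
  by (rule measurable_component_singleton) simp
 have g2[measurable]: "(\<lambda>z. g (snd z (t - 1)) (fst z)) \<in> borel_measurable (N \<Otimes>\<^sub>M ?P)"
  using measurable_compose[OF _ gm, of "\<lambda>z. (snd z (t - 1), fst z)" "N \<Otimes>\<^sub>M ?P"] by simp
 have gv[measurable]: "g v \<in> borel_measurable N" for v
  using measurable_compose[OF _ gm, of "\<lambda>y. (v, y)" N] by simp
 let ?F = "\<lambda>z. H (snd z, g (snd z (t - 1)) (fst z))"
 have "(\<integral>\<^sup>+w. H (past X t w, X t w) \<partial>M) = (\<integral>\<^sup>+w. ?F (\<xi> t w, past X t w) \<partial>M)"
  by (rule nn_integral_cong_AE) (use eq[of t] in \<open>auto elim!: eventually_mono\<close>)
 also have "... = (\<integral>\<^sup>+z. ?F z \<partial>distr M (N \<Otimes>\<^sub>M ?P) (\<lambda>w. (\<xi> t w, past X t w)))"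
  by (subst nn_integral_distr) auto
 also have "distr M (N \<Otimes>\<^sub>M ?P) (\<lambda>w. (\<xi> t w, past X t w)) = \<nu> \<Otimes>\<^sub>M distr M ?P (past X t)"
  using indep_elements_joint[OF \<open>prob_space M\<close> ind[of t]] by (simp add: law)
 also have "(\<integral>\<^sup>+z. ?F z \<partial>(\<nu> \<Otimes>\<^sub>M distr M ?P (past X t))) = (\<integral>\<^sup>+p. \<integral>\<^sup>+y. ?F (y, p) \<partial>\<nu> \<partial>distr M ?P (past X t))"
 proof -
  interpret pair_sigma_finite \<nu> "distr M ?P (past X t)" ..
  have "?F \<in> borel_measurable (\<nu> \<Otimes>\<^sub>M distr M ?P (past X t))" by measurable
  from nn_integral_snd[OF this] show ?thesis by simp
 qed
 also have "... = (\<integral>\<^sup>+w. \<integral>\<^sup>+y. ?F (y, past X t w) \<partial>\<nu> \<partial>M)"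
 proof (rule nn_integral_distr)
  have "(\<lambda>(p, y). ?F (y, p)) \<in> borel_measurable (?P \<Otimes>\<^sub>M \<nu>)"
   using measurable_compose[OF _ gm, of "\<lambda>z. (fst z (t - 1), snd z)" "?P \<Otimes>\<^sub>M \<nu>"] by simp
  from nu.borel_measurable_nn_integral[OF this] show "(\<lambda>p. \<integral>\<^sup>+y. ?F (y, p) \<partial>\<nu>) \<in> borel_measurable (distr M ?P (past X t))"
   by simp
 qed measurable
 also have "... = (\<integral>\<^sup>+w. \<integral>\<^sup>+x. H (past X t w, x) \<partial>K (X (t - 1) w) \<partial>M)"
 proof (rule nn_integral_cong)
  fix w assume "w \<in> space M"
  then have "past X t w \<in> space ?P" by (rule measurable_space[OF pm])
  then have hm: "(\<lambda>x. H (past X t w, x)) \<in> borel_measurable borel" by measurable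
  show "(\<integral>\<^sup>+y. ?F (y, past X t w) \<partial>\<nu>) = (\<integral>\<^sup>+x. H (past X t w, x) \<partial>K (X (t - 1) w))"
   unfolding K by (subst nn_integral_distr) (use hm in \<open>auto simp: measurable_cong_sets[OF sn refl]\<close>)
 qed
 finally show "(\<integral>\<^sup>+w. H (past X t w, X t w) \<partial>M) = (\<integral>\<^sup>+w. \<integral>\<^sup>+x. H (past X t w, x) \<partial>K (X (t - 1) w) \<partial>M)" .
qed measurable

text \<open>A process on all integers has no first time, so a window of times is entered through the
  common marginal law at its left end; from there the kernel fixes all joint laws, and the windows
  fix the process law.\<close>

theorem markov_process_law_unique:
 fixes X :: "int \<Rightarrow> 'a \<Rightarrow> 'v::{second_countable_topology,t2_space}" and Y :: "int \<Rightarrow> 'b \<Rightarrow> 'v"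
 assumes M: "prob_space M" and N: "prob_space N" and X: "markov M X K" and Y: "markov N Y K"
  and lX: "\<And>t. distr M borel (X t) = \<pi>" and lY: "\<And>t. distr N borel (Y t) = \<pi>"
  and Km: "\<And>h :: 'v \<Rightarrow> ennreal. h \<in> borel_measurable borel \<Longrightarrow> (\<lambda>v. \<integral>\<^sup>+x. h x \<partial>K v) \<in> borel_measurable borel"
  and Ks: "\<And>v. sets (K v) = sets borel"
 shows "process_law M X = process_law N Y"
proof -
 interpret M: prob_space M by (rule M)
 interpret N: prob_space N by (rule N)
 have Xm[measurable]: "X t \<in> borel_measurable M" for t using X by (auto simp: markov_def)
 have Ym[measurable]: "Y t \<in> borel_measurable N" for t using Y by (auto simp: markov_def)
 have window: "(\<integral>\<^sup>+w. (\<Prod>i<n. indicator (B i) (X (s + int i) w)) * h (X (s + int n) w) \<partial>M)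
   = (\<integral>\<^sup>+w. (\<Prod>i<n. indicator (B i) (Y (s + int i) w)) * h (Y (s + int n) w) \<partial>N)"
  if "\<And>i. B i \<in> sets borel" "h \<in> borel_measurable borel" for n s and B :: "nat \<Rightarrow> 'v set" and h :: "'v \<Rightarrow> ennreal"
  using that(2)
 proof (induction n arbitrary: h)
  case 0
  have "(\<integral>\<^sup>+w. h (X s w) \<partial>M) = (\<integral>\<^sup>+v. h v \<partial>\<pi>)" "(\<integral>\<^sup>+w. h (Y s w) \<partial>N) = (\<integral>\<^sup>+v. h v \<partial>\<pi>)"
  proof -
   have "(\<integral>\<^sup>+w. h (X s w) \<partial>M) = (\<integral>\<^sup>+v. h v \<partial>distr M borel (X s))"
    "(\<integral>\<^sup>+w. h (Y s w) \<partial>N) = (\<integral>\<^sup>+v. h v \<partial>distr N borel (Y s))" using 0 by (simp_all add: nn_integral_distr)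
   then show "(\<integral>\<^sup>+w. h (X s w) \<partial>M) = (\<integral>\<^sup>+v. h v \<partial>\<pi>)" "(\<integral>\<^sup>+w. h (Y s w) \<partial>N) = (\<integral>\<^sup>+v. h v \<partial>\<pi>)"
    unfolding lX lY .
  qed
  then show ?case by simp
 next
  case (Suc n)
  note [measurable] = that(1) Suc.prems
  define t where "t = s + int (Suc n)"
  define H where "H z = (\<Prod>i<Suc n. indicator (B i) (fst z (s + int i))) * h (snd z)" for z :: "(int \<Rightarrow> 'v) \<times> 'v"
  have [measurable]: "(\<lambda>z. fst z (s + int i)) \<in> borel_measurable (PiM {..<t} (\<lambda>_. borel :: 'v measure) \<Otimes>\<^sub>M borel)" if "i < Suc n" for i
   using measurable_compose[OF measurable_fst measurable_component_singleton[of "s + int i" "{..<t}"]] that by (simp add: t_def)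
  have Hm: "H \<in> borel_measurable (pastB t \<Otimes>\<^sub>M borel)"
  proof -
   have "(\<lambda>z. indicator (B i) (fst z (s + int i)) :: ennreal) \<in> borel_measurable (PiM {..<t} (\<lambda>_. borel :: 'v measure) \<Otimes>\<^sub>M borel)" if "i < Suc n" for i
    using that by measurable
   then have "(\<lambda>z. \<Prod>i<Suc n. indicator (B i) (fst z (s + int i)) :: ennreal) \<in> borel_measurable (PiM {..<t} (\<lambda>_. borel :: 'v measure) \<Otimes>\<^sub>M borel)"
    by (intro borel_measurable_prod_ennreal) auto
   then show ?thesis unfolding H_def by measurable
  qed
  \<comment> \<open>Integrating out the last coordinate replaces h by its mean under the kernel, cut
    off by the last indicator; the window gets shorter by one.\<close>
  define h' where "h' v = indicator (B n) v * (\<integral>\<^sup>+x. h x \<partial>K v)" for v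
  have h'm: "h' \<in> borel_measurable borel" unfolding h'_def using Km[OF Suc.prems] by measurable
  have step: "(\<integral>\<^sup>+w. (\<Prod>i<Suc n. indicator (B i) (Z (s + int i) w)) * h (Z (s + int (Suc n)) w) \<partial>R)
    = (\<integral>\<^sup>+w. (\<Prod>i<n. indicator (B i) (Z (s + int i) w)) * h' (Z (s + int n) w) \<partial>R)"
   if Z: "markov R Z K" for Z :: "int \<Rightarrow> 'c \<Rightarrow> 'v" and R
  proof -
   have HZ: "H (past Z t w, x) = (\<Prod>i<Suc n. indicator (B i) (Z (s + int i) w)) * h x" for w x
    unfolding H_def by (auto intro!: arg_cong2[where f = "(*)"] prod.cong simp: t_def)
   have "(\<integral>\<^sup>+w. H (past Z t w, Z t w) \<partial>R) = (\<integral>\<^sup>+w. \<integral>\<^sup>+x. H (past Z t w, x) \<partial>K (Z (t - 1) w) \<partial>R)"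
    using Z Hm by (auto simp: markov_def)
   also have "... = (\<integral>\<^sup>+w. (\<Prod>i<n. indicator (B i) (Z (s + int i) w)) * h' (Z (s + int n) w) \<partial>R)"
   proof (rule nn_integral_cong)
    fix w
    have "t - 1 = s + int n" by (simp add: t_def)
    then show "(\<integral>\<^sup>+x. H (past Z t w, x) \<partial>K (Z (t - 1) w)) = (\<Prod>i<n. indicator (B i) (Z (s + int i) w)) * h' (Z (s + int n) w)"
     unfolding HZ using Suc.prems
     by (subst nn_integral_cmult) (auto simp: h'_def mult.assoc measurable_cong_sets[OF Ks refl])
   qed
   finally show ?thesis unfolding HZ by (simp add: t_def)
  qed
  show ?case unfolding step[OF X] step[OF Y] by (rule Suc.IH[OF h'm])
 qed
 have pX: "(\<lambda>w t. X t w) \<in> measurable M (PiM UNIV (\<lambda>_. borel))" by (rule measurable_PiM_single') auto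
 have pY: "(\<lambda>w t. Y t w) \<in> measurable N (PiM UNIV (\<lambda>_. borel))" by (rule measurable_PiM_single') auto
 show ?thesis unfolding process_law_def
 proof (rule measure_eqI_PiM_infinite)
  show "finite_measure (distr M (PiM UNIV (\<lambda>_. borel)) (\<lambda>w t. X t w))"
   using M.prob_space_distr[OF pX] by (rule prob_space.finite_measure)
  fix A and J :: "int set" assume J: "finite J" and A: "\<And>i. i \<in> J \<Longrightarrow> A i \<in> sets (borel :: 'v measure)"
  let ?E = "prod_emb UNIV (\<lambda>_. borel :: 'v measure) J (Pi\<^sub>E J A)"
  have Em: "?E \<in> sets (PiM UNIV (\<lambda>_. borel))" using J A by (intro sets_PiM_I) auto
  have Ein: "f \<in> ?E \<longleftrightarrow> (\<forall>j\<in>J. f j \<in> A j)" for f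
   by (auto simp: prod_emb_def PiE_def Pi_def)
  \<comment> \<open>The finite set of times is filled up to an interval, with the whole space as the
    condition at the added times.\<close>
  obtain s n where sn: "J \<subseteq> {s..<s + int n}"
  proof (cases "J = {}")
   case False
   show ?thesis
    by (rule that[of "Min J" "nat (Max J - Min J + 1)"]) (use J False in \<open>auto simp: Min_le_iff\<close>)
  qed (use that in auto)
  define B where "B i = (if s + int i \<in> J then A (s + int i) else UNIV)" for i :: nat
  have Bm: "B i \<in> sets borel" for i using A by (auto simp: B_def)
  have ind: "indicator ?E f = (\<Prod>i<n. indicator (B i) (f (s + int i)) :: ennreal)" for f
  proof -
   have "(\<forall>j\<in>J. f j \<in> A j) \<longleftrightarrow> (\<forall>i<n. f (s + int i) \<in> B i)"
   proof
    assume R: "\<forall>i<n. f (s + int i) \<in> B i"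
    show "\<forall>j\<in>J. f j \<in> A j"
    proof
     fix j assume j: "j \<in> J"
     then have "s + int (nat (j - s)) = j" "nat (j - s) < n" using sn by force+
     then show "f j \<in> A j" using R j by (metis B_def)
    qed
   qed (auto simp: B_def)
   then show ?thesis by (auto simp: indicator_def Ein split: if_splits intro!: prod.neutral prod_zero)
  qed
  have "emeasure (distr M (PiM UNIV (\<lambda>_. borel)) (\<lambda>w t. X t w)) ?E = (\<integral>\<^sup>+w. (\<Prod>i<n. indicator (B i) (X (s + int i) w)) \<partial>M)"
   using pX Em by (subst nn_integral_indicator[symmetric]) (simp_all add: nn_integral_distr ind del: nn_integral_indicator)
  also have "... = (\<integral>\<^sup>+w. (\<Prod>i<n. indicator (B i) (Y (s + int i) w)) \<partial>N)"
   using window[of B "\<lambda>_. 1", OF Bm] by simp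
  also have "... = emeasure (distr N (PiM UNIV (\<lambda>_. borel)) (\<lambda>w t. Y t w)) ?E"
   using pY Em by (subst nn_integral_indicator[symmetric]) (simp_all add: nn_integral_distr ind del: nn_integral_indicator)
  finally show "emeasure (distr M (PiM UNIV (\<lambda>_. borel)) (\<lambda>w t. X t w)) ?E = emeasure (distr N (PiM UNIV (\<lambda>_. borel)) (\<lambda>w t. Y t w)) ?E" .
 qed (simp_all)
qed

subsection \<open>The Markov kernel and its invariant law\<close>

lemma measurable_det[measurable (raw)]:
 assumes "f \<in> borel_measurable M"
 shows "(\<lambda>x. det (f x :: real^'n^'n)) \<in> borel_measurable M"
proof -
 have "continuous_on UNIV (\<lambda>A::real^'n^'n. det A)"
  unfolding det_def by (intro continuous_intros)
 from measurable_compose[OF assms borel_measurable_continuous_onI[OF this]] show ?thesis .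
qed

text \<open>\<open>matrix_inv\<close> is defined by choice; Cramer's rule gives quotients of
  determinants, from which measurability in the matrix can be read off.\<close>

lemma matrix_inv_cramer:
 fixes A :: "real^'n^'n"
 assumes "det A \<noteq> 0"
 shows "matrix_inv A *v b = (\<chi> k. det (\<chi> i j. if j = k then b $ i else A $ i $ j) / det A)"
proof -
 have "invertible A" using assms by (simp add: invertible_det_nz)
 then have "A *v (matrix_inv A *v b) = b" by (rule matrix_inv_mult)
 then show ?thesis using cramer[OF assms] by blast
qed

lemma measurable_cramer:
 assumes [measurable]: "f \<in> borel_measurable M" "g \<in> borel_measurable M"
 shows "(\<lambda>x. (\<chi> k. det (\<chi> i j. if j = k then (g x :: real^'n) $ i else (f x :: real^'n^'n) $ i $ j) / det (f x)) :: real^'n) \<in> borel_measurable M"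
proof -
 have c: "continuous_on UNIV (\<lambda>p::(real^'n^'n) \<times> (real^'n). (\<chi> i j. if j = k then snd p $ i else fst p $ i $ j) :: real^'n^'n)" for k
 proof (intro continuous_on_vec_lambda)
  show "continuous_on UNIV (\<lambda>p::(real^'n^'n) \<times> (real^'n). if j = k then snd p $ i else fst p $ i $ j)" for i j
   by (cases "j = k") (auto intro!: continuous_intros)
 qed
 have m: "(\<lambda>x. (\<chi> i j. if j = k then g x $ i else f x $ i $ j) :: real^'n^'n) \<in> borel_measurable M" for k
  using borel_measurable_continuous_Pair[OF assms, of "\<lambda>A b. (\<chi> i j. if j = k then b $ i else A $ i $ j)"] c[of k] by simp
 have e: "(\<lambda>x. (\<chi> k. det (\<chi> i j. if j = k then g x $ i else f x $ i $ j) / det (f x)) :: real^'n)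
   = (\<lambda>x. \<Sum>k\<in>UNIV. (det (\<chi> i j. if j = k then g x $ i else f x $ i $ j) / det (f x)) *\<^sub>R axis k 1)"
  by (auto simp: fun_eq_iff vec_eq_iff axis_def if_distrib cong: if_cong)
 note [measurable] = measurable_det[OF m]
 show ?thesis unfolding e by measurable
qed

lemma gdens_measurable_pair[measurable (raw)]:
 assumes [measurable]: "f \<in> borel_measurable M" "g \<in> borel_measurable M"
 shows "(\<lambda>x. gdens (f x :: real^'n^'n) (g x)) \<in> borel_measurable M"
proof -
 \<comment> \<open>If the determinant is 0 then so is the denominator, and division by zero gives 0;
   the formula therefore holds for every S.\<close>
 have e: "gdens S y = (if det S = 0 then 0 else exp (- (y \<bullet> (\<chi> k. det (\<chi> i j. if j = k then y $ i else S $ i $ j) / det S)) / 2)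
   / sqrt ((2 * pi) ^ CARD('n) * det S))" for S :: "real^'n^'n" and y
  by (simp add: gdens_def matrix_inv_cramer)
 note [measurable] = measurable_cramer[OF assms]
 show ?thesis unfolding e by measurable
qed

lemma gdens_nn_nonneg: "positive_definite S \<Longrightarrow> 0 \<le> gdens S x"
 using gdens_nonneg less_imp_le by blast

lemma nn_integral_centered_normal_measurable:
 assumes [measurable]: "f \<in> borel_measurable borel"
 shows "(\<lambda>S. \<integral>\<^sup>+x. f x \<partial>centered_normal (S :: real^'n^'n)) \<in> borel_measurable borel"
proof -
 have "(\<lambda>S. \<integral>\<^sup>+x. f x \<partial>centered_normal S) = (\<lambda>S. \<integral>\<^sup>+x. ennreal (gdens S x) * f x \<partial>lborel)"
  by (simp add: centered_normal_gdens nn_integral_density)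
 moreover have "... \<in> borel_measurable borel" by measurable
 ultimately show ?thesis by simp
qed

lemma norm_transpose: "norm (transpose A) = norm (A :: real^'n^'n)"
proof -
 have "norm M = sqrt (\<Sum>i\<in>UNIV. \<Sum>j\<in>UNIV. (M $ i $ j)\<^sup>2)" for M :: "real^'n^'n"
  unfolding norm_vec_def L2_set_def by (simp add: sum_nonneg)
 then show ?thesis unfolding transpose_def by (simp add: sum.swap[of "\<lambda>i j. (A $ i $ j)\<^sup>2"])
qed

lemma stdg_moment:
 assumes p: "p > 0"
 shows "(\<integral>\<^sup>+z. ennreal (norm z powr p) \<partial>(stdg :: 'z::euclidean_space measure)) < \<infinity>"
proof -
 let ?D = "real DIM('z)"
 have one: "(\<integral>\<^sup>+x. ennreal (std_normal_density x) \<partial>lborel) = 1"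
  using prob_space.emeasure_space_1[OF prob_space_stdn] by (simp add: emeasure_density)
 have mx: "(\<integral>\<^sup>+x. ennreal (std_normal_density x * \<bar>x\<bar> powr p) \<partial>lborel) < \<infinity>"
 proof -
  have "integrable stdn (\<lambda>x. \<bar>x\<bar> powr p)"
   using std_normal_abs_powr[of p] p by (simp add: has_bochner_integral_iff)
  then have "integrable lborel (\<lambda>x. std_normal_density x *\<^sub>R \<bar>x\<bar> powr p)"
   by (subst (asm) integrable_density) auto
  then show ?thesis by (simp add: integrable_iff_bounded)
 qed
 have marg: "(\<integral>\<^sup>+z. ennreal (\<bar>z \<bullet> b\<bar> powr p) \<partial>(stdg :: 'z measure)) < \<infinity>" if b: "b \<in> Basis" for b :: 'z
 proof -
  define f where "f c x = (if c = b then ennreal (std_normal_density x * \<bar>x\<bar> powr p) else ennreal (std_normal_density x))" for c :: 'z and x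
  have fm: "f c \<in> borel_measurable borel" for c unfolding f_def by (cases "c = b") auto
  have "(\<integral>\<^sup>+z. ennreal (\<bar>z \<bullet> b\<bar> powr p) \<partial>(stdg :: 'z measure))
    = (\<integral>\<^sup>+z. (\<Prod>c\<in>Basis. f c (z \<bullet> c)) \<partial>(lborel :: 'z measure))"
   unfolding stdg_def
  proof (subst nn_integral_density, measurable, intro nn_integral_cong)
   fix z :: 'z
   have "(\<Prod>c\<in>Basis. f c (z \<bullet> c)) = f b (z \<bullet> b) * (\<Prod>c\<in>Basis - {b}. f c (z \<bullet> c))"
    using b by (intro prod.remove) auto
   also have "(\<Prod>c\<in>Basis - {b}. f c (z \<bullet> c)) = ennreal (\<Prod>c\<in>Basis - {b}. std_normal_density (z \<bullet> c))"
    by (simp add: f_def prod_ennreal)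
   also have "f b (z \<bullet> b) * ... = ennreal (std_normal_density (z \<bullet> b) * (\<Prod>c\<in>Basis - {b}. std_normal_density (z \<bullet> c))) * ennreal (\<bar>z \<bullet> b\<bar> powr p)"
    by (simp add: f_def ennreal_mult' prod_nonneg mult_ac)
   also have "std_normal_density (z \<bullet> b) * (\<Prod>c\<in>Basis - {b}. std_normal_density (z \<bullet> c)) = (\<Prod>c\<in>Basis. std_normal_density (z \<bullet> c))"
    using b by (intro prod.remove[symmetric]) auto
   finally show "ennreal (\<Prod>c\<in>Basis. std_normal_density (z \<bullet> c)) * ennreal (\<bar>z \<bullet> b\<bar> powr p) = (\<Prod>c\<in>Basis. f c (z \<bullet> c))" by simp
  qed
  also have "... = (\<Prod>c\<in>Basis. \<integral>\<^sup>+x. f c x \<partial>lborel)" by (rule nn_integral_lborel_prod) (use fm in auto)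
  also have "... < \<infinity>"
  proof -
   have "(\<integral>\<^sup>+x. f c x \<partial>lborel) \<noteq> top" for c using mx one by (cases "c = b") (auto simp: f_def)
   then show ?thesis by (simp add: less_top[symmetric] ennreal_prod_eq_top)
  qed
  finally show ?thesis .
 qed
 have bound: "norm z powr p \<le> (\<Sum>b\<in>Basis. ?D powr p * \<bar>z \<bullet> b\<bar> powr p)" for z :: 'z
 proof -
  obtain b :: 'z where b: "b \<in> Basis" "\<And>c. c \<in> Basis \<Longrightarrow> \<bar>z \<bullet> c\<bar> \<le> \<bar>z \<bullet> b\<bar>"
  proof -
   have "Max ((\<lambda>c. \<bar>z \<bullet> c\<bar>) ` Basis) \<in> (\<lambda>c. \<bar>z \<bullet> c\<bar>) ` Basis" by (rule Max_in) auto
   then obtain b where "b \<in> Basis" "Max ((\<lambda>c. \<bar>z \<bullet> c\<bar>) ` Basis) = \<bar>z \<bullet> b\<bar>" by (elim imageE)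
   then show ?thesis using that[of b] by (metis Max_ge finite_Basis finite_imageI imageI)
  qed
  have "norm z \<le> (\<Sum>c\<in>Basis. \<bar>z \<bullet> c\<bar>)" by (rule norm_le_l1)
  also have "... \<le> (\<Sum>c\<in>(Basis::'z set). \<bar>z \<bullet> b\<bar>)" by (intro sum_mono b)
  finally have "norm z powr p \<le> (?D * \<bar>z \<bullet> b\<bar>) powr p" using p by (intro powr_mono2) auto
  also have "... = ?D powr p * \<bar>z \<bullet> b\<bar> powr p" by (rule powr_mult)
  also have "... \<le> (\<Sum>b\<in>Basis. ?D powr p * \<bar>z \<bullet> b\<bar> powr p)" using b(1) by (intro member_le_sum) auto
  finally show ?thesis .
 qed
 have "(\<integral>\<^sup>+z. ennreal (norm z powr p) \<partial>(stdg :: 'z measure)) \<le> (\<integral>\<^sup>+z. (\<Sum>b\<in>Basis. ennreal (?D powr p) * ennreal (\<bar>z \<bullet> b\<bar> powr p)) \<partial>(stdg :: 'z measure))"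
  using bound by (intro nn_integral_mono) (simp add: ennreal_mult'[symmetric] sum_ennreal ennreal_leI)
 also have "... = (\<Sum>b\<in>(Basis::'z set). ennreal (?D powr p) * (\<integral>\<^sup>+z. ennreal (\<bar>z \<bullet> b\<bar> powr p) \<partial>(stdg :: 'z measure)))"
  by (subst nn_integral_sum) (auto simp: nn_integral_cmult)
 also have "... < \<infinity>"
  using marg by (auto simp: less_top[symmetric] ennreal_mult_eq_top_iff)
 finally show ?thesis .
qed

lemma centered_normal_moment:
 fixes S :: "real^'d^'d"
 assumes S: "positive_definite S" and p: "p > 0"
 shows "(\<integral>\<^sup>+x. ennreal (norm x powr p) \<partial>centered_normal S) < \<infinity>"
proof -
 have "(\<integral>\<^sup>+x. ennreal (norm x powr p) \<partial>centered_normal S) = (\<integral>\<^sup>+z. ennreal (norm (spd_sqrt S *v z) powr p) \<partial>stdg)"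
  unfolding centered_normal_spd_sqrt[OF S, symmetric] stdg_cart by (subst nn_integral_distr) auto
 also have "... \<le> (\<integral>\<^sup>+z. ennreal (norm (spd_sqrt S) powr p) * ennreal (norm (z::real^'d) powr p) \<partial>stdg)"
 proof (intro nn_integral_mono)
  fix z :: "real^'d"
  have "norm (spd_sqrt S *v z) powr p \<le> (norm (spd_sqrt S) * norm z) powr p"
   using p norm_matrix_vector_le by (intro powr_mono2) auto
  then show "ennreal (norm (spd_sqrt S *v z) powr p) \<le> ennreal (norm (spd_sqrt S) powr p) * ennreal (norm z powr p)"
   by (simp add: powr_mult ennreal_mult'[symmetric] ennreal_leI)
 qed
 also have "... = ennreal (norm (spd_sqrt S) powr p) * (\<integral>\<^sup>+z. ennreal (norm z powr p) \<partial>(stdg :: (real^'d) measure))"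
  by (rule nn_integral_cmult) measurable
 also have "... < \<infinity>" using stdg_moment[OF p, where 'z = "real^'d"] by (simp add: ennreal_mult_less_top)
 finally show ?thesis .
qed

text \<open>The product measure is a coupling of the two laws. The cap at 1 keeps the bound
  integrable for heavy-tailed laws.\<close>

lemma integral_diff_coupling:
 fixes \<pi>1 \<pi>2 :: "('v::euclidean_space) measure" and f :: "'v \<Rightarrow> real"
 assumes p1: "prob_space \<pi>1" and p2: "prob_space \<pi>2" and s: "sets \<pi>1 = sets borel" "sets \<pi>2 = sets borel"
  and f: "f \<in> borel_measurable borel" "\<And>v. 0 \<le> f v" "\<And>v. f v \<le> 1" "c \<ge> 0"
  and fh: "\<And>v v'. \<bar>f v - f v'\<bar> \<le> c * norm (v - v') powr r"
 shows "\<bar>(\<integral>v. f v \<partial>\<pi>1) - (\<integral>v. f v \<partial>\<pi>2)\<bar> \<le> (\<integral>p. min 1 (c * norm (fst p - snd p) powr r) \<partial>(\<pi>1 \<Otimes>\<^sub>M \<pi>2))"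
proof -
 note [measurable] = f(1) and [measurable_cong] = s
 interpret p1: prob_space \<pi>1 by (rule p1)
 interpret p2: prob_space \<pi>2 by (rule p2)
 interpret pp: pair_prob_space \<pi>1 \<pi>2 ..
 have i1: "integrable (\<pi>1 \<Otimes>\<^sub>M \<pi>2) (\<lambda>p. f (fst p))" and i2: "integrable (\<pi>1 \<Otimes>\<^sub>M \<pi>2) (\<lambda>p. f (snd p))"
  using f by (auto intro!: pp.integrable_const_bound[where B = 1])
 have e1: "(\<integral>p. f (fst p) \<partial>(\<pi>1 \<Otimes>\<^sub>M \<pi>2)) = (\<integral>v. f v \<partial>\<pi>1)"
  using integral_distr[of fst "\<pi>1 \<Otimes>\<^sub>M \<pi>2" \<pi>1 f] p2.distr_pair_fst[of \<pi>1] by simp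
 have e2: "(\<integral>p. f (snd p) \<partial>(\<pi>1 \<Otimes>\<^sub>M \<pi>2)) = (\<integral>v. f v \<partial>\<pi>2)"
  using pp.integral_snd[of "\<lambda>_ v. f v"] i2 by (simp add: case_prod_beta' p1.prob_space)
 have "(\<integral>v. f v \<partial>\<pi>1) - (\<integral>v. f v \<partial>\<pi>2) = (\<integral>p. f (fst p) - f (snd p) \<partial>(\<pi>1 \<Otimes>\<^sub>M \<pi>2))"
  using i1 i2 by (simp add: e1 e2)
 also have "\<bar>...\<bar> \<le> (\<integral>p. \<bar>f (fst p) - f (snd p)\<bar> \<partial>(\<pi>1 \<Otimes>\<^sub>M \<pi>2))" by (rule integral_abs_bound)
 also have "... \<le> (\<integral>p. min 1 (c * norm (fst p - snd p) powr r) \<partial>(\<pi>1 \<Otimes>\<^sub>M \<pi>2))"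
 proof (rule integral_mono)
  show "integrable (\<pi>1 \<Otimes>\<^sub>M \<pi>2) (\<lambda>p. \<bar>f (fst p) - f (snd p)\<bar>)" using i1 i2 by simp
  show "integrable (\<pi>1 \<Otimes>\<^sub>M \<pi>2) (\<lambda>p. min 1 (c * norm (fst p - snd p) powr r))"
   using f by (intro pp.integrable_const_bound[where B = 1]) (auto simp: min_def)
  fix p :: "'v \<times> 'v"
  show "\<bar>f (fst p) - f (snd p)\<bar> \<le> min 1 (c * norm (fst p - snd p) powr r)"
   using f(2)[of "fst p"] f(2)[of "snd p"] f(3)[of "fst p"] f(3)[of "snd p"] fh[of "fst p" "snd p"] by auto
 qed
 finally show ?thesis .
qed

lemma integral_min_tendsto_0:
 fixes \<pi>1 \<pi>2 :: "('v::euclidean_space) measure"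
 assumes p1: "prob_space \<pi>1" and p2: "prob_space \<pi>2" and s: "sets \<pi>1 = sets borel" "sets \<pi>2 = sets borel"
  and q: "0 \<le> q" "q < (1::real)" and c: "c \<ge> 0"
 shows "(\<lambda>n. \<integral>p. min 1 (c * q ^ n * norm (fst p - snd p) powr r) \<partial>(\<pi>1 \<Otimes>\<^sub>M \<pi>2)) \<longlonglongrightarrow> 0"
proof -
 note [measurable_cong] = s
 interpret p1: prob_space \<pi>1 by (rule p1)
 interpret p2: prob_space \<pi>2 by (rule p2)
 interpret pp: pair_prob_space \<pi>1 \<pi>2 ..
 have "(\<lambda>n. \<integral>p. min 1 (c * q ^ n * norm (fst p - snd p) powr r) \<partial>(\<pi>1 \<Otimes>\<^sub>M \<pi>2)) \<longlonglongrightarrow> (\<integral>p. 0 \<partial>(\<pi>1 \<Otimes>\<^sub>M \<pi>2))"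
 proof (rule integral_dominated_convergence[where w = "\<lambda>_. 1"])
  show "AE p in \<pi>1 \<Otimes>\<^sub>M \<pi>2. (\<lambda>n. min 1 (c * q ^ n * norm (fst p - snd p) powr r)) \<longlonglongrightarrow> 0"
  proof (rule AE_I2)
   fix p :: "'v \<times> 'v"
   have "(\<lambda>n. min 1 (c * q ^ n * norm (fst p - snd p) powr r)) \<longlonglongrightarrow> min 1 (c * 0 * norm (fst p - snd p) powr r)"
    using q by (intro tendsto_intros LIMSEQ_realpow_zero)
   then show "(\<lambda>n. min 1 (c * q ^ n * norm (fst p - snd p) powr r)) \<longlonglongrightarrow> 0" by simp
  qed
  show "AE p in \<pi>1 \<Otimes>\<^sub>M \<pi>2. norm (min 1 (c * q ^ n * norm (fst p - snd p) powr r)) \<le> 1" for n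
   using c q by (auto simp: min_def intro!: AE_I2)
 qed measurable
 then show ?thesis by simp
qed

text \<open>The bound on \<open>a\<close> enters the analysis only through these properties of
  \<alpha>.\<close>

locale bekk =
 fixes C A Orth :: "real^'d^'d" and a \<alpha> :: real
 assumes C: "positive_definite C" and a: "a > 0" and orth: "orthogonal_matrix Orth" and A: "A = a *\<^sub>R Orth"
  and \<alpha>: "\<alpha> > 0" and nmom_\<alpha>: "nmom a \<alpha> = 1" and nmom_less: "\<And>s. 0 < s \<Longrightarrow> s < \<alpha> \<Longrightarrow> nmom a s < 1"
begin

abbreviation "\<gamma> \<equiv> centered_normal C"

abbreviation "MQ \<equiv> stdn \<Otimes>\<^sub>M \<gamma>"
abbreviation "PQ \<equiv> PiM (UNIV :: nat set) (\<lambda>_. MQ)"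

sublocale gam: prob_space \<gamma> by (rule prob_space_centered_normal[OF C])
sublocale stdn: prob_space stdn by (rule prob_space_stdn)
sublocale mq: pair_prob_space stdn \<gamma> ..

lemma norm_A: "norm (A *v v) = a * norm v"
proof -
 have "orthogonal_transformation ((*v) Orth)" using orth by (simp add: orthogonal_transformation_matrix)
 then show ?thesis using orthogonal_transformation_norm[of "(*v) Orth" v] a
  by (simp add: A matrix_scaleR_vec)
qed

lemma AtA: "transpose A ** A = a\<^sup>2 *\<^sub>R mat 1" "A ** transpose A = a\<^sup>2 *\<^sub>R mat 1"
proof -
 have t: "transpose A = a *\<^sub>R transpose Orth" unfolding A by (simp add: transpose_def vec_eq_iff)
 show "transpose A ** A = a\<^sup>2 *\<^sub>R mat 1" "A ** transpose A = a\<^sup>2 *\<^sub>R mat 1"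
  unfolding t unfolding A matrix_algebra_distribs using orth by (simp_all add: orthogonal_matrix_def power2_eq_square)
qed

lemma norm_At: "norm (transpose A *v v) = a * norm v"
proof -
 have "(norm (transpose A *v v))\<^sup>2 = v \<bullet> (A *v (transpose A *v v))"
  using inner_transpose[of v A "transpose A *v v"] by (simp add: dot_square_norm)
 also have "... = (a * norm v)\<^sup>2"
  by (simp add: matrix_vector_mul_assoc AtA matrix_scaleR_vec dot_square_norm power_mult_distrib del: transpose_matrix_vector)
 finally show ?thesis using a by (simp del: transpose_matrix_vector)
qed

definition K :: "real^'d \<Rightarrow> (real^'d) measure" where
 "K v = centered_normal (C + outer (A *v v))"

lemma K_eq: "K v = distr MQ borel (\<lambda>(m, q). m *\<^sub>R (A *v v) + q)"
 unfolding K_def by (rule law_rank_one[OF C, symmetric])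

lemma sets_K[simp]: "sets (K v) = sets borel" by (simp add: K_def)

lemma nn_K: "f \<in> borel_measurable borel \<Longrightarrow> (\<integral>\<^sup>+x. f x \<partial>K v) = (\<integral>\<^sup>+p. f (fst p *\<^sub>R (A *v v) + snd p) \<partial>MQ)"
 unfolding K_eq by (subst nn_integral_distr) (auto simp: case_prod_beta)

lemma nn_K_measurable:
 assumes [measurable]: "f \<in> borel_measurable borel"
 shows "(\<lambda>v. \<integral>\<^sup>+x. f x \<partial>K v) \<in> borel_measurable borel"
 unfolding nn_K[OF assms] by measurable

definition invariant :: "(real^'d) measure \<Rightarrow> bool" where
 "invariant \<pi> \<longleftrightarrow> prob_space \<pi> \<and> sets \<pi> = sets borel \<and>
  (\<forall>f \<in> borel_measurable borel. (\<integral>\<^sup>+v. f v \<partial>\<pi>) = (\<integral>\<^sup>+v. \<integral>\<^sup>+x. f x \<partial>K v \<partial>\<pi>))"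

text \<open>At most 1, so that bounded Lipschitz functions are Hoelder of this order; less than
  \<alpha>, so that the moment of |m| a of this order is below 1 and the kernel contracts Hoelder
  constants.\<close>

definition holder_exp :: real where "holder_exp = min 1 (\<alpha> / 2)"

lemma holder_exp: "0 < holder_exp" "holder_exp \<le> 1" "holder_exp < \<alpha>"
 using \<alpha> by (auto simp: holder_exp_def)

lemma fst_moment:
 assumes "s > 0"
 shows "integrable MQ (\<lambda>p. (\<bar>fst p\<bar> * a) powr s)" "(\<integral>p. (\<bar>fst p\<bar> * a) powr s \<partial>MQ) = nmom a s"
proof -
 have d: "distr MQ stdn fst = stdn" by (rule gam.distr_pair_fst)
 have i: "integrable stdn (\<lambda>x. (\<bar>x\<bar> * a) powr s)" using nmom_integrable[of s a] assms a by simp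
 show "integrable MQ (\<lambda>p. (\<bar>fst p\<bar> * a) powr s)"
 proof -
  have "integrable (distr MQ stdn fst) (\<lambda>x. (\<bar>x\<bar> * a) powr s)" unfolding d by (rule i)
  then show ?thesis by (subst (asm) integrable_distr_eq) auto
 qed
 show "(\<integral>p. (\<bar>fst p\<bar> * a) powr s \<partial>MQ) = nmom a s"
 proof -
  have "nmom a s = (\<integral>x. (\<bar>x\<bar> * a) powr s \<partial>distr MQ stdn fst)" unfolding nmom_def d ..
  also have "... = (\<integral>p. (\<bar>fst p\<bar> * a) powr s \<partial>MQ)" by (rule integral_distr) auto
  finally show ?thesis by simp
 qed
qed

text \<open>Replacing f by its mean under the kernel changes neither integral and multiplies the
  Hoelder constant by \<open>nmom a holder_exp\<close>. After n replacements the two laws are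
  compared by the coupling.\<close>

lemma invariant_diff_bound:
 assumes \<pi>1: "invariant \<pi>1" and \<pi>2: "invariant \<pi>2" and f[measurable]: "f \<in> borel_measurable borel"
  and f01: "\<And>v. 0 \<le> f v" "\<And>v. f v \<le> 1" and c: "c \<ge> 0"
  and fh: "\<And>v v'. \<bar>f v - f v'\<bar> \<le> c * norm (v - v') powr holder_exp"
 shows "\<bar>(\<integral>v. f v \<partial>\<pi>1) - (\<integral>v. f v \<partial>\<pi>2)\<bar> \<le> (\<integral>p. min 1 (c * nmom a holder_exp ^ n * norm (fst p - snd p) powr holder_exp) \<partial>(\<pi>1 \<Otimes>\<^sub>M \<pi>2))"
 using f f01 c fh
proof (induction n arbitrary: f c)
 case 0
 show ?case
  using integral_diff_coupling[OF _ _ _ _ 0] \<pi>1 \<pi>2 by (simp add: invariant_def)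
next
 case (Suc n)
 note [measurable] = Suc.prems(1)
 let ?s = holder_exp
 define g where "g v = (\<integral>p. f (fst p *\<^sub>R (A *v v) + snd p) \<partial>MQ)" for v
 have gm: "g \<in> borel_measurable borel" unfolding g_def by measurable
 have ig: "integrable MQ (\<lambda>p. f (fst p *\<^sub>R (A *v v) + snd p))" for v
  using Suc.prems by (intro mq.integrable_const_bound[where B = 1]) auto
 have g0: "0 \<le> g v" for v unfolding g_def using Suc.prems by simp
 have g1: "g v \<le> 1" for v
 proof -
  have "g v \<le> (\<integral>p. 1 \<partial>MQ)" unfolding g_def using Suc.prems ig by (intro integral_mono) auto
  then show ?thesis by (simp add: mq.prob_space)
 qed
 have gh: "\<bar>g v - g v'\<bar> \<le> (c * nmom a ?s) * norm (v - v') powr ?s" for v v'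
 proof -
  have "g v - g v' = (\<integral>p. f (fst p *\<^sub>R (A *v v) + snd p) - f (fst p *\<^sub>R (A *v v') + snd p) \<partial>MQ)"
   unfolding g_def using ig by simp
  also have "\<bar>...\<bar> \<le> (\<integral>p. \<bar>f (fst p *\<^sub>R (A *v v) + snd p) - f (fst p *\<^sub>R (A *v v') + snd p)\<bar> \<partial>MQ)" by (rule integral_abs_bound)
  also have "... \<le> (\<integral>p. c * norm (v - v') powr ?s * (\<bar>fst p\<bar> * a) powr ?s \<partial>MQ)"
  proof (rule integral_mono)
   fix p
   have "\<bar>f (fst p *\<^sub>R (A *v v) + snd p) - f (fst p *\<^sub>R (A *v v') + snd p)\<bar> \<le> c * norm ((fst p *\<^sub>R (A *v v) + snd p) - (fst p *\<^sub>R (A *v v') + snd p)) powr ?s"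
    by (rule Suc.prems(5))
   also have "(fst p *\<^sub>R (A *v v) + snd p) - (fst p *\<^sub>R (A *v v') + snd p) = fst p *\<^sub>R (A *v (v - v'))"
    by (simp add: matrix_vector_mult_diff_distrib algebra_simps)
   also have "norm ... = (\<bar>fst p\<bar> * a) * norm (v - v')" by (simp add: norm_A)
   also have "c * ((\<bar>fst p\<bar> * a) * norm (v - v')) powr ?s = c * norm (v - v') powr ?s * (\<bar>fst p\<bar> * a) powr ?s"
    by (simp only: powr_mult mult_ac)
   finally show "\<bar>f (fst p *\<^sub>R (A *v v) + snd p) - f (fst p *\<^sub>R (A *v v') + snd p)\<bar> \<le> c * norm (v - v') powr ?s * (\<bar>fst p\<bar> * a) powr ?s" .
  next
   show "integrable MQ (\<lambda>p. \<bar>f (fst p *\<^sub>R (A *v v) + snd p) - f (fst p *\<^sub>R (A *v v') + snd p)\<bar>)"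
    by (intro integrable_abs Bochner_Integration.integrable_diff ig)
  qed (use fst_moment[OF holder_exp(1)] in simp)
  also have "... = (c * nmom a ?s) * norm (v - v') powr ?s"
   using fst_moment[OF holder_exp(1)] by simp
  finally show ?thesis .
 qed
 have inv: "(\<integral>v. f v \<partial>\<pi>) = (\<integral>v. g v \<partial>\<pi>)" if p: "invariant \<pi>" for \<pi>
 proof -
  have sp[measurable_cong]: "sets \<pi> = sets borel" using p by (simp add: invariant_def)
  have "(\<integral>\<^sup>+v. ennreal (f v) \<partial>\<pi>) = (\<integral>\<^sup>+v. \<integral>\<^sup>+x. ennreal (f x) \<partial>K v \<partial>\<pi>)" using p by (auto simp: invariant_def)
  also have "... = (\<integral>\<^sup>+v. ennreal (g v) \<partial>\<pi>)"
   unfolding g_def using Suc.prems by (simp add: nn_K nn_integral_eq_integral[OF ig])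
  finally show ?thesis using Suc.prems g0 gm
   by (subst (1 2) integral_eq_nn_integral) (auto simp: measurable_cong_sets[OF sp refl])
 qed
 have "\<bar>(\<integral>v. g v \<partial>\<pi>1) - (\<integral>v. g v \<partial>\<pi>2)\<bar> \<le> (\<integral>p. min 1 ((c * nmom a ?s) * nmom a ?s ^ n * norm (fst p - snd p) powr ?s) \<partial>(\<pi>1 \<Otimes>\<^sub>M \<pi>2))"
  using Suc.prems by (intro Suc.IH gm g0 g1 gh) (auto simp: nmom_def)
 then show ?case unfolding inv[OF \<pi>1] inv[OF \<pi>2] by (simp add: mult_ac)
qed

text \<open>The contraction drives the coupling bound to 0, so both laws integrate Hoelder functions
  alike; such functions approximate the indicators of closed sets.\<close>

theorem invariant_unique:
 assumes \<pi>1: "invariant \<pi>1" and \<pi>2: "invariant \<pi>2"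
 shows "\<pi>1 = \<pi>2"
proof -
 have p1: "prob_space \<pi>1" and p2: "prob_space \<pi>2" and s1: "sets \<pi>1 = sets borel" and s2: "sets \<pi>2 = sets borel"
  using \<pi>1 \<pi>2 by (auto simp: invariant_def)
 interpret p1: prob_space \<pi>1 by (rule p1)
 interpret p2: prob_space \<pi>2 by (rule p2)
 have ms: "borel_measurable \<pi>1 = borel_measurable borel" "borel_measurable \<pi>2 = borel_measurable borel"
  by (rule measurable_cong_sets, rule s1, rule refl) (rule measurable_cong_sets, rule s2, rule refl)
 let ?s = holder_exp
 define q where "q = nmom a ?s"
 have q: "0 \<le> q" "q < 1" using nmom_less[OF holder_exp(1,3)] by (auto simp: q_def nmom_def)
 have eq: "(\<integral>v. f v \<partial>\<pi>1) = (\<integral>v. f v \<partial>\<pi>2)"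
  if f: "f \<in> borel_measurable borel" "\<And>v. 0 \<le> f v" "\<And>v. f v \<le> 1" "c \<ge> 0" "\<And>v v'. \<bar>f v - f v'\<bar> \<le> c * norm (v - v') powr ?s" for f c
 proof -
  note lim = integral_min_tendsto_0[OF p1 p2 s1 s2 q f(4), of ?s]
  have "\<bar>(\<integral>v. f v \<partial>\<pi>1) - (\<integral>v. f v \<partial>\<pi>2)\<bar> \<le> 0"
   by (rule LIMSEQ_le_const[OF lim]) (use invariant_diff_bound[OF \<pi>1 \<pi>2 f] in \<open>auto simp: q_def\<close>)
  then show ?thesis by simp
 qed
 have closed_eq: "emeasure \<pi>1 F = emeasure \<pi>2 F" if F: "closed F" for F
 proof (cases "F = {}")
  case False
  have Fm[measurable]: "F \<in> sets borel" using F by simp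
  define f where "f n v = max 0 (1 - real n * infdist v F)" for n v
  have fm[measurable]: "f n \<in> borel_measurable borel" for n
   unfolding f_def by (intro borel_measurable_continuous_onI continuous_intros)
  have f01: "0 \<le> f n v" "f n v \<le> 1" for n v by (auto simp: f_def infdist_nonneg)
  have fl: "\<bar>f n v - f n v'\<bar> \<le> real n powr ?s * norm (v - v') powr ?s" for n v v'
  proof -
   have "\<bar>f n v - f n v'\<bar> \<le> \<bar>real n * infdist v F - real n * infdist v' F\<bar>" by (auto simp: f_def)
   also have "... = real n * \<bar>infdist v F - infdist v' F\<bar>" by (simp add: abs_mult right_diff_distrib[symmetric])
   also have "... \<le> real n * norm (v - v')"
    using infdist_triangle_abs[of v F v'] by (intro mult_left_mono) (auto simp: dist_norm)
   finally have l: "\<bar>f n v - f n v'\<bar> \<le> real n * norm (v - v')" .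
   \<comment> \<open>For differences in [0, 1] a Lipschitz bound implies a Hoelder bound, because x
     is at most its power of order \<open>holder_exp\<close>.\<close>
   define x where "x = \<bar>f n v - f n v'\<bar>"
   have x: "0 \<le> x" "x \<le> 1" using f01[of n v] f01[of n v'] by (auto simp: x_def)
   have "x \<le> x powr ?s"
   proof (cases "x = 0")
    case False
    then show ?thesis using x holder_exp powr_mono'[of ?s 1 x] by simp
   qed simp
   also have "... \<le> (real n * norm (v - v')) powr ?s"
    using l x holder_exp by (intro powr_mono2) (auto simp: x_def)
   finally show ?thesis by (simp add: x_def powr_mult)
  qed
  have e: "(\<integral>v. f n v \<partial>\<pi>1) = (\<integral>v. f n v \<partial>\<pi>2)" for n
   by (rule eq[OF fm f01 _ fl]) simp
  have conv: "(\<lambda>n. f n v) \<longlonglongrightarrow> indicator F v" for v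
  proof (cases "v \<in> F")
   case True
   then show ?thesis by (simp add: f_def)
  next
   case False
   then have p: "infdist v F > 0" using F \<open>F \<noteq> {}\<close> by (metis in_closed_iff_infdist_zero infdist_nonneg less_le)
   obtain N :: nat where N: "1 / infdist v F < real N" using reals_Archimedean2 by blast
   have "f n v = 0" if "n \<ge> N" for n
   proof -
    have "1 / infdist v F \<le> real n" using N that by linarith
    then show ?thesis using p by (simp add: f_def divide_le_eq)
   qed
   then have "\<forall>\<^sub>F n in sequentially. 0 = f n v" by (auto simp: eventually_sequentially)
   then have "(\<lambda>n. f n v) \<longlonglongrightarrow> 0" by (rule Lim_transform_eventually[OF tendsto_const])
   then show ?thesis using False by simp
  qed
  have c1: "(\<lambda>n. \<integral>v. f n v \<partial>\<pi>1) \<longlonglongrightarrow> (\<integral>v. indicator F v \<partial>\<pi>1)"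
   by (rule integral_dominated_convergence[where w = "\<lambda>_. 1"]) (use f01 conv fm Fm ms in auto)
  have c2: "(\<lambda>n. \<integral>v. f n v \<partial>\<pi>2) \<longlonglongrightarrow> (\<integral>v. indicator F v \<partial>\<pi>2)"
   by (rule integral_dominated_convergence[where w = "\<lambda>_. 1"]) (use f01 conv fm Fm ms in auto)
  have "(\<integral>v. indicator F v \<partial>\<pi>1) = (\<integral>v. indicator F v \<partial>\<pi>2 :: real)"
   using LIMSEQ_unique[OF c1] c2 unfolding e by simp
  then have "measure \<pi>1 F = measure \<pi>2 F" using s1 s2 by simp
  then show ?thesis by (simp add: p1.emeasure_eq_measure p2.emeasure_eq_measure)
 qed simp
 show ?thesis
 proof (rule measure_eqI_generator_eq[where E = "{F. closed F}" and \<Omega> = UNIV and A = "\<lambda>_. UNIV"])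
  show "Int_stable {F :: (real^'d) set. closed F}" by (auto simp: Int_stable_def)
  show "sets \<pi>1 = sigma_sets UNIV {F. closed F}" "sets \<pi>2 = sigma_sets UNIV {F. closed F}"
   using s1 s2 by (simp_all add: borel_eq_closed)
  show "emeasure \<pi>1 UNIV \<noteq> \<infinity>" for i :: nat using p1.emeasure_finite by auto
 qed (auto simp: closed_eq)
qed

end

lemma norm_matrix_rows: "norm M = L2_set (\<lambda>i. norm (M $ i)) UNIV" for M :: "real^'n^'n"
 by (simp add: norm_vec_def)

context bekk
begin

subsection \<open>The stationary laws of the recursions\<close>

lemma sets_mq: "sets MQ = sets borel"
 unfolding borel_prod[symmetric] by (rule sets_pair_measure_cong) auto

lemma perp_X: "perpetuity ((*v) A) MQ a"
 by (rule perpetuity.intro) (use a mq.prob_space_axioms sets_mq in \<open>simp_all add: norm_A\<close>)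

definition piX :: "(real^'d) measure" where
 "piX = distr PQ borel (perp ((*v) A))"

lemma fst_moment_nn:
 assumes "p > 0"
 shows "(\<integral>\<^sup>+y. ennreal ((a * \<bar>fst y\<bar>) powr p) \<partial>MQ) = ennreal (nmom a p)"
 using nn_integral_eq_integral[OF fst_moment(1)[OF assms]] fst_moment(2)[OF assms] by (simp add: mult.commute)

lemma snd_moment_nn:
 assumes "p > 0"
 shows "(\<integral>\<^sup>+y. ennreal (norm (snd y) powr p) \<partial>MQ) < \<infinity>"
proof -
 have "(\<integral>\<^sup>+y. ennreal (norm (snd y) powr p) \<partial>MQ) = (\<integral>\<^sup>+m. \<integral>\<^sup>+q. ennreal (norm q powr p) \<partial>\<gamma> \<partial>stdn)"
  by (subst gam.nn_integral_fst[symmetric]) auto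
 also have "... = (\<integral>\<^sup>+q. ennreal (norm q powr p) \<partial>\<gamma>)"
  using stdn.emeasure_space_1 by simp
 finally show ?thesis using centered_normal_moment[OF C assms] by simp
qed

lemma perp_X_moment:
 assumes "0 < p" "p < \<alpha>"
 shows "AE x in PQ. summable (pterm ((*v) A) x)"
  "(\<integral>\<^sup>+v. ennreal (norm v powr p) \<partial>piX) < \<infinity>"
proof -
 have 1: "(\<integral>\<^sup>+y. ennreal ((a * \<bar>fst y\<bar>) powr p) \<partial>MQ) < 1"
  using fst_moment_nn[OF assms(1)] nmom_less[OF assms] by (simp add: ennreal_less_one_iff)
 note m = perpetuity.perp_moment[OF perp_X assms(1) 1 snd_moment_nn[OF assms(1)]]
 show "AE x in PQ. summable (pterm ((*v) A) x)" by (rule m)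
 show "(\<integral>\<^sup>+v. ennreal (norm v powr p) \<partial>piX) < \<infinity>"
  unfolding piX_def using m(2) perpetuity.perp_m[OF perp_X] by (subst nn_integral_distr) auto
qed

lemma piX_invariant: "invariant piX"
 unfolding invariant_def
proof (intro conjI ballI)
 interpret S: prob_space "PQ"
  by (rule prob_space_PiM) (rule mq.prob_space_axioms)
 show "prob_space piX" unfolding piX_def
  by (rule S.prob_space_distr) (rule perpetuity.perp_m[OF perp_X])
 show "sets piX = sets borel" by (simp add: piX_def)
 fix f :: "real^'d \<Rightarrow> ennreal" assume f: "f \<in> borel_measurable borel"
 have "(\<integral>\<^sup>+v. f v \<partial>piX) = (\<integral>\<^sup>+v. \<integral>\<^sup>+y. f (snd y + fst y *\<^sub>R (A *v v)) \<partial>MQ \<partial>piX)"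
  unfolding piX_def by (rule perpetuity.perp_invariant[OF perp_X perp_X_moment(1)[OF holder_exp(1,3)] f])
 then show "(\<integral>\<^sup>+v. f v \<partial>piX) = (\<integral>\<^sup>+v. \<integral>\<^sup>+x. f x \<partial>K v \<partial>piX)"
  unfolding nn_K[OF f] by (simp add: add.commute)
qed

text \<open>If the state has law N(0, M), one step with given m leads to N(0, C + m^2 TS M). This is
  the covariance recursion whose stationary law is \<open>rho\<close>.\<close>

definition TS :: "real^'d^'d \<Rightarrow> real^'d^'d" where "TS M = A ** M ** transpose A"

lemma norm_A_mult: "norm (A ** M) = a * norm M" for M :: "real^'d^'d"
proof -
 have "norm (A ** M) = norm (transpose (A ** M))" by (simp add: norm_transpose)
 also have "... = L2_set (\<lambda>j. norm (A *v (transpose M $ j))) UNIV"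
 proof -
  have "transpose (A ** M) $ j = A *v (transpose M $ j)" for j
   by (simp add: transpose_def matrix_matrix_mult_def matrix_vector_mult_def vec_eq_iff)
  then show ?thesis by (simp add: norm_matrix_rows)
 qed
 also have "... = a * norm (transpose M)"
  unfolding norm_A norm_matrix_rows using a by (simp add: L2_set_right_distrib)
 finally show ?thesis by (simp add: norm_transpose)
qed

lemma norm_TS: "norm (TS M) = a\<^sup>2 * norm M"
proof -
 have "norm (TS M) = a * norm (M ** transpose A)" unfolding TS_def matrix_mul_assoc[symmetric] by (rule norm_A_mult)
 also have "norm (M ** transpose A) = norm (A ** transpose M)"
  by (metis norm_transpose matrix_transpose_mul transpose_transpose)
 finally show ?thesis by (simp add: norm_A_mult norm_transpose power2_eq_square)
qed

lemma TS_linear: "linear TS"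
 by (rule linearI) (simp_all add: TS_def matrix_algebra_distribs)

lemma TS_form: "x \<bullet> (TS M *v x) = (transpose A *v x) \<bullet> (M *v (transpose A *v x))"
 unfolding TS_def matrix_vector_mul_assoc[symmetric] by (rule inner_transpose)

lemma TS_symmetric: "transpose M = M \<Longrightarrow> transpose (TS M) = TS M"
 unfolding TS_def matrix_transpose_mul by (simp add: matrix_mul_assoc)

text \<open>Because A is a multiple of an orthogonal matrix, the trace of the covariance obeys a
  scalar recursion of its own. This is what reduces the tail estimates to one real variable.\<close>

lemma trace_TS: "trace (TS M) = a\<^sup>2 * trace M"
proof -
 have "trace (TS M) = trace (transpose A ** (A ** M))" unfolding TS_def by (rule trace_mul_sym)
 also have "... = trace (a\<^sup>2 *\<^sub>R M)" by (simp add: matrix_mul_assoc AtA matrix_algebra_distribs)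
 finally show ?thesis by (simp add: trace_def sum_distrib_left)
qed

definition nuS :: "(real \<times> (real^'d^'d)) measure" where "nuS = distr stdn borel (\<lambda>m. (m\<^sup>2, C))"

lemma fst_snd_borel[measurable]:
 "fst \<in> borel_measurable (borel :: (real \<times> (real^'d^'d)) measure)"
 "snd \<in> borel_measurable (borel :: (real \<times> (real^'d^'d)) measure)"
 by (auto intro!: borel_measurable_continuous_onI continuous_intros)

lemma perp_S: "perpetuity TS nuS (a\<^sup>2)"
 by (rule perpetuity.intro) (use a TS_linear in \<open>simp_all add: norm_TS nuS_def stdn.prob_space_distr\<close>)

abbreviation "seqS \<equiv> PiM UNIV (\<lambda>_::nat. nuS)"

lemma prob_seqS: "prob_space seqS"
 by (rule prob_space_PiM) (simp add: nuS_def stdn.prob_space_distr)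

definition rho :: "(real^'d^'d) measure" where "rho = distr seqS borel (perp TS)"

lemma sets_rho[simp, measurable_cong]: "sets rho = sets borel" by (simp add: rho_def)

lemma prob_rho: "prob_space rho"
 unfolding rho_def by (rule prob_space.prob_space_distr[OF prob_seqS]) (rule perpetuity.perp_m[OF perp_S])

sublocale rho: prob_space rho by (rule prob_rho)

lemma perp_S_moment:
 assumes p: "0 < p" "2 * p < \<alpha>"
 shows "AE x in seqS. summable (pterm TS x)" "(\<integral>\<^sup>+M. ennreal (norm M powr p) \<partial>rho) < \<infinity>"
proof -
 have e: "(a\<^sup>2 * \<bar>m\<^sup>2\<bar>) powr p = (\<bar>m\<bar> * a) powr (2 * p)" for m
 proof -
  have "a\<^sup>2 * \<bar>m\<^sup>2\<bar> = (\<bar>m\<bar> * a) powr 2" using a by (simp add: power_mult_distrib mult.commute)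
  then show ?thesis by (simp only: powr_powr)
 qed
 have "(\<integral>\<^sup>+y. ennreal ((a\<^sup>2 * \<bar>fst y\<bar>) powr p) \<partial>nuS) = (\<integral>\<^sup>+m. ennreal ((a\<^sup>2 * \<bar>m\<^sup>2\<bar>) powr p) \<partial>stdn)"
  unfolding nuS_def by (subst nn_integral_distr) auto
 also have "... = ennreal (nmom a (2 * p))"
  unfolding e nmom_def using nmom_integrable[of "2 * p" a] a p by (intro nn_integral_eq_integral) auto
 finally have 1: "(\<integral>\<^sup>+y. ennreal ((a\<^sup>2 * \<bar>fst y\<bar>) powr p) \<partial>nuS) < 1"
  using nmom_less[of "2 * p"] p by (simp add: ennreal_less_one_iff)
 have "(\<integral>\<^sup>+y. ennreal (norm (snd y) powr p) \<partial>nuS) = (\<integral>\<^sup>+m. ennreal (norm C powr p) \<partial>stdn)"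
  unfolding nuS_def by (subst nn_integral_distr) auto
 then have 2: "(\<integral>\<^sup>+y. ennreal (norm (snd y) powr p) \<partial>nuS) < \<infinity>" using stdn.emeasure_space_1 by simp
 note m = perpetuity.perp_moment[OF perp_S p(1) 1 2]
 show "AE x in seqS. summable (pterm TS x)" by (rule m)
 show "(\<integral>\<^sup>+M. ennreal (norm M powr p) \<partial>rho) < \<infinity>"
  unfolding rho_def using m(2) perpetuity.perp_m[OF perp_S] by (subst nn_integral_distr) auto
qed

lemma rho_invariant:
 assumes f[measurable]: "f \<in> borel_measurable borel"
 shows "(\<integral>\<^sup>+M. f M \<partial>rho) = (\<integral>\<^sup>+M. \<integral>\<^sup>+m. f (C + m\<^sup>2 *\<^sub>R TS M) \<partial>stdn \<partial>rho)"
proof -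
 have "(\<integral>\<^sup>+M. f M \<partial>rho) = (\<integral>\<^sup>+M. \<integral>\<^sup>+y. f (snd y + fst y *\<^sub>R TS M) \<partial>nuS \<partial>rho)"
  unfolding rho_def using perp_S_moment(1)[of "\<alpha> / 4"] \<alpha> by (intro perpetuity.perp_invariant[OF perp_S]) auto
 also have "... = (\<integral>\<^sup>+M. \<integral>\<^sup>+m. f (C + m\<^sup>2 *\<^sub>R TS M) \<partial>stdn \<partial>rho)"
 proof (rule nn_integral_cong)
  fix M
  have "(\<lambda>y::real \<times> (real^'d^'d). snd y + fst y *\<^sub>R TS M) \<in> borel_measurable borel"
   by (intro borel_measurable_continuous_onI continuous_intros)
  then have "(\<lambda>y. f (snd y + fst y *\<^sub>R TS M)) \<in> borel_measurable borel" by measurable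
  then show "(\<integral>\<^sup>+y. f (snd y + fst y *\<^sub>R TS M) \<partial>nuS) = (\<integral>\<^sup>+m. f (C + m\<^sup>2 *\<^sub>R TS M) \<partial>stdn)"
   unfolding nuS_def by (subst nn_integral_distr) auto
 qed
 finally show ?thesis .
qed

text \<open>Uniform ellipticity: the law of the random covariance lives on a closed convex cone that
 contains \<open>C\<close> and is preserved by \<open>M \<mapsto> A M A\<^sup>T\<close>.\<close>

definition LL :: "real^'d^'d \<Rightarrow> real" where "LL M = norm C / trace C * trace M"

definition kap :: real where "kap = (SOME k. k > 0 \<and> (\<forall>x. k * norm C * (norm x)\<^sup>2 \<le> x \<bullet> (C *v x)))"

lemma norm_C_pos: "norm C > 0"
proof -
 have "C \<noteq> 0"
 proof
  assume "C = 0"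
  then have "axis undefined 1 \<bullet> (C *v axis undefined 1) = 0" by simp
  then show False using positive_definiteD(2)[OF C, of "axis undefined 1"] by simp
 qed
 then show ?thesis by simp
qed

lemma kap: "kap > 0" "kap * norm C * (norm x)\<^sup>2 \<le> x \<bullet> (C *v x)"
proof -
 obtain k where "k > 0" "\<And>x. k * (norm x)\<^sup>2 \<le> x \<bullet> (C *v x)" using positive_definite_lower[OF C] by blast
 then have "\<exists>k. k > 0 \<and> (\<forall>x. k * norm C * (norm x)\<^sup>2 \<le> x \<bullet> (C *v x))"
  using norm_C_pos by (intro exI[of _ "k / norm C"]) auto
 from someI_ex[OF this] show "kap > 0" "kap * norm C * (norm x)\<^sup>2 \<le> x \<bullet> (C *v x)"
  by (auto simp: kap_def)
qed

lemma trace_C_pos: "trace C > 0"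
proof -
 have "trace C = (\<Sum>i\<in>UNIV. axis i 1 \<bullet> (C *v axis i 1))"
  by (simp add: trace_def matrix_vector_mult_basis column_def inner_axis')
 also have "... > 0" by (intro sum_pos positive_definiteD(2)[OF C]) auto
 finally show ?thesis .
qed

lemma LL_C: "LL C = norm C" using trace_C_pos by (simp add: LL_def)
lemma LL_add: "LL (M + N) = LL M + LL N" by (simp add: LL_def trace_add distrib_left)
lemma LL_0: "LL 0 = 0" by (simp add: LL_def trace_def)
lemma LL_scale: "LL (c *\<^sub>R M) = c * LL M" by (simp add: LL_def trace_def sum_distrib_left mult_ac)
lemma LL_TS: "LL (TS M) = a\<^sup>2 * LL M" by (simp add: LL_def trace_TS)

text \<open>\<open>LL\<close> is a multiple of the trace, normalised to \<open>norm C\<close> at C.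
  It is linear and is multiplied by a^2 under \<open>TS\<close>, as squared lengths are under the
  transpose of A; so the two-sided comparison is stable under sums, nonnegative multiples,
  \<open>TS\<close> and limits.\<close>

definition goodS :: "real^'d^'d \<Rightarrow> bool" where
 "goodS M \<longleftrightarrow> transpose M = M \<and> (\<forall>x. kap * LL M * (norm x)\<^sup>2 \<le> x \<bullet> (M *v x) \<and> x \<bullet> (M *v x) \<le> LL M * (norm x)\<^sup>2)"

lemma LL_continuous: "continuous_on UNIV LL"
 unfolding LL_def trace_def by (intro continuous_intros)

lemma LL_m[measurable]: "LL \<in> borel_measurable borel"
 by (rule borel_measurable_continuous_onI[OF LL_continuous])

lemma goodS_closed: "closed {M. goodS M}"
proof -
 have c: "continuous_on UNIV (\<lambda>M::real^'d^'d. x \<bullet> (M *v x))" for x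
  unfolding matrix_vector_mult_def by (intro continuous_intros)
 have t: "continuous_on UNIV (\<lambda>M::real^'d^'d. transpose M)"
  unfolding transpose_def by (intro continuous_intros)
 have "{M. goodS M} = {M. transpose M = M} \<inter> (\<Inter>x. {M. kap * LL M * (norm x)\<^sup>2 \<le> x \<bullet> (M *v x)} \<inter> {M. x \<bullet> (M *v x) \<le> LL M * (norm x)\<^sup>2})"
  by (auto simp: goodS_def)
 also have "closed ..."
  by (intro closed_Int closed_INT ballI closed_Collect_eq closed_Collect_le continuous_intros c t LL_continuous)
 finally show ?thesis .
qed

lemma goodS_C: "goodS C"
proof -
 have "x \<bullet> (C *v x) \<le> norm C * (norm x)\<^sup>2" for x
 proof -
  have "x \<bullet> (C *v x) \<le> norm x * norm (C *v x)" by (rule norm_cauchy_schwarz)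
  also have "... \<le> norm x * (norm C * norm x)" by (intro mult_left_mono norm_matrix_vector_le) simp
  finally show ?thesis by (simp add: power2_eq_square mult_ac)
 qed
 then show ?thesis using kap positive_definiteD(1)[OF C] by (simp add: goodS_def LL_C)
qed

lemma goodS_add: "goodS M \<Longrightarrow> goodS N \<Longrightarrow> goodS (M + N)"
 unfolding goodS_def LL_add matrix_vector_mult_add_rdistrib inner_add_right distrib_left distrib_right
 by (auto simp: transpose_def vec_eq_iff intro: add_mono)

lemma goodS_scale: "goodS M \<Longrightarrow> 0 \<le> c \<Longrightarrow> goodS (c *\<^sub>R M)"
proof -
 assume g: "goodS M" and c: "0 \<le> c"
 have "c * (kap * LL M * (norm x)\<^sup>2) \<le> c * (x \<bullet> (M *v x)) \<and> c * (x \<bullet> (M *v x)) \<le> c * (LL M * (norm x)\<^sup>2)" for x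
  using g c by (auto simp: goodS_def intro!: mult_left_mono)
 then show "goodS (c *\<^sub>R M)"
  using g by (auto simp: goodS_def LL_scale matrix_scaleR_vec mult_ac transpose_def vec_eq_iff)
qed

lemma goodS_TS: "goodS M \<Longrightarrow> goodS (TS M)"
proof -
 assume g: "goodS M"
 have "kap * LL M * (a * norm x)\<^sup>2 \<le> x \<bullet> (TS M *v x) \<and> x \<bullet> (TS M *v x) \<le> LL M * (a * norm x)\<^sup>2" for x
  using g norm_At[of x] unfolding TS_form goodS_def by metis
 then show "goodS (TS M)"
  using g TS_symmetric[of M] by (auto simp: goodS_def LL_TS power_mult_distrib mult_ac)
qed

lemma goodS_0: "goodS 0" using goodS_scale[OF goodS_C, of 0] by simp

text \<open>Every partial sum of the series is a nonnegative combination of iterates of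
  \<open>TS\<close> at C and so lies in the closed cone; the first term is C itself, whence the
  lower bound on \<open>LL\<close>.\<close>

lemma rho_good: "AE M in rho. goodS M \<and> norm C \<le> LL M"
proof -
 have cl: "closed {M. goodS M \<and> norm C \<le> LL M}"
  unfolding Collect_conj_eq by (intro closed_Int goodS_closed closed_Collect_le LL_continuous continuous_intros)
 have TSk: "goodS ((TS ^^ k) C) \<and> 0 \<le> LL ((TS ^^ k) C)" for k
  by (induction k) (auto simp: goodS_C LL_C goodS_TS LL_TS)
 interpret seq: product_prob_space "\<lambda>_. nuS" "UNIV :: nat set"
  by (rule product_prob_spaceI) (simp add: nuS_def stdn.prob_space_distr)
 have "AE y in nuS. fst y \<ge> 0 \<and> snd y = C"
 proof -
  have "closed {y :: real \<times> (real^'d^'d). fst y \<ge> 0 \<and> snd y = C}"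
   unfolding Collect_conj_eq by (intro closed_Int closed_Collect_le closed_Collect_eq continuous_intros)
  then have "{y :: real \<times> (real^'d^'d). fst y \<ge> 0 \<and> snd y = C} \<in> sets borel" by simp
  then show ?thesis unfolding nuS_def by (subst AE_distr_iff) auto
 qed
 then have "AE x in seqS. fst (x k) \<ge> 0 \<and> snd (x k) = C" for k by (intro seq.AE_component) auto
 then have ae: "AE x in seqS. \<forall>k. fst (x k) \<ge> 0 \<and> snd (x k) = C" by (subst AE_all_countable) blast
 have "AE x in seqS. perp TS x \<in> {M. goodS M \<and> norm C \<le> LL M}"
 proof -
  have key: "goodS (perp TS x) \<and> norm C \<le> LL (perp TS x)"
   if x: "\<forall>k. fst (x k) \<ge> 0 \<and> snd (x k) = C" and sm: "summable (pterm TS x)" for x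
  proof -
   have pt: "goodS (pterm TS x k) \<and> 0 \<le> LL (pterm TS x k)" for k
    using x TSk[of k] by (auto simp: pterm_def LL_scale intro!: goodS_scale prod_nonneg mult_nonneg_nonneg)
   have ps: "goodS (\<Sum>k<n. pterm TS x k) \<and> 0 \<le> LL (\<Sum>k<n. pterm TS x k)" for n
    using pt by (induction n) (auto simp: goodS_0 LL_add goodS_add LL_0)
   have ps1: "norm C \<le> LL (\<Sum>k<Suc n. pterm TS x k)" for n
   proof (induction n)
    case 0
    then show ?case using x by (simp add: pterm_0 LL_C)
   next
    case (Suc n)
    then show ?case using pt[of "Suc n"] by (simp add: LL_add)
   qed
   have "(\<lambda>n. \<Sum>k<Suc n. pterm TS x k) \<longlonglongrightarrow> perp TS x"
    unfolding perp_def using summable_LIMSEQ[OF sm] by (rule LIMSEQ_Suc)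
   moreover have "(\<Sum>k<Suc n. pterm TS x k) \<in> {M. goodS M \<and> norm C \<le> LL M}" for n using ps[of "Suc n"] ps1[of n] by blast
   ultimately have "perp TS x \<in> {M. goodS M \<and> norm C \<le> LL M}"
    using cl by (meson closed_sequentially)
   then show ?thesis by simp
  qed
  have "AE x in seqS. summable (pterm TS x)" using perp_S_moment(1)[of "\<alpha> / 4"] \<alpha> by simp
  with ae show ?thesis by eventually_elim (use key in blast)
 qed
 then have "AE x in seqS. goodS (perp TS x) \<and> norm C \<le> LL (perp TS x)" by simp
 then show ?thesis unfolding rho_def
  using cl perpetuity.perp_m[OF perp_S] by (subst AE_distr_iff) auto
qed

lemma goodS_positive_definite:
 assumes "goodS M" "norm C \<le> LL M"
 shows "positive_definite M"
proof (rule symmetric_positiveI)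
 show "transpose M = M" using assms by (simp add: goodS_def)
 fix x :: "real^'d" assume "x \<noteq> 0"
 moreover have "0 < LL M" using norm_C_pos assms by linarith
 ultimately have "0 < kap * LL M * (norm x)\<^sup>2" using kap(1) by simp
 also have "... \<le> x \<bullet> (M *v x)" using assms by (simp add: goodS_def)
 finally show "0 < x \<bullet> (M *v x)" .
qed

lemma rho_pd: "AE M in rho. positive_definite M"
 using rho_good by eventually_elim (simp add: goodS_positive_definite)

definition mixX :: "(real^'d) measure" where
 "mixX = density lborel (\<lambda>x. \<integral>\<^sup>+M. ennreal (gdens M x) \<partial>rho)"

lemma nn_mix:
 assumes f[measurable]: "f \<in> borel_measurable borel"
 shows "(\<integral>\<^sup>+x. f x \<partial>mixX) = (\<integral>\<^sup>+M. \<integral>\<^sup>+x. f x \<partial>centered_normal M \<partial>rho)"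
proof -
 interpret pair_sigma_finite rho "lborel :: (real^'d) measure" ..
 have "(\<integral>\<^sup>+x. f x \<partial>mixX) = (\<integral>\<^sup>+x. (\<integral>\<^sup>+M. ennreal (gdens M x) \<partial>rho) * f x \<partial>lborel)"
  unfolding mixX_def by (subst nn_integral_density) auto
 also have "... = (\<integral>\<^sup>+x. \<integral>\<^sup>+M. ennreal (gdens M x) * f x \<partial>rho \<partial>lborel)"
  by (intro nn_integral_cong nn_integral_multc[symmetric]) measurable
 also have "... = (\<integral>\<^sup>+M. \<integral>\<^sup>+x. ennreal (gdens M x) * f x \<partial>lborel \<partial>rho)"
  by (rule Fubini') measurable
 also have "... = (\<integral>\<^sup>+M. \<integral>\<^sup>+x. f x \<partial>centered_normal M \<partial>rho)"
  by (simp add: centered_normal_gdens nn_integral_density)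
 finally show ?thesis .
qed

text \<open>The state is a root of M applied to a standard normal z. The averages over z and m are
  exchanged, and with m fixed the step is covered by \<open>law_matrix_sum\<close>.\<close>

lemma gaussian_step:
 assumes M: "positive_definite M" and f[measurable]: "f \<in> borel_measurable borel"
 shows "(\<integral>\<^sup>+v. \<integral>\<^sup>+x. f x \<partial>K v \<partial>centered_normal M) = (\<integral>\<^sup>+m. \<integral>\<^sup>+x. f x \<partial>centered_normal (C + m\<^sup>2 *\<^sub>R TS M) \<partial>stdn)"
proof -
 let ?R = "spd_sqrt M" and ?I = "centered_normal (mat 1 :: real^'d^'d)"
 interpret I: prob_space ?I using prob_space_stdg[where 'z = "real^'d"] by (simp add: stdg_cart)
 interpret Im: pair_sigma_finite ?I stdn ..
 have sym: "transpose ?R = ?R" using spd_sqrt_construction(1)[OF M] by (rule positive_definiteD)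
 have "(\<integral>\<^sup>+v. \<integral>\<^sup>+x. f x \<partial>K v \<partial>centered_normal M) = (\<integral>\<^sup>+z. \<integral>\<^sup>+x. f x \<partial>K (?R *v z) \<partial>?I)"
  unfolding centered_normal_spd_sqrt[OF M, symmetric]
  by (subst nn_integral_distr) (auto simp: nn_K_measurable)
 also have "... = (\<integral>\<^sup>+z. \<integral>\<^sup>+m. \<integral>\<^sup>+q. f (m *\<^sub>R (A *v (?R *v z)) + q) \<partial>\<gamma> \<partial>stdn \<partial>?I)"
  unfolding nn_K[OF f] by (intro nn_integral_cong, subst gam.nn_integral_fst[symmetric]) auto
 also have "... = (\<integral>\<^sup>+m. \<integral>\<^sup>+z. \<integral>\<^sup>+q. f (m *\<^sub>R (A *v (?R *v z)) + q) \<partial>\<gamma> \<partial>?I \<partial>stdn)"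
  by (rule Im.Fubini'[symmetric]) measurable
 also have "... = (\<integral>\<^sup>+m. \<integral>\<^sup>+x. f x \<partial>centered_normal (C + m\<^sup>2 *\<^sub>R TS M) \<partial>stdn)"
 proof (rule nn_integral_cong)
  fix m
  let ?B = "m *\<^sub>R (A ** ?R)"
  have BB: "?B ** transpose ?B = m\<^sup>2 *\<^sub>R TS M"
  proof -
   have "transpose ?B = m *\<^sub>R (?R ** transpose A)"
    using sym by (simp add: transpose_def vec_eq_iff matrix_matrix_mult_def sum_distrib_left mult_ac)
   then have "?B ** transpose ?B = (m * m) *\<^sub>R ((A ** ?R) ** (?R ** transpose A))"
    by (simp add: matrix_algebra_distribs)
   also have "(A ** ?R) ** (?R ** transpose A) = A ** (?R ** ?R) ** transpose A" by (simp add: matrix_mul_assoc)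
   finally show ?thesis unfolding spd_sqrt_construction(2)[OF M] by (simp add: TS_def power2_eq_square)
  qed
  have Bz: "m *\<^sub>R (A *v (?R *v z)) = ?B *v z" for z
   by (simp add: matrix_scaleR_vec matrix_vector_mul_assoc)
  have "(\<integral>\<^sup>+z. \<integral>\<^sup>+q. f (?B *v z + q) \<partial>\<gamma> \<partial>?I) = (\<integral>\<^sup>+p. f (case p of (z, q) \<Rightarrow> ?B *v z + q) \<partial>(?I \<Otimes>\<^sub>M \<gamma>))"
   by (subst gam.nn_integral_fst[symmetric]) (auto simp: case_prod_beta)
  also have "... = (\<integral>\<^sup>+x. f x \<partial>distr (?I \<Otimes>\<^sub>M \<gamma>) borel (\<lambda>(z, q). ?B *v z + q))"
   by (subst nn_integral_distr) auto
  finally show "(\<integral>\<^sup>+z. \<integral>\<^sup>+q. f (m *\<^sub>R (A *v (?R *v z)) + q) \<partial>\<gamma> \<partial>?I) = (\<integral>\<^sup>+x. f x \<partial>centered_normal (C + m\<^sup>2 *\<^sub>R TS M))"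
   unfolding Bz law_matrix_sum(1)[OF C] BB .
 qed
 finally show ?thesis .
qed

lemma mixX_invariant: "invariant mixX"
 unfolding invariant_def
proof (intro conjI ballI)
 show "sets mixX = sets borel" by (simp add: mixX_def)
 show "prob_space mixX"
 proof
  have "emeasure mixX (space mixX) = (\<integral>\<^sup>+x. 1 \<partial>mixX)" by simp
  also have "... = (\<integral>\<^sup>+M. \<integral>\<^sup>+x. 1 \<partial>centered_normal M \<partial>rho)" by (rule nn_mix) simp
  also have "... = (\<integral>\<^sup>+M. 1 \<partial>rho)"
   by (rule nn_integral_cong_AE)
    (use rho_pd in \<open>auto elim!: eventually_mono dest!: prob_space_centered_normal prob_space.emeasure_space_1\<close>)
  finally show "emeasure mixX (space mixX) = 1" using rho.emeasure_space_1 by simp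
 qed
 fix f :: "real^'d \<Rightarrow> ennreal" assume f: "f \<in> borel_measurable borel"
 note [measurable] = f nn_integral_centered_normal_measurable[OF f]
 have "(\<integral>\<^sup>+x. f x \<partial>mixX) = (\<integral>\<^sup>+M. \<integral>\<^sup>+x. f x \<partial>centered_normal M \<partial>rho)" by (rule nn_mix[OF f])
 also have "... = (\<integral>\<^sup>+M. \<integral>\<^sup>+m. \<integral>\<^sup>+x. f x \<partial>centered_normal (C + m\<^sup>2 *\<^sub>R TS M) \<partial>stdn \<partial>rho)"
  by (rule rho_invariant) measurable
 also have "... = (\<integral>\<^sup>+M. \<integral>\<^sup>+v. \<integral>\<^sup>+x. f x \<partial>K v \<partial>centered_normal M \<partial>rho)"
  by (rule nn_integral_cong_AE) (use rho_pd in \<open>auto elim!: eventually_mono simp: gaussian_step[OF _ f]\<close>)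
 also have "... = (\<integral>\<^sup>+v. \<integral>\<^sup>+x. f x \<partial>K v \<partial>mixX)" by (rule nn_mix[symmetric, OF nn_K_measurable[OF f]])
 finally show "(\<integral>\<^sup>+x. f x \<partial>mixX) = (\<integral>\<^sup>+v. \<integral>\<^sup>+x. f x \<partial>K v \<partial>mixX)" .
qed

text \<open>The series gives moments and a solution on the given space, the mixture gives a density;
  uniqueness of the invariant law lets both descriptions be used for one measure.\<close>

theorem piX_eq_mixX: "piX = mixX"
 by (rule invariant_unique[OF piX_invariant mixX_invariant])

end

section \<open>Cutoff functions and Gaussian profiles\<close>

text \<open>For s > 1 one has s^k \<le> (s^2)^k = (8 k)^k (s^2 / (8 k))^k, and (1 + x / k)^k \<le>
  exp x.\<close>

lemma power_exp_bounded: "s ^ k * exp (- s\<^sup>2 / 8) \<le> 1 + (8 * real k) ^ k" if "s \<ge> 0" for s :: real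
proof (cases "s \<le> 1 \<or> k = 0")
 case True
 then have "s ^ k \<le> 1" using that by (auto simp: power_le_one)
 moreover have "exp (- s\<^sup>2 / 8) \<le> 1" by simp
 ultimately have "s ^ k * exp (- s\<^sup>2 / 8) \<le> 1 * 1" using that by (intro mult_mono) auto
 then show ?thesis by (simp add: add_increasing2)
next
 case False
 then have s: "s > 1" and k: "k > 0" by auto
 have "s ^ k \<le> (s\<^sup>2) ^ k" using s by (intro power_mono) (auto simp: power2_eq_square)
 also have "s\<^sup>2 = 8 * real k * (s\<^sup>2 / 8 / real k)" using k by simp
 also have "... ^ k = (8 * real k) ^ k * (s\<^sup>2 / 8 / real k) ^ k" by (rule power_mult_distrib)
 finally have 1: "s ^ k \<le> (8 * real k) ^ k * (s\<^sup>2 / 8 / real k) ^ k" .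
 have "(s\<^sup>2 / 8 / real k) ^ k \<le> (1 + s\<^sup>2 / 8 / real k) ^ k" by (intro power_mono) auto
 also have "... \<le> exp (s\<^sup>2 / 8)"
  using exp_ge_one_plus_x_over_n_power_n[of k "s\<^sup>2 / 8"] k by (simp add: order_trans[OF _ zero_le_power2])
 finally have "s ^ k \<le> (8 * real k) ^ k * exp (s\<^sup>2 / 8)"
  by (intro order_trans[OF 1] mult_left_mono) auto
 then have "s ^ k * exp (- (s\<^sup>2 / 8)) \<le> (8 * real k) ^ k * exp (s\<^sup>2 / 8) * exp (- (s\<^sup>2 / 8))"
  by (rule mult_right_mono) simp
 also have "... = (8 * real k) ^ k" by (simp add: mult.assoc exp_add[symmetric])
 finally show ?thesis by simp
qed

text \<open>A monotone substitute for the indicator of x \<ge> 1. It is Hoelder continuous, unlike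
  the indicator, and flat of order N at 0, so that it dominates Gaussian profiles and can be
  integrated against a power tail.\<close>

definition cutG :: "nat \<Rightarrow> real \<Rightarrow> real" where "cutG N x = min 1 (x ^ N)"

lemma cutG_measurable[measurable]: "cutG N \<in> borel_measurable borel"
 unfolding cutG_def by measurable

lemma cutG_01: "0 \<le> x \<Longrightarrow> 0 \<le> cutG N x" "cutG N x \<le> 1"
 by (auto simp: cutG_def)

lemma cutG_mono: "0 \<le> x \<Longrightarrow> x \<le> y \<Longrightarrow> cutG N x \<le> cutG N y"
 by (auto simp: cutG_def min_def intro: power_mono order_trans)

lemma power_diff_le_real: "0 \<le> y \<Longrightarrow> y \<le> x \<Longrightarrow> x ^ N - y ^ N \<le> real N * x ^ (N - 1) * (x - y)" for x y :: real
proof -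
 assume y: "0 \<le> y" "y \<le> x"
 have e: "x ^ N - y ^ N = (x - y) * (\<Sum>i<N. y ^ (N - Suc i) * x ^ i)" by (rule power_diff_sumr2)
 have "(\<Sum>i<N. y ^ (N - Suc i) * x ^ i) \<le> (\<Sum>i<N. x ^ (N - 1))"
 proof (rule sum_mono)
  fix i assume i: "i \<in> {..<N}"
  have "y ^ (N - Suc i) * x ^ i \<le> x ^ (N - Suc i) * x ^ i" using y by (intro mult_right_mono power_mono) auto
  also have "... = x ^ (N - 1)" using i by (simp add: power_add[symmetric])
  finally show "y ^ (N - Suc i) * x ^ i \<le> x ^ (N - 1)" .
 qed
 then have "(\<Sum>i<N. y ^ (N - Suc i) * x ^ i) \<le> real N * x ^ (N - 1)" by simp
 from mult_left_mono[OF this, of "x - y"] show ?thesis using y unfolding e by (simp add: mult_ac)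
qed

text \<open>The bound has total order \<theta> + \<beta>: when both arguments are scaled by exp (-
  t) it gains exp (- (\<theta> + \<beta>) t), which is to beat the factor exp (\<alpha> t).\<close>

lemma cutG_holder:
 assumes xy: "0 \<le> y" "y \<le> x" and th: "0 < \<theta>" "\<theta> \<le> 1" "0 \<le> \<beta>" "\<theta> + \<beta> \<le> real N"
 shows "cutG N x - cutG N y \<le> real N * (x - y) powr \<theta> * x powr \<beta>"
proof (cases "y \<ge> 1 \<or> x = y")
 case True
 then have "cutG N x - cutG N y \<le> 0" using xy one_le_power[of y N] by (auto simp: cutG_def)
 also have "0 \<le> real N * (x - y) powr \<theta> * x powr \<beta>" by simp
 finally show ?thesis .
next
 case False
 \<comment> \<open>Above 1 the cutoff is constant, so x may be lowered to 1; there a power of higher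
   order is at most one of lower order.\<close>
 define z where "z = min x 1"
 have z: "y < z" "z \<le> 1" "z \<le> x" "0 < z" using False xy by (auto simp: z_def)
 have N: "N > 0" using th by (cases N) auto
 have "cutG N x = z ^ N" using xy power_le_one[of x N] one_le_power[of x N] unfolding cutG_def z_def by (cases "x \<le> 1") (simp_all add: min_def)
 moreover have "cutG N y = y ^ N" using False xy power_le_one[of y N] by (simp add: cutG_def min_def)
 ultimately have "cutG N x - cutG N y \<le> real N * z ^ (N - 1) * (z - y)"
  using power_diff_le_real[of y z N] xy z by simp
 also have "... = real N * (z ^ (N - 1) * (z - y))" by (simp only: mult.assoc)
 finally have 1: "cutG N x - cutG N y \<le> real N * (z ^ (N - 1) * (z - y))" .
 have "z ^ (N - 1) * (z - y) \<le> (z - y) powr \<theta> * z powr \<beta>"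
 proof -
  have "z - y = (z - y) powr \<theta> * (z - y) powr (1 - \<theta>)" using z by (simp add: powr_add[symmetric])
  also have "... \<le> (z - y) powr \<theta> * z powr (1 - \<theta>)" using z xy th by (intro mult_left_mono powr_mono2) auto
  finally have "z - y \<le> (z - y) powr \<theta> * z powr (1 - \<theta>)" .
  then have "z ^ (N - 1) * (z - y) \<le> z ^ (N - 1) * ((z - y) powr \<theta> * z powr (1 - \<theta>))" using z by (intro mult_left_mono) auto
  also have "... = (z - y) powr \<theta> * z powr (real N - \<theta>)"
  proof -
   have "z ^ (N - 1) = z powr (real N - 1)" using z N by (simp add: powr_realpow[symmetric] of_nat_diff)
   then have "z ^ (N - 1) * z powr (1 - \<theta>) = z powr (real N - \<theta>)" by (simp add: powr_add[symmetric])
   then show ?thesis by (simp add: mult_ac)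
  qed
  also have "... \<le> (z - y) powr \<theta> * z powr \<beta>" using z th by (intro mult_left_mono powr_mono') auto
  finally show ?thesis .
 qed
 also have "(z - y) powr \<theta> * z powr \<beta> \<le> (x - y) powr \<theta> * x powr \<beta>"
  using z th xy by (intro mult_mono powr_mono2) auto
 finally have "real N * (z ^ (N - 1) * (z - y)) \<le> real N * ((x - y) powr \<theta> * x powr \<beta>)"
  by (rule mult_left_mono) simp
 with 1 show ?thesis by (simp only: mult.assoc)
qed

lemma cutG_le_powr: "0 \<le> x \<Longrightarrow> 0 < \<beta> \<Longrightarrow> \<beta> \<le> real N \<Longrightarrow> cutG N x \<le> x powr \<beta>"
proof (cases "x = 0")
 case False
 assume x: "0 \<le> x" and b: "0 < \<beta>" "\<beta> \<le> real N"
 show ?thesis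
 proof (cases "x \<le> 1")
  case True
  have "x powr real N \<le> x powr \<beta>" using x b True by (intro powr_mono') auto
  moreover have "x powr real N = x ^ N" using x False by (intro powr_realpow) auto
  ultimately show ?thesis by (simp add: cutG_def)
 next
  case False
  then have "1 \<le> x powr \<beta>" using b by (simp add: ge_one_powr_ge_zero)
  then show ?thesis by (simp add: cutG_def)
 qed
qed (auto simp: cutG_def power_0_left)

text \<open>With s = r / sqrt L, a Gaussian of variance about L seen at distance r is dominated by
  the cutoff of sqrt L / r: density estimates become tail estimates for L. The constant covers the
  powers k and k + N, that is both branches of the minimum.\<close>

lemma profile_le_cutG:
 assumes "s > 0"
 shows "s ^ k * exp (- s\<^sup>2 / 8) \<le> (2 + (8 * real k) ^ k + (8 * real (k + N)) ^ (k + N)) * cutG N (1 / s)"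
proof -
 let ?c = "2 + (8 * real k) ^ k + (8 * real (k + N)) ^ (k + N)"
 have c: "?c \<ge> 0" by (intro add_nonneg_nonneg) auto
 have 1: "s ^ k * exp (- s\<^sup>2 / 8) \<le> ?c * 1"
 proof -
  have "s ^ k * exp (- s\<^sup>2 / 8) \<le> 1 + (8 * real k) ^ k" using assms by (intro power_exp_bounded) simp
  moreover have "0 \<le> (8 * real (k + N)) ^ (k + N)" by (intro zero_le_power) simp
  ultimately show ?thesis unfolding mult_1_right by linarith
 qed
 have "s ^ N * (s ^ k * exp (- s\<^sup>2 / 8)) \<le> ?c"
 proof -
  have "s ^ N * (s ^ k * exp (- s\<^sup>2 / 8)) = s ^ (k + N) * exp (- s\<^sup>2 / 8)" by (simp only: power_add mult_ac)
  also have "... \<le> 1 + (8 * real (k + N)) ^ (k + N)" using assms by (intro power_exp_bounded) simp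
  also have "... \<le> ?c" using zero_le_power[of "8 * real k" k] by linarith
  finally show ?thesis .
 qed
 then have "s ^ k * exp (- s\<^sup>2 / 8) \<le> ?c * (1 / s) ^ N" using assms by (simp add: field_simps power_one_over)
 then show ?thesis using 1 unfolding cutG_def by (cases "(1 / s) ^ N \<le> 1") (auto simp: min_def)
qed

context bekk
begin

subsection \<open>The tilted random walk\<close>

definition tau :: "real measure" where
 "tau = distr (density stdn (\<lambda>m. ennreal ((\<bar>m\<bar> * a) powr \<alpha>))) borel (\<lambda>m. ln (\<bar>m\<bar> * a))"

text \<open>\<open>th\<close> is a Hoelder order, \<open>bet\<close> < \<alpha> an order of finite
  moments of the state. Their sum exceeds \<alpha> by \<open>eps\<close>, which leaves errors of
  size exp (- eps t) after multiplication by exp (\<alpha> t).\<close>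

definition th :: real where "th = min 1 \<alpha>"
definition eps :: real where "eps = th / 2"
definition bet :: real where "bet = \<alpha> - eps"

lemma th: "0 < th" "th \<le> 1" "th \<le> \<alpha>" using \<alpha> by (auto simp: th_def)
lemma eps: "0 < eps" "eps < \<alpha>" "eps < 1" using th by (auto simp: eps_def)
lemma bet: "0 < bet" "bet < \<alpha>" "th + bet = \<alpha> + eps" "bet = \<alpha> - eps" using eps th by (auto simp: bet_def eps_def)

lemma sets_tau[simp]: "sets tau = sets borel" by (simp add: tau_def)

lemma nn_tau:
 assumes [measurable]: "f \<in> borel_measurable borel"
 shows "(\<integral>\<^sup>+l. f l \<partial>tau) = (\<integral>\<^sup>+m. ennreal ((\<bar>m\<bar> * a) powr \<alpha>) * f (ln (\<bar>m\<bar> * a)) \<partial>stdn)"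
 unfolding tau_def by (subst nn_integral_distr, measurable) (subst nn_integral_density, measurable)

lemma tau_integral:
 fixes f :: "real \<Rightarrow> real"
 assumes [measurable]: "f \<in> borel_measurable borel"
 shows "integrable tau f \<longleftrightarrow> integrable stdn (\<lambda>m. (\<bar>m\<bar> * a) powr \<alpha> * f (ln (\<bar>m\<bar> * a)))"
  "(\<integral>l. f l \<partial>tau) = (\<integral>m. (\<bar>m\<bar> * a) powr \<alpha> * f (ln (\<bar>m\<bar> * a)) \<partial>stdn)"
proof -
 show "integrable tau f \<longleftrightarrow> integrable stdn (\<lambda>m. (\<bar>m\<bar> * a) powr \<alpha> * f (ln (\<bar>m\<bar> * a)))"
  unfolding tau_def by (subst integrable_distr_eq, measurable, subst integrable_density) auto
 show "(\<integral>l. f l \<partial>tau) = (\<integral>m. (\<bar>m\<bar> * a) powr \<alpha> * f (ln (\<bar>m\<bar> * a)) \<partial>stdn)"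
  unfolding tau_def by (subst integral_distr, measurable, subst integral_density) auto
qed

lemma prob_tau: "prob_space tau"
proof
 have "emeasure tau (space tau) = (\<integral>\<^sup>+l. 1 \<partial>tau)" by simp
 also have "... = (\<integral>\<^sup>+m. ennreal ((\<bar>m\<bar> * a) powr \<alpha>) \<partial>stdn)" by (subst nn_tau) auto
 also have "... = ennreal (nmom a \<alpha>)"
  unfolding nmom_def using nmom_integrable[of \<alpha> a] a \<alpha> by (intro nn_integral_eq_integral) auto
 finally show "emeasure tau (space tau) = 1" by (simp add: nmom_\<alpha>)
qed

lemma tilt_exp: "(\<bar>m\<bar> * a) powr \<alpha> * exp (s * ln (\<bar>m\<bar> * a)) = (\<bar>m\<bar> * a) powr (\<alpha> + s)"
 by (cases "m = 0") (use a in \<open>auto simp: powr_def exp_add[symmetric] algebra_simps\<close>)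

lemma tau_exp:
 assumes "\<alpha> + s > 0"
 shows "integrable tau (\<lambda>l. exp (s * l))" "(\<integral>l. exp (s * l) \<partial>tau) = nmom a (\<alpha> + s)"
 using nmom_integrable[of "\<alpha> + s" a] assms a
 by (simp_all add: tau_integral tilt_exp nmom_def)

lemma tau_full:
 assumes "u < v"
 shows "measure tau {u<..<v} > 0"
proof (rule ccontr)
 interpret T: prob_space tau by (rule prob_tau)
 assume "\<not> ?thesis"
 then have "measure tau {u<..<v} = 0" using measure_nonneg[of tau "{u<..<v}"] by linarith
 then have "emeasure tau {u<..<v} = 0" by (simp add: T.emeasure_eq_measure)
 then have "(\<integral>\<^sup>+l. indicator {u<..<v} l \<partial>tau) = 0" by simp
 then have "(\<integral>\<^sup>+m. ennreal ((\<bar>m\<bar> * a) powr \<alpha>) * indicator {u<..<v} (ln (\<bar>m\<bar> * a)) \<partial>stdn) = 0"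
  by (subst (asm) nn_tau) auto
 then have "AE m in stdn. ennreal ((\<bar>m\<bar> * a) powr \<alpha>) * indicator {u<..<v} (ln (\<bar>m\<bar> * a)) = 0"
  by (subst (asm) nn_integral_0_iff_AE) auto
 then have ae: "AE m in lborel. ennreal ((\<bar>m\<bar> * a) powr \<alpha>) * indicator {u<..<v} (ln (\<bar>m\<bar> * a)) = 0"
  by (subst (asm) AE_density) (auto elim!: eventually_mono simp: normal_density_pos)
 have "AE m in lborel. m \<notin> {exp u / a<..<exp v / a}"
  using ae
 proof eventually_elim
  case (elim m)
  show ?case
  proof
   assume "m \<in> {exp u / a<..<exp v / a}"
   then have e: "exp u / a < m" "m < exp v / a" by auto
   moreover have "0 < exp u / a" using a by simp
   ultimately have m: "m > 0" by linarith
   have ma: "exp u < m * a" "m * a < exp v" using e a by (simp_all add: field_simps)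
   have p: "m * a > 0" using m a by simp
   have "u < ln (m * a)" using ma(1) p by (metis exp_ln exp_less_cancel_iff)
   moreover have "ln (m * a) < v" using ma(2) p by (metis exp_ln exp_less_cancel_iff)
   ultimately show False using elim m a by (simp add: indicator_def)
  qed
 qed
 then have "emeasure lborel {exp u / a<..<exp v / a} = 0"
  by (subst (asm) AE_iff_measurable[where N = "{exp u / a<..<exp v / a}"]) auto
 moreover have "exp u / a < exp v / a" using assms a by (intro divide_strict_right_mono) auto
 ultimately show False by (simp add: emeasure_lborel_Ioo del: divide_strict_right_mono divide_less_cancel divide_cancel_right)
qed

sublocale walk: full_drift_walk tau eps
proof (intro full_drift_walk.intro drift_walk.intro full_drift_walk_axioms.intro)
 show "prob_space tau" by (rule prob_tau)
 show "sets tau = sets borel" by simp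
 show "eps > 0" by (rule eps)
 show "integrable tau (\<lambda>l. exp (- eps * l))" by (rule tau_exp) (use eps in simp)
 show "integrable tau (\<lambda>l. exp (eps * l))" by (rule tau_exp) (use eps \<alpha> in simp)
 have "(\<integral>l. exp (- eps * l) \<partial>tau) = nmom a (\<alpha> + - eps)" by (rule tau_exp) (use eps in simp)
 also have "... < 1" using eps by (intro nmom_less) auto
 finally show "(\<integral>l. exp (- eps * l) \<partial>tau) < 1" .
qed (rule tau_full)

lemma stdn_nz: "AE m in stdn. m \<noteq> 0"
 using AE_lborel_singleton[of "0::real"] by (subst AE_density) auto

text \<open>The weight (|m| a) powr \<alpha> of the tilted law cancels exp (- \<alpha> l). So, after
  normalisation by exp (\<alpha> t), multiplying the state by |m| a is convolution with
  \<open>tau\<close>.\<close>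

lemma tilt_scaled:
 fixes g :: "real \<Rightarrow> real"
 assumes [measurable]: "g \<in> borel_measurable borel"
 shows "(\<integral>l. exp (\<alpha> * (t - l)) * g (t - l) \<partial>tau) = exp (\<alpha> * t) * (\<integral>m. g (t - ln (\<bar>m\<bar> * a)) \<partial>stdn)"
proof -
 have "(\<integral>l. exp (\<alpha> * (t - l)) * g (t - l) \<partial>tau)
  = (\<integral>m. (\<bar>m\<bar> * a) powr \<alpha> * (exp (\<alpha> * (t - ln (\<bar>m\<bar> * a))) * g (t - ln (\<bar>m\<bar> * a))) \<partial>stdn)"
  by (rule tau_integral) measurable
 also have "... = (\<integral>m. exp (\<alpha> * t) * g (t - ln (\<bar>m\<bar> * a)) \<partial>stdn)"
 proof (rule integral_cong_AE)
  show "AE m in stdn. (\<bar>m\<bar> * a) powr \<alpha> * (exp (\<alpha> * (t - ln (\<bar>m\<bar> * a))) * g (t - ln (\<bar>m\<bar> * a))) = exp (\<alpha> * t) * g (t - ln (\<bar>m\<bar> * a))"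
   using stdn_nz
  proof eventually_elim
   case (elim m)
   then have "(\<bar>m\<bar> * a) powr \<alpha> * exp (\<alpha> * (t - ln (\<bar>m\<bar> * a))) = exp (\<alpha> * t)"
    using a by (simp add: powr_def exp_add[symmetric] algebra_simps)
   then show ?case by (simp add: mult.assoc[symmetric])
  qed
 qed measurable
 finally show ?thesis by simp
qed

subsection \<open>The tail of the trace\<close>

text \<open>Large enough for both uses of the cutoff: the Hoelder estimate needs order
  \<open>th + bet\<close>, and integrability near 0 against |y|^-(\<alpha> + d) is obtained from
  order \<alpha> + d.\<close>

definition NN :: nat where "NN = nat \<lceil>\<alpha> + real CARD('d) + 3\<rceil>"

lemma NN: "\<alpha> + real CARD('d) + 3 \<le> real NN"
 unfolding NN_def by linarith

text \<open>A smoothed version of x^\<alpha> P(sqrt (LL) > x) at x = exp t.\<close>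

definition phiV :: "real \<Rightarrow> real" where
 "phiV t = exp (\<alpha> * t) * (\<integral>M. cutG NN (exp (- t) * sqrt (LL M)) \<partial>rho)"

definition mV :: real where "mV = (\<integral>M. sqrt (LL M) powr bet \<partial>rho)"

lemma LL_le_norm: "\<bar>LL M\<bar> \<le> norm C / trace C * real CARD('d) * norm M"
proof -
 have "\<bar>trace M\<bar> \<le> (\<Sum>i\<in>UNIV. \<bar>M $ i $ i\<bar>)" unfolding trace_def by (rule sum_abs)
 also have "... \<le> (\<Sum>i\<in>(UNIV::'d set). norm M)"
 proof (rule sum_mono)
  fix i show "\<bar>M $ i $ i\<bar> \<le> norm M"
   using order_trans[OF component_le_norm_cart[of "M $ i" i] Finite_Cartesian_Product.norm_nth_le[of M i]] by simp
 qed
 finally have "\<bar>trace M\<bar> \<le> real CARD('d) * norm M" by simp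
 then have "norm C / trace C * \<bar>trace M\<bar> \<le> norm C / trace C * (real CARD('d) * norm M)"
  using trace_C_pos by (intro mult_left_mono) auto
 then show ?thesis using trace_C_pos by (simp add: LL_def abs_mult mult.assoc)
qed

lemma integrable_LL_powr: "integrable rho (\<lambda>M. sqrt (LL M) powr bet)"
proof -
 define c where "c = norm C / trace C * real CARD('d)"
 have c: "c \<ge> 0" using trace_C_pos by (simp add: c_def)
 have fin: "(\<integral>\<^sup>+M. ennreal (norm M powr (bet / 2)) \<partial>rho) < \<infinity>"
  using bet by (intro perp_S_moment) auto
 have "(\<integral>\<^sup>+M. ennreal (sqrt (LL M) powr bet) \<partial>rho) \<le> (\<integral>\<^sup>+M. ennreal (c powr (bet / 2)) * ennreal (norm M powr (bet / 2)) \<partial>rho)"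
 proof (rule nn_integral_mono_AE)
  show "AE M in rho. ennreal (sqrt (LL M) powr bet) \<le> ennreal (c powr (bet / 2)) * ennreal (norm M powr (bet / 2))"
   using rho_good
  proof eventually_elim
   case (elim M)
   then have l: "LL M > 0" using norm_C_pos by linarith
   have "sqrt (LL M) powr bet = LL M powr (bet / 2)" using l by (simp add: powr_half_sqrt[symmetric] powr_powr)
   also have "... \<le> (c * norm M) powr (bet / 2)"
    using LL_le_norm[of M] l bet by (intro powr_mono2) (auto simp: c_def)
   finally show ?case by (simp add: powr_mult ennreal_mult'[symmetric] ennreal_leI)
  qed
 qed
 also have "... = ennreal (c powr (bet / 2)) * (\<integral>\<^sup>+M. ennreal (norm M powr (bet / 2)) \<partial>rho)"
  by (rule nn_integral_cmult) measurable
 also have "... < \<infinity>" using fin by (simp add: ennreal_mult_less_top)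
 finally show ?thesis by (intro integrableI_nonneg) auto
qed

lemma rho_LL_pos: "AE M in rho. LL M > 0"
 using rho_good by eventually_elim (use norm_C_pos in linarith)

lemma cutV_int: "integrable rho (\<lambda>M. cutG NN (c * sqrt (LL M)))" if "c \<ge> 0"
proof (rule rho.integrable_const_bound[where B = 1])
 show "AE M in rho. norm (cutG NN (c * sqrt (LL M))) \<le> 1"
  using rho_LL_pos
 proof eventually_elim
  case (elim M)
  then have "0 \<le> c * sqrt (LL M)" using that by simp
  then show ?case using cutG_01(1)[of "c * sqrt (LL M)" NN] cutG_01(2)[of NN "c * sqrt (LL M)"] by simp
 qed
qed measurable

lemma phiV_m[measurable]: "phiV \<in> borel_measurable borel"
 unfolding phiV_def by measurable

lemma phiV_nonneg: "0 \<le> phiV t"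
 unfolding phiV_def using rho_LL_pos
 by (intro mult_nonneg_nonneg integral_nonneg_AE) (auto elim!: eventually_mono simp: cutG_01)

text \<open>The a priori growth bound that \<open>subharmonic_bounded\<close> asks for; it is
  Markov's inequality with the moment of order \<alpha> - eps.\<close>

lemma phiV_le: "phiV t \<le> mV * exp (eps * t)"
proof -
 have "(\<integral>M. cutG NN (exp (- t) * sqrt (LL M)) \<partial>rho) \<le> (\<integral>M. exp (- bet * t) * sqrt (LL M) powr bet \<partial>rho)"
 proof (rule integral_mono_AE)
  show "AE M in rho. cutG NN (exp (- t) * sqrt (LL M)) \<le> exp (- bet * t) * sqrt (LL M) powr bet"
   using rho_LL_pos
  proof eventually_elim
   case (elim M)
   have "cutG NN (exp (- t) * sqrt (LL M)) \<le> (exp (- t) * sqrt (LL M)) powr bet"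
    using elim bet NN by (intro cutG_le_powr) auto
   also have "... = exp (- bet * t) * sqrt (LL M) powr bet"
    by (simp add: powr_mult) (simp add: powr_def mult.commute)
   finally show ?case .
  qed
 qed (use integrable_LL_powr cutV_int in auto)
 also have "... = exp (- bet * t) * mV" by (simp add: mV_def)
 finally have "phiV t \<le> exp (\<alpha> * t) * (exp (- bet * t) * mV)" unfolding phiV_def by (rule mult_left_mono) simp
 also have "... = mV * exp (eps * t)" by (simp add: bet_def exp_add[symmetric] mult.assoc[symmetric] algebra_simps)
 finally show ?thesis .
qed

definition sLL :: "real \<Rightarrow> real^'d^'d \<Rightarrow> real" where "sLL m M = sqrt (norm C + (m * a)\<^sup>2 * LL M)"

lemma LL_step: "LL (C + m\<^sup>2 *\<^sub>R TS M) = norm C + (m * a)\<^sup>2 * LL M"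
 by (simp add: LL_add LL_scale LL_C LL_TS power_mult_distrib)

abbreviation "RS \<equiv> rho \<Otimes>\<^sub>M stdn"

lemma rho_invariant_real:
 fixes f :: "real^'d^'d \<Rightarrow> real"
 assumes f[measurable]: "f \<in> borel_measurable borel" and nn: "\<And>M. 0 \<le> f M" and i: "integrable rho f"
 shows "integrable RS (\<lambda>p. f (C + (snd p)\<^sup>2 *\<^sub>R TS (fst p)))"
  "(\<integral>M. f M \<partial>rho) = (\<integral>p. f (C + (snd p)\<^sup>2 *\<^sub>R TS (fst p)) \<partial>RS)"
proof -
 have [measurable]: "TS \<in> borel_measurable borel"
  using TS_linear by (intro borel_measurable_continuous_onI linear_continuous_on) (simp add: linear_conv_bounded_linear)
 have e: "(\<integral>\<^sup>+M. ennreal (f M) \<partial>rho) = (\<integral>\<^sup>+p. ennreal (f (C + (snd p)\<^sup>2 *\<^sub>R TS (fst p))) \<partial>RS)"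
  by (subst rho_invariant, measurable) (subst stdn.nn_integral_fst[symmetric], auto)
 show I: "integrable RS (\<lambda>p. f (C + (snd p)\<^sup>2 *\<^sub>R TS (fst p)))"
  using i nn unfolding integrable_iff_bounded by (auto simp: e[symmetric])
 show "(\<integral>M. f M \<partial>rho) = (\<integral>p. f (C + (snd p)\<^sup>2 *\<^sub>R TS (fst p)) \<partial>RS)"
  using nn e by (simp add: integral_eq_nn_integral)
qed

sublocale rs: pair_prob_space rho stdn ..

abbreviation "cutD t p \<equiv> cutG NN (exp (- t) * sLL (snd p) (fst p)) - cutG NN (exp (- t) * (\<bar>snd p\<bar> * a * sqrt (LL (fst p))))"

definition psiV :: "real \<Rightarrow> real" where
 "psiV t = exp (\<alpha> * t) * (\<integral>p. cutD t p \<partial>RS)"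

lemma sLL_bounds:
 assumes "LL M > 0"
 shows "0 \<le> \<bar>m\<bar> * a * sqrt (LL M)" "\<bar>m\<bar> * a * sqrt (LL M) < sLL m M" "sLL m M - \<bar>m\<bar> * a * sqrt (LL M) \<le> sqrt (norm C)"
proof -
 define w where "w = \<bar>m\<bar> * a * sqrt (LL M)"
 show w: "0 \<le> w" using a assms by (simp add: w_def)
 have w2: "w\<^sup>2 = (m * a)\<^sup>2 * LL M" using assms by (simp add: w_def power_mult_distrib)
 have s: "sLL m M = sqrt (norm C + w\<^sup>2)" by (simp add: sLL_def w2)
 show "w < sLL m M" unfolding s using norm_C_pos by (intro real_less_rsqrt) simp
 have "sqrt (norm C + w\<^sup>2) \<le> sqrt (norm C) + sqrt (w\<^sup>2)" by (rule sqrt_add_le_add_sqrt) auto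
 then show "sLL m M - w \<le> sqrt (norm C)" unfolding s using w by simp
qed

lemma rs_LL_pos: "AE p in RS. LL (fst p) > 0"
 by (rule rs.AE_pair_measure, measurable) (use rho_LL_pos in \<open>auto elim!: eventually_mono\<close>)

lemma cut_int1: "integrable RS (\<lambda>p. cutG NN (exp (- t) * sLL (snd p) (fst p)))"
proof (rule rs.integrable_const_bound[where B = 1])
 show "AE p in RS. norm (cutG NN (exp (- t) * sLL (snd p) (fst p))) \<le> 1"
  using rs_LL_pos by eventually_elim (auto simp: cutG_01 abs_of_nonneg sLL_def)
qed (simp add: sLL_def)

lemma cut_int2: "integrable RS (\<lambda>p. cutG NN (exp (- t) * (\<bar>snd p\<bar> * a * sqrt (LL (fst p)))))"
proof (rule rs.integrable_const_bound[where B = 1])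
 show "AE p in RS. norm (cutG NN (exp (- t) * (\<bar>snd p\<bar> * a * sqrt (LL (fst p))))) \<le> 1"
  using rs_LL_pos by eventually_elim (use a in \<open>auto simp: cutG_01 abs_of_nonneg\<close>)
qed measurable

text \<open>One step of the recursion turns \<open>LL M\<close> into (m a)^2 \<open>LL M\<close>
  plus the constant \<open>norm C\<close>. Dropping the constant leaves a pure multiplication, which
  is a step of the tilted walk; \<open>psiV\<close> measures what dropping it costs.\<close>

lemma phiV_eq: "phiV t - (\<integral>l. phiV (t - l) \<partial>tau) = psiV t"
proof -
 have 1: "phiV t = exp (\<alpha> * t) * (\<integral>p. cutG NN (exp (- t) * sLL (snd p) (fst p)) \<partial>RS)"
 proof -
  \<comment> \<open>The truncation at 0 makes the integrand nonnegative for every matrix, as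
    \<open>rho_invariant_real\<close> asks; it changes nothing almost everywhere.\<close>
  let ?f = "\<lambda>M. cutG NN (exp (- t) * sqrt (max 0 (LL M)))"
  have i: "integrable rho ?f" by (rule rho.integrable_const_bound[where B = 1]) (auto simp: cutG_01 abs_of_nonneg)
  have "(\<integral>M. cutG NN (exp (- t) * sqrt (LL M)) \<partial>rho) = (\<integral>M. ?f M \<partial>rho)"
   by (rule integral_cong_AE) (use rho_LL_pos in \<open>auto elim!: eventually_mono\<close>)
  also have "... = (\<integral>p. ?f (C + (snd p)\<^sup>2 *\<^sub>R TS (fst p)) \<partial>RS)"
   by (rule rho_invariant_real(2)[OF _ _ i]) (auto simp: cutG_01)
  also have "... = (\<integral>p. cutG NN (exp (- t) * sLL (snd p) (fst p)) \<partial>RS)"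
  proof (rule integral_cong_AE)
   show "(\<lambda>p. ?f (C + (snd p)\<^sup>2 *\<^sub>R TS (fst p))) \<in> borel_measurable RS"
    unfolding LL_step by measurable
   show "AE p in RS. ?f (C + (snd p)\<^sup>2 *\<^sub>R TS (fst p)) = cutG NN (exp (- t) * sLL (snd p) (fst p))"
    using rs_LL_pos by eventually_elim (simp add: LL_step sLL_def)
  qed (simp add: sLL_def)
  finally show ?thesis by (simp add: phiV_def)
 qed
 have 2: "(\<integral>l. phiV (t - l) \<partial>tau) = exp (\<alpha> * t) * (\<integral>p. cutG NN (exp (- t) * (\<bar>snd p\<bar> * a * sqrt (LL (fst p)))) \<partial>RS)"
 proof -
  define g where "g s = (\<integral>M. cutG NN (exp (- s) * sqrt (LL M)) \<partial>rho)" for s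
  have gm: "g \<in> borel_measurable borel" unfolding g_def by measurable
  have "(\<integral>l. phiV (t - l) \<partial>tau) = exp (\<alpha> * t) * (\<integral>m. g (t - ln (\<bar>m\<bar> * a)) \<partial>stdn)"
   unfolding phiV_def g_def[symmetric] by (rule tilt_scaled[OF gm])
  also have "(\<integral>m. g (t - ln (\<bar>m\<bar> * a)) \<partial>stdn) = (\<integral>m. (\<integral>M. cutG NN (exp (- t) * (\<bar>m\<bar> * a * sqrt (LL M))) \<partial>rho) \<partial>stdn)"
  proof (rule integral_cong_AE)
   show "AE m in stdn. g (t - ln (\<bar>m\<bar> * a)) = (\<integral>M. cutG NN (exp (- t) * (\<bar>m\<bar> * a * sqrt (LL M))) \<partial>rho)"
    using stdn_nz
   proof eventually_elim
    case (elim m)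
    then have "exp (- (t - ln (\<bar>m\<bar> * a))) = exp (- t) * (\<bar>m\<bar> * a)"
     using a by (simp add: exp_diff exp_minus divide_inverse mult.commute)
    then show ?case unfolding g_def by (simp add: mult.assoc)
   qed
  qed (use gm in measurable)
  also have "... = (\<integral>p. cutG NN (exp (- t) * (\<bar>snd p\<bar> * a * sqrt (LL (fst p)))) \<partial>RS)"
   using rs.integral_snd[of "\<lambda>M m. cutG NN (exp (- t) * (\<bar>m\<bar> * a * sqrt (LL M)))"] cut_int2[of t]
   by (simp add: case_prod_beta')
  finally show ?thesis .
 qed
 show ?thesis unfolding 1 2 psiV_def
  using cut_int1[of t] cut_int2[of t] by (simp add: right_diff_distrib)
qed

definition KV :: real where
 "KV = 1 + real NN * sqrt (norm C) powr th * (\<integral>p. sLL (snd p) (fst p) powr bet \<partial>RS)"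

lemma sLL_int: "integrable RS (\<lambda>p. sLL (snd p) (fst p) powr bet)"
proof -
 have "integrable rho (\<lambda>M. sqrt (max 0 (LL M)) powr bet)"
  by (rule Bochner_Integration.integrable_cong_AE_imp[OF integrable_LL_powr]) (use rho_LL_pos in \<open>auto elim!: eventually_mono\<close>)
 then have "integrable RS (\<lambda>p. sqrt (max 0 (LL (C + (snd p)\<^sup>2 *\<^sub>R TS (fst p)))) powr bet)"
  by (intro rho_invariant_real(1)) auto
 then show ?thesis
 proof (rule Bochner_Integration.integrable_cong_AE_imp)
  show "AE p in RS. sqrt (max 0 (LL (C + (snd p)\<^sup>2 *\<^sub>R TS (fst p)))) powr bet = sLL (snd p) (fst p) powr bet"
   using rs_LL_pos by eventually_elim (simp add: LL_step sLL_def)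
 qed (simp add: sLL_def)
qed

lemma w_int: "integrable RS (\<lambda>p. (\<bar>snd p\<bar> * a * sqrt (LL (fst p))) powr bet)"
proof (rule Bochner_Integration.integrable_bound[OF sLL_int])
 show "AE p in RS. norm ((\<bar>snd p\<bar> * a * sqrt (LL (fst p))) powr bet) \<le> norm (sLL (snd p) (fst p) powr bet)"
  using rs_LL_pos
 proof eventually_elim
  case (elim p)
  show ?case using sLL_bounds[OF elim, of "snd p"] bet by (simp add: powr_mono2)
 qed
qed measurable

lemma KV1: "KV \<ge> 1" by (simp add: KV_def)

lemma cutD_int: "integrable RS (cutD t)"
 using cut_int1[of t] cut_int2[of t] by simp

lemma cutD_nonneg: "AE p in RS. 0 \<le> cutD t p"
 using rs_LL_pos
proof eventually_elim
 case (elim p)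
 show ?case using sLL_bounds[OF elim, of "snd p"] by (simp add: cutG_mono mult_left_mono)
qed

text \<open>Monotonicity of the cutoff gives the sign. For t \<ge> 0 the Hoelder estimate gives
  decay of order \<open>th + bet\<close> = \<alpha> + eps; for t < 0 the integral is at most 1 and
  exp (\<alpha> t) \<le> exp (eps t).\<close>

lemma psiV_bounds: "0 \<le> psiV t" "psiV t \<le> KV * walk.ee t"
proof -
 note iD = cutD_int and D0 = cutD_nonneg
 from D0 show "0 \<le> psiV t" unfolding psiV_def by (intro mult_nonneg_nonneg integral_nonneg_AE) auto
 have D1: "(\<integral>p. cutD t p \<partial>RS) \<le> 1"
 proof -
  have "(\<integral>p. cutD t p \<partial>RS) \<le> (\<integral>p. 1 \<partial>RS)"
  proof (rule integral_mono_AE[OF iD])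
   show "AE p in RS. cutD t p \<le> 1"
    using rs_LL_pos
   proof eventually_elim
    case (elim p)
    have "0 \<le> cutG NN (exp (- t) * (\<bar>snd p\<bar> * a * sqrt (LL (fst p))))" using sLL_bounds(1)[OF elim, of "snd p"] by (simp add: cutG_01)
    then show ?case using cutG_01(2)[of NN "exp (- t) * sLL (snd p) (fst p)"] by linarith
   qed
  qed simp
  then show ?thesis by (simp add: rs.prob_space)
 qed
 have D2: "(\<integral>p. cutD t p \<partial>RS) \<le> exp (- (th + bet) * t) * (KV - 1)"
 proof -
  have "(\<integral>p. cutD t p \<partial>RS) \<le> (\<integral>p. exp (- (th + bet) * t) * (real NN * sqrt (norm C) powr th) * sLL (snd p) (fst p) powr bet \<partial>RS)"
  proof (rule integral_mono_AE[OF iD])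
   show "AE p in RS. cutD t p \<le> exp (- (th + bet) * t) * (real NN * sqrt (norm C) powr th) * sLL (snd p) (fst p) powr bet"
    using rs_LL_pos
   proof eventually_elim
    case (elim p)
    note b = sLL_bounds[OF elim, of "snd p"]
    let ?s = "sLL (snd p) (fst p)" and ?w = "\<bar>snd p\<bar> * a * sqrt (LL (fst p))"
    have "cutD t p \<le> real NN * (exp (- t) * ?s - exp (- t) * ?w) powr th * (exp (- t) * ?s) powr bet"
     using b th bet NN by (intro cutG_holder) (auto simp: mult_left_mono less_imp_le)
    also have "exp (- t) * ?s - exp (- t) * ?w = exp (- t) * (?s - ?w)" by (simp add: right_diff_distrib)
    also have "(exp (- t) * (?s - ?w)) powr th \<le> (exp (- t) * sqrt (norm C)) powr th"
     using b th by (intro powr_mono2 mult_left_mono) auto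
    also have "real NN * (exp (- t) * sqrt (norm C)) powr th * (exp (- t) * ?s) powr bet
      = (exp (- t) powr th * exp (- t) powr bet) * (real NN * sqrt (norm C) powr th) * ?s powr bet"
     by (simp only: powr_mult mult_ac)
    also have "exp (- t) powr th * exp (- t) powr bet = exp (- (th + bet) * t)"
     by (simp add: powr_def exp_add[symmetric] algebra_simps)
    finally show ?case by (simp add: mult_left_mono mult_right_mono)
   qed
  qed (use sLL_int in simp)
  then show ?thesis by (simp add: KV_def mult.assoc)
 qed
 show "psiV t \<le> KV * walk.ee t"
 proof (cases "t \<ge> 0")
  case True
  have "psiV t \<le> exp (\<alpha> * t) * (exp (- (th + bet) * t) * (KV - 1))" unfolding psiV_def by (rule mult_left_mono[OF D2]) simp
  also have "... = (KV - 1) * exp (- eps * t)"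
  proof -
   have "exp (\<alpha> * t) * exp (- (th + bet) * t) = exp (- eps * t)" unfolding bet(3) by (simp add: exp_add[symmetric] algebra_simps)
   then show ?thesis by (metis mult.assoc mult.commute)
  qed
  also have "... \<le> KV * exp (- eps * t)" by (intro mult_right_mono) auto
  finally show ?thesis using True by (simp add: walk.ee_def)
 next
  case False
  have "psiV t \<le> exp (\<alpha> * t) * 1" unfolding psiV_def by (rule mult_left_mono[OF D1]) simp
  also have "... \<le> exp (eps * t)" using False eps by (simp add: mult_right_mono_neg)
  also have "... \<le> KV * exp (eps * t)" using KV1 by simp
  finally show ?thesis using False by (simp add: walk.ee_def)
 qed
qed

definition CV :: real where "CV = 2 * KV / (eps * walk.c0)"

lemma phiV_bounded: "phiV t \<le> CV"
 unfolding CV_def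
proof (rule walk.subharmonic_bounded[OF phiV_m phiV_nonneg phiV_le])
 show "phiV t \<le> (\<integral>l. phiV (t - l) \<partial>tau) + KV * walk.ee t" for t
  using phiV_eq[of t] psiV_bounds(2)[of t] by linarith
qed (use KV1 in simp)

text \<open>A null limit would make the integral of \<open>psiV\<close> vanish, hence
  \<open>psiV\<close> almost everywhere. But \<open>psiV t\<close> = 0 says that the additive
  constant has no effect at level exp t, which requires |m| a sqrt (LL) to be at least exp t almost
  surely; for large t this contradicts its finite moment of order \<open>bet\<close>.\<close>

lemma phiV_not_null: "\<not> (phiV \<longlongrightarrow> 0) at_top"
proof
 assume lim: "(phiV \<longlongrightarrow> 0) at_top"
 have inv: "((\<lambda>t. phiV (t - l) - phiV t) \<longlongrightarrow> 0) at_top" for l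
 proof -
  have "filterlim (\<lambda>t::real. t - l) at_top at_top" by real_asymp
  from tendsto_diff[OF filterlim_compose[OF lim this] lim] show ?thesis by simp
 qed
 have K: "\<bar>phiV t - (\<integral>l. phiV (t - l) \<partial>tau)\<bar> \<le> KV * walk.ee t" for t
  using phiV_eq[of t] psiV_bounds[of t] by simp
 note H = walk.harmonic_limit[OF phiV_m _ _ K inv, of CV mV]
 have "(phiV \<longlongrightarrow> (\<integral>t. phiV t - (\<integral>l. phiV (t - l) \<partial>tau) \<partial>lborel) / (\<integral>l. l \<partial>tau)) at_top"
  and I: "integrable lborel (\<lambda>t. phiV t - (\<integral>l. phiV (t - l) \<partial>tau))"
  using phiV_nonneg phiV_bounded phiV_le by (auto intro!: H)
 then have "(\<integral>t. psiV t \<partial>lborel) / (\<integral>l. l \<partial>tau) = 0"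
  using tendsto_unique[OF _ _ lim] unfolding phiV_eq by fastforce
 then have "(\<integral>t. psiV t \<partial>lborel) = 0" using walk.mean_pos by simp
 then have ae: "AE t in lborel. psiV t = 0"
  using I psiV_bounds unfolding phiV_eq by (subst (asm) integral_nonneg_eq_0_iff_AE) auto
 define D where "D = (\<integral>p. (\<bar>snd p\<bar> * a * sqrt (LL (fst p))) powr bet \<partial>RS)"
 have "exp (bet * t) \<le> D" if z: "psiV t = 0" for t
 proof -
   have "(\<integral>p. cutD t p \<partial>RS) = 0" using z by (simp add: psiV_def)
  then have "AE p in RS. cutD t p = 0" using cutD_int[of t] cutD_nonneg[of t] by (subst (asm) integral_nonneg_eq_0_iff_AE) auto
  then have big: "AE p in RS. exp (bet * t) \<le> (\<bar>snd p\<bar> * a * sqrt (LL (fst p))) powr bet"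
   using rs_LL_pos
  proof eventually_elim
   case (elim p)
   let ?s = "sLL (snd p) (fst p)" and ?w = "\<bar>snd p\<bar> * a * sqrt (LL (fst p))"
   note b = sLL_bounds[OF elim(2), of "snd p"]
   \<comment> \<open>Below 1 the cutoff is strictly increasing, and the additive constant strictly
     increases its argument.\<close>
   have "exp (- t) * ?w \<ge> 1"
   proof (rule ccontr)
    assume "\<not> ?thesis"
    then have w1: "exp (- t) * ?w < 1" by simp
    have w0: "0 \<le> exp (- t) * ?w" using b by simp
    have ws: "exp (- t) * ?w < exp (- t) * ?s" using b by simp
    have N: "0 < NN" using NN \<alpha> by (cases NN) auto
    have "(exp (- t) * ?w) ^ NN < 1" using w1 w0 N by (simp add: power_less_one_iff)
    moreover have "(exp (- t) * ?w) ^ NN < (exp (- t) * ?s) ^ NN" using ws w0 N by (intro power_strict_mono) auto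
    ultimately have "cutG NN (exp (- t) * ?w) < cutG NN (exp (- t) * ?s)" by (simp add: cutG_def)
    then show False using elim(1) by simp
   qed
   then have "exp t \<le> ?w" by (simp add: exp_minus field_simps)
   then have "exp t powr bet \<le> ?w powr bet" using bet by (intro powr_mono2) auto
   then show ?case by (simp add: powr_def mult.commute)
  qed
  have "exp (bet * t) = (\<integral>p. exp (bet * t) \<partial>RS)" by (simp add: rs.prob_space)
  also have "... \<le> D" unfolding D_def by (rule integral_mono_AE[OF _ w_int big]) simp
  finally show ?thesis .
 qed
 then have "AE t in lborel. exp (bet * t) \<le> D" using ae by (auto elim!: eventually_mono)
 obtain t0 where t0: "exp (bet * t0) > D"
 proof
  have "bet * (D / bet) < exp (bet * (D / bet))" by (rule less_le_trans[OF _ exp_ge_add_one_self]) simp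
  then show "exp (bet * (D / bet)) > D" using bet by simp
 qed
 from \<open>AE t in lborel. exp (bet * t) \<le> D\<close> have "AE t in lborel. t \<notin> {t0<..<t0 + 1}"
 proof eventually_elim
  case (elim t)
  show ?case
  proof
   assume "t \<in> {t0<..<t0 + 1}"
   then have "exp (bet * t0) < exp (bet * t)" using bet by simp
   then show False using elim t0 by linarith
  qed
 qed
 then have "emeasure lborel {t0<..<t0 + 1} = 0"
  by (subst (asm) AE_iff_measurable[where N = "{t0<..<t0 + 1}"]) auto
 then show False by simp
qed

subsection \<open>The density of the stationary law\<close>

definition dd :: real where "dd = real CARD('d)"

definition cG :: "nat \<Rightarrow> real" where
 "cG k = (2 + (8 * real k) ^ k + (8 * real (k + NN)) ^ (k + NN)) / sqrt ((2 * pi * kap) ^ CARD('d))"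

lemma cG_nonneg: "0 \<le> cG k"
 unfolding cG_def using kap(1) by (intro divide_nonneg_nonneg add_nonneg_nonneg zero_le_power) auto

text \<open>Scaling by sqrt L. The number j counts further factors 1 / sqrt L: none for the size of
  a density, two for its Lipschitz bound.\<close>

lemma gauss_profile:
 assumes L: "L > 0" and r: "r > 0"
 shows "exp (- r\<^sup>2 / (2 * L)) / sqrt ((2 * pi * kap * L) ^ CARD('d)) / sqrt L ^ j
  \<le> cG (CARD('d) + j) * cutG NN (sqrt L / r) / r ^ (CARD('d) + j)"
proof -
 define s where "s = r / sqrt L"
 have s: "s > 0" using L r by (simp add: s_def)
 have rs: "r = s * sqrt L" using L by (simp add: s_def)
 let ?k = "CARD('d) + j" and ?c = "sqrt ((2 * pi * kap) ^ CARD('d))"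
 have c: "?c > 0" using kap(1) by simp
 have e: "- r\<^sup>2 / (2 * L) = - s\<^sup>2 / 2" using L by (simp add: rs power_mult_distrib)
 have q: "sqrt ((2 * pi * kap * L) ^ CARD('d)) * sqrt L ^ j = ?c * sqrt L ^ ?k"
  by (simp add: power_mult_distrib real_sqrt_mult real_sqrt_power power_add)
 have lhs: "exp (- r\<^sup>2 / (2 * L)) / sqrt ((2 * pi * kap * L) ^ CARD('d)) / sqrt L ^ j = exp (- s\<^sup>2 / 2) / (?c * sqrt L ^ ?k)"
  unfolding e divide_divide_eq_left q ..
 have "s ^ ?k * exp (- s\<^sup>2 / 2) \<le> s ^ ?k * exp (- s\<^sup>2 / 8)" using s by (intro mult_left_mono) auto
 also have "... \<le> (2 + (8 * real ?k) ^ ?k + (8 * real (?k + NN)) ^ (?k + NN)) * cutG NN (1 / s)" by (rule profile_le_cutG[OF s])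
 also have "2 + (8 * real ?k) ^ ?k + (8 * real (?k + NN)) ^ (?k + NN) = ?c * cG ?k"
  unfolding cG_def by (rule nonzero_mult_div_cancel_left[symmetric, OF less_imp_neq[OF c, symmetric], unfolded times_divide_eq_right[symmetric]])
 finally have 1: "s ^ ?k * exp (- s\<^sup>2 / 2) \<le> ?c * (cG ?k * cutG NN (1 / s))" by (simp only: mult.assoc)
 have "exp (- s\<^sup>2 / 2) / (?c * sqrt L ^ ?k) = (s ^ ?k * exp (- s\<^sup>2 / 2)) / (?c * r ^ ?k)"
  using s by (simp add: rs power_mult_distrib)
 also have "... \<le> ?c * (cG ?k * cutG NN (1 / s)) / (?c * r ^ ?k)"
  using c r by (intro divide_right_mono[OF 1]) auto
 also have "... = cG ?k * cutG NN (1 / s) / r ^ ?k" by (rule mult_divide_mult_cancel_left) (use c in linarith)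
 also have "1 / s = sqrt L / r" by (simp add: s_def)
 finally show ?thesis unfolding lhs .
qed

lemma gdens_good:
 assumes g: "goodS M" "norm C \<le> LL M"
 shows "x \<noteq> 0 \<Longrightarrow> gdens M x \<le> cG CARD('d) * cutG NN (sqrt (LL M) / norm x) / norm x ^ CARD('d)"
  and "0 < r \<Longrightarrow> r \<le> norm x \<Longrightarrow> r \<le> norm y \<Longrightarrow> norm x \<le> R \<Longrightarrow> norm y \<le> R \<Longrightarrow>
   \<bar>gdens M x - gdens M y\<bar> \<le> norm (x - y) * R / kap * (cG (CARD('d) + 2) * cutG NN (sqrt (LL M) / r) / r ^ (CARD('d) + 2))"
proof -
 have L: "LL M > 0" using g norm_C_pos by linarith
 have lo: "kap * LL M * (norm x)\<^sup>2 \<le> x \<bullet> (M *v x)" and up: "x \<bullet> (M *v x) \<le> LL M * (norm x)\<^sup>2" for x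
  using g by (auto simp: goodS_def)
 note pd = goodS_positive_definite[OF g]
 show "x \<noteq> 0 \<Longrightarrow> gdens M x \<le> cG CARD('d) * cutG NN (sqrt (LL M) / norm x) / norm x ^ CARD('d)"
  using gdens_upper[OF pd kap(1) L lo up, of x] gauss_profile[OF L, of "norm x" 0] by simp
 assume r: "0 < r" "r \<le> norm x" "r \<le> norm y" "norm x \<le> R" "norm y \<le> R"
 have "\<bar>gdens M x - gdens M y\<bar> \<le> norm (x - y) * (R / (kap * LL M)) * exp (- r\<^sup>2 / (2 * LL M)) / sqrt ((2 * pi * kap * LL M) ^ CARD('d))"
  using r by (intro gdens_Lipschitz[OF pd kap(1) L lo up]) auto
 also have "... = norm (x - y) * R / kap * (exp (- r\<^sup>2 / (2 * LL M)) / sqrt ((2 * pi * kap * LL M) ^ CARD('d)) / sqrt (LL M) ^ 2)"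
  using L by simp
 also have "... \<le> norm (x - y) * R / kap * (cG (CARD('d) + 2) * cutG NN (sqrt (LL M) / r) / r ^ (CARD('d) + 2))"
  using gauss_profile[OF L r(1), of 2] kap(1) r by (intro mult_left_mono divide_nonneg_pos mult_nonneg_nonneg) auto
 finally show "\<bar>gdens M x - gdens M y\<bar> \<le> norm (x - y) * R / kap * (cG (CARD('d) + 2) * cutG NN (sqrt (LL M) / r) / r ^ (CARD('d) + 2))" .
qed

definition pX :: "real^'d \<Rightarrow> real" where "pX x = (\<integral>M. gdens M x \<partial>rho)"

lemma pX_m[measurable]: "pX \<in> borel_measurable borel"
 unfolding pX_def by measurable

lemma pX_nonneg: "0 \<le> pX x"
 unfolding pX_def using rho_pd by (intro integral_nonneg_AE) (auto elim!: eventually_mono simp: gdens_nn_nonneg)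

lemma cutV_ln: "r > 0 \<Longrightarrow> (\<integral>M. cutG NN (sqrt (LL M) / r) \<partial>rho) \<le> CV * r powr - \<alpha>"
 and cutV_int': "r > 0 \<Longrightarrow> integrable rho (\<lambda>M. cutG NN (sqrt (LL M) / r))"
proof -
 assume r: "r > 0"
 have e: "(\<lambda>M. cutG NN (sqrt (LL M) / r)) = (\<lambda>M. cutG NN (exp (- ln r) * sqrt (LL M)))"
  using r by (simp add: exp_minus divide_inverse mult.commute)
 show "integrable rho (\<lambda>M. cutG NN (sqrt (LL M) / r))" unfolding e by (rule cutV_int) simp
 have "r powr \<alpha> * (\<integral>M. cutG NN (sqrt (LL M) / r) \<partial>rho) \<le> CV"
  using phiV_bounded[of "ln r"] r by (simp only: phiV_def e powr_def) simp
 then show "(\<integral>M. cutG NN (sqrt (LL M) / r) \<partial>rho) \<le> CV * r powr - \<alpha>"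
  using r unfolding powr_minus by (simp only: divide_inverse[symmetric] pos_le_divide_eq powr_gt_zero mult.commute[of _ "r powr \<alpha>"])
qed

lemma gdens_int: "x \<noteq> 0 \<Longrightarrow> integrable rho (\<lambda>M. gdens M x)"
proof (rule Bochner_Integration.integrable_bound)
 assume x: "x \<noteq> 0"
 show "integrable rho (\<lambda>M. cG CARD('d) * cutG NN (sqrt (LL M) / norm x) / norm x ^ CARD('d))"
  using cutV_int'[of "norm x"] x by simp
 show "AE M in rho. norm (gdens M x) \<le> norm (cG CARD('d) * cutG NN (sqrt (LL M) / norm x) / norm x ^ CARD('d))"
  using rho_good
 proof eventually_elim
  case (elim M)
  have "0 \<le> gdens M x" using elim by (simp add: gdens_nn_nonneg goodS_positive_definite)
  moreover have "gdens M x \<le> cG CARD('d) * cutG NN (sqrt (LL M) / norm x) / norm x ^ CARD('d)"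
   using elim x by (intro gdens_good) auto
  ultimately show ?case by (simp only: real_norm_def)
 qed
qed measurable

definition C1 :: real where "C1 = cG CARD('d) * CV"
definition C2 :: real where "C2 = cG (CARD('d) + 2) * CV / kap"

lemma CV_nonneg: "0 \<le> CV"
 using order_trans[OF phiV_nonneg phiV_bounded] .

lemma C12: "0 \<le> C1" "0 \<le> C2"
 using CV_nonneg cG_nonneg kap(1) by (auto simp: C1_def C2_def)

lemma powr_split: "r > 0 \<Longrightarrow> r powr - \<alpha> / r ^ k = r powr - (\<alpha> + real k)"
 by (simp add: powr_diff powr_realpow)

lemma pX_upper: "x \<noteq> 0 \<Longrightarrow> pX x \<le> C1 * norm x powr - (\<alpha> + dd)"
proof -
 assume x: "x \<noteq> 0"
 then have n: "norm x > 0" by simp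
 have "pX x \<le> (\<integral>M. cG CARD('d) / norm x ^ CARD('d) * cutG NN (sqrt (LL M) / norm x) \<partial>rho)"
  unfolding pX_def
 proof (rule integral_mono_AE[OF gdens_int[OF x]])
  show "AE M in rho. gdens M x \<le> cG CARD('d) / norm x ^ CARD('d) * cutG NN (sqrt (LL M) / norm x)"
   using rho_good by eventually_elim (use gdens_good(1)[OF _ _ x] in simp)
 qed (use cutV_int'[OF n] in simp)
 also have "... = cG CARD('d) / norm x ^ CARD('d) * (\<integral>M. cutG NN (sqrt (LL M) / norm x) \<partial>rho)" by simp
 also have "... \<le> cG CARD('d) / norm x ^ CARD('d) * (CV * norm x powr - \<alpha>)"
  using cutV_ln[OF n] cG_nonneg by (intro mult_left_mono) auto
 also have "... = C1 * (norm x powr - \<alpha> / norm x ^ CARD('d))" by (simp add: C1_def)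
 finally show ?thesis unfolding powr_split[OF n] dd_def .
qed

text \<open>The right side scales like the bound in \<open>pX_upper\<close> when x, y, r and R are
  multiplied by a common factor. Hence the rescaled densities are Lipschitz on an annulus uniformly
  in the scale.\<close>

lemma pX_Lipschitz:
 assumes r: "0 < r" "r \<le> norm x" "r \<le> norm y" "norm x \<le> R" "norm y \<le> R"
 shows "\<bar>pX x - pX y\<bar> \<le> C2 * (norm (x - y) * R) * r powr - (\<alpha> + dd + 2)"
proof -
 have xy: "x \<noteq> 0" "y \<noteq> 0" using r by auto
 let ?k = "CARD('d) + 2"
 let ?c = "norm (x - y) * R / kap * (cG ?k / r ^ ?k)"
 have c: "0 \<le> ?c" using r kap(1) cG_nonneg norm_ge_zero[of x] by (intro mult_nonneg_nonneg divide_nonneg_nonneg) auto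
 have "\<bar>pX x - pX y\<bar> = \<bar>\<integral>M. gdens M x - gdens M y \<partial>rho\<bar>" using gdens_int xy by (simp add: pX_def)
 also have "... \<le> (\<integral>M. \<bar>gdens M x - gdens M y\<bar> \<partial>rho)" by (rule integral_abs_bound)
 also have "... \<le> (\<integral>M. ?c * cutG NN (sqrt (LL M) / r) \<partial>rho)"
 proof (rule integral_mono_AE)
  show "AE M in rho. \<bar>gdens M x - gdens M y\<bar> \<le> ?c * cutG NN (sqrt (LL M) / r)"
   using rho_good by eventually_elim (use gdens_good(2)[OF _ _ r] in \<open>simp add: mult_ac\<close>)
 qed (use cutV_int'[OF r(1)] gdens_int xy in auto)
 also have "... = ?c * (\<integral>M. cutG NN (sqrt (LL M) / r) \<partial>rho)" by simp
 also have "... \<le> ?c * (CV * r powr - \<alpha>)" by (rule mult_left_mono[OF cutV_ln[OF r(1)] c])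
 also have "... = C2 * (norm (x - y) * R) * (r powr - \<alpha> / r ^ ?k)" by (simp add: C2_def)
 finally show ?thesis unfolding powr_split[OF r(1)] dd_def by (simp only: of_nat_add of_nat_numeral add.assoc)
qed

lemma lborel_nz: "AE x in lborel. (x :: real^'d) \<noteq> 0"
 using AE_lborel_singleton[of "0 :: real^'d"] .

lemma piX_density: "piX = density lborel (\<lambda>x. ennreal (pX x))"
 unfolding piX_eq_mixX mixX_def
proof (rule density_cong)
 show "AE x in lborel. (\<integral>\<^sup>+M. ennreal (gdens M x) \<partial>rho) = ennreal (pX x)"
  using lborel_nz
 proof eventually_elim
  case (elim x)
  then show ?case unfolding pX_def using gdens_int[OF elim] rho_pd
   by (intro nn_integral_eq_integral) (auto elim!: eventually_mono simp: gdens_nn_nonneg)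
 qed
qed measurable

text \<open>The stationary law is symmetric, so in the recursion m may be replaced by |m|, and only
  ln (|m| a) remains.\<close>

lemma pX_even: "pX (- x) = pX x"
 proof -
 have "A *v (- x) = - (A *v x)" for A :: "real^'d^'d" using linear_neg[OF matrix_vector_mul_linear] .
 then show ?thesis by (simp add: pX_def gdens_def)
qed

lemma sets_piX[measurable_cong, simp]: "sets piX = sets borel" by (simp add: piX_def)

lemma space_piX[simp]: "space piX = UNIV"
 using sets_eq_imp_space_eq[OF sets_piX] by simp

sublocale pix: prob_space piX
 using piX_invariant by (simp add: invariant_def)

lemma piX_integral:
 fixes f :: "real^'d \<Rightarrow> real"
 assumes [measurable]: "f \<in> borel_measurable borel"
 shows "(\<integral>x. f x \<partial>piX) = (\<integral>x. pX x * f x \<partial>lborel)" "integrable piX f \<longleftrightarrow> integrable lborel (\<lambda>x. pX x * f x)"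
 unfolding piX_density by (simp_all add: integral_density integrable_density pX_nonneg)

lemma piX_uminus:
 fixes f :: "real^'d \<Rightarrow> real"
 assumes [measurable]: "f \<in> borel_measurable borel"
 shows "(\<integral>x. f (- x) \<partial>piX) = (\<integral>x. f x \<partial>piX)"
proof -
 have "(\<integral>x. pX (- x) * f (- x) \<partial>lborel) = (\<integral>x. pX x * f x \<partial>(distr lborel borel (\<lambda>x::real^'d. - x)))"
  by (subst integral_distr) auto
 also have "distr lborel borel (\<lambda>x::real^'d. - x) = lborel"
  using lborel_affine[of "-1" "0 :: real^'d"] by (simp add: density_1)
 finally show ?thesis by (simp add: piX_integral pX_even)
qed

text \<open>The density bound at distance r times the volume of the ball of radius R.\<close>

definition annB :: "real \<Rightarrow> real \<Rightarrow> real" where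
 "annB r R = C1 * r powr - (\<alpha> + dd) * (unit_ball_vol dd * R ^ CARD('d))"

lemma annB_nonneg: "0 \<le> R \<Longrightarrow> 0 \<le> annB r R"
 unfolding annB_def using C12 by (intro mult_nonneg_nonneg) (auto simp: dd_def)

text \<open>Uniform in t: the factors exp (\<alpha> t) from the normalisation, exp (- (\<alpha> + d)
  t) from the density and exp (d t) from the volume cancel.\<close>

lemma ann_mass:
 assumes r: "0 < r" "r \<le> R"
 shows "exp (\<alpha> * t) * measure piX {v. r * exp t \<le> norm v \<and> norm v \<le> R * exp t} \<le> annB r R"
proof -
 let ?S = "{v :: real^'d. r * exp t \<le> norm v \<and> norm v \<le> R * exp t}"
 let ?c = "C1 * (r * exp t) powr - (\<alpha> + dd)"
 have c: "0 \<le> ?c" using C12 by simp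
 have Sm[measurable]: "?S \<in> sets borel" by measurable
 have "emeasure piX ?S = (\<integral>\<^sup>+x. ennreal (pX x) * indicator ?S x \<partial>lborel)"
  unfolding piX_density by (rule emeasure_density) auto
 also have "... \<le> (\<integral>\<^sup>+x. ennreal ?c * indicator (cball (0 :: real^'d) (R * exp t)) x \<partial>lborel)"
 proof (intro nn_integral_mono)
  fix x :: "real^'d"
  show "ennreal (pX x) * indicator ?S x \<le> ennreal ?c * indicator (cball 0 (R * exp t)) x"
  proof (cases "x \<in> ?S")
   case True
   have p: "r * exp t > 0" using r by simp
   then have x: "x \<noteq> 0" using True by auto
   have "pX x \<le> C1 * norm x powr - (\<alpha> + dd)" by (rule pX_upper[OF x])
   also have "... \<le> ?c" using True p \<alpha> C12 by (intro mult_left_mono powr_mono2') (auto simp: dd_def)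
   finally show ?thesis using True by (simp add: ennreal_leI)
  qed simp
 qed
 also have "... = ennreal ?c * emeasure lborel (cball (0 :: real^'d) (R * exp t))" by (rule nn_integral_cmult_indicator) simp
 also have "emeasure lborel (cball (0 :: real^'d) (R * exp t)) = ennreal (unit_ball_vol dd * (R * exp t) ^ CARD('d))"
  using r by (subst emeasure_cball) (auto simp: dd_def)
 finally have "measure piX ?S \<le> ?c * (unit_ball_vol dd * (R * exp t) ^ CARD('d))"
  using c r mult_nonneg_nonneg[OF c, of "unit_ball_vol dd * (R * exp t) ^ CARD('d)"]
  by (simp add: pix.emeasure_eq_measure ennreal_mult'[symmetric] dd_def)
 then have "exp (\<alpha> * t) * measure piX ?S \<le> exp (\<alpha> * t) * (?c * (unit_ball_vol dd * (R * exp t) ^ CARD('d)))"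
  by (rule mult_left_mono) simp
 also have "(r * exp t) powr - (\<alpha> + dd) = r powr - (\<alpha> + dd) * exp (- (\<alpha> + dd) * t)"
  using r by (simp add: powr_mult) (simp add: powr_def)
 also have "(R * exp t) ^ CARD('d) = R ^ CARD('d) * exp (dd * t)"
  by (simp add: power_mult_distrib exp_of_nat_mult dd_def)
 also have "exp (\<alpha> * t) * (C1 * (r powr - (\<alpha> + dd) * exp (- (\<alpha> + dd) * t)) * (unit_ball_vol dd * (R ^ CARD('d) * exp (dd * t))))
   = annB r R * (exp (\<alpha> * t) * exp (- (\<alpha> + dd) * t) * exp (dd * t))" by (simp only: annB_def mult_ac)
 also have "exp (\<alpha> * t) * exp (- (\<alpha> + dd) * t) * exp (dd * t) = 1"
  by (simp add: exp_add[symmetric] algebra_simps)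
 finally show ?thesis by simp
qed

end

section \<open>Approximation of limits, and test functions supported in annuli\<close>

lemma (in pair_sigma_finite) integrable_mult_pair:
 fixes f g :: "_ \<Rightarrow> real"
 assumes f: "integrable M1 f" and g: "integrable M2 g"
 shows "integrable (M1 \<Otimes>\<^sub>M M2) (\<lambda>p. f (fst p) * g (snd p))"
proof (rule Fubini_integrable)
 note [measurable] = borel_measurable_integrable[OF f] borel_measurable_integrable[OF g]
 show "(\<lambda>p. f (fst p) * g (snd p)) \<in> borel_measurable (M1 \<Otimes>\<^sub>M M2)" by measurable
qed (use f g in \<open>simp_all add: abs_mult\<close>)

text \<open>It is applied twice: with \<open>Phi\<close> of invariant functions that approximate
  orbit averages, and with local averages that approximate point values of the rescaled
  densities.\<close>

lemma tendsto_approx: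
 fixes f :: "real \<Rightarrow> real"
 assumes "\<And>e. e > 0 \<Longrightarrow> \<exists>g L. (g \<longlongrightarrow> L) at_top \<and> (\<forall>\<^sub>F t in at_top. \<bar>f t - g t\<bar> \<le> e)"
 shows "\<exists>L. (f \<longlongrightarrow> L) at_top"
proof -
 have "\<exists>L. \<forall>\<^sub>F t in at_top. \<bar>f t - L\<bar> < inverse (real (Suc n))" for n
 proof -
  obtain g L where g: "(g \<longlongrightarrow> L) at_top" and e: "\<forall>\<^sub>F t in at_top. \<bar>f t - g t\<bar> \<le> inverse (real (Suc n)) / 2"
   using assms[of "inverse (real (Suc n)) / 2"] by auto
  have "\<forall>\<^sub>F t in at_top. dist (g t) L < inverse (real (Suc n)) / 2" using g by (rule tendstoD) simp
  with e have "\<forall>\<^sub>F t in at_top. \<bar>f t - L\<bar> < inverse (real (Suc n))" by eventually_elim (unfold dist_real_def, linarith)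
  then show ?thesis ..
 qed
 then obtain L where L: "\<And>n. \<forall>\<^sub>F t in at_top. \<bar>f t - L n\<bar> < inverse (real (Suc n))" by metis
 have LL: "\<bar>L n - L k\<bar> < inverse (real (Suc n)) + inverse (real (Suc k))" for n k
 proof -
  have "\<forall>\<^sub>F t::real in at_top. \<bar>L n - L k\<bar> < inverse (real (Suc n)) + inverse (real (Suc k))"
   using eventually_conj[OF L[of n] L[of k]] by (rule eventually_mono) linarith
  then show ?thesis by (simp add: eventually_const)
 qed
 have "Cauchy L"
 proof (rule CauchyI)
  fix e :: real assume "e > 0"
  then obtain N where N: "inverse (real (Suc N)) < e / 2" using reals_Archimedean[of "e / 2"] by auto
  have "norm (L n - L k) < e" if "n \<ge> N" "k \<ge> N" for n k
  proof -
   have "inverse (real (Suc n)) \<le> inverse (real (Suc N))" "inverse (real (Suc k)) \<le> inverse (real (Suc N))"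
    using that by (auto intro!: le_imp_inverse_le)
   then show ?thesis using LL[of n k] N unfolding real_norm_def by linarith
  qed
  then show "\<exists>N. \<forall>n\<ge>N. \<forall>k\<ge>N. norm (L n - L k) < e" by blast
 qed
 then obtain l where l: "L \<longlonglongrightarrow> l" by (auto simp: Cauchy_convergent_iff convergent_def)
 have "(f \<longlongrightarrow> l) at_top"
 proof (rule tendstoI)
  fix e :: real assume e: "e > 0"
  obtain N where N: "inverse (real (Suc N)) < e / 2" using reals_Archimedean[of "e / 2"] e by auto
  obtain n where n: "n \<ge> N" "\<bar>L n - l\<bar> < e / 2"
   using LIMSEQ_D[OF l, of "e / 2"] e by (metis half_gt_zero linear order_refl real_norm_def)
  have "inverse (real (Suc n)) \<le> inverse (real (Suc N))" using n by (auto intro!: le_imp_inverse_le)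
  then show "\<forall>\<^sub>F t in at_top. dist (f t) l < e"
   by (intro eventually_mono[OF L[of n]]) (use n N in \<open>unfold dist_real_def, linarith\<close>)
 qed
 then show ?thesis ..
qed

text \<open>The constants are carried explicitly because the same ones must serve all rotated copies
  of a test function and their averages.\<close>

definition annular :: "real \<Rightarrow> real \<Rightarrow> real \<Rightarrow> real \<Rightarrow> ('v::euclidean_space \<Rightarrow> real) \<Rightarrow> bool" where
 "annular r R F L f \<longleftrightarrow> 0 < r \<and> r \<le> R \<and> (\<forall>v. \<bar>f v\<bar> \<le> F) \<and> (\<forall>v w. \<bar>f v - f w\<bar> \<le> L * norm (v - w)) \<and>
  (\<forall>v. f v \<noteq> 0 \<longrightarrow> r \<le> norm v \<and> norm v \<le> R)"

context
 fixes r R F L :: real and f :: "'v::euclidean_space \<Rightarrow> real"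
 assumes f: "annular r R F L f"
begin

lemma annularD: "0 < r" "r \<le> R" "\<bar>f v\<bar> \<le> F" "\<bar>f v - f w\<bar> \<le> L * norm (v - w)" "f v \<noteq> 0 \<Longrightarrow> r \<le> norm v" "f v \<noteq> 0 \<Longrightarrow> norm v \<le> R"
 using f by (auto simp: annular_def)

lemma annular_nonneg: "0 \<le> F" "0 \<le> L"
proof -
 show "0 \<le> F" using order_trans[OF abs_ge_zero annularD(3)] .
 obtain b :: 'v where "b \<in> Basis" using nonempty_Basis by blast
 then show "0 \<le> L" using order_trans[OF abs_ge_zero annularD(4)[of b 0]] by simp
qed

lemma annular_m: "f \<in> borel_measurable borel"
proof (intro borel_measurable_continuous_onI lipschitz_on_continuous_on)
 show "L-lipschitz_on UNIV f"
  using annularD(4) annular_nonneg by (intro lipschitz_onI) (auto simp: dist_norm)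
qed

text \<open>If y and z are both shorter than r/2, both values of f vanish. Otherwise the weight is
  at least 1, and the plain Hoelder bound may be multiplied by it; the extra order \<beta> is needed
  for a total order above the tail index.\<close>

lemma annular_holder:
 assumes th: "0 < \<theta>" "\<theta> \<le> 1" and b: "0 < \<beta>"
 shows "\<bar>f (y + z) - f y\<bar> \<le> (2 * F + L) * (2 / r) powr \<beta> * (norm z powr \<theta> * (norm y powr \<beta> + norm z powr \<beta>))"
proof (cases "norm y < r / 2 \<and> norm z < r / 2")
 case True
 then have "norm (y + z) < r" using norm_triangle_ineq[of y z] by linarith
 then have "f (y + z) = 0" "f y = 0" using annularD(5)[of "y + z"] annularD(5)[of y] annularD(1) True by force+
 then show ?thesis using annular_nonneg by simp
next
 case False
 have "r / 2 > 0" using annularD(1) by simp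
 with False have "(r / 2) powr \<beta> \<le> norm y powr \<beta> + norm z powr \<beta>"
  using b by (smt (verit) powr_ge_zero powr_mono2)
 then have "(2 / r) powr \<beta> * (r / 2) powr \<beta> \<le> (2 / r) powr \<beta> * (norm y powr \<beta> + norm z powr \<beta>)"
  by (rule mult_left_mono) simp
 then have 1: "1 \<le> (2 / r) powr \<beta> * (norm y powr \<beta> + norm z powr \<beta>)"
  using annularD(1) by (simp add: powr_mult[symmetric])
 have 2: "\<bar>f (y + z) - f y\<bar> \<le> (2 * F + L) * norm z powr \<theta>"
 proof (cases "norm z \<le> 1")
  case True
  have "norm z \<le> norm z powr \<theta>"
   using powr_mono'[of \<theta> 1 "norm z"] th True by (cases "z = 0") auto
  then have "L * norm z \<le> (2 * F + L) * norm z powr \<theta>" using annular_nonneg by (intro mult_mono) auto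
  then show ?thesis using annularD(4)[of "y + z" y] by simp
 next
  case False
  then have "1 \<le> norm z powr \<theta>" using th by (simp add: ge_one_powr_ge_zero)
  then have "(2 * F + L) * 1 \<le> (2 * F + L) * norm z powr \<theta>" using annular_nonneg by (intro mult_left_mono) auto
  then show ?thesis using annularD(3)[of "y + z"] annularD(3)[of y] annular_nonneg unfolding mult_1_right by linarith
 qed
 also have "... \<le> (2 * F + L) * norm z powr \<theta> * ((2 / r) powr \<beta> * (norm y powr \<beta> + norm z powr \<beta>))"
  using mult_left_mono[OF 1, of "(2 * F + L) * norm z powr \<theta>"] annular_nonneg by simp
 finally show ?thesis by (simp only: mult_ac)
qed

end

context bekk
begin

subsection \<open>Convergence of the rescaled laws\<close>

definition Phi :: "(real^'d \<Rightarrow> real) \<Rightarrow> real \<Rightarrow> real" where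
 "Phi f t = exp (\<alpha> * t) * (\<integral>v. f (exp (- t) *\<^sub>R v) \<partial>piX)"

lemma norm_Orth: "norm (Orth *v v) = norm v"
 using norm_A[of v] a by (simp add: A matrix_scaleR_vec)

lemma annular_Orth: "annular r R F L f \<Longrightarrow> annular r R F L (\<lambda>v. f (Orth *v v))"
 unfolding annular_def norm_Orth
 by (auto simp: norm_Orth) (metis norm_Orth matrix_vector_mult_diff_distrib)

lemma annular_integrable: "annular r R F L f \<Longrightarrow> g \<in> borel_measurable N \<Longrightarrow> prob_space N \<Longrightarrow> integrable N (\<lambda>x. f (g x :: real^'d))"
proof -
 assume f: "annular r R F L f" and [measurable]: "g \<in> borel_measurable N" and N: "prob_space N"
 interpret prob_space N by fact
 note [measurable] = annular_m[OF f]
 show "integrable N (\<lambda>x. f (g x))"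
  using annularD(3)[OF f] by (intro integrable_const_bound[where B = F]) auto
qed

lemma Phi_m: "annular r R F L f \<Longrightarrow> Phi f \<in> borel_measurable borel"
proof -
 assume "annular r R F L f"
 note [measurable] = annular_m[OF this]
 show ?thesis unfolding Phi_def by measurable
qed

lemma ann_integral_bound:
 fixes h :: "real^'d \<Rightarrow> real"
 assumes [measurable]: "h \<in> borel_measurable borel" and r: "0 < r" "r \<le> R" and G: "0 \<le> G"
  and h: "\<And>v. \<bar>h v\<bar> \<le> G" "\<And>v. h v \<noteq> 0 \<Longrightarrow> r * exp t \<le> norm v \<and> norm v \<le> R * exp t"
 shows "\<bar>exp (\<alpha> * t) * (\<integral>v. h v \<partial>piX)\<bar> \<le> G * annB r R"
proof -
 let ?S = "{v :: real^'d. r * exp t \<le> norm v \<and> norm v \<le> R * exp t}"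
 have "\<bar>\<integral>v. h v \<partial>piX\<bar> \<le> (\<integral>v. \<bar>h v\<bar> \<partial>piX)" by (rule integral_abs_bound)
 also have "... \<le> (\<integral>v. G * indicator ?S v \<partial>piX)"
 proof (rule integral_mono)
  show "integrable piX (\<lambda>v. \<bar>h v\<bar>)" by (rule pix.integrable_const_bound[where B = G]) (use h in auto)
  show "integrable piX (\<lambda>v. G * indicator ?S v)" by (rule pix.integrable_const_bound[where B = G]) (use G in \<open>auto simp: indicator_def\<close>)
  show "\<bar>h v\<bar> \<le> G * indicator ?S v" for v using h[of v] by (auto simp: indicator_def)
 qed
 also have "... = G * measure piX ?S" by simp
 finally have "exp (\<alpha> * t) * \<bar>\<integral>v. h v \<partial>piX\<bar> \<le> exp (\<alpha> * t) * (G * measure piX ?S)" by (rule mult_left_mono) simp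
 also have "... = G * (exp (\<alpha> * t) * measure piX ?S)" by simp
 also have "... \<le> G * annB r R" by (rule mult_left_mono[OF ann_mass[OF r] G])
 finally show ?thesis by (simp add: abs_mult)
qed

lemma scaled_support:
 "0 < r \<Longrightarrow> r \<le> norm (exp (- t) *\<^sub>R v) \<longleftrightarrow> r * exp t \<le> norm (v :: real^'d)"
 "norm (exp (- t) *\<^sub>R v) \<le> R \<longleftrightarrow> norm v \<le> R * exp t"
 by (simp_all add: exp_minus field_simps)

lemma ann_support:
 assumes f: "annular r R F L f" and nz: "f (exp (- t) *\<^sub>R v) \<noteq> 0"
 shows "r * exp t \<le> norm (v :: real^'d) \<and> norm v \<le> R * exp t"
 using annularD(5,6)[OF f nz] unfolding scaled_support(1)[OF annularD(1)[OF f]] scaled_support(2) ..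

lemma Phi_bound:
 assumes f: "annular r R F L f"
 shows "\<bar>Phi f t\<bar> \<le> F * annB r R"
 unfolding Phi_def
proof (rule ann_integral_bound)
 note [measurable] = annular_m[OF f]
 show "(\<lambda>v. f (exp (- t) *\<^sub>R v)) \<in> borel_measurable borel" by measurable
 show "r * exp t \<le> norm v \<and> norm v \<le> R * exp t" if "f (exp (- t) *\<^sub>R v) \<noteq> 0" for v
  using ann_support[OF f that] .
qed (use annularD[OF f] annular_nonneg[OF f] in auto)

lemma Phi_diff:
 assumes f: "annular r R F L f" and g: "annular r R F L g" and e: "\<And>v. \<bar>f v - g v\<bar> \<le> e"
 shows "\<bar>Phi f t - Phi g t\<bar> \<le> e * annB r R"
proof -
 note [measurable] = annular_m[OF f] annular_m[OF g]
 have "Phi f t - Phi g t = exp (\<alpha> * t) * (\<integral>v. f (exp (- t) *\<^sub>R v) - g (exp (- t) *\<^sub>R v) \<partial>piX)"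
  using annular_integrable[OF f _ pix.prob_space_axioms] annular_integrable[OF g _ pix.prob_space_axioms]
  by (simp add: Phi_def right_diff_distrib)
 also have "\<bar>...\<bar> \<le> e * annB r R"
 proof (rule ann_integral_bound)
  show "r * exp t \<le> norm v \<and> norm v \<le> R * exp t" if "f (exp (- t) *\<^sub>R v) - g (exp (- t) *\<^sub>R v) \<noteq> 0" for v
   using that ann_support[OF f, of t v] ann_support[OF g, of t v] by force
 qed (use annularD[OF f] e order_trans[OF abs_ge_zero e] in auto)
 finally show ?thesis .
qed

definition mX :: real where "mX = (\<integral>v. norm v powr bet \<partial>piX)"

lemma mX_int: "integrable piX (\<lambda>v. norm v powr bet)"
 using perp_X_moment(2)[of bet] bet by (intro integrableI_nonneg) auto

lemma Phi_exp:
 assumes f: "annular r R F L f"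
 shows "\<bar>Phi f t\<bar> \<le> F * (1 / r) powr bet * mX * exp (eps * t)"
proof -
 note [measurable] = annular_m[OF f]
 let ?c = "F * (1 / r) powr bet * exp (- t) powr bet"
 have "\<bar>\<integral>v. f (exp (- t) *\<^sub>R v) \<partial>piX\<bar> \<le> (\<integral>v. \<bar>f (exp (- t) *\<^sub>R v)\<bar> \<partial>piX)" by (rule integral_abs_bound)
 also have "... \<le> (\<integral>v. ?c * norm v powr bet \<partial>piX)"
 proof (rule integral_mono)
  show "integrable piX (\<lambda>v. \<bar>f (exp (- t) *\<^sub>R v)\<bar>)" using annular_integrable[OF f _ pix.prob_space_axioms] by simp
  show "integrable piX (\<lambda>v. ?c * norm v powr bet)" using mX_int by simp
  fix v :: "real^'d"
  let ?x = "exp (- t) *\<^sub>R v"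
  have e: "?c * norm v powr bet = F * (norm ?x / r) powr bet" using annularD(1)[OF f] by (simp add: powr_mult powr_divide)
  show "\<bar>f ?x\<bar> \<le> ?c * norm v powr bet"
  proof (cases "f ?x = 0")
   case False
   then have "1 \<le> norm ?x / r" using annularD(5)[OF f False] annularD(1)[OF f] by simp
   then have "1 \<le> (norm ?x / r) powr bet" using bet by (simp add: ge_one_powr_ge_zero del: norm_scaleR)
   then have "F * 1 \<le> F * (norm ?x / r) powr bet" using annular_nonneg[OF f] by (intro mult_left_mono)
   then show ?thesis unfolding e using annularD(3)[OF f, of ?x] by linarith
  qed (use annular_nonneg[OF f] in simp)
 qed
 also have "... = ?c * mX" by (simp add: mX_def)
 finally have "exp (\<alpha> * t) * \<bar>\<integral>v. f (exp (- t) *\<^sub>R v) \<partial>piX\<bar> \<le> exp (\<alpha> * t) * (?c * mX)" by (rule mult_left_mono) simp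
 also have "... = F * (1 / r) powr bet * mX * (exp (\<alpha> * t) * exp (- t) powr bet)" by (simp only: mult_ac)
 also have "exp (\<alpha> * t) * exp (- t) powr bet = exp (eps * t)"
  by (simp add: powr_def exp_add[symmetric] bet_def algebra_simps)
 finally show ?thesis by (simp add: Phi_def abs_mult)
qed

definition LamP :: "real \<Rightarrow> real \<Rightarrow> real \<Rightarrow> real \<Rightarrow> real" where
 "LamP r R F L = (3 * L * R + \<alpha> * F) * annB (r * exp (- 1)) R + 2 * F * annB r R"

text \<open>For time steps of length at most 1 the two scaled supports lie in one annulus, with
  inner radius reduced by the factor exp (- 1); longer steps follow from boundedness. The two
  summands of \<open>LamP\<close> stem from these two cases.\<close>

lemma Phi_Lipschitz_step:
 assumes f: "annular r R F L f" and st: "s < t"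
 shows "\<bar>Phi f t - Phi f s\<bar> \<le> LamP r R F L * (t - s)"
proof (cases "t \<le> s + 1")
 case True
 note d = annularD[OF f] and n = annular_nonneg[OF f]
 note [measurable] = annular_m[OF f]
 let ?h = "\<lambda>v. f (exp (- t) *\<^sub>R v) - exp (\<alpha> * (s - t)) * f (exp (- s) *\<^sub>R v)"
 let ?G = "(3 * L * R + \<alpha> * F) * (t - s)"
 have R0: "0 \<le> R" using d(1,2) by simp
 have "exp (\<alpha> * t) * exp (\<alpha> * (s - t)) = exp (\<alpha> * s)" by (simp add: exp_add[symmetric] algebra_simps)
 then have "Phi f t - Phi f s = exp (\<alpha> * t) * (\<integral>v. ?h v \<partial>piX)"
  using annular_integrable[OF f _ pix.prob_space_axioms] by (simp add: Phi_def right_diff_distrib mult.assoc[symmetric])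
 also have "\<bar>...\<bar> \<le> ?G * annB (r * exp (- 1)) R"
 proof (rule ann_integral_bound)
  show "0 < r * exp (- 1)" using d(1) by simp
  have "r * exp (- 1) \<le> r * 1" using d(1) by (intro mult_left_mono) auto
  then show "r * exp (- 1) \<le> R" using d(2) by linarith
  show "0 \<le> ?G" using n R0 \<alpha> st by simp
  have sup: "r * exp (- 1) * exp t \<le> norm v \<and> norm v \<le> R * exp t"
   if nz: "f (exp (- t) *\<^sub>R v) \<noteq> 0 \<or> f (exp (- s) *\<^sub>R v) \<noteq> 0" for v
  proof -
   have "r * exp s \<le> norm v \<and> norm v \<le> R * exp t"
    using nz
   proof
    assume "f (exp (- t) *\<^sub>R v) \<noteq> 0"
    then have "r * exp t \<le> norm v" "norm v \<le> R * exp t" using ann_support[OF f] by blast+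
    moreover have "r * exp s \<le> r * exp t" using d(1) st by simp
    ultimately show ?thesis by linarith
   next
    assume "f (exp (- s) *\<^sub>R v) \<noteq> 0"
    then have "r * exp s \<le> norm v" "norm v \<le> R * exp s" using ann_support[OF f] by blast+
    moreover have "R * exp s \<le> R * exp t" using R0 st by (intro mult_left_mono) auto
    ultimately show ?thesis by linarith
   qed
   moreover have "r * exp (- 1) * exp t \<le> r * exp s" using d(1) True by (simp add: mult.assoc exp_add[symmetric])
   ultimately show ?thesis by linarith
  qed
  then show "?h v \<noteq> 0 \<Longrightarrow> r * exp (- 1) * exp t \<le> norm v \<and> norm v \<le> R * exp t" for v by force
  show "\<bar>?h v\<bar> \<le> ?G" for v
  proof (cases "f (exp (- t) *\<^sub>R v) \<noteq> 0 \<or> f (exp (- s) *\<^sub>R v) \<noteq> 0")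
   case nz: True
   have "\<bar>f (exp (- t) *\<^sub>R v) - f (exp (- s) *\<^sub>R v)\<bar> \<le> L * ((exp (- s) - exp (- t)) * norm v)"
   proof -
    have "norm (exp (- t) *\<^sub>R v - exp (- s) *\<^sub>R v) = (exp (- s) - exp (- t)) * norm v"
     using st by (simp add: scaleR_diff_left[symmetric])
    then show ?thesis using d(4)[of "exp (- t) *\<^sub>R v" "exp (- s) *\<^sub>R v"] by simp
   qed
   also have "(exp (- s) - exp (- t)) * norm v \<le> (exp (- s) - exp (- t)) * (R * exp t)"
    using sup[OF nz] st by (intro mult_left_mono) auto
   also have "... = R * (exp (t - s) - 1)" by (simp add: left_diff_distrib exp_add[symmetric] algebra_simps exp_diff)
   also have "... \<le> R * (3 * (t - s))"
   proof (rule mult_left_mono[OF _ R0])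
    \<comment> \<open>From 1 - u \<le> exp (- u) follows exp u - 1 \<le> u exp u, which is at most 3
      u for 0 < u \<le> 1.\<close>
    have "1 + - (t - s) \<le> exp (- (t - s))" by (rule exp_ge_add_one_self)
    then have "exp (t - s) * (1 + - (t - s)) \<le> exp (t - s) * exp (- (t - s))" by (rule mult_left_mono) simp
    also have "exp (t - s) * exp (- (t - s)) = 1" by (simp add: exp_add[symmetric])
    finally have "exp (t - s) * (1 + - (t - s)) \<le> 1" .
    then have "exp (t - s) - 1 \<le> exp (t - s) * (t - s)" by (simp add: algebra_simps)
    also have "exp (t - s) \<le> exp 1" using True by simp
    also have "exp 1 \<le> (3 :: real)" by (rule exp_le)
    finally show "exp (t - s) - 1 \<le> 3 * (t - s)" using st by (simp add: mult_right_mono)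
   qed
   finally have 1: "\<bar>f (exp (- t) *\<^sub>R v) - f (exp (- s) *\<^sub>R v)\<bar> \<le> L * (R * (3 * (t - s)))"
    using n by (simp add: mult_left_mono)
   have "1 + \<alpha> * (s - t) \<le> exp (\<alpha> * (s - t))" by (rule exp_ge_add_one_self)
   moreover have "exp (\<alpha> * (s - t)) \<le> 1" using st \<alpha> by (simp add: mult_le_0_iff)
   ultimately have "\<bar>(1 - exp (\<alpha> * (s - t))) * f (exp (- s) *\<^sub>R v)\<bar> \<le> (\<alpha> * (t - s)) * F"
    unfolding abs_mult using d(3) \<alpha> st by (intro mult_mono) (auto simp: algebra_simps)
   with 1 show ?thesis by (simp add: algebra_simps) 
  qed (use \<open>0 \<le> ?G\<close> in simp)
 qed measurable
 also have "... \<le> LamP r R F L * (t - s)"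
 proof -
  have "0 \<le> 2 * F * annB r R * (t - s)" using n st annB_nonneg[OF R0, of r] by simp
  then show ?thesis by (simp add: LamP_def algebra_simps)
 qed
 finally show ?thesis .
next
 case False
 note d = annularD[OF f] and n = annular_nonneg[OF f]
 have R0: "0 \<le> R" using d(1,2) by simp
 have "\<bar>Phi f t - Phi f s\<bar> \<le> 2 * F * annB r R * 1" using Phi_bound[OF f, of t] Phi_bound[OF f, of s] by linarith
 also have "... \<le> LamP r R F L * (t - s)"
  using False n R0 \<alpha> annB_nonneg[OF R0] by (intro mult_mono) (auto simp: LamP_def)
 finally show ?thesis .
qed

lemma Phi_Lipschitz:
 assumes f: "annular r R F L f"
 shows "\<bar>Phi f s - Phi f t\<bar> \<le> LamP r R F L * \<bar>s - t\<bar>"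
 using Phi_Lipschitz_step[OF f, of s t] Phi_Lipschitz_step[OF f, of t s] by (cases s t rule: linorder_cases) (auto simp: abs_minus_commute)

sublocale pm: pair_prob_space piX "MQ" ..

abbreviation "PM \<equiv> piX \<Otimes>\<^sub>M MQ"
abbreviation "mA p \<equiv> fst (snd p) *\<^sub>R (A *v fst p)"

lemma piX_distr: "distr PM borel (\<lambda>p. mA p + snd (snd p)) = piX"
proof (rule measure_eqI)
 fix B assume "B \<in> sets (distr PM borel (\<lambda>p. mA p + snd (snd p)))"
 then have [measurable]: "B \<in> sets borel" by simp
 have "emeasure (distr PM borel (\<lambda>p. mA p + snd (snd p))) B = (\<integral>\<^sup>+x. indicator B x \<partial>distr PM borel (\<lambda>p. mA p + snd (snd p)))" by simp
 also have "... = (\<integral>\<^sup>+p. indicator B (mA p + snd (snd p)) \<partial>PM)" by (rule nn_integral_distr) measurable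
 also have "... = (\<integral>\<^sup>+v. \<integral>\<^sup>+y. indicator B (fst y *\<^sub>R (A *v v) + snd y) \<partial>MQ \<partial>piX)"
 proof -
  have m: "(\<lambda>p. indicator B (mA p + snd (snd p)) :: ennreal) \<in> borel_measurable PM" by measurable
  show ?thesis using mq.nn_integral_fst[OF m] by simp
 qed
 also have "... = (\<integral>\<^sup>+v. indicator B v \<partial>piX)"
 proof -
  have "\<forall>f \<in> borel_measurable borel. (\<integral>\<^sup>+v. f v \<partial>piX) = (\<integral>\<^sup>+v. \<integral>\<^sup>+x. f x \<partial>K v \<partial>piX)"
   using piX_invariant unfolding invariant_def by blast
  then have "(\<integral>\<^sup>+v. indicator B v \<partial>piX) = (\<integral>\<^sup>+v. \<integral>\<^sup>+x. indicator B x \<partial>K v \<partial>piX)" by (rule bspec) measurable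
  then show ?thesis by (simp only: nn_K[OF borel_measurable_indicator[OF \<open>B \<in> sets borel\<close>]])
 qed
 finally show "emeasure (distr PM borel (\<lambda>p. mA p + snd (snd p))) B = emeasure piX B" by simp
qed simp

definition JJ :: real where "JJ = (\<integral>p. norm (snd (snd p)) powr th * (norm (mA p) powr bet + norm (snd (snd p)) powr bet) \<partial>PM)"

text \<open>The state enters with order \<open>bet\<close> < \<alpha> only, and the Gaussian
  variables m and Q have moments of all positive orders.\<close>

lemma JJ_int: "integrable PM (\<lambda>p. norm (snd (snd p)) powr th * (norm (mA p) powr bet + norm (snd (snd p)) powr bet))"
proof -
 have g: "integrable \<gamma> (\<lambda>q. norm q powr p)" if "p > 0" for p
  using centered_normal_moment[OF C that] by (intro integrableI_nonneg) auto
 have m: "integrable stdn (\<lambda>m. (\<bar>m\<bar> * a) powr bet)" using nmom_integrable[of bet a] bet a by simp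
 have "integrable PM (\<lambda>p. norm (fst p) powr bet * ((\<bar>fst (snd p)\<bar> * a) powr bet * norm (snd (snd p)) powr th))"
  by (intro pm.integrable_mult_pair mX_int mq.integrable_mult_pair m g th)
 moreover have "integrable PM (\<lambda>p. 1 * (1 * norm (snd (snd p)) powr (th + bet)))"
  by (intro pm.integrable_mult_pair[of "\<lambda>_. 1"] mq.integrable_mult_pair[of "\<lambda>_. 1"] g) (use th bet in auto)
 ultimately have "integrable PM (\<lambda>p. norm (fst p) powr bet * ((\<bar>fst (snd p)\<bar> * a) powr bet * norm (snd (snd p)) powr th)
   + 1 * (1 * norm (snd (snd p)) powr (th + bet)))" by (rule Bochner_Integration.integrable_add)
 also have "(\<lambda>p. norm (fst p) powr bet * ((\<bar>fst (snd p)\<bar> * a) powr bet * norm (snd (snd p)) powr th)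
   + 1 * (1 * norm (snd (snd p)) powr (th + bet)))
  = (\<lambda>p. norm (snd (snd p)) powr th * (norm (mA p) powr bet + norm (snd (snd p)) powr bet))"
  using a by (simp add: norm_A powr_mult powr_add algebra_simps)
 finally show ?thesis .
qed

definition KP :: "real \<Rightarrow> real \<Rightarrow> real \<Rightarrow> real" where
 "KP r F L = (2 * F + L) * (2 / r) powr bet * JJ + 2 * F"

lemma JJ_nonneg: "0 \<le> JJ" unfolding JJ_def by (intro integral_nonneg_AE) auto

text \<open>In law the state is m A X + Q. Removing Q costs a Hoelder error with the moment
  \<open>JJ\<close>; what remains is |m| a Orth X up to sign, a step of the tilted walk together
  with one rotation of the test function. The summand 2 F of \<open>KP\<close> serves negative
  t.\<close>

lemma Phi_step:
 assumes f: "annular r R F L f"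
 shows "\<bar>Phi f t - (\<integral>l. Phi (\<lambda>v. f (Orth *v v)) (t - l) \<partial>tau)\<bar> \<le> KP r F L * walk.ee t"
proof -
 note [measurable] = annular_m[OF f]
 note d = annularD[OF f] and n = annular_nonneg[OF f]
 let ?e = "exp (- t)"
 let ?D = "\<lambda>p. f (?e *\<^sub>R (mA p + snd (snd p))) - f (?e *\<^sub>R mA p)"
 have 1: "Phi f t = exp (\<alpha> * t) * (\<integral>p. f (?e *\<^sub>R (mA p + snd (snd p))) \<partial>PM)"
  unfolding Phi_def by (subst piX_distr[symmetric], subst integral_distr) auto
 have 2: "(\<integral>l. Phi (\<lambda>v. f (Orth *v v)) (t - l) \<partial>tau) = exp (\<alpha> * t) * (\<integral>p. f (?e *\<^sub>R mA p) \<partial>PM)"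
 proof -
  define g where "g s = (\<integral>v. f (Orth *v (exp (- s) *\<^sub>R v)) \<partial>piX)" for s
  have gm: "g \<in> borel_measurable borel" unfolding g_def by measurable
  define G where "G m = (\<integral>v. f (?e *\<^sub>R (m *\<^sub>R (A *v v))) \<partial>piX)" for m
  have Gm: "G \<in> borel_measurable borel" unfolding G_def by measurable
  have "(\<integral>l. Phi (\<lambda>v. f (Orth *v v)) (t - l) \<partial>tau) = exp (\<alpha> * t) * (\<integral>m. g (t - ln (\<bar>m\<bar> * a)) \<partial>stdn)"
   unfolding Phi_def g_def[symmetric] by (rule tilt_scaled[OF gm])
  also have "(\<integral>m. g (t - ln (\<bar>m\<bar> * a)) \<partial>stdn) = (\<integral>m. G m \<partial>stdn)"
  proof (rule integral_cong_AE)
   show "AE m in stdn. g (t - ln (\<bar>m\<bar> * a)) = G m"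
    using stdn_nz
   proof eventually_elim
    case (elim m)
    have "exp (- (t - ln (\<bar>m\<bar> * a))) = ?e * \<bar>m\<bar> * a"
     using elim a by (simp add: exp_diff exp_minus divide_inverse mult.commute)
    then have e: "Orth *v (exp (- (t - ln (\<bar>m\<bar> * a))) *\<^sub>R v) = (?e * \<bar>m\<bar>) *\<^sub>R (A *v v)" for v
     by (simp add: A matrix_scaleR_vec matrix_vector_mult_scaleR)
    show ?case
    proof (cases "m \<ge> 0")
     case False
     have "A *v (- v) = - (A *v v)" for v using linear_neg[OF matrix_vector_mul_linear] .
     then have "(\<integral>v. f ((?e * \<bar>m\<bar>) *\<^sub>R (A *v v)) \<partial>piX) = (\<integral>v. f ((?e * m) *\<^sub>R (A *v (- v))) \<partial>piX)" using False by simp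
     also have "... = (\<integral>v. f ((?e * m) *\<^sub>R (A *v v)) \<partial>piX)" by (rule piX_uminus) measurable
     finally show ?thesis unfolding g_def G_def e by simp
    next
     case True
     show ?thesis unfolding g_def G_def e using True by simp
    qed
   qed
  qed (use gm Gm in measurable)
  also have "... = (\<integral>y. G (fst y) \<partial>MQ)"
  proof -
   have "distr MQ stdn fst = stdn" by (rule gam.distr_pair_fst)
   then have "(\<integral>m. G m \<partial>stdn) = (\<integral>m. G m \<partial>distr MQ stdn fst)" by (simp only:)
   also have "... = (\<integral>y. G (fst y) \<partial>MQ)" by (rule integral_distr) (use Gm in measurable)
   finally show ?thesis .
  qed
  also have "... = (\<integral>p. f (?e *\<^sub>R mA p) \<partial>PM)"
   unfolding G_def using pm.integral_snd[of "\<lambda>v y. f (?e *\<^sub>R (fst y *\<^sub>R (A *v v)))"]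
    annular_integrable[OF f _ pm.prob_space_axioms, of "\<lambda>p. ?e *\<^sub>R mA p"]
   by (simp add: case_prod_beta')
  finally show ?thesis .
 qed
 have i: "integrable PM (\<lambda>p. f (?e *\<^sub>R (mA p + snd (snd p))))" "integrable PM (\<lambda>p. f (?e *\<^sub>R mA p))"
  by (rule annular_integrable[OF f _ pm.prob_space_axioms], measurable)+
 then have iD: "integrable PM ?D" by simp
 have 3: "Phi f t - (\<integral>l. Phi (\<lambda>v. f (Orth *v v)) (t - l) \<partial>tau) = exp (\<alpha> * t) * (\<integral>p. ?D p \<partial>PM)"
  unfolding 1 2 Bochner_Integration.integral_diff[OF i] by (rule right_diff_distrib[symmetric])
 have K: "0 \<le> (2 * F + L) * (2 / r) powr bet * JJ" using n JJ_nonneg by simp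
 show ?thesis
 proof (cases "t \<ge> 0")
  case True
  let ?H = "(2 * F + L) * (2 / r) powr bet"
  have "\<bar>\<integral>p. ?D p \<partial>PM\<bar> \<le> (\<integral>p. \<bar>?D p\<bar> \<partial>PM)" by (rule integral_abs_bound)
  also have "... \<le> (\<integral>p. ?H * ?e powr (th + bet) * (norm (snd (snd p)) powr th * (norm (mA p) powr bet + norm (snd (snd p)) powr bet)) \<partial>PM)"
  proof (rule integral_mono)
   show "integrable PM (\<lambda>p. ?H * ?e powr (th + bet) * (norm (snd (snd p)) powr th * (norm (mA p) powr bet + norm (snd (snd p)) powr bet)))"
    using JJ_int by (rule integrable_mult_right)
   fix p
   have "\<bar>?D p\<bar> \<le> ?H * (norm (?e *\<^sub>R snd (snd p)) powr th * (norm (?e *\<^sub>R mA p) powr bet + norm (?e *\<^sub>R snd (snd p)) powr bet))"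
    using annular_holder[OF f th(1,2) bet(1), of "?e *\<^sub>R mA p" "?e *\<^sub>R snd (snd p)"] by (simp only: scaleR_add_right)
   moreover have sc: "norm (?e *\<^sub>R x) powr s = ?e powr s * norm x powr s" for x :: "real^'d" and s by (simp add: powr_mult)
   ultimately show "\<bar>?D p\<bar> \<le> ?H * ?e powr (th + bet) * (norm (snd (snd p)) powr th * (norm (mA p) powr bet + norm (snd (snd p)) powr bet))"
    by (simp only: sc powr_add distrib_left distrib_right mult_ac)
  qed (use iD in simp)
  also have "... = ?H * ?e powr (th + bet) * JJ" by (simp add: JJ_def)
  finally have "exp (\<alpha> * t) * \<bar>\<integral>p. ?D p \<partial>PM\<bar> \<le> exp (\<alpha> * t) * (?H * ?e powr (th + bet) * JJ)" by (rule mult_left_mono) simp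
  also have "... = ?H * JJ * (exp (\<alpha> * t) * ?e powr (th + bet))" by (simp only: mult_ac)
  also have "exp (\<alpha> * t) * ?e powr (th + bet) = exp (- eps * t)"
   unfolding bet(3) by (simp add: powr_def exp_add[symmetric] algebra_simps)
  also have "?H * JJ * exp (- eps * t) \<le> KP r F L * exp (- eps * t)" using n by (intro mult_right_mono) (auto simp: KP_def)
  finally show ?thesis unfolding 3 using True by (simp add: abs_mult walk.ee_def)
 next
  case False
  have "\<bar>\<integral>p. ?D p \<partial>PM\<bar> \<le> (\<integral>p. \<bar>?D p\<bar> \<partial>PM)" by (rule integral_abs_bound)
  also have "... \<le> (\<integral>p. 2 * F \<partial>PM)"
  proof (rule integral_mono)
   show "\<bar>?D p\<bar> \<le> 2 * F" for p using d(3)[of "?e *\<^sub>R (mA p + snd (snd p))"] d(3)[of "?e *\<^sub>R mA p"] by linarith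
  qed (use iD in simp_all)
  also have "... = 2 * F" by (simp add: pm.prob_space)
  also have "... \<le> KP r F L" using K by (simp add: KP_def)
  finally have "exp (\<alpha> * t) * \<bar>\<integral>p. ?D p \<partial>PM\<bar> \<le> exp (eps * t) * KP r F L"
   using False eps by (intro mult_mono) (auto simp: mult_right_mono_neg)
  then show ?thesis unfolding 3 using False by (simp add: abs_mult walk.ee_def mult.commute)
 qed
qed

abbreviation "Opow k \<equiv> ((*v) Orth ^^ k)"

lemma annular_Opow: "annular r R F L f \<Longrightarrow> annular r R F L (\<lambda>v. f (Opow k v))"
proof (induction k)
 case (Suc k)
 from annular_Orth[OF Suc.IH[OF Suc.prems]] show ?case by (simp add: funpow_swap1)
qed simp

text \<open>The levels of \<open>harmonic_asymp_invariant\<close> are the test function composed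
  with the powers of \<open>Orth\<close>; one set of constants serves them all because
  \<open>Orth\<close> is an isometry.\<close>

lemma Phi_shift:
 assumes f: "annular r R F L f"
 shows "((\<lambda>t. Phi (\<lambda>v. f (Orth *v v)) (t - l) - Phi f t) \<longlongrightarrow> 0) at_top"
proof -
 define \<phi> where "\<phi> k = Phi (\<lambda>v. f (Opow k v))" for k
 note fk = annular_Opow[OF f]
 have "((\<lambda>t. \<phi> (Suc 0) (t - l) - \<phi> 0 t) \<longlongrightarrow> 0) at_top"
 proof (rule walk.harmonic_asymp_invariant)
  show "\<phi> k \<in> borel_measurable borel" for k unfolding \<phi>_def by (rule Phi_m[OF fk])
  show "\<bar>\<phi> k t\<bar> \<le> F * annB r R" for k t unfolding \<phi>_def by (rule Phi_bound[OF fk])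
  show "\<bar>\<phi> k t - (\<integral>l. \<phi> (Suc k) (t - l) \<partial>tau)\<bar> \<le> KP r F L * walk.ee t" for k t
   using Phi_step[OF fk[of k], of t] by (simp add: \<phi>_def funpow_swap1)
  show "\<bar>\<phi> k s - \<phi> k t\<bar> \<le> LamP r R F L * \<bar>s - t\<bar>" for k s t unfolding \<phi>_def by (rule Phi_Lipschitz[OF fk])
 qed
 then show ?thesis by (simp add: \<phi>_def)
qed

text \<open>A zero shift in \<open>Phi_shift\<close> compares a test function with its rotated copy
  at the same scale.\<close>

lemma Phi_Opow_diff:
 assumes f: "annular r R F L f"
 shows "((\<lambda>t. Phi (\<lambda>v. f (Opow k v)) t - Phi f t) \<longlongrightarrow> 0) at_top"
proof (induction k)
 case (Suc k)
 have "((\<lambda>t. (Phi (\<lambda>v. f (Opow (Suc k) v)) t - Phi (\<lambda>v. f (Opow k v)) t) + (Phi (\<lambda>v. f (Opow k v)) t - Phi f t)) \<longlongrightarrow> 0 + 0) at_top"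
  by (intro tendsto_add Suc.IH) (use Phi_shift[OF annular_Opow[OF f, of k], of 0] in \<open>simp add: funpow_swap1\<close>)
 then show ?case by simp
qed simp

lemma Phi_invariant_converges:
 assumes f: "annular r R F L f" and inv: "\<And>v. f (Orth *v v) = f v"
 shows "\<exists>l. (Phi f \<longlongrightarrow> l) at_top"
proof (rule exI, rule walk.harmonic_limit(1)[OF Phi_m[OF f] Phi_bound[OF f] Phi_exp[OF f]])
 show "\<bar>Phi f t - (\<integral>l. Phi f (t - l) \<partial>tau)\<bar> \<le> KP r F L * walk.ee t" for t
  using Phi_step[OF f, of t] by (simp add: inv)
 show "((\<lambda>t. Phi f (t - l) - Phi f t) \<longlongrightarrow> 0) at_top" for l
  using Phi_shift[OF f, of l] by (simp add: inv)
qed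

definition Oavg :: "nat \<Rightarrow> (real^'d \<Rightarrow> real) \<Rightarrow> real^'d \<Rightarrow> real" where
 "Oavg n f v = (\<Sum>k<Suc n. f (Opow k v)) / real (Suc n)"

lemma annular_Oavg:
 assumes f: "annular r R F L f"
 shows "annular r R F L (Oavg n f)"
proof -
 note d = annularD[OF annular_Opow[OF f]]
 have avg: "\<bar>(\<Sum>k<Suc n. g k) / real (Suc n)\<bar> \<le> B" if g: "\<And>k. \<bar>g k\<bar> \<le> B" for g :: "nat \<Rightarrow> real" and B
 proof -
  have "\<bar>\<Sum>k<Suc n. g k\<bar> \<le> (\<Sum>k<Suc n. \<bar>g k\<bar>)" by (rule sum_abs)
  also have "... \<le> real (card {..<Suc n}) * B" using g by (intro sum_bounded_above) auto
  finally show ?thesis by (simp add: abs_divide pos_divide_le_eq mult.commute)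
 qed
 have "r \<le> norm v \<and> norm v \<le> R" if "Oavg n f v \<noteq> 0" for v
 proof -
  have "\<exists>k. f (Opow k v) \<noteq> 0"
  proof (rule ccontr)
   assume "\<nexists>k. f (Opow k v) \<noteq> 0"
   then show False using that by (simp add: Oavg_def)
  qed
  then obtain k where "f (Opow k v) \<noteq> 0" ..
  then show ?thesis using d(5,6)[of k v] by blast
 qed
 moreover have "\<bar>Oavg n f v - Oavg n f w\<bar> \<le> L * norm (v - w)" for v w
  unfolding Oavg_def diff_divide_distrib[symmetric] sum_subtractf[symmetric] by (rule avg) (rule d(4))
 moreover have "\<bar>Oavg n f v\<bar> \<le> F" for v unfolding Oavg_def by (rule avg) (rule d(3))
 ultimately show ?thesis using d(1,2) by (auto simp: annular_def)
qed

text \<open>A mean ergodic theorem for the isometry \<open>Orth\<close>, by compactness.\<close>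

lemma Oavg_limit:
 assumes f: "annular r R F L f"
 obtains g where "annular r R F L g" "\<And>v. g (Orth *v v) = g v" "\<And>e. e > 0 \<Longrightarrow> \<exists>n. \<forall>v. \<bar>Oavg n f v - g v\<bar> \<le> e"
proof -
 note fa = annular_Oavg[OF f]
 note d = annularD[OF fa] and n = annular_nonneg[OF f]
 obtain g k where k: "strict_mono (k :: nat \<Rightarrow> nat)"
  and gl: "\<And>e. 0 < e \<Longrightarrow> \<exists>N. \<forall>n x. n \<ge> N \<and> x \<in> cball 0 R \<longrightarrow> norm (Oavg (k n) f x - g x) < e"
 proof (rule Arzela_Ascoli[of "cball (0 :: real^'d) R" "\<lambda>n. Oavg n f" F])
  show "\<exists>s>0. \<forall>n y. y \<in> cball 0 R \<and> norm (x - y) < s \<longrightarrow> norm (Oavg n f x - Oavg n f y) < e"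
   if "0 < e" for x and e :: real
  proof (intro exI conjI allI impI)
   show "0 < e / (L + 1)" using that n by simp
   fix m y assume y: "y \<in> cball 0 R \<and> norm (x - y) < e / (L + 1)"
   have "\<bar>Oavg m f x - Oavg m f y\<bar> \<le> (L + 1) * norm (x - y)"
    using d(4)[of m x y] by (simp add: distrib_right add_increasing2)
   also have "... < (L + 1) * (e / (L + 1))" using y n by (intro mult_strict_left_mono) auto
   finally show "norm (Oavg m f x - Oavg m f y) < e" using n by simp
  qed
 qed (use d(3) in auto)
 \<comment> \<open>Arzela-Ascoli determines the limit on the ball only; outside, every average
   vanishes.\<close>
 define g' where "g' x = (if x \<in> cball 0 R then g x else 0)" for x
 have out: "Oavg m f x = 0" if "x \<notin> cball 0 R" for m x using d(6)[of m x] that by auto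
 have u: "\<exists>N. \<forall>n\<ge>N. \<forall>x. \<bar>Oavg (k n) f x - g' x\<bar> < e" if "0 < e" for e
  using gl[OF that] that by (auto simp: g'_def out)
 have lim: "(\<lambda>n. Oavg (k n) f x) \<longlonglongrightarrow> g' x" for x
  using u by (intro LIMSEQ_I) (metis real_norm_def)
 show ?thesis
 proof
  show "annular r R F L g'"
   unfolding annular_def
  proof (intro conjI allI impI)
   show "\<bar>g' v\<bar> \<le> F" for v by (rule LIMSEQ_le_const2[OF tendsto_rabs[OF lim]]) (use d(3) in auto)
   show "\<bar>g' v - g' w\<bar> \<le> L * norm (v - w)" for v w
    by (rule LIMSEQ_le_const2[OF tendsto_rabs[OF tendsto_diff[OF lim lim]]]) (use d(4) in auto)
   fix v assume "g' v \<noteq> 0"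
   then obtain m where "Oavg m f v \<noteq> 0" using LIMSEQ_unique[OF lim[of v], of 0] by fastforce
   then show "r \<le> norm v" "norm v \<le> R" using d(5,6) by blast+
  qed (use d(1,2) in auto)
  show "g' (Orth *v v) = g' v" for v
  proof -
   have "\<bar>Oavg m f (Orth *v v) - Oavg m f v\<bar> \<le> 2 * F / real (Suc m)" for m
   proof -
    \<comment> \<open>Rotating shifts the orbit by one, so the two sums differ in their end terms
      only.\<close>
    have "(\<Sum>j<Suc m. f (Opow j (Orth *v v))) - (\<Sum>j<Suc m. f (Opow j v)) = f (Opow (Suc m) v) - f v"
     by (induction m) (simp_all add: funpow_swap1)
    also have "\<bar>...\<bar> \<le> 2 * F" using annularD(3)[OF f, of "Opow (Suc m) v"] annularD(3)[OF f, of v] by linarith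
    finally show ?thesis unfolding Oavg_def diff_divide_distrib[symmetric] abs_divide by (simp add: divide_right_mono)
   qed
   then have b: "\<bar>Oavg (k m) f (Orth *v v) - Oavg (k m) f v\<bar> \<le> 2 * F / real (Suc (k m))" for m .
   have "(\<lambda>m. 2 * F / real (Suc m)) \<longlonglongrightarrow> 0" by real_asymp
   from LIMSEQ_subseq_LIMSEQ[OF this k] have "(\<lambda>m. 2 * F / real (Suc (k m))) \<longlonglongrightarrow> 0" by (simp add: o_def)
   then have "(\<lambda>m. Oavg (k m) f (Orth *v v) - Oavg (k m) f v) \<longlonglongrightarrow> 0"
    by (rule Lim_null_comparison[rotated]) (use b in auto)
   from LIMSEQ_unique[OF this tendsto_diff[OF lim lim]] show ?thesis by simp
  qed
  show "\<exists>n. \<forall>v. \<bar>Oavg n f v - g' v\<bar> \<le> e" if "e > 0" for e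
   using u[OF that] by (meson less_imp_le order_refl)
 qed
qed

text \<open>Each rotated copy of f has asymptotically the same \<open>Phi\<close>, hence so has
  every orbit average; suitable averages are uniformly close to an invariant function, whose
  \<open>Phi\<close> converges.\<close>

lemma Phi_converges:
 assumes f: "annular r R F L f"
 shows "\<exists>l. (Phi f \<longlongrightarrow> l) at_top"
proof (rule tendsto_approx)
 fix e :: real assume e: "e > 0"
 obtain g where g: "annular r R F L g" "\<And>v. g (Orth *v v) = g v" and ga: "\<And>e. e > 0 \<Longrightarrow> \<exists>n. \<forall>v. \<bar>Oavg n f v - g v\<bar> \<le> e"
  by (rule Oavg_limit[OF f]) blast
 have B: "0 \<le> annB r R" using annularD(1,2)[OF f] by (intro annB_nonneg) simp
 \<comment> \<open>The summand 1 keeps the divisor positive when \<open>annB r R\<close> is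
   0.\<close>
 have "e / 2 / (annB r R + 1) > 0" using e B by simp
 from ga[OF this] obtain n where n: "\<And>v. \<bar>Oavg n f v - g v\<bar> \<le> e / 2 / (annB r R + 1)" by blast
 obtain l where l: "(Phi g \<longlongrightarrow> l) at_top" using Phi_invariant_converges[OF g] by blast
 have PO: "Phi (Oavg n f) t - Phi f t = (\<Sum>k<Suc n. Phi (\<lambda>v. f (Opow k v)) t - Phi f t) / real (Suc n)" for t
 proof -
  have "Phi (Oavg n f) t = (\<Sum>k<Suc n. Phi (\<lambda>v. f (Opow k v)) t) / real (Suc n)"
   unfolding Phi_def Oavg_def
   by (subst Bochner_Integration.integral_divide_zero, subst Bochner_Integration.integral_sum)
    (auto intro!: annular_integrable[OF annular_Opow[OF f] _ pix.prob_space_axioms] simp: sum_distrib_left simp del: sum.lessThan_Suc)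
  then show ?thesis by (simp add: sum_subtractf diff_divide_distrib del: sum.lessThan_Suc)
 qed
 have "((\<lambda>t. \<Sum>k<Suc n. Phi (\<lambda>v. f (Opow k v)) t - Phi f t) \<longlongrightarrow> (\<Sum>k<Suc n. 0)) at_top"
  by (intro tendsto_sum Phi_Opow_diff[OF f])
 from tendsto_divide[OF this tendsto_const[of "real (Suc n)"]]
 have "((\<lambda>t. Phi (Oavg n f) t - Phi f t) \<longlongrightarrow> 0) at_top" unfolding PO by simp
 from tendstoD[OF this, of "e / 2"] e have ev: "\<forall>\<^sub>F t in at_top. \<bar>Phi (Oavg n f) t - Phi f t\<bar> < e / 2" by simp
 have "\<bar>Phi (Oavg n f) t - Phi g t\<bar> \<le> e / 2" for t
 proof -
  have "\<bar>Phi (Oavg n f) t - Phi g t\<bar> \<le> e / 2 / (annB r R + 1) * annB r R"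
   by (rule Phi_diff[OF annular_Oavg[OF f] g(1) n])
  also have "... \<le> e / 2 / (annB r R + 1) * (annB r R + 1)" using e B by (intro mult_left_mono) auto
  also have "... = e / 2" by (rule nonzero_eq_divide_eq[THEN iffD1, OF _ refl]) (use B in linarith)
  finally show ?thesis .
 qed
 then have "\<forall>\<^sub>F t in at_top. \<bar>Phi f t - Phi g t\<bar> \<le> e"
  by (intro eventually_mono[OF ev]) (smt (verit) field_sum_of_halves)
 with l show "\<exists>g L. (g \<longlongrightarrow> L) at_top \<and> (\<forall>\<^sub>F t in at_top. \<bar>Phi f t - g t\<bar> \<le> e)" by blast
qed

end

section \<open>Scaling and power tails of Lebesgue integrals\<close>

lemma lborel_scale:
 fixes f :: "'a::euclidean_space \<Rightarrow> ennreal" and g :: "'a \<Rightarrow> real"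
 assumes c: "c > 0"
 shows "f \<in> borel_measurable borel \<Longrightarrow> (\<integral>\<^sup>+x. f x \<partial>lborel) = ennreal (c ^ DIM('a)) * (\<integral>\<^sup>+x. f (c *\<^sub>R x) \<partial>lborel)"
  and "g \<in> borel_measurable borel \<Longrightarrow> (\<integral>x. g x \<partial>lborel) = c ^ DIM('a) * (\<integral>x. g (c *\<^sub>R x) \<partial>lborel)"
proof -
 have l: "lborel = density (distr lborel borel (\<lambda>x :: 'a. c *\<^sub>R x)) (\<lambda>_. ennreal (c ^ DIM('a)))"
  using lborel_affine[of c "0 :: 'a"] c by simp
 show "f \<in> borel_measurable borel \<Longrightarrow> (\<integral>\<^sup>+x. f x \<partial>lborel) = ennreal (c ^ DIM('a)) * (\<integral>\<^sup>+x. f (c *\<^sub>R x) \<partial>lborel)"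
  by (subst l) (simp add: nn_integral_density nn_integral_distr nn_integral_cmult)
 show "g \<in> borel_measurable borel \<Longrightarrow> (\<integral>x. g x \<partial>lborel) = c ^ DIM('a) * (\<integral>x. g (c *\<^sub>R x) \<partial>lborel)"
  using c by (subst l) (simp add: integral_density integral_distr)
qed

lemma single_le_suminf: "u n \<le> suminf u" for u :: "nat \<Rightarrow> ennreal"
 using sum_le_suminf[of u "{n}"] by simp

text \<open>Dyadic shells: the n-th has volume of order at most 2^(n d), and the integrand is at
  most of order 2^(- n p) there, so the shell integrals are dominated by a geometric series of ratio
  2^(d - p).\<close>

lemma integrable_norm_powr_tail:
 assumes r: "0 < r" and p: "real DIM('v) < p"
 shows "integrable lborel (\<lambda>y :: 'v::euclidean_space. indicator {y. r \<le> norm y} y * norm y powr - p)"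
proof (rule integrableI_nonneg)
 let ?d = "real DIM('v)"
 let ?c = "\<lambda>n. (2 ^ n * r) powr - p"
 let ?B = "\<lambda>n. cball (0 :: 'v) (2 ^ Suc n * r)"
 define w where "w = r powr - p * (unit_ball_vol ?d * (2 * r) ^ DIM('v))"
 have w: "0 \<le> w" unfolding w_def using r by simp
 define b where "b = 2 powr (?d - p)"
 have b: "0 < b" "b < 1" using p by (auto simp: b_def powr_less_one)
 have "(\<integral>\<^sup>+y. ennreal (indicator {y :: 'v. r \<le> norm y} y * norm y powr - p) \<partial>lborel)
  \<le> (\<integral>\<^sup>+y. (\<Sum>n. ennreal (?c n) * indicator (?B n) y) \<partial>lborel)"
 proof (rule nn_integral_mono)
  fix y :: 'v
  show "ennreal (indicator {y. r \<le> norm y} y * norm y powr - p) \<le> (\<Sum>n. ennreal (?c n) * indicator (?B n) y)"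
  proof (cases "r \<le> norm y")
   case True
   define n where "n = (LEAST n. norm y \<le> 2 ^ Suc n * r)"
   have "\<exists>n. norm y \<le> 2 ^ Suc n * r"
   proof -
    obtain n where "norm y / r < 2 ^ n" using real_arch_pow[of 2 "norm y / r"] by auto
    then have "norm y < 2 ^ n * r" using r by (simp add: field_simps)
    also have "... \<le> 2 ^ Suc n * r" using r by simp
    finally show ?thesis by (intro exI[of _ n]) simp
   qed
   then have n1: "norm y \<le> 2 ^ Suc n * r" unfolding n_def by (rule LeastI_ex)
   have n2: "2 ^ n * r \<le> norm y"
   proof (cases n)
    case (Suc k)
    then show ?thesis using not_less_Least[of k "\<lambda>n. norm y \<le> 2 ^ Suc n * r"] by (simp add: n_def[symmetric] del: power_Suc)
   qed (use True in simp)
   have "norm y powr - p \<le> ?c n" using n2 r p by (intro powr_mono2') auto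
   then have "ennreal (indicator {y. r \<le> norm y} y * norm y powr - p) \<le> ennreal (?c n) * indicator (?B n) y"
    using True n1 by (simp add: ennreal_leI)
   also have "... \<le> (\<Sum>n. ennreal (?c n) * indicator (?B n) y)"
    by (rule single_le_suminf[of "\<lambda>n. ennreal (?c n) * indicator (?B n) y" n])
   finally show ?thesis .
  qed simp
 qed
 also have "... = (\<Sum>n. \<integral>\<^sup>+y. ennreal (?c n) * indicator (?B n) y \<partial>lborel)" 
 proof (rule nn_integral_suminf)
  show "(\<lambda>y. ennreal (?c n) * indicator (?B n) y) \<in> borel_measurable lborel" for n
   by (rule borel_measurable_times_ennreal[OF borel_measurable_const borel_measurable_indicator]) simp
 qed
 also have "... = (\<Sum>n. ennreal (w * b ^ n))"
 proof (rule suminf_cong)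
  fix n
  have "(2 ^ n) powr - p * (2 ^ n) ^ DIM('v) = (2 ^ n :: real) powr (?d - p)"
   using powr_add[of "2 ^ n" "- p" ?d] powr_realpow[of "2 ^ n" "DIM('v)"] by simp
  also have "... = (2 powr real n) powr (?d - p)" using powr_realpow[of 2 n] by simp
  also have "... = b ^ n" using powr_realpow[OF b(1), of n] by (simp add: b_def powr_powr mult.commute)
  finally have e: "(2 ^ n) powr - p * (2 ^ n) ^ DIM('v) = b ^ n" .
  have "(\<integral>\<^sup>+y. ennreal (?c n) * indicator (?B n) y \<partial>lborel) = ennreal (?c n) * emeasure lborel (?B n)"
   by (rule nn_integral_cmult_indicator) simp
  also have "... = ennreal (?c n * (unit_ball_vol ?d * (2 ^ Suc n * r) ^ DIM('v)))"
   using r by (subst emeasure_cball) (auto simp: ennreal_mult'')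
  also have "?c n * (unit_ball_vol ?d * (2 ^ Suc n * r) ^ DIM('v)) = w * ((2 ^ n) powr - p * (2 ^ n) ^ DIM('v))"
   using r by (simp add: powr_mult power_mult_distrib w_def mult_ac)
  finally show "(\<integral>\<^sup>+y. ennreal (?c n) * indicator (?B n) y \<partial>lborel) = ennreal (w * b ^ n)" unfolding e .
 qed
 also have "... < \<infinity>"
 proof -
  have "summable (\<lambda>n. w * b ^ n)" using b by (intro summable_mult summable_geometric) auto
  then show ?thesis using w b by (subst suminf_ennreal2) auto
 qed
 finally show "(\<integral>\<^sup>+y. ennreal (indicator {y :: 'v. r \<le> norm y} y * norm y powr - p) \<partial>lborel) < \<infinity>" .
qed auto

context bekk
begin

subsection \<open>The limit density\<close>

text \<open>exp (\<alpha> t) times the density of the rescaled state exp (- t) X.\<close>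

definition qq :: "real \<Rightarrow> real^'d \<Rightarrow> real" where "qq t y = exp ((\<alpha> + dd) * t) * pX (exp t *\<^sub>R y)"

lemma qq_m[measurable]: "qq t \<in> borel_measurable borel" unfolding qq_def by measurable

lemma qq_nonneg: "0 \<le> qq t y" by (simp add: qq_def pX_nonneg)

lemma exp_scale: "r > 0 \<Longrightarrow> exp (p * t) * (exp t * r) powr - p = r powr - p"
 for p t r :: real
proof -
 assume r: "r > 0"
 have "exp t powr - p = exp (- (p * t))" by (simp add: powr_def)
 then have "(exp t * r) powr - p = exp (- (p * t)) * r powr - p" using powr_mult[of "exp t" r "- p"] r by simp
 then show ?thesis by (simp only: mult.assoc[symmetric] exp_minus_inverse mult_1_left)
qed

lemma qq_upper: "y \<noteq> 0 \<Longrightarrow> qq t y \<le> C1 * norm y powr - (\<alpha> + dd)"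
proof -
 assume y: "y \<noteq> 0"
 have "qq t y \<le> exp ((\<alpha> + dd) * t) * (C1 * (exp t * norm y) powr - (\<alpha> + dd))"
  unfolding qq_def using pX_upper[of "exp t *\<^sub>R y"] y by (intro mult_left_mono) auto
 also have "... = C1 * (exp ((\<alpha> + dd) * t) * (exp t * norm y) powr - (\<alpha> + dd))" by (simp only: mult_ac)
 finally show ?thesis unfolding exp_scale[OF zero_less_norm_iff[THEN iffD2, OF y]] .
qed

lemma qq_Lipschitz:
 assumes r: "0 < r" "r \<le> norm x" "r \<le> norm y" "norm x \<le> R" "norm y \<le> R"
 shows "\<bar>qq t x - qq t y\<bar> \<le> C2 * R * r powr - (\<alpha> + dd + 2) * norm (x - y)"
proof -
 let ?e = "exp t" and ?p = "\<alpha> + dd + 2"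
 have "\<bar>pX (?e *\<^sub>R x) - pX (?e *\<^sub>R y)\<bar> \<le> C2 * (norm (?e *\<^sub>R x - ?e *\<^sub>R y) * (?e * R)) * (?e * r) powr - ?p"
  using r by (intro pX_Lipschitz) auto
 also have "norm (?e *\<^sub>R x - ?e *\<^sub>R y) = ?e * norm (x - y)" by (simp add: scaleR_diff_right[symmetric])
 finally have "exp ((\<alpha> + dd) * t) * \<bar>pX (?e *\<^sub>R x) - pX (?e *\<^sub>R y)\<bar>
   \<le> exp ((\<alpha> + dd) * t) * (C2 * (?e * norm (x - y) * (?e * R)) * (?e * r) powr - ?p)" by (rule mult_left_mono) simp
 also have "... = C2 * R * norm (x - y) * ((exp ((\<alpha> + dd) * t) * ?e * ?e) * (?e * r) powr - ?p)" by (simp only: mult_ac)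
 also have "exp ((\<alpha> + dd) * t) * ?e * ?e = exp (?p * t)" by (simp add: exp_add[symmetric] algebra_simps)
 also have "exp (?p * t) * (?e * r) powr - ?p = r powr - ?p" by (rule exp_scale[OF r(1)])
 also have "exp ((\<alpha> + dd) * t) * \<bar>pX (?e *\<^sub>R x) - pX (?e *\<^sub>R y)\<bar> = \<bar>qq t x - qq t y\<bar>"
  by (simp add: qq_def right_diff_distrib[symmetric] abs_mult)
 finally show ?thesis by (simp only: mult_ac)
qed

lemma qq_integral:
 assumes [measurable]: "f \<in> borel_measurable borel"
 shows "Phi f t = (\<integral>y. f y * qq t y \<partial>lborel)"
proof -
 have "(\<integral>v. f (exp (- t) *\<^sub>R v) \<partial>piX) = (\<integral>v. pX v * f (exp (- t) *\<^sub>R v) \<partial>lborel)" by (rule piX_integral) measurable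
 also have "... = exp t ^ DIM(real^'d) * (\<integral>v. pX (exp t *\<^sub>R v) * f (exp (- t) *\<^sub>R (exp t *\<^sub>R v)) \<partial>lborel)"
  by (rule lborel_scale) auto
 also have "... = exp (dd * t) * (\<integral>v. pX (exp t *\<^sub>R v) * f v \<partial>lborel)"
  by (simp add: exp_of_nat_mult dd_def exp_minus)
 finally have "Phi f t = exp (\<alpha> * t) * exp (dd * t) * (\<integral>v. pX (exp t *\<^sub>R v) * f v \<partial>lborel)" by (simp add: Phi_def)
 also have "exp (\<alpha> * t) * exp (dd * t) = exp ((\<alpha> + dd) * t)" by (simp add: exp_add[symmetric] algebra_simps)
 also have "exp ((\<alpha> + dd) * t) * (\<integral>v. pX (exp t *\<^sub>R v) * f v \<partial>lborel) = (\<integral>v. exp ((\<alpha> + dd) * t) * (pX (exp t *\<^sub>R v) * f v) \<partial>lborel)" by simp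
 finally show ?thesis by (simp only: qq_def mult_ac)
qed

text \<open>Point values are recovered from convergent integrals: the average of \<open>qq t\<close>
  against a small bump at y differs from its value at y by at most a Lipschitz constant times the
  radius, for all t at once.\<close>

lemma qq_converges:
 assumes y: "y \<noteq> 0"
 shows "\<exists>l. ((\<lambda>t. qq t y) \<longlongrightarrow> l) at_top"
proof (rule tendsto_approx)
 fix e :: real assume e: "e > 0"
 define n where "n = norm y"
 have n: "n > 0" using y by (simp add: n_def)
 define Lq where "Lq = C2 * (2 * n) * (n / 2) powr - (\<alpha> + dd + 2)"
 have Lq: "Lq \<ge> 0" using C12 n by (simp add: Lq_def)
 \<comment> \<open>At most half of |y|, so that the bump lies in a fixed annulus, and small enough
   that the Lipschitz constant times the radius is at most e.\<close>
 define h where "h = min (n / 2) (e / (Lq + 1))"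
 have h: "h > 0" "h \<le> n / 2" "Lq * h \<le> e"
 proof -
  show h: "h > 0" using n e Lq by (simp add: h_def)
  show "h \<le> n / 2" unfolding h_def by (rule min.cobounded1)
  have "h \<le> e / (Lq + 1)" unfolding h_def by (rule min.cobounded2)
  then have "h * (Lq + 1) \<le> e" using Lq by (simp add: pos_le_divide_eq)
  then show "Lq * h \<le> e" using h by (simp add: distrib_left mult.commute)
 qed
 define f where "f z = max 0 (h - norm (z - y))" for z :: "real^'d"
 have supp: "n / 2 \<le> norm z \<and> norm z \<le> 2 * n \<and> norm (z - y) < h" if "f z \<noteq> 0" for z
 proof -
  have "norm (z - y) < h" using that by (auto simp: f_def max_def split: if_splits)
  then show ?thesis using h norm_triangle_ineq2[of y z] norm_triangle_sub[of z y] n by (auto simp: n_def norm_minus_commute)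
 qed
 have f: "annular (n / 2) (2 * n) h 1 f"
  unfolding annular_def
 proof (intro conjI allI impI)
  show "\<bar>f z - f w\<bar> \<le> 1 * norm (z - w)" for z w
   using norm_triangle_ineq3[of "z - y" "w - y"] by (auto simp: f_def max_def abs_if split: if_splits)
 qed (use n supp h in \<open>auto simp: f_def\<close>)
 note [measurable] = annular_m[OF f]
 have fi: "integrable lborel f"
 proof (rule Bochner_Integration.integrable_bound)
  show "integrable lborel (\<lambda>z. h * indicator (cball y h) z)"
   by (intro integrable_mult_right integrable_real_indicator) (use h(1) in \<open>auto simp: emeasure_cball ennreal_mult_less_top\<close>)
  show "AE z in lborel. norm (f z) \<le> norm (h * indicator (cball y h) z)"
   using supp annularD(3)[OF f] h by (intro AE_I2) (force simp: indicator_def dist_norm norm_minus_commute)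
 qed measurable
 define I where "I = (\<integral>z. f z \<partial>lborel)"
 have f0: "f z \<ge> 0" for z by (simp add: f_def)
 have "I \<noteq> 0"
 proof
  assume "I = 0"
  then have "AE z in lborel. f z = 0"
   unfolding I_def by (subst (asm) integral_nonneg_eq_0_iff_AE[OF fi]) (use f0 in auto)
  then have "AE z in lborel. z \<notin> ball y h" by eventually_elim (auto simp: f_def dist_norm norm_minus_commute)
  then have "emeasure lborel (ball y h) = 0" by (subst (asm) AE_iff_measurable[where N = "ball y h"]) auto
  moreover have "unit_ball_vol (real CARD('d)) > 0" by (rule unit_ball_vol_pos) simp
  ultimately show False using h(1) by (simp add: emeasure_ball)
 qed
 moreover have "I \<ge> 0" unfolding I_def using f0 by (intro integral_nonneg_AE) auto
 ultimately have I: "I > 0" by simp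
 have "\<bar>qq t y - Phi f t / I\<bar> \<le> e" for t
 proof -
  have iq: "integrable lborel (\<lambda>z. f z * qq t z)"
  proof (rule Bochner_Integration.integrable_bound)
   show "integrable lborel (\<lambda>z. f z * (C1 * (n / 2) powr - (\<alpha> + dd)))" using fi by simp
   show "AE z in lborel. norm (f z * qq t z) \<le> norm (f z * (C1 * (n / 2) powr - (\<alpha> + dd)))"
   proof (rule AE_I2)
    fix z
    show "norm (f z * qq t z) \<le> norm (f z * (C1 * (n / 2) powr - (\<alpha> + dd)))"
    proof (cases "f z = 0")
     case False
     then have z: "n / 2 \<le> norm z" "z \<noteq> 0" using supp[OF False] n by auto
     have "qq t z \<le> C1 * norm z powr - (\<alpha> + dd)" by (rule qq_upper[OF z(2)])
     also have "... \<le> C1 * (n / 2) powr - (\<alpha> + dd)" using z(1) n C12 \<alpha> by (intro mult_left_mono powr_mono2') (auto simp: dd_def)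
     finally show ?thesis using f0[of z] qq_nonneg[of t z] C12 by (simp add: abs_mult mult_left_mono)
    qed simp
   qed
  qed measurable
  have "\<bar>Phi f t - qq t y * I\<bar> = \<bar>\<integral>z. f z * (qq t z - qq t y) \<partial>lborel\<bar>"
   unfolding qq_integral[OF annular_m[OF f]] I_def using iq fi by (simp add: right_diff_distrib mult.commute)
  also have "... \<le> (\<integral>z. \<bar>f z * (qq t z - qq t y)\<bar> \<partial>lborel)" by (rule integral_abs_bound)
  also have "... \<le> (\<integral>z. f z * e \<partial>lborel)"
  proof (rule integral_mono)
   show "integrable lborel (\<lambda>z. \<bar>f z * (qq t z - qq t y)\<bar>)" using iq fi by (simp add: right_diff_distrib)
   show "\<bar>f z * (qq t z - qq t y)\<bar> \<le> f z * e" for z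
   proof (cases "f z = 0")
    case False
    have "\<bar>qq t z - qq t y\<bar> \<le> Lq * norm (z - y)"
     unfolding Lq_def using supp[OF False] n by (intro qq_Lipschitz) (auto simp: n_def)
    also have "... \<le> Lq * h" using supp[OF False] Lq by (intro mult_left_mono) auto
    finally show ?thesis using f0[of z] h(3) by (simp add: abs_mult mult_left_mono)
   qed simp
  qed (use fi in simp)
  also have "... = e * I" by (simp add: I_def)
  finally have 1: "\<bar>Phi f t - qq t y * I\<bar> \<le> e * I" .
  have "Phi f t - qq t y * I = - (I * (qq t y - Phi f t / I))" using I by (simp add: right_diff_distrib)
  then have "\<bar>Phi f t - qq t y * I\<bar> = \<bar>qq t y - Phi f t / I\<bar> * I" using I by (simp only: abs_minus_cancel abs_mult) simp
  with 1 show ?thesis using I by simp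
 qed
 moreover obtain l where "(Phi f \<longlongrightarrow> l) at_top" using Phi_converges[OF f] by blast
 then have "((\<lambda>t. Phi f t / I) \<longlongrightarrow> l / I) at_top" using I by (intro tendsto_divide) auto
 ultimately show "\<exists>g L. (g \<longlongrightarrow> L) at_top \<and> (\<forall>\<^sub>F t in at_top. \<bar>qq t y - g t\<bar> \<le> e)" by (intro exI[of _ "\<lambda>t. Phi f t / I"]) auto
qed

text \<open>The value 0 at the origin, a null set, keeps the upper bound and the scaling law true at
  every point.\<close>

definition UU :: "real^'d \<Rightarrow> real" where "UU y = (if y = 0 then 0 else Lim at_top (\<lambda>t. qq t y))"

lemma UU_lim: "y \<noteq> 0 \<Longrightarrow> ((\<lambda>t. qq t y) \<longlongrightarrow> UU y) at_top"
 using qq_converges[of y] by (auto simp: UU_def tendsto_Lim)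

lemma UU_m[measurable]: "UU \<in> borel_measurable borel"
proof (rule borel_measurable_LIMSEQ_real)
 show "(\<lambda>n. if y = 0 then 0 else qq (real n) y) \<longlonglongrightarrow> UU y" for y
  using filterlim_compose[OF UU_lim filterlim_real_sequentially] by (cases "y = 0") (auto simp: UU_def)
 show "(\<lambda>y. if y = 0 then 0 else qq (real n) y) \<in> borel_measurable borel" for n by measurable
qed

lemma UU_nonneg: "0 \<le> UU y"
 using tendsto_lowerbound[OF UU_lim, of y 0] qq_nonneg by (cases "y = 0") (auto simp: UU_def)

lemma UU_upper: "UU y \<le> C1 * norm y powr - (\<alpha> + dd)"
 using tendsto_upperbound[OF UU_lim, of y] qq_upper[of y] C12 by (cases "y = 0") (auto simp: UU_def)

text \<open>Multiplying the argument by c amounts to shifting t by ln c.\<close>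

lemma UU_scale:
 assumes c: "c > 0"
 shows "UU (c *\<^sub>R y) = c powr - (\<alpha> + dd) * UU y"
proof (cases "y = 0")
 case False
 have k1: "exp ((\<alpha> + dd) * (t + ln c)) = exp ((\<alpha> + dd) * t) * c powr (\<alpha> + dd)" for t
  using c by (simp add: distrib_left exp_add powr_def)
 have k2: "c powr - p * (c powr p * x) = x" for p x using c by (simp add: powr_minus)
 have "qq (t + ln c) y = c powr (\<alpha> + dd) * qq t (c *\<^sub>R y)" for t
  using c unfolding qq_def k1 by (simp add: exp_add)
 then have e: "qq t (c *\<^sub>R y) = c powr - (\<alpha> + dd) * qq (t + ln c) y" for t by (simp only: k2)
 have "filterlim (\<lambda>t. t + ln c) at_top at_top" by real_asymp
 from filterlim_compose[OF UU_lim[OF False] this]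
 have "((\<lambda>t. qq t (c *\<^sub>R y)) \<longlongrightarrow> c powr - (\<alpha> + dd) * UU y) at_top" unfolding e by (intro tendsto_mult_left)
 with UU_lim[of "c *\<^sub>R y"] False c show ?thesis by (intro tendsto_unique[OF _ UU_lim]) auto
qed (simp add: UU_def)

text \<open>Dominated convergence with the density bound as majorant. It reaches functions with
  jumps and with unbounded support, in particular the indicator of a norm exceeding a level, by
  which the tail measure is normalised.\<close>

lemma Phi_limit:
 assumes [measurable]: "f \<in> borel_measurable borel" and i: "integrable lborel (\<lambda>y. f y * norm y powr - (\<alpha> + dd))"
 shows "(Phi f \<longlongrightarrow> (\<integral>y. f y * UU y \<partial>lborel)) at_top" "integrable lborel (\<lambda>y. f y * UU y)"
proof -
 have b: "\<bar>f y * u\<bar> \<le> norm (C1 * (f y * norm y powr - (\<alpha> + dd)))" if "0 \<le> u" "u \<le> C1 * norm y powr - (\<alpha> + dd)" for y u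
 proof -
  have "\<bar>f y\<bar> * u \<le> \<bar>f y\<bar> * (C1 * norm y powr - (\<alpha> + dd))" using that by (intro mult_left_mono) auto
  then show ?thesis using that(1) C12 by (simp add: abs_mult mult_ac)
 qed
 have iC: "integrable lborel (\<lambda>y. norm (C1 * (f y * norm y powr - (\<alpha> + dd))))" using i by (intro integrable_norm integrable_mult_right)
 show "integrable lborel (\<lambda>y. f y * UU y)"
  by (rule Bochner_Integration.integrable_bound[OF iC]) (use b UU_nonneg UU_upper in auto)
 have "((\<lambda>t. \<integral>y. f y * qq t y \<partial>lborel) \<longlongrightarrow> (\<integral>y. f y * UU y \<partial>lborel)) at_top"
 proof (rule integral_dominated_convergence_at_top[OF _ _ iC])
  show "AE y in lborel. ((\<lambda>t. f y * qq t y) \<longlongrightarrow> f y * UU y) at_top"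
   using lborel_nz by eventually_elim (intro tendsto_mult_left UU_lim)
  have "AE y in lborel. norm (f y * qq t y) \<le> norm (C1 * (f y * norm y powr - (\<alpha> + dd)))" for t
   using lborel_nz by eventually_elim (unfold real_norm_def[of "_ * qq _ _"], intro b qq_nonneg qq_upper)
  then show "\<forall>\<^sub>F t in at_top. AE y in lborel. norm (f y * qq t y) \<le> norm (C1 * (f y * norm y powr - (\<alpha> + dd)))" by (intro always_eventually) simp
 qed measurable
 then show "(Phi f \<longlongrightarrow> (\<integral>y. f y * UU y \<partial>lborel)) at_top" by (simp only: qq_integral[OF assms(1), symmetric])
qed

lemma tail_integrable: "0 < r \<Longrightarrow> integrable lborel (\<lambda>y :: real^'d. indicator {y. r \<le> norm y} y * norm y powr - (\<alpha> + dd))"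
 using \<alpha> by (intro integrable_norm_powr_tail) (auto simp: dd_def)

lemma tail_function_integrable:
 fixes f :: "real^'d \<Rightarrow> real"
 assumes [measurable]: "f \<in> borel_measurable borel" and r: "0 < r" and B: "\<And>y. \<bar>f y\<bar> \<le> B" and z: "\<And>y. norm y < r \<Longrightarrow> f y = 0"
 shows "integrable lborel (\<lambda>y. f y * norm y powr - (\<alpha> + dd))"
proof (rule Bochner_Integration.integrable_bound)
 show "integrable lborel (\<lambda>y :: real^'d. B * (indicator {y. r \<le> norm y} y * norm y powr - (\<alpha> + dd)))"
  using tail_integrable[OF r] by simp
 show "AE y in lborel. norm (f y * norm y powr - (\<alpha> + dd)) \<le> norm (B * (indicator {y. r \<le> norm y} y * norm y powr - (\<alpha> + dd)))"
 proof (rule AE_I2)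
  fix y
  show "norm (f y * norm y powr - (\<alpha> + dd)) \<le> norm (B * (indicator {y. r \<le> norm y} y * norm y powr - (\<alpha> + dd)))"
   using B[of y] z[of y] by (cases "norm y < r") (auto simp: abs_mult intro!: mult_right_mono)
 qed
qed measurable

text \<open>The limit of x^\<alpha> P(|X| > x), by \<open>tail_indicator_limit\<close>.\<close>

definition cU :: real where "cU = (\<integral>y. indicator {y. 1 < norm y} y * UU y \<partial>lborel)"

lemma cut_norm_integrable: "integrable lborel (\<lambda>y :: real^'d. cutG NN (norm y) * norm y powr - (\<alpha> + dd))"
proof (rule Bochner_Integration.integrable_bound)
 show "integrable lborel (\<lambda>y :: real^'d. indicator {y. 1 \<le> norm y} y * norm y powr - (\<alpha> + dd) + indicator (cball 0 1) y)"
  using tail_integrable[of 1] by (intro Bochner_Integration.integrable_add) (auto simp: emeasure_cball)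
 show "AE y in lborel. norm (cutG NN (norm y) * norm y powr - (\<alpha> + dd)) \<le> norm (indicator {y. 1 \<le> norm y} y * norm y powr - (\<alpha> + dd) + indicator (cball 0 1) (y :: real^'d))"
  using lborel_nz
 proof eventually_elim
  case (elim y)
  show ?case
  proof (cases "1 \<le> norm y")
   case True
   have "cutG NN (norm y) * norm y powr - (\<alpha> + dd) \<le> 1 * norm y powr - (\<alpha> + dd)" by (intro mult_right_mono cutG_01) simp
   moreover have "cutG NN 1 \<le> 2" using cutG_01(2)[of NN 1] by linarith
   ultimately show ?thesis using True by (simp add: abs_mult cutG_01(1) indicator_def)
  next
   case False
   have "cutG NN (norm y) \<le> norm y powr (\<alpha> + dd)" using NN \<alpha> by (intro cutG_le_powr) (auto simp: dd_def)
   then have "cutG NN (norm y) * norm y powr - (\<alpha> + dd) \<le> norm y powr (\<alpha> + dd) * norm y powr - (\<alpha> + dd)" by (rule mult_right_mono) simp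
   also have "... = 1" using elim by (simp add: powr_add[symmetric])
   finally show ?thesis using False by (simp add: abs_mult cutG_01)
  qed
 qed
qed measurable

text \<open>Chosen so that a Gaussian law with good covariance M gives mass at most 1/2 to the ball
  of radius \<open>del\<close> times sqrt (LL M).\<close>

definition del :: real where "del = min 1 (sqrt ((2 * pi * kap) ^ CARD('d)) / (2 * unit_ball_vol dd))"

text \<open>At least half of the mass lies outside the ball of radius \<open>del\<close> times sqrt
  (LL M), where the cutoff is at least its value on the sphere; shrinking the argument of the cutoff
  by \<open>del\<close> costs at most the factor \<open>del ^ NN\<close>.\<close>

lemma gaussian_cut_lower:
 assumes g: "goodS M" "norm C \<le> LL M" and t: "c > 0"
 shows "ennreal (1 / 2 * del ^ NN * cutG NN (c * sqrt (LL M))) \<le> (\<integral>\<^sup>+v. ennreal (cutG NN (c * norm v)) \<partial>centered_normal M)"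
proof -
 define s where "s = sqrt (LL M)"
 let ?k = "sqrt ((2 * pi * kap) ^ CARD('d))" and ?V = "unit_ball_vol dd"
 have L: "LL M > 0" using g norm_C_pos by linarith
 have s: "s > 0" using L by (simp add: s_def)
 have k: "?k > 0" "?V > 0" using kap(1) by (auto simp: dd_def)
 have d: "0 < del" "del \<le> 1" "del \<le> ?k / (2 * ?V)" using k by (auto simp: del_def)
 have lo: "kap * LL M * (norm x)\<^sup>2 \<le> x \<bullet> (M *v x)" and up: "x \<bullet> (M *v x) \<le> LL M * (norm x)\<^sup>2" for x
  using g by (auto simp: goodS_def)
 note pd = goodS_positive_definite[OF g]
 interpret N: prob_space "centered_normal M" by (rule prob_space_centered_normal[OF pd])
 have N: "sets (centered_normal M) = sets borel" "space (centered_normal M) = UNIV" by (simp_all add: centered_normal_def)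
 let ?S = "{v :: real^'d. del * s \<le> norm v}"
 have Sm: "?S \<in> sets borel" by measurable
 have "emeasure (centered_normal M) (ball 0 (del * s)) = (\<integral>\<^sup>+x. ennreal (gdens M x) * indicator (ball (0 :: real^'d) (del * s)) x \<partial>lborel)"
  unfolding centered_normal_gdens by (rule emeasure_density) auto
 also have "... \<le> (\<integral>\<^sup>+x. ennreal (1 / sqrt ((2 * pi * kap * LL M) ^ CARD('d))) * indicator (ball (0 :: real^'d) (del * s)) x \<partial>lborel)"
 proof (intro nn_integral_mono mult_right_mono ennreal_leI)
  fix x :: "real^'d"
  have "exp (- (norm x)\<^sup>2 / (2 * LL M)) / sqrt ((2 * pi * kap * LL M) ^ CARD('d)) \<le> 1 / sqrt ((2 * pi * kap * LL M) ^ CARD('d))"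
   using L kap(1) by (intro divide_right_mono) auto
  then show "gdens M x \<le> 1 / sqrt ((2 * pi * kap * LL M) ^ CARD('d))" using gdens_upper[OF pd kap(1) L lo up, of x] by linarith
 qed simp
 also have "... = ennreal (1 / sqrt ((2 * pi * kap * LL M) ^ CARD('d))) * emeasure lborel (ball (0 :: real^'d) (del * s))"
  by (rule nn_integral_cmult_indicator) simp
 also have "emeasure lborel (ball (0 :: real^'d) (del * s)) = ennreal (?V * (del * s) ^ CARD('d))"
  using d s by (subst emeasure_ball) (auto simp: dd_def)
 also have "ennreal (1 / sqrt ((2 * pi * kap * LL M) ^ CARD('d))) * ennreal (?V * (del * s) ^ CARD('d))
   = ennreal (1 / sqrt ((2 * pi * kap * LL M) ^ CARD('d)) * (?V * (del * s) ^ CARD('d)))"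
  by (rule ennreal_mult[symmetric]) (use k d s L kap(1) in auto)
 also have "sqrt ((2 * pi * kap * LL M) ^ CARD('d)) = ?k * s ^ CARD('d)"
  by (simp add: power_mult_distrib real_sqrt_mult real_sqrt_power s_def)
 also have "1 / (?k * s ^ CARD('d)) * (?V * (del * s) ^ CARD('d)) = ?V / ?k * del ^ CARD('d)" using s k by (simp add: power_mult_distrib)
 finally have "measure (centered_normal M) (ball 0 (del * s)) \<le> ?V / ?k * del ^ CARD('d)"
  using k d by (simp add: N.emeasure_eq_measure)
 also have "... \<le> ?V / ?k * (?k / (2 * ?V))"
 proof (rule mult_left_mono)
  have "del ^ CARD('d) \<le> del" using d power_decreasing[of 1 "CARD('d)" del] by (simp add: Suc_leI)
  then show "del ^ CARD('d) \<le> ?k / (2 * ?V)" using d(3) by linarith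
 qed (use k in simp)
 also have "... = 1 / 2" using k(2) less_imp_neq[OF k(1)] by simp
 finally have B: "measure (centered_normal M) (ball 0 (del * s)) \<le> 1 / 2" .
 have "measure (centered_normal M) ?S = 1 - measure (centered_normal M) (ball 0 (del * s))"
  using N.prob_compl[of "ball 0 (del * s)"] N by (simp add: Diff_eq Compl_eq not_less dist_norm ball_def)
 with B have S: "1 / 2 \<le> measure (centered_normal M) ?S" by linarith
 have "del ^ NN * cutG NN (c * s) \<le> cutG NN (c * (del * s))"
 proof -
  have "del ^ NN * min 1 ((c * s) ^ NN) \<le> min 1 (del ^ NN * (c * s) ^ NN)"
  proof (rule min.boundedI)
   show "del ^ NN * min 1 ((c * s) ^ NN) \<le> 1" using d t s by (intro mult_le_one) (auto simp: power_le_one)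
   show "del ^ NN * min 1 ((c * s) ^ NN) \<le> del ^ NN * (c * s) ^ NN" using d by (intro mult_left_mono) auto
  qed
  then show ?thesis by (simp add: cutG_def power_mult_distrib mult_ac)
 qed
 then have "1 / 2 * (del ^ NN * cutG NN (c * s)) \<le> measure (centered_normal M) ?S * cutG NN (c * (del * s))"
  using S t s d by (intro mult_mono) (auto intro!: mult_nonneg_nonneg cutG_01)
 then have "ennreal (1 / 2 * del ^ NN * cutG NN (c * s)) \<le> ennreal (cutG NN (c * (del * s))) * emeasure (centered_normal M) ?S"
  using t s d by (simp add: N.emeasure_eq_measure ennreal_mult'[symmetric] cutG_01 ennreal_leI mult_ac)
 also have "... = (\<integral>\<^sup>+v. ennreal (cutG NN (c * (del * s))) * indicator ?S v \<partial>centered_normal M)"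
  by (rule nn_integral_cmult_indicator[symmetric]) (simp add: N Sm)
 also have "... \<le> (\<integral>\<^sup>+v. ennreal (cutG NN (c * norm v)) \<partial>centered_normal M)"
 proof (rule nn_integral_mono)
  fix v
  show "ennreal (cutG NN (c * (del * s))) * indicator ?S v \<le> ennreal (cutG NN (c * norm v))"
   using t s d by (cases "v \<in> ?S") (auto intro!: ennreal_leI cutG_mono)
 qed
 finally show ?thesis unfolding s_def .
qed

lemma Phi_cut_lower: "1 / 2 * del ^ NN * phiV t \<le> Phi (\<lambda>v. cutG NN (norm v)) t"
proof -
 let ?e = "exp (- t)"
 have d: "0 \<le> del" using kap(1) by (auto simp: del_def dd_def)
 have i: "integrable piX (\<lambda>v. cutG NN (norm (?e *\<^sub>R v)))"
  by (rule pix.integrable_const_bound[where B = 1]) (auto simp: cutG_01)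
 have nn: "AE M in rho. 0 \<le> cutG NN (?e * sqrt (LL M))" using rho_LL_pos by eventually_elim (simp add: cutG_01)
 have i1: "integrable rho (\<lambda>M. 1 / 2 * del ^ NN * cutG NN (?e * sqrt (LL M)))" using cutV_int[of ?e] by simp
 have n1: "AE M in rho. 0 \<le> 1 / 2 * del ^ NN * cutG NN (?e * sqrt (LL M))" using nn by eventually_elim (use d in simp)
 have "ennreal (1 / 2 * del ^ NN * (\<integral>M. cutG NN (?e * sqrt (LL M)) \<partial>rho)) = (\<integral>\<^sup>+M. ennreal (1 / 2 * del ^ NN * cutG NN (?e * sqrt (LL M))) \<partial>rho)"
  unfolding nn_integral_eq_integral[OF i1 n1] by simp
 also have "... \<le> (\<integral>\<^sup>+M. \<integral>\<^sup>+v. ennreal (cutG NN (?e * norm v)) \<partial>centered_normal M \<partial>rho)"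
  by (rule nn_integral_mono_AE) (use rho_good in \<open>eventually_elim, intro gaussian_cut_lower, auto\<close>)
 also have "... = (\<integral>\<^sup>+v. ennreal (cutG NN (?e * norm v)) \<partial>piX)"
  unfolding piX_eq_mixX by (rule nn_mix[symmetric]) measurable
 also have "... = ennreal (\<integral>v. cutG NN (norm (?e *\<^sub>R v)) \<partial>piX)"
  using nn_integral_eq_integral[OF i] by (simp add: cutG_01)
 finally have "1 / 2 * del ^ NN * (\<integral>M. cutG NN (?e * sqrt (LL M)) \<partial>rho) \<le> (\<integral>v. cutG NN (norm (?e *\<^sub>R v)) \<partial>piX)"
  by (subst (asm) ennreal_le_iff) (auto intro!: integral_nonneg_AE simp: cutG_01)
 then have "exp (\<alpha> * t) * (1 / 2 * del ^ NN * (\<integral>M. cutG NN (?e * sqrt (LL M)) \<partial>rho)) \<le> exp (\<alpha> * t) * (\<integral>v. cutG NN (norm (?e *\<^sub>R v)) \<partial>piX)"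
  by (rule mult_left_mono) simp
 then show ?thesis unfolding phiV_def Phi_def by (simp only: mult_ac)
qed

lemma tail_indicator_limit:
 assumes r: "0 < r"
 shows "integrable lborel (\<lambda>y. indicator {y. r < norm y} y * UU y)" "(Phi (indicator {y. r < norm y}) \<longlongrightarrow> (\<integral>y. indicator {y. r < norm y} y * UU y \<partial>lborel)) at_top"
proof -
 have "integrable lborel (\<lambda>y::real^'d. indicator {y. r < norm y} y * norm y powr - (\<alpha> + dd))"
  by (rule tail_function_integrable[OF _ r, of _ 1]) (auto simp: indicator_def)
 from Phi_limit[OF _ this] show "integrable lborel (\<lambda>y. indicator {y. r < norm y} y * UU y)"
  "(Phi (indicator {y. r < norm y}) \<longlongrightarrow> (\<integral>y. indicator {y. r < norm y} y * UU y \<partial>lborel)) at_top" by auto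
qed

text \<open>If \<open>cU\<close> were 0, scaling would give UU = 0 almost everywhere, so
  \<open>Phi\<close> of the cutoff of the norm would tend to 0; but it is bounded below by a
  multiple of \<open>phiV\<close>, which does not.\<close>

lemma cU_pos: "cU > 0"
proof (rule ccontr)
 assume "\<not> cU > 0"
 moreover have "cU \<ge> 0" unfolding cU_def by (intro integral_nonneg_AE) (auto simp: UU_nonneg)
 ultimately have c0: "cU = 0" by simp
 have "AE y in lborel. \<forall>n. indicator {y. inverse (real (Suc n)) < norm y} y * UU y = 0"
  unfolding AE_all_countable
 proof
  fix n
  let ?c = "inverse (real (Suc n))"
  have c: "?c > 0" by simp
  have "(\<integral>y. indicator {y. ?c < norm y} y * UU y \<partial>lborel) = ?c ^ DIM(real^'d) * (\<integral>y. indicator {y. ?c < norm y} (?c *\<^sub>R y) * UU (?c *\<^sub>R y) \<partial>lborel)"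
   by (rule lborel_scale[OF c]) measurable
  also have "(\<lambda>y :: real^'d. indicator {y. ?c < norm y} (?c *\<^sub>R y) * UU (?c *\<^sub>R y)) = (\<lambda>y. ?c powr - (\<alpha> + dd) * (indicator {y. 1 < norm y} y * UU y))"
   unfolding UU_scale[OF c] by (auto simp: fun_eq_iff indicator_def)
  also have "?c ^ DIM(real^'d) * (\<integral>y. ?c powr - (\<alpha> + dd) * (indicator {y. 1 < norm y} y * UU y) \<partial>lborel) = 0"
   using c0 by (simp add: cU_def)
  finally show "AE y in lborel. indicator {y. ?c < norm y} y * UU y = 0"
   by (subst (asm) integral_nonneg_eq_0_iff_AE[OF tail_indicator_limit(1)[OF c]]) (auto simp: UU_nonneg)
 qed
 then have U0: "AE y in lborel. UU y = 0"
 proof eventually_elim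
  case (elim y)
  show ?case
  proof (cases "y = 0")
   case False
   then obtain n where "inverse (real (Suc n)) < norm y" using reals_Archimedean[of "norm y"] by auto
   then show ?thesis using elim by (auto dest!: spec[of _ n])
  qed (simp add: UU_def)
 qed
 have "(\<integral>y. cutG NN (norm y) * UU y \<partial>lborel) = (\<integral>y. 0 \<partial>(lborel :: (real^'d) measure))"
  by (rule integral_cong_AE) (use U0 in \<open>auto elim!: eventually_mono\<close>)
 with Phi_limit(1)[OF _ cut_norm_integrable] have lim: "(Phi (\<lambda>v. cutG NN (norm v)) \<longlongrightarrow> 0) at_top" by simp
 have d: "del > 0" using kap(1) by (auto simp: del_def dd_def)
 have "((\<lambda>t. 2 / del ^ NN * Phi (\<lambda>v. cutG NN (norm v)) t) \<longlongrightarrow> 2 / del ^ NN * 0) at_top" by (intro tendsto_mult_left lim)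
 then have l: "((\<lambda>t. 2 / del ^ NN * Phi (\<lambda>v. cutG NN (norm v)) t) \<longlongrightarrow> 0) at_top" by simp
 have "\<forall>\<^sub>F t in at_top. norm (phiV t) \<le> 2 / del ^ NN * Phi (\<lambda>v. cutG NN (norm v)) t"
  using Phi_cut_lower phiV_nonneg d by (intro always_eventually) (simp add: field_simps)
 from Lim_null_comparison[OF this l] have "(phiV \<longlongrightarrow> 0) at_top" .
 then show False using phiV_not_null by simp
qed

end

subsection \<open>The extended Euclidean space\<close>

lemma vec_nth_continuous: "continuous_on UNIV (\<lambda>y :: 'b::topological_space ^ 'n. y $ i)"
 unfolding continuous_on_def by (auto intro: tendsto_vec_nth)

lemma nonzero_box_open: "open {y :: ereal ^ 'n. \<exists>i. ereal c < \<bar>y $ i\<bar>}"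
proof -
 have "open {x :: ereal. ereal c < \<bar>x\<bar>}"
 proof -
  have "{x :: ereal. ereal c < \<bar>x\<bar>} = {ereal c<..} \<union> {..<- ereal c} \<union> (if c < 0 then UNIV else {})"
  proof (intro set_eqI)
   fix x :: ereal show "x \<in> {x. ereal c < \<bar>x\<bar>} \<longleftrightarrow> x \<in> {ereal c<..} \<union> {..<- ereal c} \<union> (if c < 0 then UNIV else {})"
    by (cases x) auto
  qed
  also have "open ..." by auto
  finally show ?thesis .
 qed
 then have "open ((\<lambda>y :: ereal ^ 'n. y $ i) -` {x. ereal c < \<bar>x\<bar>})" for i by (rule open_vimage[OF _ vec_nth_continuous])
 then have "open (\<Union>i. (\<lambda>y :: ereal ^ 'n. y $ i) -` {x. ereal c < \<bar>x\<bar>})" by blast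
 also have "(\<Union>i. (\<lambda>y :: ereal ^ 'n. y $ i) -` {x. ereal c < \<bar>x\<bar>}) = {y. \<exists>i. ereal c < \<bar>y $ i\<bar>}" by auto
 finally show ?thesis .
qed

lemma nonzero_open: "open (- {0} :: (ereal ^ 'n) set)"
proof -
 have pos: "ereal 0 < \<bar>x\<bar> \<longleftrightarrow> x \<noteq> 0" for x :: ereal by (cases x) auto
 have "- {0} = {y :: ereal ^ 'n. \<exists>i. ereal 0 < \<bar>y $ i\<bar>}" unfolding pos by (auto simp: vec_eq_iff)
 then show ?thesis using nonzero_box_open[of 0] by simp
qed

text \<open>The sets where some coordinate exceeds c in modulus are open, grow as c decreases and
  exhaust the punctured space. So test functions vanish near 0, while infinity remains in their
  domain.\<close>

lemma compact_away_from_zero: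
 assumes K: "compact K" "(0 :: ereal ^ 'n) \<notin> K"
 obtains c where "c > 0" "K \<subseteq> {y. \<exists>i. ereal c < \<bar>y $ i\<bar>}"
proof -
 let ?V = "\<lambda>n. {y :: ereal ^ 'n. \<exists>i. ereal (inverse (real (Suc n))) < \<bar>y $ i\<bar>}"
 have cov: "K \<subseteq> (\<Union>n. ?V n)"
 proof
  fix y assume "y \<in> K"
  then have "y \<noteq> 0" using K by auto
  then obtain i where "y $ i \<noteq> 0" by (auto simp: vec_eq_iff)
  then have "\<exists>n. ereal (inverse (real (Suc n))) < \<bar>y $ i\<bar>"
   using reals_Archimedean[of "\<bar>real_of_ereal (y $ i)\<bar>"] by (cases "y $ i") auto
  then show "y \<in> (\<Union>n. ?V n)" by auto
 qed
 obtain N where "N \<subseteq> UNIV" and N: "finite N" "K \<subseteq> (\<Union>n\<in>N. ?V n)"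
  by (rule compactE_image[OF K(1) nonzero_box_open cov])
 have "?V n \<subseteq> ?V (Max (insert 0 N))" if "n \<in> N" for n
 proof -
  have "n \<le> Max (insert 0 N)" using N(1) that by (intro Max_ge) auto
  then have "ereal (inverse (real (Suc (Max (insert 0 N))))) \<le> ereal (inverse (real (Suc n)))" by (auto intro!: le_imp_inverse_le)
  then show ?thesis using le_less_trans by blast
 qed
 then have "K \<subseteq> ?V (Max (insert 0 N))" using N(2) by blast
 then show thesis by (intro that[of "inverse (real (Suc (Max (insert 0 N))))"]) auto
qed

lemma embed_ereal_m[measurable]: "embed_ereal \<in> borel_measurable borel"
 unfolding embed_ereal_def[abs_def]
 by (intro borel_measurable_continuous_onI continuous_on_vec_lambda continuous_on_ereal continuous_on_component continuous_on_id)

lemma embed_ereal_simps: "embed_ereal v $ i = ereal (v $ i)" "embed_ereal v = 0 \<longleftrightarrow> v = 0"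
 "scale_ereal t (embed_ereal v) = embed_ereal (t *\<^sub>R v)"
 by (auto simp: embed_ereal_def scale_ereal_def vec_eq_iff zero_ereal_def)

lemma embed_ereal_box: "ereal c < \<bar>embed_ereal v $ i\<bar> \<Longrightarrow> c < norm v"
 using component_le_norm_cart[of v i] by (simp add: embed_ereal_simps)

lemma scale_ereal_m[measurable]: "scale_ereal t \<in> borel_measurable borel"
 unfolding scale_ereal_def[abs_def]
 by (intro borel_measurable_continuous_onI continuous_on_vec_lambda continuous_on_cmult_ereal vec_nth_continuous) simp

lemma scale_ereal_image:
 fixes B :: "(ereal ^ 'n) set"
 assumes "t > 0"
 shows "scale_ereal t ` B = scale_ereal (1 / t) -` B"
proof -
 have m: "ereal s * (ereal (1 / s) * x) = x" if "s > 0" for s x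
  using that by (cases x) auto
 have inv: "scale_ereal s (scale_ereal (1 / s) y) = y" if "s > 0" for s and y :: "ereal ^ 'n"
  by (simp add: scale_ereal_def vec_eq_iff m that)
 show ?thesis
 proof (intro set_eqI iffI)
  fix x assume "x \<in> scale_ereal t ` B"
  then show "x \<in> scale_ereal (1 / t) -` B" using inv[of "1 / t"] assms by auto
 next
  fix x assume "x \<in> scale_ereal (1 / t) -` B"
  then show "x \<in> scale_ereal t ` B" by (intro image_eqI[of _ _ "scale_ereal (1 / t) x"]) (auto simp: inv[OF assms])
 qed
qed

lemma integral_scale_measure_real:
 fixes f :: "'a \<Rightarrow> real"
 assumes [measurable]: "f \<in> borel_measurable M" and c: "0 \<le> c"
 shows "(\<integral>x. f x \<partial>scale_measure (ennreal c) M) = c * (\<integral>x. f x \<partial>M)"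
proof -
 have "scale_measure (ennreal c) M = density M (\<lambda>_. ennreal c)"
  by (rule measure_eqI) (auto simp: emeasure_density_const)
 then show ?thesis using c by (simp add: integral_density)
qed

context bekk
begin

subsection \<open>Regular variation of the stationary law\<close>

text \<open>The tail measure divides by P(|X| > x), which behaves like \<open>cU\<close>
  x^-\<alpha>; hence the normalisation. As an image under \<open>embed_ereal\<close>,
  \<open>mu\<close> gives no mass to points with infinite coordinates.\<close>

definition muD :: "(real^'d) measure" where "muD = density lborel (\<lambda>y. ennreal (UU y / cU))"

definition mu :: "(ereal^'d) measure" where "mu = restrict_space (distr muD borel embed_ereal) (- {0})"

lemma sets_mu: "B \<in> sets mu \<longleftrightarrow> B \<in> sets borel \<and> B \<subseteq> - {0}"
 unfolding mu_def using borel_open[OF nonzero_open] by (subst sets_restrict_space_iff) auto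

lemma emeasure_mu: "B \<in> sets mu \<Longrightarrow> emeasure mu B = (\<integral>\<^sup>+y. ennreal (UU y / cU) * indicator B (embed_ereal y) \<partial>lborel)"
proof -
 assume B: "B \<in> sets mu"
 then have Bb[measurable]: "B \<in> sets borel" by (simp add: sets_mu)
 have "emeasure mu B = emeasure (distr muD borel embed_ereal) B"
  unfolding mu_def using B borel_open[OF nonzero_open] by (intro emeasure_restrict_space) (auto simp: sets_mu)
 also have "... = emeasure muD (embed_ereal -` B)" by (subst emeasure_distr) (auto simp: muD_def)
 also have "... = (\<integral>\<^sup>+y. ennreal (UU y / cU) * indicator (embed_ereal -` B) y \<partial>lborel)"
  unfolding muD_def using measurable_sets[OF embed_ereal_m Bb] by (intro emeasure_density) auto
 finally show ?thesis by (simp add: indicator_def)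
qed

lemma UU_tail_integrable:
 fixes f :: "real^'d \<Rightarrow> real"
 assumes "f \<in> borel_measurable borel" "0 < r" "\<And>y. \<bar>f y\<bar> \<le> B" "\<And>y. norm y < r \<Longrightarrow> f y = 0"
 shows "integrable lborel (\<lambda>y. f y * UU y)" "(Phi f \<longlongrightarrow> (\<integral>y. f y * UU y \<partial>lborel)) at_top"
 using Phi_limit[OF assms(1) tail_function_integrable[OF assms]] by auto

lemma mu_radon: "radon_punctured mu"
 unfolding radon_punctured_def
proof (intro conjI allI impI)
 show "sets mu = sets punctured_borel" by (simp add: mu_def punctured_borel_def sets_restrict_space)
 fix K :: "(ereal^'d) set" assume K: "compact K \<and> 0 \<notin> K"
 then obtain c where c: "c > 0" "K \<subseteq> {y. \<exists>i. ereal c < \<bar>y $ i\<bar>}" using compact_away_from_zero[of K] by blast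
 let ?V = "{y :: ereal^'d. \<exists>i. ereal c < \<bar>y $ i\<bar>}"
 have V: "?V \<in> sets mu" using c(1) borel_open[OF nonzero_box_open[of c]] by (auto simp: sets_mu)
 have i: "integrable lborel (\<lambda>y. indicator {y. c \<le> norm y} y * UU y)"
  by (rule UU_tail_integrable(1)[OF _ c(1), of _ 1]) (auto simp: indicator_def)
 have "emeasure mu K \<le> emeasure mu ?V" by (rule emeasure_mono[OF c(2) V])
 also have "... = (\<integral>\<^sup>+y. ennreal (UU y / cU) * indicator ?V (embed_ereal y) \<partial>lborel)" by (rule emeasure_mu[OF V])
 also have "... \<le> (\<integral>\<^sup>+y. ennreal (inverse cU * (indicator {y. c \<le> norm y} y * UU y)) \<partial>lborel)"
 proof (rule nn_integral_mono)
  fix y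
  show "ennreal (UU y / cU) * indicator ?V (embed_ereal y) \<le> ennreal (inverse cU * (indicator {y. c \<le> norm y} y * UU y))"
   by (auto simp: indicator_def divide_inverse mult.commute dest!: embed_ereal_box)
 qed
 also have "... < \<infinity>"
  using nn_integral_eq_integral[OF integrable_mult_right[OF i, of "inverse cU"]] cU_pos UU_nonneg by simp
 finally show "emeasure mu K < \<infinity>" .
qed

lemma mu_nonnull: "emeasure mu (space mu) \<noteq> 0"
proof
 assume "emeasure mu (space mu) = 0"
 then have "(\<integral>\<^sup>+y. ennreal (UU y / cU) * indicator (space mu) (embed_ereal y) \<partial>lborel) = 0" by (simp only: emeasure_mu[OF sets.top])
 moreover have "space mu = - {0}" by (simp add: mu_def space_restrict_space)
 moreover have "(\<lambda>y. indicator (- {0} :: (ereal^'d) set) (embed_ereal y) :: ennreal) \<in> borel_measurable borel"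
  using borel_open[OF nonzero_open] by measurable
 ultimately have "AE y in lborel. ennreal (UU y / cU) * indicator (- {0}) (embed_ereal y) = 0"
  by (subst (asm) nn_integral_0_iff_AE) auto
 then have "AE y in lborel. indicator {y. 1 < norm y} y * UU y = 0"
 proof eventually_elim
  case (elim y)
  then show ?case using cU_pos UU_nonneg[of y] by (cases "y = 0") (auto simp: embed_ereal_simps divide_le_0_iff)
 qed
 then have "cU = (\<integral>y. 0 \<partial>(lborel :: (real^'d) measure))" unfolding cU_def by (intro integral_cong_AE) auto
 then show False using cU_pos by simp
qed

lemma mu_homogeneous:
 assumes t: "t > 0" and B: "B \<in> sets mu"
 shows "emeasure mu (scale_ereal t ` B) = ennreal (t powr - \<alpha>) * emeasure mu B"
proof -
 have Bb[measurable]: "B \<in> sets borel" and B0: "0 \<notin> B" using B by (auto simp: sets_mu)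
 let ?B = "scale_ereal t ` B"
 have im: "?B = scale_ereal (1 / t) -` B" by (rule scale_ereal_image[OF t])
 have "scale_ereal (1 / t) 0 = (0 :: ereal^'d)" by (simp add: scale_ereal_def vec_eq_iff)
 then have S: "?B \<in> sets mu" unfolding im using measurable_sets[OF scale_ereal_m Bb, of "1 / t"] B0 by (auto simp: sets_mu)
 note [measurable] = S[unfolded sets_mu, THEN conjunct1]
 have "emeasure mu ?B = (\<integral>\<^sup>+y. ennreal (UU y / cU) * indicator ?B (embed_ereal y) \<partial>lborel)" by (rule emeasure_mu[OF S])
 also have "... = ennreal (t ^ DIM(real^'d)) * (\<integral>\<^sup>+y. ennreal (UU (t *\<^sub>R y) / cU) * indicator ?B (embed_ereal (t *\<^sub>R y)) \<partial>lborel)"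
  by (rule lborel_scale(1)[OF t]) measurable
 also have "(\<lambda>y. ennreal (UU (t *\<^sub>R y) / cU) * indicator ?B (embed_ereal (t *\<^sub>R y)))
   = (\<lambda>y. ennreal (t powr - (\<alpha> + dd)) * (ennreal (UU y / cU) * indicator B (embed_ereal y)))"
 proof
  fix y
  have "embed_ereal (t *\<^sub>R y) \<in> ?B \<longleftrightarrow> embed_ereal y \<in> B" using t by (simp add: im embed_ereal_simps)
  then show "ennreal (UU (t *\<^sub>R y) / cU) * indicator ?B (embed_ereal (t *\<^sub>R y))
   = ennreal (t powr - (\<alpha> + dd)) * (ennreal (UU y / cU) * indicator B (embed_ereal y))"
   using UU_nonneg[of y] cU_pos by (simp add: UU_scale[OF t] indicator_def ennreal_mult'[symmetric])
 qed
 also have "(\<integral>\<^sup>+y. ennreal (t powr - (\<alpha> + dd)) * (ennreal (UU y / cU) * indicator B (embed_ereal y)) \<partial>lborel)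
   = ennreal (t powr - (\<alpha> + dd)) * emeasure mu B"
  unfolding emeasure_mu[OF B] by (rule nn_integral_cmult) measurable
 also have "ennreal (t ^ DIM(real^'d)) * (ennreal (t powr - (\<alpha> + dd)) * emeasure mu B) = ennreal (t ^ CARD('d) * t powr - (\<alpha> + dd)) * emeasure mu B"
  using t by (simp add: ennreal_mult mult.assoc)
 also have "t ^ CARD('d) * t powr - (\<alpha> + dd) = t powr - \<alpha>"
  using t by (simp add: powr_realpow[symmetric] powr_add[symmetric] dd_def)
 finally show ?thesis .
qed

text \<open>With x = exp t, the integral of f and the tail probability are values of
  \<open>Phi\<close> up to the common factor exp (\<alpha> t), so the tail measure integrates f to a
  quotient of two convergent functions.\<close>

lemma piX_regularly_varying:
 assumes N: "prob_space N" and Y[measurable]: "Y \<in> borel_measurable N" and law: "distr N borel Y = piX"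
 shows "regularly_varying_index N Y \<alpha>"
proof -
 interpret N: prob_space N by (rule N)
 have vague: "vague_limit (tail_measure N Y) mu"
  unfolding vague_limit_def
 proof (intro allI impI)
  fix f :: "ereal^'d \<Rightarrow> real"
  assume "continuous_on (- {0}) f \<and> (\<exists>K. compact K \<and> 0 \<notin> K \<and> (\<forall>y. y \<notin> K \<longrightarrow> f y = 0))"
  then obtain K where f: "continuous_on (- {0}) f" and K: "compact K" "0 \<notin> K" "\<And>y. y \<notin> K \<Longrightarrow> f y = 0" by blast
  obtain c where c: "c > 0" "K \<subseteq> {y. \<exists>i. ereal c < \<bar>y $ i\<bar>}" using compact_away_from_zero[OF K(1,2)] by blast
  have "compact (f ` K)" using K(1,2) f by (intro compact_continuous_image) (auto intro: continuous_on_subset)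
  then obtain B where B: "\<And>y. y \<in> K \<Longrightarrow> \<bar>f y\<bar> \<le> B" using compact_imp_bounded by (force simp: bounded_iff)
  have B': "\<bar>f y\<bar> \<le> max 0 B" for y using B[of y] K(3)[of y] by (cases "y \<in> K") auto
  \<comment> \<open>Test functions are zero at 0, so continuity off 0 gives measurability on the
    whole space.\<close>
  have f0: "indicator (- {0}) y *\<^sub>R f y = f y" for y using K(2,3) by (cases "y = 0") auto
  have fm[measurable]: "f \<in> borel_measurable borel"
   using borel_measurable_continuous_on_indicator[OF borel_open[OF nonzero_open] f] unfolding f0 .
  let ?h = "\<lambda>v. f (embed_ereal v)" and ?T = "indicator {y :: real^'d. 1 < norm y} :: _ \<Rightarrow> real"
  have h: "\<bar>?h v\<bar> \<le> max 0 B" "norm v < c \<Longrightarrow> ?h v = 0" for v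
   using B' K(3)[of "embed_ereal v"] c(2) embed_ereal_box[of c v] by force+
  have hm: "?h \<in> borel_measurable borel" by measurable
  note H = UU_tail_integrable[of ?h, OF hm c(1) h]
  have muf: "(\<integral>y. f y \<partial>mu) = (\<integral>v. ?h v * UU v \<partial>lborel) / cU"
  proof -
   have "(\<integral>y. f y \<partial>mu) = (\<integral>v. ?h v \<partial>muD)"
    unfolding mu_def using borel_open[OF nonzero_open]
    by (subst integral_restrict_space) (auto simp: f0[unfolded real_scaleR_def] integral_distr muD_def)
   also have "... = (\<integral>v. ?h v * UU v / cU \<partial>lborel)"
    unfolding muD_def using UU_nonneg cU_pos by (subst integral_density) (auto simp: mult.commute)
   finally show ?thesis by simp
  qed
  have T: "(Phi ?T \<longlongrightarrow> cU) at_top" unfolding cU_def by (rule tail_indicator_limit(2)) simp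
  have lim: "((\<lambda>t. Phi ?h t / Phi ?T t) \<longlongrightarrow> (\<integral>y. f y \<partial>mu)) at_top"
   unfolding muf using cU_pos by (intro tendsto_divide H(2) T) auto
  have law_int: "(\<integral>w. g (Y w) \<partial>N) = (\<integral>v. g v \<partial>piX)" if "g \<in> borel_measurable borel" for g :: "real^'d \<Rightarrow> real"
   unfolding law[symmetric] using that by (subst integral_distr) auto
  \<comment> \<open>Positivity of the tail probability makes the inverse in
    \<open>tail_measure\<close> finite; it holds for all large x because the limit \<open>cU\<close>
    is positive.\<close>
  have eq: "(\<integral>y. f y \<partial>tail_measure N Y x) = Phi ?h (ln x) / Phi ?T (ln x)" if x: "x > 0" and pos: "Phi ?T (ln x) > 0" for x
  proof -
   have e: "exp (- ln x) *\<^sub>R v = v /\<^sub>R x" for v :: "real^'d" using x by (simp add: exp_minus)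
   let ?P = "measure N {w \<in> space N. x < norm (Y w)}"
   have "?P = (\<integral>w. indicator {w \<in> space N. x < norm (Y w)} w \<partial>N)"
    by (subst Bochner_Integration.integral_indicator) (auto intro!: arg_cong[where f = "measure N"])
   also have "... = (\<integral>w. indicator {v. x < norm v} (Y w) \<partial>N)"
    by (rule Bochner_Integration.integral_cong) (auto simp: indicator_def)
   also have "... = (\<integral>v. indicator {v. x < norm v} v \<partial>piX)" by (rule law_int) measurable
   also have "... = (\<integral>v. ?T (v /\<^sub>R x) \<partial>piX)"
    using x by (intro Bochner_Integration.integral_cong) (auto simp: indicator_def field_simps)
   finally have P: "Phi ?T (ln x) = exp (\<alpha> * ln x) * ?P" by (simp add: Phi_def e)
   have P0: "?P > 0" using pos unfolding P by (simp add: zero_less_mult_iff)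
   have "inverse (emeasure N {w \<in> space N. norm (Y w) > x}) = ennreal (inverse ?P)"
    unfolding N.emeasure_eq_measure using P0 by (rule inverse_ennreal)
   then have "(\<integral>y. f y \<partial>tail_measure N Y x) = inverse ?P * (\<integral>y. f y \<partial>restrict_space (distr N borel (\<lambda>w. embed_ereal (Y w /\<^sub>R x))) (- {0}))"
    unfolding tail_measure_def using P0
    by (simp add: integral_scale_measure_real[OF measurable_restrict_space1])
   also have "(\<integral>y. f y \<partial>restrict_space (distr N borel (\<lambda>w. embed_ereal (Y w /\<^sub>R x))) (- {0})) = (\<integral>w. ?h (Y w /\<^sub>R x) \<partial>N)"
    using borel_open[OF nonzero_open]
    by (subst integral_restrict_space) (auto simp: f0[unfolded real_scaleR_def] integral_distr)
   also have "... = (\<integral>v. ?h (v /\<^sub>R x) \<partial>piX)" by (rule law_int) measurable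
   finally show ?thesis unfolding P by (simp add: Phi_def e divide_inverse)
  qed
  have "\<forall>\<^sub>F x in at_top. Phi ?T (ln x) > 0"
   using filterlim_compose[OF T ln_at_top] cU_pos by (rule order_tendstoD)
  then have "\<forall>\<^sub>F x in at_top. Phi ?h (ln x) / Phi ?T (ln x) = (\<integral>y. f y \<partial>tail_measure N Y x)"
   using eventually_gt_at_top[of 0] by eventually_elim (simp add: eq)
  from Lim_transform_eventually[OF filterlim_compose[OF lim ln_at_top] this]
  show "((\<lambda>x. \<integral>y. f y \<partial>tail_measure N Y x) \<longlongrightarrow> (\<integral>y. f y \<partial>mu)) at_top" .
 qed
 then have "regularly_varying_limit N Y mu"
  unfolding regularly_varying_limit_def using mu_radon mu_nonnull Y by simp
 then show ?thesis unfolding regularly_varying_index_def using mu_homogeneous by blast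
qed

end

subsection \<open>The stationary processes\<close>

lemma (in prob_space) indep_elements_nn_integral:
 assumes X: "X \<in> measurable M S" and Y: "Y \<in> measurable M T" and \<nu>: "sets \<nu> = sets S"
  and eq: "\<And>A B. A \<in> sets S \<Longrightarrow> B \<in> sets T \<Longrightarrow> (\<integral>\<^sup>+w. indicator B (Y w) * indicator A (X w) \<partial>M) = emeasure M (Y -` B \<inter> space M) * emeasure \<nu> A"
 shows "distr M S X = \<nu>" "indep_elements M S X T Y"
proof -
 have I: "(\<integral>\<^sup>+w. indicator B (Y w) * indicator A (X w) \<partial>M) = emeasure M ((X -` A \<inter> space M) \<inter> (Y -` B \<inter> space M))"
  if [measurable]: "A \<in> sets S" "B \<in> sets T" for A B
 proof -
  have "(\<integral>\<^sup>+w. indicator B (Y w) * indicator A (X w) \<partial>M) = (\<integral>\<^sup>+w. indicator ((X -` A \<inter> space M) \<inter> (Y -` B \<inter> space M)) w \<partial>M)"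
   by (rule nn_integral_cong) (auto simp: indicator_def)
  also have "... = emeasure M ((X -` A \<inter> space M) \<inter> (Y -` B \<inter> space M))"
   by (rule nn_integral_indicator[OF sets.Int[OF measurable_sets[OF X that(1)] measurable_sets[OF Y that(2)]]])
  finally show ?thesis .
 qed
 have full: "Y -` space T \<inter> space M = space M" using measurable_space[OF Y] by auto
 have d: "emeasure M (X -` A \<inter> space M) = emeasure \<nu> A" if "A \<in> sets S" for A
  using eq[OF that sets.top[of T]] I[OF that sets.top[of T]] emeasure_space_1 by (simp add: full Int_absorb2)
 show "distr M S X = \<nu>" by (rule measure_eqI) (use \<nu> d X in \<open>auto simp: emeasure_distr\<close>)
 show "indep_elements M S X T Y"
 proof (rule indep_elementsI[OF prob_space_axioms X Y])
  fix A B assume AB: "A \<in> sets S" "B \<in> sets T"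
  have "ennreal (prob ((X -` A \<inter> space M) \<inter> (Y -` B \<inter> space M))) = ennreal (prob (X -` A \<inter> space M) * prob (Y -` B \<inter> space M))"
   using I[OF AB] eq[OF AB] d[OF AB(1)] by (simp add: emeasure_eq_measure[symmetric] ennreal_mult mult.commute)
  then show "prob ((X -` A \<inter> space M) \<inter> (Y -` B \<inter> space M)) = prob (X -` A \<inter> space M) * prob (Y -` B \<inter> space M)" by simp
 qed
qed

lemma (in prob_space) indep_vars_reindex:
 assumes X: "indep_vars (\<lambda>_. N) X UNIV" and f: "inj_on f I"
 shows "indep_vars (\<lambda>_. N) (\<lambda>k. X (f k)) I"
 unfolding indep_vars_def2
proof (intro conjI ballI indep_setsI)
 have rv: "random_variable N (X i)" for i using X by (simp add: indep_vars_def2)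
 then show "random_variable N (X (f i))" for i .
 show "{X (f i) -` A \<inter> space M |A. A \<in> sets N} \<subseteq> events" for i using rv by auto
 fix A J assume J: "J \<noteq> {}" "J \<subseteq> I" "finite J" and A: "\<forall>j\<in>J. A j \<in> {X (f j) -` A \<inter> space M |A. A \<in> sets N}"
 have inj: "inj_on f J" using f J(2) by (rule inj_on_subset)
 let ?A = "\<lambda>i. A (the_inv_into J f i)"
 have e: "?A (f j) = A j" if "j \<in> J" for j using the_inv_into_f_f[OF inj that] by simp
 have "prob (\<Inter>i\<in>f ` J. ?A i) = (\<Prod>i\<in>f ` J. prob (?A i))"
 proof (rule indep_setsD[of "\<lambda>i. {X i -` A \<inter> space M |A. A \<in> sets N}" UNIV])
  show "indep_sets (\<lambda>i. {X i -` A \<inter> space M |A. A \<in> sets N}) UNIV" using X by (simp add: indep_vars_def2)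
  show "\<forall>i\<in>f ` J. ?A i \<in> {X i -` A \<inter> space M |A. A \<in> sets N}" using A e by (simp add: ball_simps)
 qed (use J in auto)
 then show "prob (\<Inter>j\<in>J. A j) = (\<Prod>j\<in>J. prob (A j))" by (simp add: prod.reindex[OF inj] e)
qed

text \<open>Each \<open>Z j\<close> is a function of X at the times j and j - 1, so those with j < t
  are determined by the past before t. Induction on the largest index splits off one factor at a
  time.\<close>

lemma indep_vars_from_past:
 fixes Z :: "int \<Rightarrow> 'a \<Rightarrow> 'v::{second_countable_topology,t2_space}" and X :: "int \<Rightarrow> 'a \<Rightarrow> 'w::{second_countable_topology,t2_space}"
 assumes "prob_space M" and ind: "\<And>t. indep_elements M borel (Z t) (pastB t) (past X t)"
  and Zf: "\<And>t. Z t = (\<lambda>w. g (X t w, X (t - 1) w))" and g[measurable]: "g \<in> borel_measurable (borel \<Otimes>\<^sub>M borel)"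
 shows "prob_space.indep_vars M (\<lambda>_. borel) Z UNIV"
proof -
 interpret prob_space M by fact
 have Zm[measurable]: "Z t \<in> borel_measurable M" for t using ind by (simp add: indep_elements_def)
 \<comment> \<open>The extra intersection with the space covers the empty index set, whose
   intersection is the whole type.\<close>
 have key: "finite J \<Longrightarrow> (\<forall>j\<in>J. B j \<in> sets borel) \<Longrightarrow>
   prob ((\<Inter>j\<in>J. Z j -` B j \<inter> space M) \<inter> space M) = (\<Prod>j\<in>J. prob (Z j -` B j \<inter> space M))" for J B
 proof (induction J rule: finite_linorder_max_induct)
  case (insert t J)
  let ?E = "{p \<in> space (PiM {..<t} (\<lambda>_. borel :: 'w measure)). \<forall>j\<in>J. g (p j, p (j - 1)) \<in> B j}"
  have E: "?E \<in> sets (pastB t)"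
  proof -
   have "?E = space (pastB t) \<inter> (\<Inter>j\<in>J. (\<lambda>p. g (p j, p (j - 1))) -` B j \<inter> space (pastB t))" by auto
   also have "... \<in> sets (pastB t)"
   proof (cases "J = {}")
    case False
    have "(\<lambda>p. g (p j, p (j - 1))) \<in> borel_measurable (pastB t)" if "j \<in> J" for j
     using insert.hyps(2) that by (intro measurable_compose[OF _ g] measurable_Pair measurable_component_singleton) auto
    then show ?thesis using False insert by (intro sets.Int sets.finite_INT measurable_sets[of _ _ borel]) auto
   qed simp
   finally show ?thesis .
  qed
  have pe: "past X t -` ?E \<inter> space M = (\<Inter>j\<in>J. Z j -` B j \<inter> space M) \<inter> space M"
   using insert.hyps(2) by (auto simp: space_PiM Zf)
  have "prob ((\<Inter>j\<in>insert t J. Z j -` B j \<inter> space M) \<inter> space M) = prob ((Z t -` B t \<inter> space M) \<inter> (past X t -` ?E \<inter> space M))"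
   unfolding pe by (rule arg_cong[where f = prob]) auto
  also have "... = prob (Z t -` B t \<inter> space M) * prob (past X t -` ?E \<inter> space M)"
  proof (rule indep_setD)
   show "indep_set {Z t -` A \<inter> space M |A. A \<in> sets borel} {past X t -` A \<inter> space M |A. A \<in> sets (pastB t)}"
    using ind[of t] by (simp add: indep_elements_def)
   show "Z t -` B t \<inter> space M \<in> {Z t -` A \<inter> space M |A. A \<in> sets borel}" using insert.prems by blast
   show "past X t -` ?E \<inter> space M \<in> {past X t -` A \<inter> space M |A. A \<in> sets (pastB t)}" using E by blast
  qed
  finally have 1: "prob ((\<Inter>j\<in>insert t J. Z j -` B j \<inter> space M) \<inter> space M) = prob (Z t -` B t \<inter> space M) * prob (past X t -` ?E \<inter> space M)" .
  have IH: "prob ((\<Inter>j\<in>J. Z j -` B j \<inter> space M) \<inter> space M) = (\<Prod>j\<in>J. prob (Z j -` B j \<inter> space M))"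
   using insert.IH insert.prems by blast
  have tJ: "t \<notin> J" using insert.hyps(2) by auto
  show ?case unfolding 1 pe IH prod.insert[OF insert.hyps(1) tJ] ..
 qed (simp add: prob_space)
 show ?thesis
  unfolding indep_vars_def2
 proof (intro conjI ballI indep_setsI)
  fix A J assume J: "J \<noteq> {}" "finite J" and A: "\<forall>j\<in>J. A j \<in> {Z j -` B \<inter> space M |B. B \<in> sets borel}"
  from A have "\<forall>j\<in>J. \<exists>B. B \<in> sets borel \<and> A j = Z j -` B \<inter> space M" by auto
  then obtain B where B: "\<forall>j\<in>J. B j \<in> sets borel \<and> A j = Z j -` B j \<inter> space M" by (auto simp: bchoice_iff)
  have "(\<Inter>j\<in>J. A j) = (\<Inter>j\<in>J. Z j -` B j \<inter> space M) \<inter> space M" using B J(1) by auto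
  then show "prob (\<Inter>j\<in>J. A j) = (\<Prod>j\<in>J. prob (A j))" using key[OF J(2), of B] B by simp
 qed auto
qed

lemma markov_shift:
 fixes X :: "int \<Rightarrow> 'a \<Rightarrow> 'v::{second_countable_topology,t2_space}"
 assumes X: "markov M X K"
 shows "markov M (\<lambda>t. X (t + h)) K"
 unfolding markov_def
proof (intro conjI allI ballI)
 show "X (t + h) \<in> borel_measurable M" for t using X by (simp add: markov_def)
 fix t and H :: "(int \<Rightarrow> 'v) \<times> 'v \<Rightarrow> ennreal" assume H: "H \<in> borel_measurable (pastB t \<Otimes>\<^sub>M borel)"
 define G where "G y = H (\<lambda>s\<in>{..<t}. fst y (s + h), snd y)" for y :: "(int \<Rightarrow> 'v) \<times> 'v"
 have "(\<lambda>y. (\<lambda>s\<in>{..<t}. fst y (s + h), snd y)) \<in> measurable (PiM {..<t + h} (\<lambda>_. borel) \<Otimes>\<^sub>M borel) (PiM {..<t} (\<lambda>_. borel :: 'v measure) \<Otimes>\<^sub>M borel)"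
  by (intro measurable_Pair measurable_restrict measurable_compose[OF measurable_fst] measurable_component_singleton measurable_snd) auto
 from measurable_compose[OF this H] have "G \<in> borel_measurable (PiM {..<t + h} (\<lambda>_. borel) \<Otimes>\<^sub>M borel)" unfolding G_def[abs_def] .
 then have "(\<integral>\<^sup>+w. G (past X (t + h) w, X (t + h) w) \<partial>M) = (\<integral>\<^sup>+w. \<integral>\<^sup>+x. G (past X (t + h) w, x) \<partial>K (X (t + h - 1) w) \<partial>M)"
  using X unfolding markov_def by blast
 moreover have "(\<lambda>s\<in>{..<t}. past X (t + h) w (s + h)) = past (\<lambda>t. X (t + h)) t w" for w by (auto simp: fun_eq_iff restrict_def)
 ultimately show "(\<integral>\<^sup>+w. H (past (\<lambda>t. X (t + h)) t w, X (t + h) w) \<partial>M) = (\<integral>\<^sup>+w. \<integral>\<^sup>+x. H (past (\<lambda>t. X (t + h)) t w, x) \<partial>K (X (t - 1 + h) w) \<partial>M)"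
  by (simp add: G_def add.commute add_diff_eq)
qed

lemma strictly_stationary_marginal:
 assumes X: "strictly_stationary M X"
 shows "distr M borel (X t) = distr M borel (X 0)"
proof -
 have [measurable]: "X t \<in> borel_measurable M" for t using X by (simp add: strictly_stationary_def)
 have p: "distr (process_law M (\<lambda>t. X (t + h))) borel (\<lambda>p. p 0) = distr M borel (X h)" for h
 proof -
  have "(\<lambda>w t. X (t + h) w) \<in> measurable M (PiM UNIV (\<lambda>_. borel))" by (intro measurable_PiM_single') auto
  then show ?thesis unfolding process_law_def by (subst distr_distr) (auto simp: comp_def)
 qed
 have "process_law M (\<lambda>s. X (s + t)) = process_law M X" using X by (simp add: strictly_stationary_def)
 then show ?thesis using p[of t] p[of 0] by simp
qed

context bekk
begin

definition Ht :: "real^'d \<Rightarrow> real^'d^'d" where "Ht v = spd_sqrt (C + A ** outer v ** transpose A)"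

lemma Ht: "positive_definite (C + outer (A *v v))" "Ht v = spd_sqrt (C + outer (A *v v))" "invertible (Ht v)"
 and Ht_law: "distr (centered_normal (mat 1)) borel ((*v) (Ht v)) = K v"
proof -
 show pd: "positive_definite (C + outer (A *v v))" by (rule positive_definite_outer[OF C])
 show e: "Ht v = spd_sqrt (C + outer (A *v v))" by (simp add: Ht_def outer_matrix)
 show "invertible (Ht v)" unfolding e by (rule positive_definite_invertible[OF spd_sqrt_construction(1)[OF pd]])
 show "distr (centered_normal (mat 1)) borel ((*v) (Ht v)) = K v" unfolding e K_def by (rule centered_normal_spd_sqrt[OF pd])
qed

lemma Ht_m[measurable]: "Ht \<in> borel_measurable borel"
proof -
 have o: "(\<lambda>v. outer (A *v v)) \<in> borel_measurable borel"
  unfolding outer_def matrix_vector_mult_def by (intro borel_measurable_continuous_onI continuous_intros)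
 show ?thesis unfolding Ht(2)[abs_def] by (rule measurable_spd_sqrt) (use o Ht(1) in auto)
qed

lemma markov_invariant:
 assumes N: "prob_space N" and Y: "markov N Y K" and st: "\<And>t. distr N borel (Y t) = \<pi>"
 shows "\<pi> = piX"
proof (rule invariant_unique[OF _ piX_invariant])
 interpret N: prob_space N by (rule N)
 have Ym[measurable]: "Y t \<in> borel_measurable N" for t using Y by (simp add: markov_def)
 show "invariant \<pi>"
  unfolding invariant_def
 proof (intro conjI ballI)
  show "prob_space \<pi>" unfolding st[of 0, symmetric] by (rule N.prob_space_distr) measurable
  show "sets \<pi> = sets borel" unfolding st[of 0, symmetric] by simp
  fix h :: "real^'d \<Rightarrow> ennreal" assume h[measurable]: "h \<in> borel_measurable borel"
  have "(\<integral>\<^sup>+v. h v \<partial>\<pi>) = (\<integral>\<^sup>+w. h (Y 0 w) \<partial>N)" unfolding st[of 0, symmetric] by (rule nn_integral_distr) auto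
  also have "... = (\<integral>\<^sup>+w. \<integral>\<^sup>+x. h x \<partial>K (Y (0 - 1) w) \<partial>N)"
  proof -
   have "(\<lambda>y. h (snd y)) \<in> borel_measurable (PiM {..<0} (\<lambda>_. borel :: (real^'d) measure) \<Otimes>\<^sub>M borel)" by measurable
   then show ?thesis using Y unfolding markov_def by fastforce
  qed
  also have "... = (\<integral>\<^sup>+v. \<integral>\<^sup>+x. h x \<partial>K v \<partial>\<pi>)"
   unfolding st[of "0 - 1", symmetric] by (rule nn_integral_distr[symmetric]) (use nn_K_measurable[OF h] in auto)
  finally show "(\<integral>\<^sup>+v. h v \<partial>\<pi>) = (\<integral>\<^sup>+v. \<integral>\<^sup>+x. h x \<partial>K v \<partial>\<pi>)" .
 qed
qed

text \<open>Given the past, \<open>Ht v\<close> times a standard normal vector has the law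
  \<open>K v\<close> of the linear recursion. The marginals are then the unique invariant
  law.\<close>

lemma bekk_markov:
 assumes N: "prob_space N" and b: "stationary_bekk_solution N C A Z Y"
 shows "markov N Y K" "distr N borel (Y t) = piX"
proof -
 have st: "strictly_stationary N Y" and Zl: "\<And>t. distr N borel (Z t) = centered_normal (mat 1)"
  and ind: "\<And>t. indep_elements N borel (Z t) (pastB t) (past Y t)"
  and eq: "\<And>t. AE w in N. Y t w = Ht (Y (t - 1) w) *v Z t w"
  using b by (auto simp: stationary_bekk_solution_def iid_def Ht_def)
 have Ym: "\<And>t. Y t \<in> borel_measurable N" using st by (simp add: strictly_stationary_def)
 have gm: "(\<lambda>(v, z). Ht v *v z) \<in> borel_measurable (borel \<Otimes>\<^sub>M borel)" unfolding case_prod_beta by measurable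
 show m: "markov N Y K"
  by (rule markov_from_innovations[OF N Ym ind Zl Ht_law[symmetric] gm eq])
 show "distr N borel (Y t) = piX"
  unfolding strictly_stationary_marginal[OF st, of t]
  by (rule markov_invariant[OF N m strictly_stationary_marginal[OF st]])
qed

lemma markov_stationary_law:
 assumes N: "prob_space N" "markov N Y K" "\<And>t. distr N borel (Y t) = piX"
  and M: "prob_space M" "markov M X K" "\<And>t. distr M borel (X t) = piX"
 shows "process_law N Y = process_law M X"
 by (rule markov_process_law_unique[OF N(1) M(1) N(2) M(2) N(3) M(3) nn_K_measurable sets_K])

text \<open>The shifted process is Markov with the same kernel and marginals, so its law is the same
  by uniqueness.\<close>

lemma markov_strictly_stationary:
 assumes M: "prob_space M" and X: "markov M X K" and l: "\<And>t. distr M borel (X t) = piX"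
 shows "strictly_stationary M X"
 unfolding strictly_stationary_def using X markov_stationary_law[OF M markov_shift[OF X] l M X l] by (simp add: markov_def)

text \<open>On the given space the innovation is found by inverting the equation, as
  \<open>Ht\<close> of the previous state inverted and applied to the present one. Given the
  complete past its law is standard normal whatever the past is; this shows at once its law and its
  independence of the past.\<close>

lemma markov_bekk_solution:
 assumes M: "prob_space M" and X: "markov M X K" and l: "\<And>t. distr M borel (X t) = piX"
 shows "\<exists>Z. stationary_bekk_solution M C A Z X"
proof -
 interpret prob_space M by (rule M)
 have Xm[measurable]: "X t \<in> borel_measurable M" for t using X by (simp add: markov_def)
 define g where "g y = matrix_inv (Ht (snd y)) *v fst y" for y :: "(real^'d) \<times> (real^'d)"
 have g_eq: "g (Ht v *v z, v) = z" "Ht v *v g (x, v) = x" for v z x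
  by (simp_all add: g_def matrix_inv_mult[OF Ht(3)])
 have gm[measurable]: "g \<in> borel_measurable (borel \<Otimes>\<^sub>M borel)"
 proof -
  have e: "g y = (\<chi> k. det (\<chi> i j. if j = k then fst y $ i else Ht (snd y) $ i $ j) / det (Ht (snd y)))" for y
   unfolding g_def using Ht(3)[of "snd y"] by (intro matrix_inv_cramer) (simp add: invertible_det_nz)
  show ?thesis unfolding e[abs_def] by (rule measurable_cramer) measurable
 qed
 define Z where "Z t w = g (X t w, X (t - 1) w)" for t w
 have Zm[measurable]: "Z t \<in> borel_measurable M" for t unfolding Z_def[abs_def] by measurable
 have Z: "distr M borel (Z t) = centered_normal (mat 1)" "indep_elements M borel (Z t) (pastB t) (past X t)" for t
 proof -
  have eq: "(\<integral>\<^sup>+w. indicator B (past X t w) * indicator E (Z t w) \<partial>M) = emeasure M (past X t -` B \<inter> space M) * emeasure (centered_normal (mat 1)) E"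
   if E[measurable]: "E \<in> sets borel" and B[measurable]: "B \<in> sets (pastB t)" for E B
  proof -
   let ?P = "PiM {..<t} (\<lambda>_. borel :: (real^'d) measure)"
   define H :: "_ \<Rightarrow> ennreal" where "H y = indicator B (fst y) * indicator E (g (snd y, fst y (t - 1)))" for y :: "(int \<Rightarrow> real^'d) \<times> (real^'d)"
   have [measurable]: "(\<lambda>y. fst y (t - 1)) \<in> borel_measurable (?P \<Otimes>\<^sub>M (borel :: (real^'d) measure))"
    by (rule measurable_compose[OF measurable_fst measurable_component_singleton]) simp
   have Hm: "H \<in> borel_measurable (?P \<Otimes>\<^sub>M borel)" unfolding H_def[abs_def] by measurable
   have p: "past X t w (t - 1) = X (t - 1) w" for w by simp
   have "(\<integral>\<^sup>+w. indicator B (past X t w) * indicator E (Z t w) \<partial>M) = (\<integral>\<^sup>+w. H (past X t w, X t w) \<partial>M)"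
    unfolding H_def Z_def by (simp only: fst_conv snd_conv p)
   also have "... = (\<integral>\<^sup>+w. \<integral>\<^sup>+x. H (past X t w, x) \<partial>K (X (t - 1) w) \<partial>M)" using X Hm unfolding markov_def by blast
   also have "... = (\<integral>\<^sup>+w. indicator B (past X t w) * emeasure (centered_normal (mat 1)) E \<partial>M)"
   proof (rule nn_integral_cong)
    fix w
    let ?v = "X (t - 1) w"
    have gv: "(\<lambda>x. indicator E (g (x, ?v)) :: ennreal) \<in> borel_measurable (K ?v)"
     unfolding measurable_cong_sets[OF sets_K refl] by measurable
    have "(\<integral>\<^sup>+x. H (past X t w, x) \<partial>K ?v) = (\<integral>\<^sup>+x. indicator B (past X t w) * indicator E (g (x, ?v)) \<partial>K ?v)"
     unfolding H_def by (simp only: fst_conv snd_conv p)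
    also have "... = indicator B (past X t w) * (\<integral>\<^sup>+x. indicator E (g (x, ?v)) \<partial>K ?v)" by (rule nn_integral_cmult[OF gv])
    also have "(\<integral>\<^sup>+x. indicator E (g (x, ?v)) \<partial>K ?v) = (\<integral>\<^sup>+z. indicator E (g (Ht ?v *v z, ?v)) \<partial>centered_normal (mat 1))"
     unfolding Ht_law[symmetric] by (rule nn_integral_distr) (auto simp: centered_normal_def)
    also have "... = emeasure (centered_normal (mat 1)) E" unfolding g_eq by (rule nn_integral_indicator) (simp add: centered_normal_def)
    finally show "(\<integral>\<^sup>+x. H (past X t w, x) \<partial>K ?v) = indicator B (past X t w) * emeasure (centered_normal (mat 1)) E" .
   qed
   also have "... = (\<integral>\<^sup>+w. indicator (past X t -` B \<inter> space M) w * emeasure (centered_normal (mat 1)) E \<partial>M)"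
    by (rule nn_integral_cong) (simp add: indicator_def)
   also have "... = emeasure M (past X t -` B \<inter> space M) * emeasure (centered_normal (mat 1)) E"
    using measurable_sets[OF past_measurable[OF Xm] B] by (subst nn_integral_multc) auto
   finally show ?thesis .
  qed
  have s: "sets (centered_normal (mat 1 :: real^'d^'d)) = sets borel" by (simp add: centered_normal_def)
  show "distr M borel (Z t) = centered_normal (mat 1)" by (rule indep_elements_nn_integral(1)[OF Zm past_measurable[OF Xm] s eq])
  show "indep_elements M borel (Z t) (pastB t) (past X t)" by (rule indep_elements_nn_integral(2)[OF Zm past_measurable[OF Xm] s eq])
 qed
 have "indep_vars (\<lambda>_. borel) Z UNIV"
  by (rule indep_vars_from_past[OF M Z(2) _ gm]) (simp add: Z_def[abs_def])
 then have "stationary_bekk_solution M C A Z X"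
  unfolding stationary_bekk_solution_def iid_def Ht_def[symmetric]
  using Z markov_strictly_stationary[OF M X l] g_eq(2) by (simp add: Z_def)
 then show ?thesis by blast
qed

end

section \<open>The solution driven by given innovations\<close>

locale bekk_sre = bekk C A Orth a \<alpha> for C A Orth :: "real^'d^'d" and a \<alpha> +
 fixes M :: "'a measure" and m :: "int \<Rightarrow> 'a \<Rightarrow> real" and Q :: "int \<Rightarrow> 'a \<Rightarrow> real^'d"
 assumes M: "prob_space M" and inn: "sre_innovations M C m Q"
begin

sublocale prob_space M by (rule M)

abbreviation "ww t w \<equiv> (m t w, Q t w)"

lemmas w_iid = sre_pair_iid[OF M inn C]

lemma w_m[measurable]: "m t \<in> borel_measurable M" "Q t \<in> borel_measurable M" "(\<lambda>w. ww t w) \<in> borel_measurable M"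
 using inn w_iid(3) by (auto simp: sre_innovations_def iid_def indep_vars_def)

definition wrev :: "int \<Rightarrow> 'a \<Rightarrow> nat \<Rightarrow> real \<times> (real^'d)" where "wrev t w = (\<lambda>k. ww (t - int k) w)"

lemma sets_PQ: "sets PQ = sets (PiM UNIV (\<lambda>_. borel))"
 by (rule sets_PiM_cong[OF refl sets_mq])

lemma wrev_m[measurable]: "wrev t \<in> measurable M PQ"
 unfolding measurable_cong_sets[OF refl sets_PQ] wrev_def[abs_def] by (intro measurable_PiM_single') auto

lemma wrev_law: "distr M PQ (wrev t) = PQ"
proof -
 have i: "indep_vars (\<lambda>_. borel) (\<lambda>k w. ww (t - int k) w) (UNIV :: nat set)"
  using indep_vars_reindex[OF w_iid(1), of "\<lambda>k. t - int k" UNIV] by (simp add: inj_on_def)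
 have "distr M (PiM UNIV (\<lambda>_. borel)) (\<lambda>x. \<lambda>k\<in>UNIV. ww (t - int k) x) = PiM UNIV (\<lambda>k. distr M borel (\<lambda>w. ww (t - int k) w))"
  using i by (subst indep_vars_iff_distr_eq_PiM'[symmetric]) auto
 then have "distr M (PiM UNIV (\<lambda>_. borel)) (wrev t) = PQ" by (simp add: w_iid(2) wrev_def[abs_def] restrict_UNIV)
 moreover have "distr M PQ (wrev t) = distr M (PiM UNIV (\<lambda>_. borel)) (wrev t)" by (rule distr_cong[OF refl sets_PQ refl])
 ultimately show ?thesis by simp
qed

definition XX :: "int \<Rightarrow> 'a \<Rightarrow> real^'d" where "XX t w = perp ((*v) A) (wrev t w)"

lemma XX_m[measurable]: "XX t \<in> borel_measurable M"
 unfolding XX_def[abs_def] by (rule measurable_compose[OF wrev_m perpetuity.perp_m[OF perp_X]])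

lemma XX_law: "distr M borel (XX t) = piX"
proof -
 have "distr (distr M PQ (wrev t)) borel (perp ((*v) A)) = distr M borel (perp ((*v) A) \<circ> wrev t)"
  by (rule distr_distr[OF perpetuity.perp_m[OF perp_X] wrev_m])
 then show ?thesis unfolding wrev_law piX_def by (simp add: XX_def[abs_def] comp_def)
qed

lemma XX_sre: "AE w in M. XX t w = m t w *\<^sub>R (A *v XX (t - 1) w) + Q t w"
proof -
 have "AE x in distr M PQ (wrev (t - 1)). summable (pterm ((*v) A) x)"
  unfolding wrev_law by (rule perp_X_moment(1)[OF holder_exp(1,3)])
 from AE_distrD[OF wrev_m this] show ?thesis
 proof eventually_elim
  case (elim w)
  have e: "(\<lambda>k. wrev t w (Suc k)) = wrev (t - 1) w" by (simp add: wrev_def fun_eq_iff diff_diff_eq)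
  from perp_rec(1)[OF perpetuity.bT[OF perp_X], of "wrev t w"] elim show ?case
   unfolding XX_def e by (simp add: wrev_def add.commute)
 qed
qed

text \<open>Every \<open>XX s\<close> with s < t is a function of the pairs up to time s, so the
  past of \<open>XX\<close> is a measurable function of the pairs before t.\<close>

lemma w_indep_past: "indep_elements M borel (\<lambda>w. ww t w) (pastB t) (past XX t)"
proof -
 let ?A = "\<lambda>w. restrict (\<lambda>i. ww i w) {t}" and ?B = "\<lambda>w. restrict (\<lambda>i. ww i w) {..<t}"
 let ?W = "PiM {..<t} (\<lambda>_. borel :: (real \<times> (real^'d)) measure)"
 define G where "G u = (\<lambda>s\<in>{..<t}. perp ((*v) A) (\<lambda>k. u (s - int k)))" for u :: "int \<Rightarrow> real \<times> (real^'d)"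
 have G: "G \<in> measurable ?W (pastB t)"
  unfolding G_def[abs_def]
 proof (rule measurable_restrict)
  fix s assume s: "s \<in> {..<t}"
  have "(\<lambda>u k. u (s - int k)) \<in> measurable ?W PQ"
   unfolding measurable_cong_sets[OF refl sets_PQ] using s by (intro measurable_PiM_single' measurable_component_singleton) auto
  then show "(\<lambda>u. perp ((*v) A) (\<lambda>k. u (s - int k))) \<in> measurable ?W borel"
   by (rule measurable_compose[OF _ perpetuity.perp_m[OF perp_X]])
 qed
 have ind: "indep_var (PiM {t} (\<lambda>_. borel)) ?A ?W ?B" by (rule indep_var_restrict[OF w_iid(1)]) auto
 have GB: "G (?B w) = past XX t w" for w
  by (auto simp: G_def XX_def wrev_def fun_eq_iff)
 show ?thesis
 proof (rule indep_elementsI[OF M w_m(3) past_measurable[OF XX_m]])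
  fix E F assume E: "E \<in> sets (borel :: (real \<times> (real^'d)) measure)" and F: "F \<in> sets (PiM {..<t} (\<lambda>_. borel :: (real^'d) measure))"
  let ?E = "(\<lambda>u. u t) -` E \<inter> space (PiM {t} (\<lambda>_. borel :: (real \<times> (real^'d)) measure))" and ?F = "G -` F \<inter> space ?W"
  have s: "?E \<in> sets (PiM {t} (\<lambda>_. borel))" "?F \<in> sets ?W"
   using E F by (auto intro!: measurable_sets[OF measurable_component_singleton] measurable_sets[OF G])
  have "?A -` ?E \<inter> space M = (\<lambda>w. ww t w) -` E \<inter> space M" by (auto simp: space_PiM)
  moreover have "?B -` ?F \<inter> space M = past XX t -` F \<inter> space M" by (auto simp: space_PiM GB)
  moreover have "(\<lambda>x. (?A x, ?B x)) -` (?E \<times> ?F) \<inter> space M = (?A -` ?E \<inter> space M) \<inter> (?B -` ?F \<inter> space M)" by auto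
  ultimately show "prob ((\<lambda>w. ww t w) -` E \<inter> space M \<inter> (past XX t -` F \<inter> space M)) = prob ((\<lambda>w. ww t w) -` E \<inter> space M) * prob (past XX t -` F \<inter> space M)"
   using indep_varD[OF ind s] by simp
 qed
qed

lemma XX_markov: "markov M XX K"
proof (rule markov_from_innovations[OF M XX_m w_indep_past w_iid(2), where g = "\<lambda>v y. fst y *\<^sub>R (A *v v) + snd y"])
 show "K v = distr MQ borel (\<lambda>y. fst y *\<^sub>R (A *v v) + snd y)" for v by (simp add: K_eq case_prod_beta')
 show "(\<lambda>(v, y). fst y *\<^sub>R (A *v v) + snd y) \<in> borel_measurable (borel \<Otimes>\<^sub>M (borel :: (real \<times> (real^'d)) measure))"
  unfolding borel_prod[symmetric] case_prod_beta by measurable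
 show "AE w in M. XX t w = fst (ww t w) *\<^sub>R (A *v XX (t - 1) w) + snd (ww t w)" for t using XX_sre by simp
qed

lemma XX_solution: "stationary_sre_solution M A m Q XX"
 unfolding stationary_sre_solution_def using markov_strictly_stationary[OF M XX_markov XX_law] XX_sre by blast

lemma nn_m: "f \<in> borel_measurable borel \<Longrightarrow> (\<integral>\<^sup>+w. f (m t w) \<partial>M) = (\<integral>\<^sup>+x. f x \<partial>stdn)"
proof -
 assume "f \<in> borel_measurable borel"
 moreover have "distr M borel (m t) = stdn" using inn by (simp add: sre_innovations_def iid_def)
 ultimately show ?thesis using nn_integral_distr[of "m t" M borel f] by simp
qed

lemma m_moment: "(\<integral>w. (\<bar>m t w\<bar> * a) powr \<alpha> \<partial>M) = 1"
proof -
 have "(\<integral>\<^sup>+w. ennreal ((\<bar>m t w\<bar> * a) powr \<alpha>) \<partial>M) = ennreal (nmom a \<alpha>)"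
  unfolding nmom_def using nmom_integrable[of \<alpha> a] a \<alpha>
  by (subst nn_m) (auto intro!: nn_integral_eq_integral)
 then show ?thesis by (subst integral_eq_nn_integral) (auto simp: nmom_\<alpha>)
qed

definition PP :: "int \<Rightarrow> nat \<Rightarrow> 'a \<Rightarrow> real" where "PP t n w = (\<Prod>j<n. \<bar>m (t - int j) w\<bar> * a)"

lemma PP_nonneg: "0 \<le> PP t n w" unfolding PP_def using a by (intro prod_nonneg) auto

lemma PP_moment: "(\<integral>\<^sup>+w. ennreal (PP t n w powr holder_exp) \<partial>M) = ennreal (nmom a holder_exp ^ n)"
proof -
 have im: "indep_vars (\<lambda>_. borel) m UNIV" using inn by (simp add: sre_innovations_def iid_def)
 have i: "indep_vars (\<lambda>_. borel) (\<lambda>j w. ennreal ((\<bar>m (t - int j) w\<bar> * a) powr holder_exp)) {..<n}"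
 proof -
  have "indep_vars (\<lambda>_. borel) (\<lambda>j w. m (t - int j) w) {..<n}"
   using indep_vars_reindex[OF im, of "\<lambda>j. t - int j" "{..<n}"] by (simp add: inj_on_def)
  from indep_vars_compose2[OF this, of "\<lambda>_ x. ennreal ((\<bar>x\<bar> * a) powr holder_exp)" "\<lambda>_. borel"] show ?thesis by simp
 qed
 have "PP t n w powr holder_exp = (\<Prod>j<n. (\<bar>m (t - int j) w\<bar> * a) powr holder_exp)" for w
  unfolding PP_def using a by (induction n) (auto simp: powr_mult prod_nonneg)
 then have "(\<integral>\<^sup>+w. ennreal (PP t n w powr holder_exp) \<partial>M) = (\<integral>\<^sup>+w. (\<Prod>j<n. ennreal ((\<bar>m (t - int j) w\<bar> * a) powr holder_exp)) \<partial>M)"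
  by (simp add: prod_ennreal)
 also have "... = (\<Prod>j<n. \<integral>\<^sup>+w. ennreal ((\<bar>m (t - int j) w\<bar> * a) powr holder_exp) \<partial>M)"
  by (rule indep_vars_nn_integral[OF _ i]) auto
 also have "... = (\<Prod>j<n. ennreal (nmom a holder_exp))"
 proof (rule prod.cong[OF refl])
  fix j
  show "(\<integral>\<^sup>+w. ennreal ((\<bar>m (t - int j) w\<bar> * a) powr holder_exp) \<partial>M) = ennreal (nmom a holder_exp)"
   unfolding nmom_def using nmom_integrable[of holder_exp a] a holder_exp(1)
   by (subst nn_m) (auto intro!: nn_integral_eq_integral)
 qed
 finally show ?thesis by (simp add: ennreal_power nmom_def)
qed

lemma tail_to_0:
 fixes V :: "'a \<Rightarrow> real^'d"
 assumes [measurable]: "V \<in> borel_measurable M" and "\<eta> > 0"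
 obtains R :: real where "R > 0" "prob {w \<in> space M. R < norm (V w)} < \<eta>"
proof -
 have "(\<lambda>n. prob {w \<in> space M. real n < norm (V w)}) \<longlonglongrightarrow> prob (\<Inter>n. {w \<in> space M. real n < norm (V w)})"
  by (rule finite_Lim_measure_decseq) (auto simp: decseq_def)
 also have "(\<Inter>n. {w \<in> space M. real n < norm (V w)}) = {}"
 proof -
  have "\<exists>n. norm (V w) \<le> real n" for w using real_arch_simple by blast
  then have "\<not> (\<forall>n. real n < norm (V w))" for w by (meson leD)
  then show ?thesis by auto
 qed
 finally have "(\<lambda>n. prob {w \<in> space M. real n < norm (V w)}) \<longlonglongrightarrow> 0" by simp
 then have "\<forall>\<^sub>F n in sequentially. prob {w \<in> space M. real n < norm (V w)} < \<eta>" using assms(2) by (rule order_tendstoD)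
 with eventually_gt_at_top[of 0] have "\<forall>\<^sub>F n in sequentially. 0 < n \<and> prob {w \<in> space M. real n < norm (V w)} < \<eta>" by eventually_elim simp
 then obtain n :: nat where "0 < n" "prob {w \<in> space M. real n < norm (V w)} < \<eta>" by (auto dest: eventually_happens'[OF sequentially_bot])
 then show thesis by (intro that[of "real n"]) auto
qed

text \<open>The difference of two solutions is multiplied by m A in each step, so its norm at t is
  \<open>PP t n\<close> times that at t - n. The product tends to 0 in probability by its fractional
  moment, and stationarity keeps the other factor tight.\<close>

lemma XX_unique:
 assumes Y: "stationary_sre_solution M A m Q Y"
 shows "AE w in M. \<forall>t. Y t w = XX t w"
proof -
 have stY: "strictly_stationary M Y" and Ye: "\<And>t. AE w in M. Y t w = m t w *\<^sub>R (A *v Y (t - 1) w) + Q t w"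
  using Y by (auto simp: stationary_sre_solution_def)
 have stX: "strictly_stationary M XX" using XX_solution by (simp add: stationary_sre_solution_def)
 have Ym[measurable]: "Y t \<in> borel_measurable M" for t using stY by (simp add: strictly_stationary_def)
 let ?D = "\<lambda>t w. norm (Y t w - XX t w)"
 have "AE w in M. \<forall>t. Y t w = m t w *\<^sub>R (A *v Y (t - 1) w) + Q t w \<and> XX t w = m t w *\<^sub>R (A *v XX (t - 1) w) + Q t w"
  unfolding AE_all_countable using Ye XX_sre by (auto intro: eventually_conj)
 then have it: "AE w in M. \<forall>t n. ?D t w = PP t n w * ?D (t - int n) w"
 proof eventually_elim
  case (elim w)
  have step: "?D t w = \<bar>m t w\<bar> * a * ?D (t - 1) w" for t
  proof -
   have "Y t w - XX t w = m t w *\<^sub>R (A *v (Y (t - 1) w - XX (t - 1) w))"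
    using elim[rule_format, of t] by (simp add: matrix_vector_mult_diff_distrib scaleR_diff_right)
   then show ?thesis by (simp add: norm_A)
  qed
  have "?D t w = PP t n w * ?D (t - int n) w" for t n
  proof (induction n)
   case (Suc n)
   then show ?case using step[of "t - int n"] by (simp add: PP_def diff_diff_eq add.commute mult.assoc)
  qed (simp add: PP_def)
  then show ?case by blast
 qed
 have "AE w in M. Y t w = XX t w" for t
 proof -
  have small: "prob {w \<in> space M. e < ?D t w} \<le> 3 * \<eta>" if e: "e > 0" and \<eta>: "\<eta> > 0" for e \<eta>
  proof -
   obtain R1 where R1: "R1 > 0" "prob {w \<in> space M. R1 < norm (Y 0 w)} < \<eta>" by (rule tail_to_0[OF Ym \<eta>])
   obtain R2 where R2: "R2 > 0" "prob {w \<in> space M. R2 < norm (XX 0 w)} < \<eta>" by (rule tail_to_0[OF XX_m \<eta>])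
   have same: "prob {w \<in> space M. r < norm (V s w)} = prob {w \<in> space M. r < norm (V 0 w)}"
    if V: "strictly_stationary M V" for V :: "int \<Rightarrow> 'a \<Rightarrow> real^'d" and s r
   proof -
    have [measurable]: "V s \<in> borel_measurable M" for s using V by (simp add: strictly_stationary_def)
    have "prob {w \<in> space M. r < norm (V s w)} = measure (distr M borel (V s)) {v. r < norm v}" for s
     by (subst measure_distr) (auto intro!: arg_cong[where f = prob])
    then show ?thesis using strictly_stationary_marginal[OF V, of s] by simp
   qed
   \<comment> \<open>If the two states at time t - n have norms at most R1 and R2, a difference
     above e at time t forces R times \<open>PP t n w\<close> to be at least 1, which Markov's
     inequality makes unlikely.\<close>
   define R where "R = (R1 + R2) / e"
   have R: "R > 0" using R1 R2 e by (simp add: R_def)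
   let ?s = holder_exp
   have bnd: "prob {w \<in> space M. e < ?D t w} \<le> 2 * \<eta> + R powr ?s * nmom a ?s ^ n" for n
   proof -
    let ?u = "t - int n"
    let ?A = "{w \<in> space M. R1 < norm (Y ?u w)}" and ?B = "{w \<in> space M. R2 < norm (XX ?u w)}" and ?E = "{w \<in> space M. 1 \<le> R powr ?s * PP t n w powr ?s}"
    have [measurable]: "PP t n \<in> borel_measurable M" unfolding PP_def[abs_def] by measurable
    have "prob {w \<in> space M. e < ?D t w} \<le> prob (?A \<union> ?B \<union> ?E)"
    proof (rule finite_measure_mono_AE)
     show "AE w in M. w \<in> {w \<in> space M. e < ?D t w} \<longrightarrow> w \<in> ?A \<union> ?B \<union> ?E"
      using it
     proof eventually_elim
      case (elim w)
      show ?case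
      proof (intro impI, rule ccontr)
       assume w: "w \<in> {w \<in> space M. e < ?D t w}" and n: "w \<notin> ?A \<union> ?B \<union> ?E"
       have "?D ?u w \<le> R1 + R2" using w n norm_triangle_ineq4[of "Y ?u w" "XX ?u w"] by auto
       then have "PP t n w * ?D ?u w \<le> PP t n w * (R1 + R2)" by (rule mult_left_mono[OF _ PP_nonneg])
       then have "e < PP t n w * (R1 + R2)" using w elim[rule_format, of t n] by simp
       then have "1 \<le> R * PP t n w" using e by (simp add: R_def field_simps)
       then have "1 \<le> (R * PP t n w) powr ?s" using holder_exp(1) by (intro ge_one_powr_ge_zero) auto
       then show False using n w R PP_nonneg by (simp add: powr_mult)
      qed
     qed
    qed measurable
    also have "... \<le> prob (?A \<union> ?B) + prob ?E" by (rule measure_Un_le) measurable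
    also have "prob (?A \<union> ?B) \<le> prob ?A + prob ?B" by (rule measure_Un_le) measurable
    also have "prob ?A + prob ?B \<le> 2 * \<eta>"
     using same[OF stY, of R1 ?u] same[OF stX, of R2 ?u] R1(2) R2(2) by linarith
    also have "prob ?E \<le> R powr ?s * nmom a ?s ^ n"
    proof -
     have "emeasure M ?E = emeasure M ({w \<in> space M. 1 \<le> ennreal (R powr ?s) * ennreal (PP t n w powr ?s)})"
      by (rule arg_cong[where f = "emeasure M"]) (auto simp: ennreal_mult[symmetric] ennreal_1[symmetric] simp del: ennreal_1)
     also have "... \<le> ennreal (R powr ?s) * (\<integral>\<^sup>+w. ennreal (PP t n w powr ?s) * indicator (space M) w \<partial>M)"
      by (rule nn_integral_Markov_inequality) auto
     also have "(\<integral>\<^sup>+w. ennreal (PP t n w powr ?s) * indicator (space M) w \<partial>M) = (\<integral>\<^sup>+w. ennreal (PP t n w powr ?s) \<partial>M)"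
      by (rule nn_integral_cong) simp
     finally have "emeasure M ?E \<le> ennreal (R powr ?s * nmom a ?s ^ n)" unfolding PP_moment by (simp add: ennreal_mult' nmom_def)
     then show ?thesis by (simp add: emeasure_eq_measure nmom_def)
    qed
    finally show ?thesis by simp
   qed
   have "(\<lambda>n. 2 * \<eta> + R powr ?s * nmom a ?s ^ n) \<longlonglongrightarrow> 2 * \<eta> + R powr ?s * 0"
    using nmom_less[OF holder_exp(1,3)] by (intro tendsto_intros LIMSEQ_realpow_zero) (auto simp: nmom_def)
   then have "prob {w \<in> space M. e < ?D t w} \<le> 2 * \<eta> + R powr ?s * 0" by (rule LIMSEQ_le_const) (use bnd in auto)
   then show ?thesis using \<eta> by simp
  qed
  have "prob {w \<in> space M. e < ?D t w} = 0" if e: "e > 0" for e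
  proof (rule antisym[OF field_le_epsilon])
   fix \<eta> :: real assume "\<eta> > 0"
   then show "prob {w \<in> space M. e < ?D t w} \<le> 0 + \<eta>" using small[OF e, of "\<eta> / 3"] by simp
  qed simp
  then have "AE w in M. \<not> e < ?D t w" if "e > 0" for e
   using that by (subst AE_iff_measurable[OF _ refl]) (auto simp: emeasure_eq_measure)
  then have "AE w in M. \<forall>k. \<not> inverse (real (Suc k)) < ?D t w" unfolding AE_all_countable by simp
  then show ?thesis
  proof eventually_elim
   case (elim w)
   then show ?case using reals_Archimedean[of "?D t w"] by (cases "?D t w = 0") auto
  qed
 qed
 then show ?thesis by (simp add: AE_all_countable)
qed

end

theorem proposition2p13:
  fixes C A Orth :: "real ^ 'd ^ 'd" and a :: real
    and M :: "'a measure" and m :: "int \<Rightarrow> 'a \<Rightarrow> real" and Q :: "int \<Rightarrow> 'a \<Rightarrow> real ^ 'd"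
  assumes "positive_definite C" and "a > 0" and "orthogonal_matrix Orth"
    and "A = a *\<^sub>R Orth"
    and "prob_space M" and "sre_innovations M C m Q"
    and "a < exp (1 / 2 * (- Digamma 1 + ln 2))"
  shows "1.88736 \<le> exp (1 / 2 * (- Digamma 1 + ln 2 :: real)) \<and>
    exp (1 / 2 * (- Digamma 1 + ln 2 :: real)) < 1.88737 \<and>
    (\<exists>\<alpha> > 0. (\<forall>t. (\<integral>\<omega>. (\<bar>m t \<omega>\<bar> * a) powr \<alpha> \<partial>M) = 1) \<and>
      (\<exists>X. stationary_sre_solution M A m Q X \<and>
        (\<forall>Y. stationary_sre_solution M A m Q Y \<longrightarrow> (AE \<omega> in M. \<forall>t. Y t \<omega> = X t \<omega>)) \<and>
        (\<forall>t. regularly_varying_index M (X t) \<alpha>) \<and>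
        (\<exists>Z. stationary_bekk_solution M C A Z X) \<and>
        (\<forall>(N :: 'b measure) Z Y. prob_space N \<and> stationary_bekk_solution N C A Z Y \<longrightarrow>
          process_law N Y = process_law M X \<and>
          (\<forall>t. regularly_varying_index N (Y t) \<alpha>))))"
proof -
  have bounds: "1.88736 \<le> exp (1 / 2 * (- Digamma 1 + ln 2 :: real))" "exp (1 / 2 * (- Digamma 1 + ln 2 :: real)) < 1.88737"
    using exp_half_euler_bounds by (simp_all add: Digamma_1)
  obtain \<alpha> where \<alpha>: "\<alpha> > 0" "nmom a \<alpha> = 1" "\<And>s. 0 < s \<Longrightarrow> s < \<alpha> \<Longrightarrow> nmom a s < 1"
    using exists_moment_index[of a] assms(2,7) by (auto simp: Digamma_1)
  interpret bekk_sre C A Orth a \<alpha> M m Q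
    by (intro bekk_sre.intro bekk.intro bekk_sre_axioms.intro assms \<alpha>)
  \<comment> \<open>A BEKK solution on another space is Markov with kernel \<open>K\<close> and
    marginal \<open>piX\<close>; it can be matched with \<open>XX\<close> in law only.\<close>
  have law: "process_law N Y = process_law M XX \<and> (\<forall>t. regularly_varying_index N (Y t) \<alpha>)"
    if N: "prob_space N" and b: "stationary_bekk_solution N C A Z Y" for N :: "'b measure" and Z Y
  proof
    note mk = bekk_markov[OF N b]
    show "process_law N Y = process_law M XX" by (rule markov_stationary_law[OF N mk assms(5) XX_markov XX_law])
    show "\<forall>t. regularly_varying_index N (Y t) \<alpha>" using mk by (auto simp: markov_def intro!: piX_regularly_varying[OF N])
  qed
  have "stationary_sre_solution M A m Q XX \<and>
      (\<forall>Y. stationary_sre_solution M A m Q Y \<longrightarrow> (AE \<omega> in M. \<forall>t. Y t \<omega> = XX t \<omega>)) \<and>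
      (\<forall>t. regularly_varying_index M (XX t) \<alpha>) \<and> (\<exists>Z. stationary_bekk_solution M C A Z XX) \<and>
      (\<forall>(N :: 'b measure) Z Y. prob_space N \<and> stationary_bekk_solution N C A Z Y \<longrightarrow>
        process_law N Y = process_law M XX \<and> (\<forall>t. regularly_varying_index N (Y t) \<alpha>))"
    using XX_solution XX_unique piX_regularly_varying[OF assms(5) XX_m XX_law]
      markov_bekk_solution[OF assms(5) XX_markov XX_law] law by blast
  with bounds \<alpha>(1) m_moment show ?thesis by blast
qed

end
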